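(* Let $0<\alpha<n$ and let $I_\alpha$ be the Riesz potential $$I_\alpha f(x)=\int_{\mathbb{R}^n}\frac{1}{|x-y|^{n-\alpha}}f(y)\,dy,\qquad f\in L^s(\mathbb{R}^n),\ 1\le s<\frac n\alpha .$$ Suppose $p(\cdot):\mathbb{R}^n\to(0,\infty)$ is a measurable function satisfying the local log-Hölder condition $$|p(x)-p(y)|\le\frac{c}{-\log|x-y|},\qquad 0<|x-y|<\tfrac12,$$ for some constant $c$, and the log-Hölder condition at infinity $$|p(x)-p_\infty|\le\frac{C_\infty}{\log(e+|x|)},\qquad x\in\mathbb{R}^n,$$ for some constants $C_\infty$ and $p_\infty$, and suppose that $0<p_-\le p_+<\frac n\alpha$. If $\frac1{q(\cdot)}=\frac1{p(\cdot)}-\frac\alpha n$, then $I_\alpha$ can be extended to a bounded operator from $H^{p(\cdot)}(\mathbb{R}^n)$ to $H^{q(\cdot)}(\mathbb{R}^n)$.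
   Context: For a measurable $p(\cdot):\mathbb{R}^n\to(0,\infty)$ put $p_-=\inf_{x}p(x)$ and $p_+=\sup_{x}p(x)$. When $0<p_-\le p_+<\infty$, $L^{p(\cdot)}(\mathbb{R}^n)$ is the space of measurable $f$ such that $\int|f(x)/\lambda|^{p(x)}dx<\infty$ for some $\lambda>0$, with the quasi-norm $\|f\|_{p(\cdot)}=\inf\{\lambda>0:\int|f(x)/\lambda|^{p(x)}dx\le1\}$. Variable Hardy space: let $\mathcal{F}_N=\{\varphi\in S(\mathbb{R}^n):\sum_{|\beta|\le N}\sup_{x\in\mathbb{R}^n}(1+|x|)^N|\partial^\beta\varphi(x)|\le1\}$, where $S(\mathbb{R}^n)$ is the Schwartz space. For $f\in S'(\mathbb{R}^n)$ let $\mathcal{M}f(x)=\sup_{t>0}\sup_{\varphi\in\mathcal{F}_N}|(t^{-n}\varphi(t^{-1}\cdot)*f)(x)|$, where $N$ is a large and fixed integer (sufficiently large depending on $n$ and the exponents). Then $H^{p(\cdot)}(\mathbb{R}^n)$ is the set of $f\in S'(\mathbb{R}^n)$ with $\|f\|_{H^{p(\cdot)}}:=\|\mathcal{M}f\|_{p(\cdot)}<\infty$; $H^{q(\cdot)}(\mathbb{R}^n)$ is defined in the same way with $q(\cdot)$ in place of $p(\cdot)$. "Can be extended" is understood as follows: $I_\alpha$ is given by its integral formula on the subspaces $H^{p(\cdot)}(\mathbb{R}^n)\cap L^{p_0}(\mathbb{R}^n)$, $\max\{1,p_+\}<p_0<\frac n\alpha$, which are dense in $H^{p(\cdot)}(\mathbb{R}^n)$,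 and there is a bounded linear operator $H^{p(\cdot)}(\mathbb{R}^n)\to H^{q(\cdot)}(\mathbb{R}^n)$ agreeing with it there. Bounded means $\|I_\alpha f\|_{H^{q(\cdot)}}\le C\|f\|_{H^{p(\cdot)}}$ with $C$ independent of $f$. *)

theory Defs
  imports "HOL-Analysis.Analysis"
begin

definition coord_deriv :: "'n::finite \<Rightarrow> (real ^ 'n \<Rightarrow> complex) \<Rightarrow> real ^ 'n \<Rightarrow> complex" where
  "coord_deriv i f x = frechet_derivative f (at x) (axis i 1)"

text \<open>
  The list of coordinates \<open>is\<close> runs over all finite lists, so this says that iterated
  partial derivatives of all orders exist and are (totally) differentiable, hence continuous.
\<close>

definition smooth :: "(real ^ 'n::finite \<Rightarrow> complex) \<Rightarrow> bool" where
  "smooth f \<longleftrightarrow> (\<forall>is. foldr coord_deriv is f differentiable_on UNIV)"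

text \<open>
  Multi-indices are functions on the set of coordinates.  Since the index type carries no
  order, the partial derivatives of a multi-index are taken along some fixed enumeration of the
  coordinates; on smooth functions the choice of the enumeration is immaterial.
\<close>

definition coord_list :: "'n::finite list" where
  "coord_list = (SOME xs. distinct xs \<and> set xs = UNIV)"

definition multi_deriv ::
  "('n::finite \<Rightarrow> nat) \<Rightarrow> (real ^ 'n \<Rightarrow> complex) \<Rightarrow> real ^ 'n \<Rightarrow> complex" where
  "multi_deriv \<beta> f = foldr (\<lambda>i. coord_deriv i ^^ \<beta> i) coord_list f"

definition schwartz :: "(real ^ 'n::finite \<Rightarrow> complex) set" where
  "schwartz = {\<phi>. smooth \<phi> \<and>
     (\<forall>k \<beta>. bdd_above (range (\<lambda>x. (1 + norm x) ^ k * cmod (multi_deriv \<beta> \<phi> x))))}"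

definition schwartz_norm :: "nat \<Rightarrow> (real ^ 'n::finite \<Rightarrow> complex) \<Rightarrow> real" where
  "schwartz_norm N \<phi> =
     (\<Sum>\<beta> | sum \<beta> UNIV \<le> N. SUP x. (1 + norm x) ^ N * cmod (multi_deriv \<beta> \<phi> x))"

lemma coord_list: "distinct (coord_list :: 'n::finite list)" "set (coord_list :: 'n list) = UNIV"
proof -
  have "\<exists>xs :: 'n list. distinct xs \<and> set xs = UNIV"
    using finite_distinct_list[of "UNIV :: 'n set"] by auto
  then have "distinct (coord_list :: 'n list) \<and> set (coord_list :: 'n list) = UNIV"
    unfolding coord_list_def by (rule someI_ex)
  then show "distinct (coord_list :: 'n list)" "set (coord_list :: 'n list) = UNIV" by auto
qed

lemma finite_multi_indices: "finite {\<beta> :: 'n::finite \<Rightarrow> nat. sum \<beta> UNIV \<le> N}"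
proof (rule finite_subset)
  show "{\<beta> :: 'n \<Rightarrow> nat. sum \<beta> UNIV \<le> N} \<subseteq> Pi\<^sub>E UNIV (\<lambda>_. {..N})"
  proof
    fix \<beta> :: "'n \<Rightarrow> nat"
    assume "\<beta> \<in> {\<beta>. sum \<beta> UNIV \<le> N}"
    moreover have "\<beta> i \<le> sum \<beta> UNIV" for i
      by (rule member_le_sum) simp_all
    ultimately show "\<beta> \<in> Pi\<^sub>E UNIV (\<lambda>_. {..N})"
      by (simp add: PiE_UNIV_domain Pi_iff) (meson le_trans)
  qed
qed (rule finite_PiE; simp)

text \<open>The Frechet topology of the Schwartz space; the seminorms increase with \<open>N\<close>.\<close>

definition schwartz_topology :: "(real ^ 'n::finite \<Rightarrow> complex) topology" where
  "schwartz_topology = topology_generated_by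
     {{\<psi> \<in> schwartz. schwartz_norm N (\<lambda>x. \<psi> x - \<phi> x) < e} | \<phi> N e. \<phi> \<in> schwartz \<and> 0 < e}"

text \<open>
  A tempered distribution is normalized to be \<open>0\<close> outside the Schwartz space, so that equality of
  distributions is equality of HOL functions and the vector space operations are pointwise.
\<close>

definition tempered :: "((real ^ 'n::finite \<Rightarrow> complex) \<Rightarrow> complex) set" where
  "tempered = {f.
     (\<forall>\<phi>\<in>schwartz. \<forall>\<psi>\<in>schwartz. f (\<lambda>x. \<phi> x + \<psi> x) = f \<phi> + f \<psi>) \<and>
     (\<forall>c. \<forall>\<phi>\<in>schwartz. f (\<lambda>x. c * \<phi> x) = c * f \<phi>) \<and>
     continuous_map schwartz_topology euclidean f \<and>
     (\<forall>\<phi>. \<phi> \<notin> schwartz \<longrightarrow> f \<phi> = 0)}"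

definition represents ::
  "(real ^ 'n::finite \<Rightarrow> complex) \<Rightarrow> ((real ^ 'n \<Rightarrow> complex) \<Rightarrow> complex) \<Rightarrow> bool" where
  "represents g f \<longleftrightarrow> (\<forall>\<phi>\<in>schwartz.
     integrable lebesgue (\<lambda>x. g x * \<phi> x) \<and> f \<phi> = (LINT x|lebesgue. g x * \<phi> x))"

definition convolution ::
  "(real ^ 'n::finite \<Rightarrow> complex) \<Rightarrow> ((real ^ 'n \<Rightarrow> complex) \<Rightarrow> complex) \<Rightarrow> real ^ 'n \<Rightarrow> complex" where
  "convolution \<phi> f x = f (\<lambda>y. \<phi> (x - y))"

definition dilate :: "real \<Rightarrow> (real ^ 'n::finite \<Rightarrow> complex) \<Rightarrow> real ^ 'n \<Rightarrow> complex" where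
  "dilate t \<phi> x = complex_of_real (1 / t ^ CARD('n)) * \<phi> (x /\<^sub>R t)"

text \<open>Only used for positive \<open>r\<close>.\<close>

definition ennpowr :: "ennreal \<Rightarrow> real \<Rightarrow> ennreal" where
  "ennpowr a r = (if a = \<infinity> then \<infinity> else ennreal (enn2real a powr r))"

text \<open>The infimum of the empty set is \<open>\<infinity>\<close> here.\<close>

definition var_norm :: "(real ^ 'n::finite \<Rightarrow> real) \<Rightarrow> (real ^ 'n \<Rightarrow> ennreal) \<Rightarrow> ennreal" where
  "var_norm p g =
     Inf {ennreal l | l. 0 < l \<and> (\<integral>\<^sup>+ x. ennpowr (g x / ennreal l) (p x) \<partial>lebesgue) \<le> 1}"

definition test_class :: "nat \<Rightarrow> (real ^ 'n::finite \<Rightarrow> complex) set" where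
  "test_class N = {\<phi> \<in> schwartz. schwartz_norm N \<phi> \<le> 1}"

definition grand_maximal ::
  "nat \<Rightarrow> ((real ^ 'n::finite \<Rightarrow> complex) \<Rightarrow> complex) \<Rightarrow> real ^ 'n \<Rightarrow> ennreal" where
  "grand_maximal N f x =
     (SUP t\<in>{0<..}. SUP \<phi>\<in>test_class N. ennreal (cmod (convolution (dilate t \<phi>) f x)))"

definition hardy_norm ::
  "nat \<Rightarrow> (real ^ 'n::finite \<Rightarrow> real) \<Rightarrow> ((real ^ 'n \<Rightarrow> complex) \<Rightarrow> complex) \<Rightarrow> ennreal" where
  "hardy_norm N p f = var_norm p (grand_maximal N f)"

definition hardy ::
  "nat \<Rightarrow> (real ^ 'n::finite \<Rightarrow> real) \<Rightarrow> ((real ^ 'n \<Rightarrow> complex) \<Rightarrow> complex) set" where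
  "hardy N p = {f \<in> tempered. hardy_norm N p f < \<infinity>}"

definition Lp_fun :: "real \<Rightarrow> (real ^ 'n::finite \<Rightarrow> complex) set" where
  "Lp_fun s = {g \<in> borel_measurable lebesgue. integrable lebesgue (\<lambda>x. cmod (g x) powr s)}"

definition hardy_dense ::
  "nat \<Rightarrow> (real ^ 'n::finite \<Rightarrow> real) \<Rightarrow> ((real ^ 'n \<Rightarrow> complex) \<Rightarrow> complex) set \<Rightarrow> bool" where
  "hardy_dense N p D \<longleftrightarrow> D \<subseteq> hardy N p \<and>
     (\<forall>f\<in>hardy N p. \<forall>e>0. \<exists>h\<in>D. hardy_norm N p (\<lambda>\<phi>. f \<phi> - h \<phi>) < e)"

definition bounded_hardy_operator ::
  "nat \<Rightarrow> (real ^ 'n::finite \<Rightarrow> real) \<Rightarrow> (real ^ 'n \<Rightarrow> real) \<Rightarrow>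
   (((real ^ 'n \<Rightarrow> complex) \<Rightarrow> complex) \<Rightarrow> ((real ^ 'n \<Rightarrow> complex) \<Rightarrow> complex)) \<Rightarrow> bool" where
  "bounded_hardy_operator N p q T \<longleftrightarrow>
     (\<forall>f\<in>hardy N p. T f \<in> hardy N q) \<and>
     (\<forall>f\<in>hardy N p. \<forall>g\<in>hardy N p. T (\<lambda>\<phi>. f \<phi> + g \<phi>) = (\<lambda>\<phi>. T f \<phi> + T g \<phi>)) \<and>
     (\<forall>c. \<forall>f\<in>hardy N p. T (\<lambda>\<phi>. c * f \<phi>) = (\<lambda>\<phi>. c * T f \<phi>)) \<and>
     (\<exists>C::real. \<forall>f\<in>hardy N p. hardy_norm N q (T f) \<le> ennreal C * hardy_norm N p f)"

definition local_log_holder :: "(real ^ 'n::finite \<Rightarrow> real) \<Rightarrow> bool" where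
  "local_log_holder p \<longleftrightarrow> (\<exists>c. \<forall>x y. 0 < norm (x - y) \<and> norm (x - y) < 1 / 2 \<longrightarrow>
     \<bar>p x - p y\<bar> \<le> c / (- ln (norm (x - y))))"

definition log_holder_at_infinity :: "(real ^ 'n::finite \<Rightarrow> real) \<Rightarrow> bool" where
  "log_holder_at_infinity p \<longleftrightarrow>
     (\<exists>C p_inf. \<forall>x. \<bar>p x - p_inf\<bar> \<le> C / ln (exp 1 + norm x))"

definition exp_minus :: "(real ^ 'n::finite \<Rightarrow> real) \<Rightarrow> ereal" where
  "exp_minus p = (INF x. ereal (p x))"

definition exp_plus :: "(real ^ 'n::finite \<Rightarrow> real) \<Rightarrow> ereal" where
  "exp_plus p = (SUP x. ereal (p x))"

definition riesz_potential ::
  "real \<Rightarrow> (real ^ 'n::finite \<Rightarrow> complex) \<Rightarrow> real ^ 'n \<Rightarrow> complex" where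
  "riesz_potential \<alpha> f x =
     (LINT y|lebesgue. complex_of_real (1 / norm (x - y) powr (real CARD('n) - \<alpha>)) * f y)"

end

theory Submission
  imports Defs
begin

text \<open>
  A function \<open>\<phi>\<close> whose derivatives of order at most \<open>N\<close> obey the bounds of an \<open>L\<^sup>1\<close>-normalized bump
  centred at \<open>x\<close> with scale \<open>s\<close> satisfies \<open>\<bar>f \<phi>\<bar> \<le> C M f x\<close>, where \<open>M\<close> is the grand maximal function.

  Boundedness: with a radial mollifier \<open>\<theta>\<close>, the operator
  \<open>f \<mapsto> c\<^sub>\<alpha> \<integral> t powr (\<alpha> - 1) f (\<theta>\<^sub>t * \<cdot>) dt\<close> makes sense on the whole Hardy space and is the Riesz potential
  on functions.  Since \<open>\<bar>f (\<theta>\<^sub>t * \<phi>)\<bar>\<close> is controlled by the infimum of \<open>M f\<close> on a ball of radius \<open>t\<close>, and log-Holder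
  continuity bounds this infimum by powers of \<open>t\<close>, Hedberg's splitting of the \<open>t\<close>-integral gives a pointwise bound for
  the grand maximal function of the image.

  Density: let \<open>E = {M f \<le> \<lambda>}\<close>.  With cutoffs \<open>\<rho>\<^sub>k\<close> living where the distance to \<open>E\<close> is about \<open>2\<^sup>-\<^sup>k\<close> and
  high order smoothing operators \<open>S\<^sub>k\<close> at that scale, the functionals \<open>\<phi> \<mapsto> f (\<Sum>\<^sub>k \<rho>\<^sub>k S\<^sub>k \<phi>)\<close> are given by densities
  bounded by \<open>C min \<lambda> (M f)\<close>.  A weak limit \<open>g\<close> of them lies in the Lebesgue spaces, satisfies \<open>M g \<le> C M f\<close>, and
  \<open>M (f - g)\<close> tends to \<open>0\<close> almost everywhere as \<open>\<lambda> \<rightarrow> \<infinity>\<close> along a suitable sequence, so dominated convergence applies.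
\<close>

text \<open>As the exponent may lie below 1, the proof avoids the Hardy-Littlewood maximal operator
  and atomic decompositions altogether; the grand maximal function is only compared at different
  points. A mollification at scale t is an adapted test function of scale at least t, so any point
  within t serves as its centre, and an infimum over a ball takes over the role of an average.
  Log-Hoelder continuity is thus applied to numbers, and only to \<open>p\<close>; of
  \<open>q\<close> just its relation to \<open>p\<close> enters.

  For density the obstacle is again a small p_-. The error on the set \<open>E\<close> is a
  Marcinkiewicz type integral, and such integrals are controlled in \<open>L^1\<close>. A high order
  of decay bounds the error by a j-th power of an integrable function, while the superlevel set at
  height t has measure of order t^(-p_-), so 1/j < p_- suffices. Each of the j factors consumes n +
  1 orders, whence N >= j (n + 1).

  Constants have to be fixed before the distribution and the height are chosen; they are therefore
  closed terms in the dimension and \<open>N\<close>.\<close>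

abbreviation cplx :: "real \<Rightarrow> complex" where "cplx \<equiv> complex_of_real"

type_synonym 'n cfun = "(real, 'n) vec \<Rightarrow> complex"

abbreviation scale (infixr "*R" 75) where "a *R x \<equiv> scaleR a x"

abbreviation lint_lborel (binder "LL " 10) where "lint_lborel f \<equiv> integral\<^sup>L lborel f"

abbreviation nn_lborel (binder "NN " 10) where "nn_lborel f \<equiv> nn_integral lborel f"

section \<open>Iterated partial derivatives\<close>

abbreviation Dl :: "'n::finite list => ('n cfun) => 'n cfun" where
 "Dl is f \<equiv> foldr coord_deriv is f"

lemma coord_deriv_eqI:
 assumes "(f has_derivative f') (at x)"
 shows "coord_deriv i f x = f' (axis i 1)" using frechet_derivative_at[OF assms] by (simp add: coord_deriv_def)

lemma smooth_has_derivative: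
 assumes "smooth f"
 shows "(Dl is f has_derivative frechet_derivative (Dl is f) (at x)) (at x)" using assms frechet_derivative_works
 by (metis smooth_def differentiable_on_def iso_tuple_UNIV_I)

lemma smooth_has_derivative0:
 assumes "smooth f"
 shows "(f has_derivative frechet_derivative f (at x)) (at x)" using smooth_has_derivative[OF assms, of "[]"] by simp

lemma smooth_coord_deriv: "smooth f ==> smooth (coord_deriv i f)" unfolding smooth_def
proof
 fix "is" assume "\<forall>is. Dl is f differentiable_on UNIV"
 then have "Dl (is @ [i]) f differentiable_on UNIV" by blast
 then show "Dl is (coord_deriv i f) differentiable_on UNIV" by simp
qed

lemma smooth_Dl: "smooth f ==> smooth (Dl is f)" by (induction "is") (auto intro: smooth_coord_deriv)

text \<open>\<open>smooth\<close> speaks about all iterated derivatives at once; a class of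
  differentiable functions closed under \<open>coord_deriv\<close> contains them all. The closure
  properties are reduced to naming such a class.\<close>

lemma smooth_coinduct:
 assumes "f \<in> G"
  and "!!f. f \<in> G ==> f differentiable_on UNIV"
  and "!!f i. f \<in> G ==> coord_deriv i f \<in> G"
 shows "smooth f"
proof -
 have "Dl is f \<in> G" for "is" by (induction "is") (auto intro: assms)
 then show ?thesis using assms(2) by (simp add: smooth_def)
qed

lemma frechet_sum:
 assumes "(f has_derivative f') (at x)"
 shows "f' h = (\<Sum>i\<in>UNIV. (h $ i) *R coord_deriv i f x)"
proof -
 interpret bounded_linear f' using assms by (rule has_derivative_bounded_linear)
 have "f' h = f' (\<Sum>i\<in>UNIV. (h $ i) *R axis i 1)" by (simp add: basis_expansion flip: scalar_mult_eq_scaleR)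
 also have "... = (\<Sum>i\<in>UNIV. (h $ i) *R f' (axis i 1))" by (simp add: sum scaleR)
 finally show ?thesis using coord_deriv_eqI[OF assms] by simp
qed

lemma smooth_has_derivative_sum:
 assumes "smooth f"
 shows "(f has_derivative (%h. \<Sum>i\<in>UNIV. (h $ i) *R coord_deriv i f x)) (at x)"
proof -
 have "frechet_derivative f (at x) = (%h. \<Sum>i\<in>UNIV. (h $ i) *R coord_deriv i f x)" using frechet_sum[OF smooth_has_derivative0[OF assms]] by auto
 then show ?thesis using smooth_has_derivative0[OF assms, of x] by simp
qed

lemma smooth_continuous: "smooth f ==> continuous_on A f" by (meson continuous_at_imp_continuous_on has_derivative_continuous smooth_has_derivative0)

lemma smooth_measurable: "smooth f ==> f \<in> borel_measurable borel" by (intro borel_measurable_continuous_onI smooth_continuous)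

lemma coord_deriv_add:
 assumes "smooth f" "smooth g"
 shows "coord_deriv i (%x. f x + g x) = (%x. coord_deriv i f x + coord_deriv i g x)"
 by (rule ext, subst coord_deriv_eqI[OF has_derivative_add[OF smooth_has_derivative0 smooth_has_derivative0]])
  (use assms in \<open>auto simp: coord_deriv_def\<close>)

lemma coord_deriv_diff:
 assumes "smooth f" "smooth g"
 shows "coord_deriv i (%x. f x - g x) = (%x. coord_deriv i f x - coord_deriv i g x)"
 by (rule ext, subst coord_deriv_eqI[OF has_derivative_diff[OF smooth_has_derivative0 smooth_has_derivative0]])
  (use assms in \<open>auto simp: coord_deriv_def\<close>)

lemma coord_deriv_mult:
 assumes "smooth f" "smooth g"
 shows "coord_deriv i (%x. f x * g x) = (%x. coord_deriv i f x * g x + f x * coord_deriv i g x)"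
 by (rule ext, subst coord_deriv_eqI[OF has_derivative_mult[OF smooth_has_derivative0 smooth_has_derivative0]])
  (use assms in \<open>auto simp: coord_deriv_def\<close>)

lemma coord_deriv_cmult:
 assumes "smooth f"
 shows "coord_deriv i (%x. c * f x) = (%x. c * coord_deriv i f x)" by (rule ext, subst coord_deriv_eqI[OF has_derivative_mult_right[OF smooth_has_derivative0]])
  (use assms in \<open>auto simp: coord_deriv_def\<close>)

lemma coord_deriv_affine:
 assumes "smooth f"
 shows "coord_deriv i (%x. f (a + c *R x)) = (%x. cplx c * coord_deriv i f (a + c *R x))"
proof
 fix x
 let ?D = "frechet_derivative f (at (a + c *R x))"
 interpret bounded_linear ?D using smooth_has_derivative0[OF assms] by (rule has_derivative_bounded_linear)
 have "((%x. a + c *R x) has_derivative (%h. c *R h)) (at x)" by (auto intro!: derivative_eq_intros)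
 from has_derivative_compose[OF this smooth_has_derivative0[OF assms]]
 have "((%x. f (a + c *R x)) has_derivative (%h. ?D (c *R h))) (at x)" .
 from coord_deriv_eqI[OF this] show "coord_deriv i (%x. f (a + c *R x)) x = cplx c * coord_deriv i f (a + c *R x)"
  unfolding coord_deriv_def scaleR by (simp add: scaleR_conv_of_real)
qed

lemma coord_deriv_const: "coord_deriv i (%x. c) = (%x. 0)" by (rule ext, subst coord_deriv_eqI[OF has_derivative_const]) simp

lemma smooth_const: "smooth (%x. c)" by (rule smooth_coinduct[where G="range (%c x. c)"]) (auto simp: coord_deriv_const)

lemma smooth_add: assumes "smooth f" "smooth g" shows "smooth (%x. f x + g x)"
proof (rule smooth_coinduct[where G="{%x. f x + g x |f g. smooth f \<and> smooth g}"])
 fix h i assume "h \<in> {%x. f x + g x |f g. smooth f \<and> smooth g}"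
 then obtain f g where h: "h = (%x. f x + g x)" "smooth f" "smooth g" by blast
 then show "h differentiable_on UNIV" using smooth_def[of f] smooth_def[of g] by (metis differentiable_on_add foldr.simps(1) id_apply)
 show "coord_deriv i h \<in> {%x. f x + g x |f g. smooth f \<and> smooth g}" using h coord_deriv_add[OF h(2,3)] smooth_coord_deriv by blast
qed (use assms in blast)

lemma smooth_cmult: assumes "smooth f" shows "smooth (%x. c * f x)"
proof (rule smooth_coinduct[where G="{%x. c * f x |f. smooth f}"])
 fix h i assume "h \<in> {%x. c * f x |f. smooth f}"
 then obtain f where h: "h = (%x. c * f x)" "smooth f" by blast
 then show "h differentiable_on UNIV" by (auto simp: differentiable_on_def differentiable_def intro!: has_derivative_mult_right smooth_has_derivative0)
 show "coord_deriv i h \<in> {%x. c * f x |f. smooth f}" using h coord_deriv_cmult[OF h(2)] smooth_coord_deriv by blast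
qed (use assms in blast)

lemma smooth_diff: assumes "smooth f" "smooth g" shows "smooth (%x. f x - g x)" using smooth_add[OF assms(1) smooth_cmult[OF assms(2), of "-1"]] by simp

lemma smooth_sum: "(!!a. a \<in> A ==> smooth (f a)) ==> smooth (%x. \<Sum>a\<in>A. f a x)"
 by (induction A rule: infinite_finite_induct) (auto intro: smooth_const smooth_add)

lemma smooth_affine: assumes "smooth f" shows "smooth (%x. f (a + c *R x))"
proof (rule smooth_coinduct[where G="{%x. k * f (a + c *R x) |k f. smooth f}"])
 fix h i assume "h \<in> {%x. k * f (a + c *R x) |k f. smooth f}"
 then obtain f k where h: "h = (%x. k * f (a + c *R x))" "smooth f" by blast
 have d: "((%x. f (a + c *R x)) has_derivative (%h. frechet_derivative f (at (a + c *R x)) (c *R h))) (at x)" for x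
  by (rule has_derivative_compose[OF _ smooth_has_derivative0[OF h(2)]])
   (auto intro!: derivative_eq_intros)
 show "h differentiable_on UNIV" unfolding h differentiable_on_def differentiable_def using d has_derivative_mult_right by blast
 have "coord_deriv i h = (%x. (k * of_real c) * coord_deriv i f (a + c *R x))"
 proof
  fix x show "coord_deriv i h x = (k * of_real c) * coord_deriv i f (a + c *R x)" unfolding h coord_deriv_eqI[OF has_derivative_mult_right[OF d]]
   using coord_deriv_affine[OF h(2), of i a c] coord_deriv_eqI[OF d, of i] by (metis mult.assoc)
 qed
 then show "coord_deriv i h \<in> {%x. k * f (a + c *R x) |k f. smooth f}" using smooth_coord_deriv[OF h(2)] by blast
next
 show "(%x. f (a + c *R x)) \<in> {%x. k * f (a + c *R x) |k f. smooth f}" using assms by (intro CollectI exI[of _ 1] exI[of _ f]) auto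
qed

text \<open>Products alone are not closed under differentiation, since the product rule yields a sum
  of two products. Closing them under sums as well makes \<open>smooth_coinduct\<close>
  applicable.\<close>

inductive_set smooth_products :: "('n::finite cfun) set" where
 prod: "smooth f ==> smooth g ==> (%x. f x * g x) \<in> smooth_products"
| add: "u \<in> smooth_products ==> v \<in> smooth_products ==> (%x. u x + v x) \<in> smooth_products"

lemma smooth_products_deriv:
 assumes "h \<in> smooth_products"
 shows "(\<forall>x. h differentiable (at x)) \<and> coord_deriv i h \<in> smooth_products" using assms
proof induction
 case (prod f g)
 have "(%x. f x * g x) differentiable (at x)" for x using has_derivative_mult[OF smooth_has_derivative0 smooth_has_derivative0] prod
  by (auto simp: differentiable_def)
 then show ?case unfolding coord_deriv_mult[OF prod] by (intro conjI allI smooth_products.intros smooth_coord_deriv prod)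
next
 case (add u v)
 have d: "((%x. u x + v x) has_derivative (%h. frechet_derivative u (at x) h + frechet_derivative v (at x) h)) (at x)" for x
  using add by (intro has_derivative_add) (simp_all add: frechet_derivative_works)
 have "coord_deriv i (%x. u x + v x) = (%x. coord_deriv i u x + coord_deriv i v x)" by (rule ext, subst coord_deriv_eqI[OF d]) (simp add: coord_deriv_def)
 then show ?case using add d by (auto simp: differentiable_def intro: smooth_products.add)
qed

lemma smooth_mult: assumes "smooth f" "smooth g" shows "smooth (%x. f x * g x)" by (rule smooth_coinduct[OF smooth_products.prod[OF assms]])
  (use smooth_products_deriv in \<open>auto simp: differentiable_on_def intro: differentiable_at_withinI\<close>)

lemma Dl_snoc: "Dl (is @ [i]) f = Dl is (coord_deriv i f)" by simp

lemma Dl_add: "smooth f ==> smooth g ==> Dl is (%x. f x + g x) = (%x. Dl is f x + Dl is g x)" by (induction "is") (auto simp: coord_deriv_add smooth_Dl)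

lemma Dl_diff: "smooth f ==> smooth g ==> Dl is (%x. f x - g x) = (%x. Dl is f x - Dl is g x)" by (induction "is") (auto simp: coord_deriv_diff smooth_Dl)

lemma Dl_cmult: "smooth f ==> Dl is (%x. c * f x) = (%x. c * Dl is f x)" by (induction "is") (auto simp: coord_deriv_cmult smooth_Dl)

lemma Dl_0: "Dl is (%x. 0) = (%x. 0)" by (induction "is") (auto simp: coord_deriv_const)

lemma Dl_const: "is ~= [] ==> Dl is (%x. c) = (%x. 0)" by (induction "is" rule: rev_induct) (auto simp: coord_deriv_const Dl_0)

lemma Dl_sum: "finite A ==> (!!a. a \<in> A ==> smooth (f a)) ==> Dl is (%x. \<Sum>a\<in>A. f a x) = (%x. \<Sum>a\<in>A. Dl is (f a) x)"
 by (induction A rule: finite_induct) (auto simp: Dl_0 Dl_add smooth_sum)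

lemma Dl_affine:
 "smooth f ==> Dl is (%x. f (a + c *R x)) = (%x. cplx (c ^ length is) * Dl is f (a + c *R x))"
 by (induction "is") (auto simp: coord_deriv_affine coord_deriv_cmult smooth_Dl smooth_affine)

text \<open>A Leibniz rule without binomial coefficients: expanding gives 2 ^ length is products,
  and in each one every derivative falls on exactly one factor. Only the numbers of derivatives on
  either side are recorded, which is all that scale estimates need.\<close>

lemma Dl_mult_le:
 assumes "smooth f" "smooth g"
  and "!!js ks. length js + length ks = length is ==> cmod (Dl js f y) * cmod (Dl ks g y) <= B"
 shows "cmod (Dl is (%x. f x * g x) y) <= 2 ^ length is * B" using assms
proof (induction "is" arbitrary: f g rule: rev_induct)
 case Nil
 then show ?case using Nil(3)[of "[]" "[]"] by (simp add: norm_mult)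
next
 case (snoc i "is")
 have s: "smooth (coord_deriv i f)" "smooth (coord_deriv i g)" using snoc smooth_coord_deriv by auto
 have "cmod (Dl is (%x. coord_deriv i f x * g x) y) <= 2 ^ length is * B" using snoc.prems(3)[of "_ @ [i]" _] by (intro snoc.IH s snoc.prems) auto
 moreover have "cmod (Dl is (%x. f x * coord_deriv i g x) y) <= 2 ^ length is * B" using snoc.prems(3)[of _ "_ @ [i]"] by (intro snoc.IH s snoc.prems) auto
 moreover have "Dl (is @ [i]) (%x. f x * g x) y =
   Dl is (%x. coord_deriv i f x * g x) y + Dl is (%x. f x * coord_deriv i g x) y" unfolding Dl_snoc coord_deriv_mult[OF snoc.prems(1,2)]
  by (subst Dl_add) (auto intro!: smooth_mult snoc.prems s)
 moreover have "cmod (Dl is (%x. coord_deriv i f x * g x) y + Dl is (%x. f x * coord_deriv i g x) y)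
  <= cmod (Dl is (%x. coord_deriv i f x * g x) y) + cmod (Dl is (%x. f x * coord_deriv i g x) y)" by (rule norm_triangle_ineq)
 ultimately show ?case by simp
qed

lemma Dl_eq_0_open:
 assumes "open U" "y \<in> U" "!!x. x \<in> U ==> f x = 0"
 shows "Dl is f y = 0" using assms(2)
proof (induction "is" arbitrary: y)
 case Nil
 then show ?case using assms by simp
next
 case (Cons i "is")
 have "(Dl is f has_derivative (%_. 0)) (at y)" by (rule has_derivative_transform_within_open[OF has_derivative_const[of 0] assms(1) Cons.prems])
   (use Cons.IH in simp)
 then show ?case using coord_deriv_eqI by fastforce
qed

subsection \<open>Symmetry\<close>

lemma second_difference_bound:
 fixes f :: "'n::finite cfun"
 assumes f: "smooth f" and "0 < e"
 shows "\<exists>d>0. \<forall>h. 0 < h \<and> h < d -->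
  cmod (f (x + h *R axis i 1 + h *R axis j 1) - f (x + h *R axis i 1) - f (x + h *R axis j 1) + f x
   - of_real (h * h) * coord_deriv j (coord_deriv i f) x) <= e * (h * h)"
proof -
 let ?u = "axis i 1 :: real ^ 'n" and ?v = "axis j 1 :: real ^ 'n"
 let ?g = "coord_deriv i f"
 define L where "L = frechet_derivative ?g (at x)"
 have g: "(?g has_derivative L) (at x)" unfolding L_def by (intro smooth_has_derivative0 smooth_coord_deriv f)
 then interpret L: bounded_linear L by (rule has_derivative_bounded_linear)
 from g obtain d where d: "d > 0" "!!y. norm (y - x) < d ==> norm (?g y - ?g x - L (y - x)) <= e / 4 * norm (y - x)"
  using spec[OF conjunct2[OF g[unfolded has_derivative_at_alt]], of "e/4"] \<open>0 < e\<close> by auto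
 have Lv: "L ?v = coord_deriv j ?g x" unfolding L_def coord_deriv_def ..
 show ?thesis
 proof (intro exI[of _ "d/2"] conjI allI impI)
  show "d/2 > 0" using d by simp
  fix h assume h: "0 < h \<and> h < d/2"
  \<comment> \<open>The increment of \<psi> over [0, h] is the second difference minus its predicted
    value. The mean value inequality reduces the claim to linearization errors of \<open>?g\<close>
    at two points whose distances from \<open>x\<close> are at most 2 h and h.\<close>
  define \<psi> where "\<psi> = (%s. f (x + s *R ?u + h *R ?v) - f (x + s *R ?u) - of_real (s * h) * L ?v)"
  have der: "(\<psi> has_vector_derivative (?g (x + s *R ?u + h *R ?v) - ?g (x + s *R ?u) - of_real h * L ?v)) (at s within {0..h})" for s
  proof -
   have *: "((%s. f (a + s *R ?u)) has_derivative (%t. t *R ?g (a + s *R ?u))) (at s)" for a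
   proof -
    have "((%s. a + s *R ?u) has_derivative (%t. t *R ?u)) (at s)" by (auto intro!: derivative_eq_intros)
    from has_derivative_compose[OF this smooth_has_derivative0[OF f]]
    have "((%s. f (a + s *R ?u)) has_derivative (%t. frechet_derivative f (at (a + s *R ?u)) (t *R ?u))) (at s)" .
    moreover have "frechet_derivative f (at (a + s *R ?u)) (t *R ?u) = t *R ?g (a + s *R ?u)" for t
     using has_derivative_bounded_linear[OF smooth_has_derivative0[OF f]] by (simp add: coord_deriv_def linear_simps)
    ultimately show ?thesis by simp
   qed
   have "(\<psi> has_derivative (%t. t *R ?g (x + h *R ?v + s *R ?u) - t *R ?g (x + s *R ?u) - of_real (t * h) * L ?v)) (at s)" unfolding \<psi>_def
    using *[of "x + h *R ?v"] *[of x] by (auto intro!: derivative_eq_intros simp: algebra_simps)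
   moreover have "(%t. t *R ?g (x + h *R ?v + s *R ?u) - t *R ?g (x + s *R ?u) - of_real (t * h) * L ?v)
     = (%t. t *R (?g (x + s *R ?u + h *R ?v) - ?g (x + s *R ?u) - of_real h * L ?v))"
   proof
    fix t
    have "x + h *R ?v + s *R ?u = x + s *R ?u + h *R ?v" by (simp only: add.assoc add.commute[of "h *R ?v"])
    then show "t *R ?g (x + h *R ?v + s *R ?u) - t *R ?g (x + s *R ?u) - of_real (t * h) * L ?v
     = t *R (?g (x + s *R ?u + h *R ?v) - ?g (x + s *R ?u) - of_real h * L ?v)" by (simp only: scaleR_diff_right) (simp add: scaleR_conv_of_real)
   qed
   ultimately show ?thesis unfolding has_vector_derivative_def by (rule has_derivative_at_withinI[OF has_derivative_eq_rhs])
  qed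
  have bd: "norm (?g (x + s *R ?u + h *R ?v) - ?g (x + s *R ?u) - of_real h * L ?v) <= e * h" if s: "s \<in> {0..h}" for s
  proof -
   let ?a = "s *R ?u + h *R ?v" and ?b = "s *R ?u"
   have n: "norm ?a <= 2 * h" "norm ?b <= h" using s h norm_triangle_ineq[of "s *R ?u" "h *R ?v"] by auto
   have 1: "norm (?g (x + ?a) - ?g x - L ?a) <= e / 4 * norm ?a" using d(2)[of "x + ?a"] n h by simp
   have 2: "norm (?g (x + ?b) - ?g x - L ?b) <= e / 4 * norm ?b" using d(2)[of "x + ?b"] n h by simp
   have E: "?g (x + s *R ?u + h *R ?v) - ?g (x + s *R ?u) - of_real h * L ?v =
    (?g (x + ?a) - ?g x - L ?a) - (?g (x + ?b) - ?g x - L ?b)" by (simp only: L.add L.scaleR) (simp add: algebra_simps scaleR_conv_of_real)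
   have "norm (?g (x + s *R ?u + h *R ?v) - ?g (x + s *R ?u) - of_real h * L ?v) <= e / 4 * norm ?a + e / 4 * norm ?b"
    unfolding E by (rule order_trans[OF norm_triangle_ineq4 add_mono[OF 1 2]])
   also have "... <= e / 4 * (2 * h) + e / 4 * h" using n \<open>0 < e\<close> by (intro add_mono mult_left_mono) auto
   also have "... <= e * h" using h \<open>0 < e\<close> by simp
   finally show ?thesis .
  qed
  have "norm (\<psi> h - \<psi> 0) <= e * h * norm (h - 0)"
   by (rule differentiable_bound[where S="{0..h}" and f'="%s t. t *R (?g (x + s *R ?u + h *R ?v) - ?g (x + s *R ?u) - of_real h * L ?v)"])
    (use der bd h \<open>0 < e\<close> in \<open>auto simp: has_vector_derivative_def mult.commute intro!: onorm_le mult_left_mono\<close>)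
  then show "cmod (f (x + h *R ?u + h *R ?v) - f (x + h *R ?u) - f (x + h *R ?v) + f x
   - of_real (h * h) * coord_deriv j ?g x) <= e * (h * h)" using h by (simp add: \<psi>_def Lv algebra_simps)
 qed
qed

lemma coord_deriv_commute:
 assumes "smooth f"
 shows "coord_deriv i (coord_deriv j f) = coord_deriv j (coord_deriv i f)"
proof
 fix x
 let ?A = "coord_deriv i (coord_deriv j f) x" and ?B = "coord_deriv j (coord_deriv i f) x"
 have "cmod (?A - ?B) <= e" if "e > 0" for e
 proof -
  from second_difference_bound[OF assms, of "e/2" x i j] that
  obtain d1 where d1: "d1 > 0" "!!h. 0 < h ==> h < d1 ==> cmod (f (x + h *R axis i 1 + h *R axis j 1) - f (x + h *R axis i 1) - f (x + h *R axis j 1) + f x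
   - of_real (h * h) * ?B) <= e/2 * (h * h)" by auto
  from second_difference_bound[OF assms, of "e/2" x j i] that
  obtain d2 where d2: "d2 > 0" "!!h. 0 < h ==> h < d2 ==> cmod (f (x + h *R axis j 1 + h *R axis i 1) - f (x + h *R axis j 1) - f (x + h *R axis i 1) + f x
   - of_real (h * h) * ?A) <= e/2 * (h * h)" by auto
  define h where "h = min d1 d2 / 2"
  have h: "0 < h" "h < d1" "h < d2" using d1 d2 by (auto simp: h_def)
  define Q where "Q = f (x + h *R axis i 1 + h *R axis j 1) - f (x + h *R axis i 1) - f (x + h *R axis j 1) + f x"
  have sw: "x + h *R axis j 1 + h *R axis i 1 = x + h *R axis i 1 + h *R axis j (1::real)" by (simp add: algebra_simps)
  have 1: "cmod (Q - of_real (h*h) * ?B) <= e/2 * (h*h)" using d1(2) h by (simp add: Q_def)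
  have 2: "cmod (Q - of_real (h*h) * ?A) <= e/2 * (h*h)" using d2(2)[of h] h unfolding Q_def sw by (simp add: algebra_simps)
  have "cmod (of_real (h*h) * (?A - ?B)) <= e * (h*h)" using norm_triangle_ineq4[of "Q - of_real (h*h) * ?B" "Q - of_real (h*h) * ?A"] 1 2
   by (simp add: algebra_simps)
  then have "(h*h) * cmod (?A - ?B) <= (h*h) * e" by (simp add: norm_mult mult_ac)
  then show ?thesis using h by (metis mult_le_cancel_left_pos mult_pos_pos)
 qed
 then have "cmod (?A - ?B) <= 0" by (meson field_le_epsilon le_less_trans dense_ge)
 then show "?A = ?B" by simp
qed

lemma Dl_remove1:
 assumes "smooth f" "i \<in> set ys"
 shows "Dl ys f = Dl (i # remove1 i ys) f" using assms(2)
proof (induction ys)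
 case (Cons k ys)
 show ?case
 proof (cases "k = i")
  case False
  then have "Dl ys f = Dl (i # remove1 i ys) f" using Cons by simp
  then have "Dl (k # ys) f = coord_deriv k (coord_deriv i (Dl (remove1 i ys) f))" by simp
  also have "... = coord_deriv i (coord_deriv k (Dl (remove1 i ys) f))" by (rule coord_deriv_commute) (rule smooth_Dl[OF assms(1)])
  finally show ?thesis using False by simp
 qed simp
qed simp

lemma Dl_perm:
 assumes "smooth f" "mset xs = mset ys"
 shows "Dl xs f = Dl ys f" using assms(2)
proof (induction xs arbitrary: ys)
 case (Cons i xs)
 have i: "i \<in> set ys" by (metis Cons.prems list.set_intros(1) set_mset_mset)
 have "mset xs = mset (remove1 i ys)" using Cons.prems by (metis add_mset_remove_trivial mset.simps(2) mset_remove1)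
 from Cons.IH[OF this] show ?case unfolding Dl_remove1[OF assms(1) i] by simp
qed simp

section \<open>Multi-indices against lists of coordinates\<close>

definition mi_list :: "('n::finite => nat) => 'n list" where
 "mi_list \<beta> = concat (map (%i. replicate (\<beta> i) i) coord_list)"

lemma multi_deriv_eq_Dl: "multi_deriv \<beta> f = Dl (mi_list \<beta>) f"
proof -
 have r: "foldr coord_deriv (replicate k i) f = (coord_deriv i ^^ k) f" for k and i :: "'m::finite" and f by (induction k) auto
 have "foldr (%i. coord_deriv i ^^ \<beta> i) xs f = Dl (concat (map (%i. replicate (\<beta> i) i) xs)) f" for xs by (induction xs) (auto simp: r)
 then show ?thesis by (simp add: multi_deriv_def mi_list_def)
qed

lemma mset_mi_list:
 fixes \<beta> :: "'n::finite => nat"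
 shows "count (mset (mi_list \<beta>)) i = \<beta> i"
proof -
 have "distinct xs ==> count (mset (concat (map (%i. replicate (\<beta> i) i) xs))) i = (if i \<in> set xs then \<beta> i else 0)" for xs by (induction xs) auto
 then show ?thesis using coord_list[where 'n='n] by (simp add: mi_list_def)
qed

lemma length_mi_list: "length (mi_list \<beta>) = sum \<beta> UNIV"
proof -
 have "size (mset (mi_list \<beta>)) = (\<Sum>i\<in>set_mset (mset (mi_list \<beta>)). count (mset (mi_list \<beta>)) i)" by (rule size_multiset_overloaded_eq)
 also have "... = (\<Sum>i\<in>UNIV. count (mset (mi_list \<beta>)) i)" by (intro sum.mono_neutral_left) (auto simp: count_eq_zero_iff simp del: count_mset)
 finally show ?thesis by (simp only: mset_mi_list size_mset)
qed

text \<open>Derivatives commute, so only multiplicities matter. This lets the estimates run over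
  lists and return to the multi-index seminorms at the end.\<close>

lemma Dl_eq_multi_deriv:
 assumes "smooth f"
 shows "Dl is f = multi_deriv (count (mset is)) f" "sum (count (mset is)) UNIV = length is"
proof -
 have m: "mset (mi_list (count (mset is))) = mset is" by (rule multiset_eqI) (simp only: mset_mi_list)
 then show "Dl is f = multi_deriv (count (mset is)) f" unfolding multi_deriv_eq_Dl by (metis Dl_perm[OF assms])
 show "sum (count (mset is)) UNIV = length is" using length_mi_list[of "count (mset is)"] m by (metis size_mset)
qed

section \<open>Schwartz functions and tempered distributions\<close>

text \<open>The multipliers of the Schwartz space that occur here: constants, cutoffs and Schwartz
  functions themselves. Decay cannot be demanded, because the cutoff \<open>rest\<close> is 1 on a
  set of infinite measure.\<close>

definition ubd :: "('n::finite cfun) => bool" where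
 "ubd f \<longleftrightarrow> smooth f \<and> (\<forall>is. \<exists>B. \<forall>x. cmod (Dl is f x) <= B)"

lemma schwartz_iff:
 "ph \<in> schwartz \<longleftrightarrow> smooth ph \<and> (\<forall>k is. \<exists>B. \<forall>x. (1 + norm x) ^ k * cmod (Dl is ph x) <= B)"
 (is "?L \<longleftrightarrow> ?R")
proof
 assume L: ?L
 then have s: "smooth ph" by (simp add: schwartz_def)
 show ?R
 proof (intro conjI allI s)
  fix k "is"
  have "bdd_above (range (%x. (1 + norm x) ^ k * cmod (multi_deriv (count (mset is)) ph x)))" using L by (simp add: schwartz_def)
  then show "\<exists>B. \<forall>x. (1 + norm x) ^ k * cmod (Dl is ph x) <= B" unfolding Dl_eq_multi_deriv(1)[OF s] by (auto simp: bdd_above_def)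
 qed
next
 assume ?R
 then show ?L unfolding schwartz_def multi_deriv_eq_Dl bdd_above_def by blast
qed

lemma schwartz_smooth: "ph \<in> schwartz ==> smooth ph" by (simp add: schwartz_def)

text \<open>There are finitely many lists of bounded length over a finite set of coordinates, so the
  separate constants add up to a single one.\<close>

lemma schwartz_boundE:
 assumes "ph \<in> schwartz"
 obtains B where "B >= 0" "!!is x. length is <= M ==> (1 + norm x) ^ k * cmod (Dl is ph x) <= B"
proof -
 have "\<forall>is. \<exists>B. \<forall>x. (1 + norm x) ^ k * cmod (Dl is ph x) <= B" using assms by (simp add: schwartz_iff)
 then obtain B where B: "!!is x. (1 + norm x) ^ k * cmod (Dl is ph x) <= B is" by metis
 have fin: "finite {is :: 'a list. length is <= M}" using finite_lists_length_le[of "UNIV :: 'a set" M] by simp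
 have B0: "B is >= 0" for "is" by (rule order_trans[OF _ B[of 0 "is"]]) simp
 show ?thesis
 proof (rule that)
  show "(\<Sum>is | length is <= M. B is) >= 0" by (intro sum_nonneg B0)
  fix "is" x assume l: "length (is :: 'a list) <= M"
  have "B is <= (\<Sum>is | length is <= M. B is)" using l fin B0 by (intro member_le_sum) auto
  then show "(1 + norm x) ^ k * cmod (Dl is ph x) <= (\<Sum>is | length is <= M. B is)" using B[of x "is"] by linarith
 qed
qed

lemma ubd_boundE:
 assumes "ubd ph"
 obtains B where "B >= 0" "!!is x. length is <= M ==> cmod (Dl is ph x) <= B"
proof -
 obtain B where B: "!!is x. cmod (Dl is ph x) <= B is" using assms unfolding ubd_def by metis
 have fin: "finite {is :: 'a list. length is <= M}" using finite_lists_length_le[of "UNIV :: 'a set" M] by simp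
 have B0: "B is >= 0" for "is" by (rule order_trans[OF _ B[of "is" 0]]) simp
 show ?thesis
 proof (rule that)
  show "(\<Sum>is | length is <= M. B is) >= 0" by (intro sum_nonneg B0)
  fix "is" x assume l: "length (is :: 'a list) <= M"
  have "B is <= (\<Sum>is | length is <= M. B is)" using l fin B0 by (intro member_le_sum) auto
  then show "cmod (Dl is ph x) <= (\<Sum>is | length is <= M. B is)" using B[of "is" x] by linarith
 qed
qed

lemma ubd_smooth: "ubd f ==> smooth f" by (simp add: ubd_def)

lemma ubd_coord_deriv: "ubd f ==> ubd (coord_deriv i f)" unfolding ubd_def by (metis Dl_snoc smooth_coord_deriv)

lemma ubd_Dl: "ubd f ==> ubd (Dl is f)" by (induction "is") (auto intro: ubd_coord_deriv)

lemma schwartz_ubd: assumes "ph \<in> schwartz" shows "ubd ph" unfolding ubd_def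
proof (intro conjI allI)
 fix "is"
 obtain B where "!!x. (1 + norm x) ^ 0 * cmod (Dl is ph x) <= B" using assms unfolding schwartz_iff by blast
 then show "\<exists>B. \<forall>x. cmod (Dl is ph x) <= B" by auto
qed (use assms in \<open>simp add: schwartz_iff\<close>)

lemma ubd_const: "ubd (%x. c)" unfolding ubd_def
proof (intro conjI smooth_const allI)
 fix "is" :: "'a list"
 show "\<exists>B. \<forall>x. cmod (Dl is (%x. c) x) <= B" by (cases "is = []") (auto simp: Dl_const)
qed

lemma ubd_add: assumes "ubd f" "ubd g" shows "ubd (%x. f x + g x)" unfolding ubd_def
proof (intro conjI allI)
 fix "is"
 obtain A B where "!!x. cmod (Dl is f x) <= A" "!!x. cmod (Dl is g x) <= B" using assms unfolding ubd_def by metis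
 then have "cmod (Dl is (%x. f x + g x) x) <= A + B" for x using assms by (simp add: Dl_add ubd_smooth norm_triangle_mono)
 then show "\<exists>B. \<forall>x. cmod (Dl is (%x. f x + g x) x) <= B" by blast
qed (use assms in \<open>simp add: smooth_add ubd_smooth\<close>)

lemma ubd_cmult: assumes "ubd f" shows "ubd (%x. c * f x)" unfolding ubd_def
proof (intro conjI allI)
 fix "is"
 obtain A where "!!x. cmod (Dl is f x) <= A" using assms unfolding ubd_def by metis
 then have "cmod (Dl is (%x. c * f x) x) <= cmod c * A" for x using assms by (simp add: Dl_cmult ubd_smooth norm_mult mult_left_mono)
 then show "\<exists>B. \<forall>x. cmod (Dl is (%x. c * f x) x) <= B" by blast
qed (use assms in \<open>simp add: smooth_cmult ubd_smooth\<close>)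

lemma ubd_diff: assumes "ubd f" "ubd g" shows "ubd (%x. f x - g x)" using ubd_add[OF assms(1) ubd_cmult[OF assms(2), of "-1"]] by simp

lemma ubd_affine: assumes "ubd f" shows "ubd (%x. f (a + c *R x))" unfolding ubd_def
proof (intro conjI allI)
 fix "is"
 obtain A where "!!x. cmod (Dl is f x) <= A" using assms unfolding ubd_def by metis
 then have "cmod (Dl is (%x. f (a + c *R x)) x) <= cmod (cplx (c ^ length is)) * A" for x
  using assms by (simp only: Dl_affine ubd_smooth norm_mult) (intro mult_left_mono norm_ge_zero)
 then show "\<exists>B. \<forall>x. cmod (Dl is (%x. f (a + c *R x)) x) <= B" by blast
qed (use assms in \<open>simp add: smooth_affine ubd_smooth\<close>)

lemma schwartz_mult_ubd:
 fixes f :: "'n::finite cfun"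
 assumes "ubd f" "ph \<in> schwartz" shows "(%x. f x * ph x) \<in> schwartz" unfolding schwartz_iff
proof (intro conjI allI)
 fix k and "is" :: "'n list"
 obtain A where A: "!!js x. length js <= length is ==> cmod (Dl js f x) <= A" "A >= 0" using ubd_boundE[OF assms(1), of "length is"] by metis
 obtain B where B: "!!js x. length js <= length is ==> (1 + norm x) ^ k * cmod (Dl js ph x) <= B" using schwartz_boundE[OF assms(2), of "length is" k] by metis
 have "(1 + norm x) ^ k * cmod (Dl is (%x. f x * ph x) x) <= 2 ^ length is * (A * B)" for x
 proof -
  have p: "(1 + norm x) ^ k > 0" by (simp add: add_pos_nonneg)
  have "cmod (Dl is (%x. f x * ph x) x) <= 2 ^ length is * (A * B / (1 + norm x) ^ k)"
  proof (rule Dl_mult_le)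
   fix js ks :: "'n list" assume l: "length js + length ks = length is"
   have "cmod (Dl js f x) * cmod (Dl ks ph x) <= A * (B / (1 + norm x) ^ k)"
    using A(1)[of js x] B[of ks x] l A(2) p by (intro mult_mono) (auto simp: field_simps)
   then show "cmod (Dl js f x) * cmod (Dl ks ph x) <= A * B / (1 + norm x) ^ k" by simp
  qed (use assms ubd_smooth schwartz_smooth in auto)
  then show ?thesis using p by (simp add: field_simps)
 qed
 then show "\<exists>B. \<forall>x. (1 + norm x) ^ k * cmod (Dl is (%x. f x * ph x) x) <= B" by blast
qed (use assms ubd_smooth schwartz_smooth smooth_mult in auto)

lemma ubd_mult:
 fixes f :: "'n::finite cfun"
 assumes "ubd f" "ubd g" shows "ubd (%x. f x * g x)" unfolding ubd_def
proof (intro conjI allI)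
 fix "is" :: "'n list"
 obtain A where A: "!!js x. length js <= length is ==> cmod (Dl js f x) <= A" "A >= 0" using ubd_boundE[OF assms(1), of "length is"] by metis
 obtain B where B: "!!js x. length js <= length is ==> cmod (Dl js g x) <= B" using ubd_boundE[OF assms(2), of "length is"] by metis
 have "cmod (Dl is (%x. f x * g x) x) <= 2 ^ length is * (A * B)" for x using A B assms by (intro Dl_mult_le mult_mono) (auto intro: ubd_smooth)
 then show "\<exists>B. \<forall>x. cmod (Dl is (%x. f x * g x) x) <= B" by blast
qed (use assms ubd_smooth smooth_mult in auto)

lemma schwartz_add: assumes "ph \<in> schwartz" "\<psi> \<in> schwartz" shows "(%x. ph x + \<psi> x) \<in> schwartz" unfolding schwartz_iff
proof (intro conjI allI)
 fix k "is"
 obtain A B where "!!x. (1 + norm x) ^ k * cmod (Dl is ph x) <= A" "!!x. (1 + norm x) ^ k * cmod (Dl is \<psi> x) <= B"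
  using assms unfolding schwartz_iff by metis
 then have *: "(1 + norm x) ^ k * cmod (Dl is ph x) + (1 + norm x) ^ k * cmod (Dl is \<psi> x) <= A + B" for x by (rule add_mono)
 have "(1 + norm x) ^ k * cmod (Dl is (%x. ph x + \<psi> x) x) <= A + B" for x
 proof -
  have "(1 + norm x) ^ k * cmod (Dl is ph x + Dl is \<psi> x) <= (1 + norm x) ^ k * (cmod (Dl is ph x) + cmod (Dl is \<psi> x))"
   by (intro mult_left_mono norm_triangle_ineq) simp
  then show ?thesis using *[of x] assms by (simp add: Dl_add schwartz_smooth algebra_simps)
 qed
 then show "\<exists>B. \<forall>x. (1 + norm x) ^ k * cmod (Dl is (%x. ph x + \<psi> x) x) <= B" by blast
qed (use assms in \<open>simp add: smooth_add schwartz_smooth\<close>)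

lemma schwartz_cmult: assumes "ph \<in> schwartz" shows "(%x. c * ph x) \<in> schwartz" using schwartz_mult_ubd[OF ubd_const assms] .

lemma schwartz_diff: assumes "ph \<in> schwartz" "\<psi> \<in> schwartz" shows "(%x. ph x - \<psi> x) \<in> schwartz"
 using schwartz_add[OF assms(1) schwartz_cmult[OF assms(2), of "-1"]] by simp

lemma schwartz_0: "(%x. 0) \<in> schwartz" by (auto simp: schwartz_iff smooth_const Dl_0)

lemma schwartz_sum: "(!!a. a \<in> A ==> f a \<in> schwartz) ==> (%x. \<Sum>a\<in>A. f a x) \<in> schwartz"
 by (induction A rule: infinite_finite_induct) (auto intro: schwartz_0 schwartz_add)

lemma schwartz_affine: assumes "ph \<in> schwartz" "c ~= 0" shows "(%x. ph (a + c *R x)) \<in> schwartz" unfolding schwartz_iff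
proof (intro conjI allI)
 fix k "is"
 obtain A where A: "!!x. (1 + norm x) ^ k * cmod (Dl is ph x) <= A" using assms unfolding schwartz_iff by metis
 define q where "q = (1 + norm a) * (1 + 1 / \<bar>c\<bar>)"
 have c: "\<bar>c\<bar> > 0" using assms by simp
 have "(1 + norm x) ^ k * cmod (Dl is (%x. ph (a + c *R x)) x) <= q ^ k * \<bar>c\<bar> ^ length is * A" for x
 proof -
  let ?y = "a + c *R x"
  have "norm (c *R x) <= norm ?y + norm a" using norm_triangle_ineq4[of ?y a] by simp
  then have "norm x <= (norm ?y + norm a) / \<bar>c\<bar>" using c by (simp add: field_simps)
  also have "1 + (norm ?y + norm a) / \<bar>c\<bar> <= q * (1 + norm ?y)" using c by (simp add: q_def field_simps)
  finally have "1 + norm x <= q * (1 + norm ?y)" by simp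
  then have "(1 + norm x) ^ k <= (q * (1 + norm ?y)) ^ k" by (intro power_mono) auto
  then have "(1 + norm x) ^ k * cmod (Dl is ph ?y) <= (q * (1 + norm ?y)) ^ k * cmod (Dl is ph ?y)" by (intro mult_right_mono) auto
  also have "... = q ^ k * ((1 + norm ?y) ^ k * cmod (Dl is ph ?y))" by (simp add: power_mult_distrib)
  also have "... <= q ^ k * A" using c by (intro mult_left_mono A) (simp add: q_def)
  finally have "(1 + norm x) ^ k * cmod (Dl is ph ?y) <= q ^ k * A" .
  then have "\<bar>c\<bar> ^ length is * ((1 + norm x) ^ k * cmod (Dl is ph ?y)) <= \<bar>c\<bar> ^ length is * (q ^ k * A)" by (intro mult_left_mono) auto
  then show ?thesis using assms by (simp only: Dl_affine schwartz_smooth norm_mult norm_of_real) (simp add: power_abs mult_ac)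
 qed
 then show "\<exists>B. \<forall>x. (1 + norm x) ^ k * cmod (Dl is (%x. ph (a + c *R x)) x) <= B" by blast
qed (use assms in \<open>simp add: smooth_affine schwartz_smooth\<close>)

subsection \<open>The seminorms\<close>

text \<open>\<open>schwartz_norm\<close> is a sum over multi-indices, while the estimates are
  uniform bounds over lists; this count is the price of the passage.\<close>

definition mi_card :: "'n::finite itself => nat => real" where
 "mi_card _ N = real (card {\<beta> :: 'n => nat. sum \<beta> UNIV <= N})"

lemma mi_card_pos: "mi_card TYPE('n::finite) N > 0"
proof -
 have "(%_. 0) \<in> {\<beta> :: 'n => nat. sum \<beta> UNIV <= N}" by simp
 then show ?thesis unfolding mi_card_def using finite_multi_indices[where 'n='n, of N] by (metis card_gt_0_iff empty_iff of_nat_0_less_iff)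
qed

lemma schwartz_seminorm_bdd:
 assumes "ph \<in> schwartz"
 shows "bdd_above (range (%x. (1 + norm x) ^ N * cmod (multi_deriv \<beta> ph x)))" using assms by (auto simp: schwartz_def)

lemma schwartz_norm_ge:
 assumes "ph \<in> schwartz" "length is <= N"
 shows "(1 + norm x) ^ N * cmod (Dl is ph x) <= schwartz_norm N ph"
proof -
 let ?s = "%\<beta>. SUP x. (1 + norm x) ^ N * cmod (multi_deriv \<beta> ph x)"
 have s0: "?s \<beta> >= 0" for \<beta> by (rule cSUP_upper2[OF schwartz_seminorm_bdd[OF assms(1)], of 0]) auto
 define b where "b = count (mset is)"
 have b: "Dl is ph = multi_deriv b ph" "sum b UNIV <= N" using Dl_eq_multi_deriv[OF schwartz_smooth[OF assms(1)], of "is"] assms(2) by (simp_all add: b_def)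
 have "(1 + norm x) ^ N * cmod (Dl is ph x) <= ?s b" unfolding b(1) by (rule cSUP_upper[OF _ schwartz_seminorm_bdd[OF assms(1)]]) simp
 also have "... <= schwartz_norm N ph" unfolding schwartz_norm_def using b(2) s0 finite_multi_indices by (intro member_le_sum) auto
 finally show ?thesis .
qed

lemma schwartz_norm_nonneg: "ph \<in> schwartz ==> schwartz_norm N ph >= 0" by (rule order_trans[OF _ schwartz_norm_ge[of ph "[]" N 0]]) auto

lemma schwartz_norm_le:
 fixes ph :: "'n::finite cfun"
 assumes "!!is x. length is <= N ==> (1 + norm x) ^ N * cmod (Dl is ph x) <= B"
 shows "schwartz_norm N ph <= mi_card TYPE('n) N * B"
proof -
 have "schwartz_norm N ph <= (\<Sum>\<beta> | sum (\<beta> :: 'n => nat) UNIV <= N. B)" unfolding schwartz_norm_def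
 proof (intro sum_mono cSUP_least)
  fix \<beta> :: "'n => nat" and x :: "real ^ 'n" assume "\<beta> \<in> {\<beta>. sum \<beta> UNIV <= N}"
  then show "(1 + norm x) ^ N * cmod (multi_deriv \<beta> ph x) <= B" unfolding multi_deriv_eq_Dl by (intro assms) (simp add: length_mi_list)
 qed simp
 then show ?thesis by (simp add: mi_card_def)
qed

lemma schwartz_norm_add:
 assumes "ph \<in> schwartz" "\<psi> \<in> schwartz"
 shows "schwartz_norm N (%x. ph x + \<psi> x) <= schwartz_norm N ph + schwartz_norm N \<psi>" unfolding schwartz_norm_def sum.distrib[symmetric]
proof (intro sum_mono cSUP_least)
 fix \<beta> :: "'a => nat" and x :: "real ^ 'a"
 have "(1 + norm x) ^ N * cmod (multi_deriv \<beta> (%x. ph x + \<psi> x) x) <=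
  (1 + norm x) ^ N * (cmod (multi_deriv \<beta> ph x) + cmod (multi_deriv \<beta> \<psi> x))"
  unfolding multi_deriv_eq_Dl Dl_add[OF schwartz_smooth[OF assms(1)] schwartz_smooth[OF assms(2)]] by (intro mult_left_mono norm_triangle_ineq) auto
 also have "... <= (SUP x. (1 + norm x) ^ N * cmod (multi_deriv \<beta> ph x)) + (SUP x. (1 + norm x) ^ N * cmod (multi_deriv \<beta> \<psi> x))"
  unfolding distrib_left by (intro add_mono cSUP_upper schwartz_seminorm_bdd assms) auto
 finally show "(1 + norm x) ^ N * cmod (multi_deriv \<beta> (%x. ph x + \<psi> x) x) <= ..." .
qed simp

lemma schwartz_norm_mono:
 assumes "ph \<in> schwartz" "M <= N"
 shows "schwartz_norm M ph <= schwartz_norm N ph"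
proof -
 have "schwartz_norm M ph <= (\<Sum>\<beta> | sum \<beta> UNIV <= M. SUP x. (1 + norm x) ^ N * cmod (multi_deriv \<beta> ph x))" unfolding schwartz_norm_def
 proof (intro sum_mono cSUP_mono schwartz_seminorm_bdd assms)
  fix \<beta> and x :: "real ^ 'a"
  show "\<exists>m\<in>UNIV. (1 + norm x) ^ M * cmod (multi_deriv \<beta> ph x) <= (1 + norm m) ^ N * cmod (multi_deriv \<beta> ph m)"
   using assms(2) by (intro bexI[of _ x] mult_right_mono power_increasing) auto
 qed simp
 also have "... <= schwartz_norm N ph" unfolding schwartz_norm_def
 proof (intro sum_mono2 finite_multi_indices)
  fix \<beta> :: "'a => nat"
  show "0 <= (SUP x. (1 + norm x) ^ N * cmod (multi_deriv \<beta> ph x))" by (rule cSUP_upper2[OF schwartz_seminorm_bdd[OF assms(1)], of 0]) auto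
 qed (use assms(2) in auto)
 finally show ?thesis .
qed

section \<open>Continuity of functionals in terms of seminorms\<close>

lemma topspace_schwartz: "topspace schwartz_topology = (schwartz :: ('n::finite cfun) set)"
proof -
 have "ph \<in> \<Union> {{\<psi> \<in> schwartz. schwartz_norm N (%x. \<psi> x - ph x) < e} | ph N e. ph \<in> schwartz \<and> 0 < e}"
  if "ph \<in> schwartz" for ph :: "'n cfun"
 proof (rule UnionI)
  have "schwartz_norm 0 (%x. ph x - ph x) <= mi_card TYPE('n) 0 * 0" by (rule schwartz_norm_le) simp
  then show "ph \<in> {\<psi> \<in> schwartz. schwartz_norm 0 (%x. \<psi> x - ph x) < 1}" using that by simp
 qed (use that zero_less_one in blast)
 then show ?thesis unfolding schwartz_topology_def topology_generated_by_topspace by blast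
qed

text \<open>A finite intersection of balls with different \<open>N\<close> still contains one ball,
  since the seminorms increase with \<open>N\<close>; a generating set centred elsewhere is handled
  by the triangle inequality.\<close>

lemma schwartz_open_contains_ball:
 assumes "openin schwartz_topology U" "ph \<in> U"
 shows "\<exists>N e. 0 < e \<and> {\<psi> \<in> schwartz. schwartz_norm N (%x. \<psi> x - ph x) < e} \<subseteq> U"
proof -
 have "generate_topology_on {{\<psi> \<in> schwartz. schwartz_norm N (%x. \<psi> x - ph x) < e} | ph N e. ph \<in> schwartz \<and> 0 < e} U"
  using assms(1) by (simp add: schwartz_topology_def openin_topology_generated_by_iff)
 then show ?thesis using assms(2)
 proof (induction arbitrary: ph)
  case (Int a b)
  obtain N1 e1 where 1: "0 < e1" "{\<psi> \<in> schwartz. schwartz_norm N1 (%x. \<psi> x - ph x) < e1} \<subseteq> a" using Int by blast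
  obtain N2 e2 where 2: "0 < e2" "{\<psi> \<in> schwartz. schwartz_norm N2 (%x. \<psi> x - ph x) < e2} \<subseteq> b" using Int by blast
  have ph: "ph \<in> schwartz"
  proof -
   have "openin schwartz_topology a" using Int.hyps(1) by (simp add: schwartz_topology_def openin_topology_generated_by_iff)
   then show ?thesis using Int.prems openin_subset topspace_schwartz by blast
  qed
  have "{\<psi> \<in> schwartz. schwartz_norm (max N1 N2) (%x. \<psi> x - ph x) < min e1 e2} \<subseteq> a \<inter> b"
  proof
   fix \<psi> assume "\<psi> \<in> {\<psi> \<in> schwartz. schwartz_norm (max N1 N2) (%x. \<psi> x - ph x) < min e1 e2}"
   moreover from this have "schwartz_norm N1 (%x. \<psi> x - ph x) <= schwartz_norm (max N1 N2) (%x. \<psi> x - ph x)"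
    "schwartz_norm N2 (%x. \<psi> x - ph x) <= schwartz_norm (max N1 N2) (%x. \<psi> x - ph x)" using ph by (auto intro!: schwartz_norm_mono schwartz_diff)
   ultimately show "\<psi> \<in> a \<inter> b" using 1 2 by auto
  qed
  then show ?case using 1 2 by (intro exI[of _ "max N1 N2"] exI[of _ "min e1 e2"] conjI) auto
 next
  case (UN K)
  then show ?case by blast
 next
  case (Basis s)
  then obtain ph0 N e where s: "s = {\<psi> \<in> schwartz. schwartz_norm N (%x. \<psi> x - ph0 x) < e}" "ph0 \<in> schwartz" by blast
  have "{\<psi> \<in> schwartz. schwartz_norm N (%x. \<psi> x - ph x) < e - schwartz_norm N (%x. ph x - ph0 x)} \<subseteq> s"
  proof
   fix \<psi> assume \<psi>: "\<psi> \<in> {\<psi> \<in> schwartz. schwartz_norm N (%x. \<psi> x - ph x) < e - schwartz_norm N (%x. ph x - ph0 x)}"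
   have "schwartz_norm N (%x. (\<psi> x - ph x) + (ph x - ph0 x)) <= schwartz_norm N (%x. \<psi> x - ph x) + schwartz_norm N (%x. ph x - ph0 x)"
    using \<psi> s Basis by (intro schwartz_norm_add schwartz_diff) auto
   then show "\<psi> \<in> s" using \<psi> by (simp add: s)
  qed
  moreover have "e - schwartz_norm N (%x. ph x - ph0 x) > 0" using Basis s by simp
  ultimately show ?case by blast
 qed simp
qed

text \<open>Continuity at 0 gives a ball on which \<open>f\<close> is bounded by 1, and homogeneity
  turns this into a bound by one seminorm. It is phrased through bounds over lists because later
  estimates arrive in that form.\<close>

lemma tempered_bound:
 fixes f :: "('n::finite cfun) => complex"
 assumes f: "f \<in> tempered"
 obtains M C where "C >= 0"
  "!!ph B. ph \<in> schwartz ==> (!!is x. length is <= M ==> (1 + norm x) ^ M * cmod (Dl is ph x) <= B) ==> cmod (f ph) <= C * B"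
proof -
 have f0: "f (%x. 0) = 0" and fc: "!!c ph. ph \<in> schwartz ==> f (%x. c * ph x) = c * f ph"
  using f schwartz_0 unfolding tempered_def by (force dest: spec[of _ 0])+
 define U where "U = {ph \<in> topspace schwartz_topology. f ph \<in> ball 0 1}"
 have "openin schwartz_topology U" unfolding U_def by (rule openin_continuous_map_preimage) (use f in \<open>auto simp: tempered_def\<close>)
 moreover have "(%x. 0) \<in> U" by (simp add: U_def topspace_schwartz schwartz_0 f0)
 ultimately obtain N e where e: "0 < e" "{\<psi> \<in> schwartz. schwartz_norm N (%x. \<psi> x - 0) < e} \<subseteq> U"
  using schwartz_open_contains_ball by blast
 define K where "K = mi_card TYPE('n) N"
 have K: "K > 0" by (simp add: K_def mi_card_pos)
 show ?thesis
 proof (rule that[of "2 * K / e" N])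
  show "2 * K / e >= 0" using e K by simp
  fix ph :: "'n cfun" and B
  assume ph: "ph \<in> schwartz" and B: "!!is x. length is <= N ==> (1 + norm x) ^ N * cmod (Dl is ph x) <= B"
  have B0: "B >= 0" by (rule order_trans[OF _ B[of "[]" 0]]) auto
  show "cmod (f ph) <= 2 * K / e * B"
  proof (rule field_le_epsilon)
   fix d :: real assume d: "d > 0"
   \<comment> \<open>\<open>B\<close> may be 0, so the rescaling uses the slightly larger
     \<open>B'\<close>; the excess is chosen so that 1 / t equals the bound sought plus
     \<open>d\<close>.\<close>
   define B' where "B' = B + d * e / (2 * K)"
   have B': "B' > 0" "B' >= B" using d e K B0 by (auto simp: B'_def add_nonneg_pos)
   define t where "t = e / (2 * K * B')"
   have t: "t > 0" using e K B' by (simp add: t_def)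
   have "schwartz_norm N (%x. cplx t * ph x) <= K * (t * B')" unfolding K_def
   proof (rule schwartz_norm_le)
    fix "is" :: "'n list" and x :: "real ^ 'n" assume "length is <= N"
    then have "t * ((1 + norm x) ^ N * cmod (Dl is ph x)) <= t * B'" using B B'(2) t by (intro mult_left_mono) (auto intro: order_trans)
    then show "(1 + norm x) ^ N * cmod (Dl is (%x. cplx t * ph x) x) <= t * B'" using t by (simp add: Dl_cmult schwartz_smooth[OF ph] norm_mult mult_ac)
   qed
   also have "... = e / 2" using K B' by (simp add: t_def)
   also have "... < e" using e by simp
   finally have "(%x. cplx t * ph x) \<in> U" using e(2) schwartz_cmult[OF ph] by auto
   then have "cmod (cplx t * f ph) < 1" by (simp add: U_def fc[OF ph])
   then have "cmod (f ph) < 1 / t" using t by (simp add: norm_mult field_simps)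
   also have "1 / t = 2 * K / e * B + d" using e K B' by (simp add: t_def B'_def field_simps)
   finally show "cmod (f ph) <= 2 * K / e * B + d" by simp
  qed
 qed
qed

lemma temperedI:
 fixes f :: "('n::finite cfun) => complex"
 assumes add: "!!ph \<psi>. ph \<in> schwartz ==> \<psi> \<in> schwartz ==> f (%x. ph x + \<psi> x) = f ph + f \<psi>"
  and mult: "!!c ph. ph \<in> schwartz ==> f (%x. c * ph x) = c * f ph"
  and out: "!!ph. ph \<notin> schwartz ==> f ph = 0"
  and bd: "!!ph. ph \<in> schwartz ==> cmod (f ph) <= C * schwartz_norm N ph"
 shows "f \<in> tempered"
proof -
 have diff: "f (%x. ph x - \<psi> x) = f ph - f \<psi>" if "ph \<in> schwartz" "\<psi> \<in> schwartz" for ph \<psi>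
  using add[OF that(1) schwartz_cmult[OF that(2), of "-1"]] mult[OF that(2), of "-1"] by simp
 have "openin schwartz_topology {ph \<in> topspace schwartz_topology. f ph \<in> U}" if U: "open U" for U unfolding topspace_schwartz
 proof (subst openin_subopen, intro ballI)
  fix ph assume ph: "ph \<in> {ph \<in> schwartz. f ph \<in> U}"
  then obtain e where e: "e > 0" "ball (f ph) e \<subseteq> U" using U by (auto simp: open_contains_ball)
  define d where "d = e / (\<bar>C\<bar> + 1)"
  have d: "d > 0" using e by (simp add: d_def)
  let ?T = "{\<psi> \<in> schwartz. schwartz_norm N (%x. \<psi> x - ph x) < d}"
  have "schwartz_norm N (%x. ph x - ph x) <= mi_card TYPE('n) N * 0" by (rule schwartz_norm_le) (simp add: Dl_0)
  then have 1: "ph \<in> ?T" using ph d by simp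
  have 2: "openin schwartz_topology ?T" unfolding schwartz_topology_def using ph d by (intro topology_generated_by_Basis) blast
  have 3: "?T \<subseteq> {ph \<in> schwartz. f ph \<in> U}"
  proof
   fix \<psi> assume \<psi>: "\<psi> \<in> ?T"
   let ?n = "schwartz_norm N (%x. \<psi> x - ph x)"
   have n0: "?n >= 0" using \<psi> ph by (intro schwartz_norm_nonneg schwartz_diff) auto
   have "cmod (f \<psi> - f ph) <= C * ?n" using bd[of "%x. \<psi> x - ph x"] \<psi> ph by (simp add: diff schwartz_diff)
   also have "... <= (\<bar>C\<bar> + 1) * ?n" using n0 by (intro mult_right_mono) auto
   also have "... < (\<bar>C\<bar> + 1) * d" using \<psi> by (intro mult_strict_left_mono) auto
   also have "... = e" by (simp add: d_def)
   finally have "f \<psi> \<in> ball (f ph) e" by (simp add: dist_norm norm_minus_commute)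
   then show "\<psi> \<in> {ph \<in> schwartz. f ph \<in> U}" using e \<psi> by auto
  qed
  show "\<exists>T. openin schwartz_topology T \<and> ph \<in> T \<and> T \<subseteq> {ph \<in> schwartz. f ph \<in> U}" using 1 2 3 by blast
 qed
 then have "continuous_map schwartz_topology euclidean f" by (simp add: continuous_map_def)
 then show ?thesis using add mult out by (simp add: tempered_def)
qed

lemma tempered_add: "f \<in> tempered ==> ph \<in> schwartz ==> \<psi> \<in> schwartz ==> f (%x. ph x + \<psi> x) = f ph + f \<psi>"
 and tempered_cmult: "f \<in> tempered ==> ph \<in> schwartz ==> f (%x. c * ph x) = c * f ph"
 and tempered_out: "f \<in> tempered ==> ph \<notin> schwartz ==> f ph = 0" by (auto simp: tempered_def)

lemma tempered_0: "f \<in> tempered ==> f (%x. 0) = 0" using tempered_cmult[OF _ schwartz_0, of f 0] by simp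

lemma tempered_diff:
 assumes "f \<in> tempered" "ph \<in> schwartz" "\<psi> \<in> schwartz"
 shows "f (%x. ph x - \<psi> x) = f ph - f \<psi>"
 using tempered_add[OF assms(1,2) schwartz_cmult[OF assms(3), of "-1"]] tempered_cmult[OF assms(1,3), of "-1"] by simp

lemma tempered_sum:
 assumes "f \<in> tempered" "!!a. a \<in> A ==> g a \<in> schwartz"
 shows "f (%x. \<Sum>a\<in>A. g a x) = (\<Sum>a\<in>A. f (g a))" using assms(2) by (induction A rule: infinite_finite_induct)
  (simp_all add: tempered_0[OF assms(1)] tempered_add[OF assms(1)] schwartz_sum)

section \<open>Test functions adapted to a ball\<close>

text \<open>
 The test functions of the grand maximal function at \<open>x\<close> are, up to a constant depending only on
 \<open>N\<close>, the functions with \<open>bump N 1 x s\<close> for some \<open>s > 0\<close>.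
\<close>

definition bump :: "nat => real => real ^ 'n::finite => real => ('n cfun) => bool" where
 "bump N c x s ph \<longleftrightarrow> ph \<in> schwartz \<and>
  (\<forall>is y. length is <= N --> cmod (Dl is ph y) * s ^ (CARD('n) + length is) * (1 + norm (y - x) / s) ^ N <= c)"

lemma bumpD: "bump N c x s ph ==> length is <= N ==>
  cmod (Dl is ph y) * s ^ (CARD('n::finite) + length is) * (1 + norm (y - x) / s) ^ N <= c"
 for x :: "real ^ 'n" by (simp add: bump_def)

lemma bump_schwartz: "bump N c x s ph ==> ph \<in> schwartz" by (simp add: bump_def)

lemma bumpD':
 fixes x :: "real ^ 'n::finite"
 assumes "bump N c x s ph" "length is <= N" "s > 0"
 shows "cmod (Dl is ph y) <= c / (s ^ (CARD('n) + length is) * (1 + norm (y - x) / s) ^ N)"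
proof -
 have "s ^ (CARD('n) + length is) * (1 + norm (y - x) / s) ^ N > 0" using assms by (intro mult_pos_pos zero_less_power add_pos_nonneg) auto
 then show ?thesis using bumpD[OF assms(1,2), of y] by (simp add: field_simps)
qed

lemma bump_nonneg:
 assumes "bump N c x s ph" "s > 0" shows "c >= 0" by (rule order_trans[OF _ bumpD[OF assms(1), of "[]" x]]) (use assms in auto)

lemma bump_mono: "bump N c x s ph ==> c <= c' ==> bump N c' x s ph" unfolding bump_def by (meson order_trans)

text \<open>Moving the centre by a multiple of the scale costs a constant. This is what allows
  passing to a nearby point where the maximal function is small.\<close>

lemma bump_shift:
 assumes "bump N c x s ph" "s > 0" "norm (z - x) <= k * s" "k >= 0"
 shows "bump N (c * (1 + k) ^ N) z s ph" unfolding bump_def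
proof (intro conjI allI impI)
 fix "is" :: "'a list" and y assume l: "length is <= N"
 have "norm (y - z) <= norm (y - x) + norm (z - x)" using norm_triangle_ineq4[of "y - x" "z - x"] by simp
 also have "... <= norm (y - x) + k * s" using assms by simp
 finally have "norm (y - z) / s <= (norm (y - x) + k * s) / s" using assms(2) by (intro divide_right_mono) auto
 then have "1 + norm (y - z) / s <= 1 + (norm (y - x) / s + k)" using assms(2) by (simp add: add_divide_distrib)
 also have "... <= (1 + norm (y - x) / s) * (1 + k)"
 proof -
  have "1 + (a + k) <= (1 + a) * (1 + k)" if "a >= 0" for a using that assms(4) by (simp add: algebra_simps)
  then show ?thesis using assms(2) by simp
 qed
 finally have "(1 + norm (y - z) / s) ^ N <= ((1 + norm (y - x) / s) * (1 + k)) ^ N" using assms by (intro power_mono) auto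
 then have "cmod (Dl is ph y) * s ^ (CARD('a) + length is) * (1 + norm (y - z) / s) ^ N
  <= cmod (Dl is ph y) * s ^ (CARD('a) + length is) * ((1 + norm (y - x) / s) * (1 + k)) ^ N" using assms by (intro mult_left_mono) auto
 also have "... = (cmod (Dl is ph y) * s ^ (CARD('a) + length is) * (1 + norm (y - x) / s) ^ N) * (1 + k) ^ N" by (simp add: power_mult_distrib)
 also have "... <= c * (1 + k) ^ N" using bumpD[OF assms(1) l, of y] assms(4) by (intro mult_right_mono) auto
 finally show "cmod (Dl is ph y) * s ^ (CARD('a) + length is) * (1 + norm (y - z) / s) ^ N <= c * (1 + k) ^ N" .
qed (rule bump_schwartz[OF assms(1)])

lemma test_class_bump:
 fixes x :: "real ^ 'n::finite"
 assumes "\<psi> \<in> test_class N" "t > 0"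
 shows "bump N 1 x t (%y. dilate t \<psi> (x - y))"
proof -
 have \<psi>: "\<psi> \<in> schwartz" "schwartz_norm N \<psi> <= 1" using assms by (auto simp: test_class_def)
 let ?h = "%y. \<psi> (x /\<^sub>R t + (- 1 / t) *R y)"
 have eq: "(%y. dilate t \<psi> (x - y)) = (%y. cplx (1 / t ^ CARD('n)) * ?h y)" by (simp add: dilate_def scaleR_diff_right divide_inverse)
 have h: "?h \<in> schwartz" using assms by (intro schwartz_affine \<psi>) auto
 show ?thesis unfolding bump_def eq
 proof (intro conjI allI impI schwartz_cmult h)
  fix "is" :: "'n list" and y assume l: "length is <= N"
  let ?u = "x /\<^sub>R t + (- 1 / t) *R y"
  have u: "norm ?u = norm (y - x) / t"
  proof -
   have "?u = (1 / t) *R (x - y)" by (simp add: scaleR_diff_right divide_inverse)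
   then show ?thesis using assms by (simp add: norm_minus_commute divide_inverse)
  qed
  have "cmod (Dl is (%y. cplx (1 / t ^ CARD('n)) * ?h y) y) = cmod (Dl is \<psi> ?u) / t ^ (CARD('n) + length is)"
   unfolding Dl_cmult[OF schwartz_smooth[OF h]] Dl_affine[OF schwartz_smooth[OF \<psi>(1)]] norm_mult norm_of_real
   using assms by (simp add: power_add power_divide divide_simps flip: power_abs)
  then have "cmod (Dl is (%y. cplx (1 / t ^ CARD('n)) * ?h y) y) * t ^ (CARD('n) + length is) * (1 + norm (y - x) / t) ^ N
    = (1 + norm ?u) ^ N * cmod (Dl is \<psi> ?u)" using assms u by simp
  also have "... <= 1" using schwartz_norm_ge[OF \<psi>(1) l, of ?u] \<psi>(2) by linarith
  finally show "cmod (Dl is (%y. cplx (1 / t ^ CARD('n)) * ?h y) y) * t ^ (CARD('n) + length is) * (1 + norm (y - x) / t) ^ N <= 1" .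
 qed
qed

lemma grand_maximal_le:
 assumes "!!ph s. s > 0 ==> bump N 1 x s ph ==> ennreal (cmod (F ph)) <= B"
 shows "grand_maximal N F x <= B" unfolding grand_maximal_def convolution_def by (intro SUP_least assms) (auto intro: test_class_bump)

text \<open>Undoing translation and dilation carries \<open>ph\<close> to the reference position,
  where division by \<open>mi_card\<close> times \<open>c\<close> puts it into
  \<open>test_class\<close>. Because of this division c = 0 is a separate case.\<close>

lemma bump_le_grand_maximal:
 fixes x :: "real ^ 'n::finite"
 assumes f: "f \<in> tempered" and b: "bump N c x s ph" and s: "s > 0"
 shows "ennreal (cmod (f ph)) <= ennreal (mi_card TYPE('n) N * c) * grand_maximal N f x"
proof (cases "c = 0")
 case True
 have "ph y = 0" for y
 proof -
  have "cmod (ph y) * s ^ (CARD('n) + 0) * (1 + norm (y - x) / s) ^ N <= 0" using bumpD[OF b, of "[]" y] True by simp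
  moreover have "s ^ (CARD('n) + 0) * (1 + norm (y - x) / s) ^ N > 0" using s by (intro mult_pos_pos zero_less_power add_pos_nonneg) auto
  ultimately have "cmod (ph y) <= 0" by (metis mult.assoc mult_le_0_iff not_le)
  then show ?thesis by simp
 qed
 then have "ph = (%x. 0)" by auto
 then show ?thesis using tempered_0[OF f] by simp
next
 case False
 then have c: "c > 0" using bump_nonneg[OF b s] by simp
 define K where "K = mi_card TYPE('n) N * c"
 have K: "K > 0" using c mi_card_pos[where 'n='n, of N] by (simp add: K_def)
 have ph: "ph \<in> schwartz" using b by (rule bump_schwartz)
 define \<psi> where "\<psi> = (%u. cplx (s ^ CARD('n) / K) * ph (x + (- s) *R u))"
 have h: "(%u. ph (x + (- s) *R u)) \<in> schwartz" using s ph by (intro schwartz_affine) auto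
 have \<psi>: "\<psi> \<in> schwartz" unfolding \<psi>_def by (rule schwartz_cmult[OF h])
 have "schwartz_norm N \<psi> <= mi_card TYPE('n) N * (c / K)"
 proof (rule schwartz_norm_le)
  fix "is" :: "'n list" and u :: "real ^ 'n" assume l: "length is <= N"
  let ?y = "x + (- s) *R u"
  have "cmod (Dl is \<psi> u) = s ^ (CARD('n) + length is) / K * cmod (Dl is ph ?y)"
   unfolding \<psi>_def Dl_cmult[OF schwartz_smooth[OF h]] Dl_affine[OF schwartz_smooth[OF ph]] norm_mult norm_of_real
   using s K by (simp add: power_add abs_mult power_abs)
  moreover have "norm (?y - x) / s = norm u" using s by simp
  ultimately have "(1 + norm u) ^ N * cmod (Dl is \<psi> u) = (cmod (Dl is ph ?y) * s ^ (CARD('n) + length is) * (1 + norm (?y - x) / s) ^ N) / K"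
   by (simp add: mult_ac)
  also have "... <= c / K" using bumpD[OF b l, of ?y] K by (intro divide_right_mono) auto
  finally show "(1 + norm u) ^ N * cmod (Dl is \<psi> u) <= c / K" .
 qed
 also have "... = 1" using c mi_card_pos[where 'n='n, of N] by (simp add: K_def)
 finally have t: "\<psi> \<in> test_class N" using \<psi> by (simp add: test_class_def)
 have "(%y. dilate s \<psi> (x - y)) = (%y. cplx (1 / K) * ph y)" using s K by (auto simp: dilate_def \<psi>_def)
 then have "convolution (dilate s \<psi>) f x = cplx (1 / K) * f ph" using tempered_cmult[OF f ph, of "cplx (1 / K)"] by (simp add: convolution_def)
 then have eq: "cmod (f ph) = K * cmod (convolution (dilate s \<psi>) f x)" using K by (simp add: norm_mult norm_divide)
 have "ennreal (cmod (convolution (dilate s \<psi>) f x)) <= grand_maximal N f x"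
  unfolding grand_maximal_def using s t by (intro SUP_upper2[of s] SUP_upper2[of \<psi>]) auto
 then have "ennreal K * ennreal (cmod (convolution (dilate s \<psi>) f x)) <= ennreal K * grand_maximal N f x" by (rule mult_left_mono) simp
 then show ?thesis unfolding eq using K by (simp add: K_def ennreal_mult)
qed

lemma schwartz_bump:
 fixes x :: "real ^ 'n::finite"
 assumes "ph \<in> schwartz" "s > 0"
 obtains c where "bump N c x s ph"
proof -
 define h where "h = (%u. ph (x + s *R u))"
 have h: "h \<in> schwartz" unfolding h_def using assms by (intro schwartz_affine) auto
 obtain B where B: "!!is u. length is <= N ==> (1 + norm u) ^ N * cmod (Dl is h u) <= B" using schwartz_boundE[OF h, of N N] by metis
 have "bump N (s ^ CARD('n) * B) x s ph" unfolding bump_def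
 proof (intro conjI assms allI impI)
  fix "is" :: "'n list" and y assume l: "length is <= N"
  define u where "u = (1 / s) *R (y - x)"
  have y: "y = x + s *R u" using assms by (simp add: u_def)
  have n: "norm (y - x) / s = norm u" using assms by (simp add: u_def)
  have "cmod (Dl is h u) = s ^ length is * cmod (Dl is ph y)" unfolding h_def Dl_affine[OF schwartz_smooth[OF assms(1)]] norm_mult norm_of_real y
   using assms(2) by (simp add: power_abs)
  then have "cmod (Dl is ph y) * s ^ (CARD('n) + length is) * (1 + norm (y - x) / s) ^ N = s ^ CARD('n) * ((1 + norm u) ^ N * cmod (Dl is h u))"
   unfolding n by (simp add: power_add mult_ac)
  also have "... <= s ^ CARD('n) * B" using B[OF l, of u] assms by (intro mult_left_mono) auto
  finally show "cmod (Dl is ph y) * s ^ (CARD('n) + length is) * (1 + norm (y - x) / s) ^ N <= s ^ CARD('n) * B" .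
 qed
 then show ?thesis using that by blast
qed

lemma schwartz_norm_bump:
 fixes ph :: "'n::finite cfun"
 assumes "ph \<in> schwartz"
 shows "bump N (schwartz_norm N ph) 0 1 ph" unfolding bump_def using schwartz_norm_ge[OF assms, of _ N] assms by (simp add: mult.commute)

text \<open>A test function used at \<open>x\<close> can be re-centred at \<open>z\<close> with the
  loss (1 + norm (z - x) / t) ^ N, which tends to 1 as \<open>z\<close> tends to \<open>x\<close>.
  Besides measurability this makes the set {M f <= lam} closed.\<close>

lemma grand_maximal_lsc:
 fixes f :: "('n::finite cfun) => complex"
 assumes f: "f \<in> tempered"
 shows "open {x. l < grand_maximal N f x}"
proof (rule openI)
 fix x assume "x \<in> {x. l < grand_maximal N f x}"
 then have l: "l < grand_maximal N f x" by simp
 then obtain t \<psi> where t: "t > 0" "\<psi> \<in> test_class N" "l < ennreal (cmod (convolution (dilate t \<psi>) f x))"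
  unfolding grand_maximal_def less_SUP_iff by auto
 have \<psi>: "\<psi> \<in> schwartz" "schwartz_norm N \<psi> <= 1" using t by (auto simp: test_class_def)
 define a where "a = cmod (convolution (dilate t \<psi>) f x)"
 have la: "l < ennreal a" using t by (simp add: a_def)
 have key: "ennreal (a / (1 + norm (z - x) / t) ^ N) <= grand_maximal N f z" for z
 proof -
  define k where "k = norm (z - x) / t"
  have k: "k >= 0" using t by (simp add: k_def)
  then have k1: "(1 + k) ^ N > 0" by (intro zero_less_power) auto
  define v where "v = (1 / t) *R (x - z)"
  have nv: "norm v = k" using t by (simp add: v_def k_def norm_minus_commute)
  define \<psi>' where "\<psi>' = (%u. cplx (1 / (1 + k) ^ N) * \<psi> (v + 1 *R u))"
  have h: "(%u. \<psi> (v + 1 *R u)) \<in> schwartz" by (intro schwartz_affine \<psi>) auto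
  have s': "\<psi>' \<in> schwartz" unfolding \<psi>'_def by (rule schwartz_cmult[OF h])
  have "schwartz_norm N \<psi>' <= schwartz_norm N \<psi>" unfolding schwartz_norm_def
  proof (intro sum_mono cSUP_mono schwartz_seminorm_bdd \<psi>)
   fix \<beta> and u :: "real ^ 'n"
   have "1 + norm u <= (1 + k) * (1 + norm (v + u))" using norm_triangle_ineq4[of "v + u" v] nv k
    by (simp add: algebra_simps) (smt (verit) mult_nonneg_nonneg norm_ge_zero)
   then have "(1 + norm u) ^ N <= (1 + k) ^ N * (1 + norm (v + u)) ^ N" by (metis power_mono power_mult_distrib norm_ge_zero add_nonneg_nonneg zero_le_one)
   then have "(1 + norm u) ^ N * (cmod (Dl (mi_list \<beta>) \<psi> (v + u)) / (1 + k) ^ N) <=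
     (1 + k) ^ N * (1 + norm (v + u)) ^ N * (cmod (Dl (mi_list \<beta>) \<psi> (v + u)) / (1 + k) ^ N)" using k by (intro mult_right_mono) auto
   moreover have "cmod (Dl (mi_list \<beta>) \<psi>' u) = cmod (Dl (mi_list \<beta>) \<psi> (v + u)) / (1 + k) ^ N"
    unfolding \<psi>'_def Dl_cmult[OF schwartz_smooth[OF h]] Dl_affine[OF schwartz_smooth[OF \<psi>(1)]] norm_mult norm_of_real using k by simp
   ultimately have "(1 + norm u) ^ N * cmod (multi_deriv \<beta> \<psi>' u) <= (1 + norm (v + u)) ^ N * cmod (multi_deriv \<beta> \<psi> (v + u))"
    using k1 k by (auto simp: multi_deriv_eq_Dl split: if_splits)
   then show "\<exists>m\<in>UNIV. (1 + norm u) ^ N * cmod (multi_deriv \<beta> \<psi>' u) <= (1 + norm m) ^ N * cmod (multi_deriv \<beta> \<psi> m)" by blast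
  qed simp
  then have t': "\<psi>' \<in> test_class N" using s' \<psi> by (simp add: test_class_def)
  have e: "(z - y) /\<^sub>R t + v = (x - y) /\<^sub>R t" for y by (simp add: v_def divide_inverse scaleR_diff_right)
  have "(%y. dilate t \<psi>' (z - y)) = (%y. cplx (1 / (1 + k) ^ N) * dilate t \<psi> (x - y))"
   using e by (auto simp: dilate_def \<psi>'_def mult_ac add.commute[of v])
  moreover have "(%y. dilate t \<psi> (x - y)) \<in> schwartz" using test_class_bump[OF t(2,1)] by (rule bump_schwartz)
  ultimately have "convolution (dilate t \<psi>') f z = cplx (1 / (1 + k) ^ N) * convolution (dilate t \<psi>) f x"
   by (simp only: convolution_def) (rule tempered_cmult[OF f])
  then have "a / (1 + k) ^ N = cmod (convolution (dilate t \<psi>') f z)"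
   using k by (simp add: a_def norm_mult norm_divide norm_power flip: of_real_add of_real_power)
  moreover have "ennreal (cmod (convolution (dilate t \<psi>') f z)) <= grand_maximal N f z"
   unfolding grand_maximal_def using t t' by (intro SUP_upper2[of t] SUP_upper2[of \<psi>']) auto
  ultimately show ?thesis by (simp add: k_def)
 qed
 have "((%z. a / (1 + norm (z - x) / t) ^ N) \<longlongrightarrow> a / (1 + norm (x - x) / t) ^ N) (at x)" using t by (intro tendsto_intros) auto
 then have "((%z. ennreal (a / (1 + norm (z - x) / t) ^ N)) \<longlongrightarrow> ennreal a) (at x)" by (intro tendsto_ennrealI) simp
 then have "\<forall>\<^sub>F z in at x. l < ennreal (a / (1 + norm (z - x) / t) ^ N)" using la by (rule order_tendstoD)
 then obtain e where e: "e > 0" "!!z. z ~= x ==> dist z x < e ==> l < ennreal (a / (1 + norm (z - x) / t) ^ N)" unfolding eventually_at by auto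
 have "ball x e \<subseteq> {x. l < grand_maximal N f x}"
 proof
  fix z assume "z \<in> ball x e"
  then have "z ~= x ==> l < ennreal (a / (1 + norm (z - x) / t) ^ N)" using e(2)[of z] by (simp add: dist_commute)
  then show "z \<in> {x. l < grand_maximal N f x}" using key[of z] l by (cases "z = x") auto
 qed
 then show "\<exists>e>0. ball x e \<subseteq> {x. l < grand_maximal N f x}" using e by blast
qed

lemma grand_maximal_measurable:
 assumes "f \<in> tempered"
 shows "grand_maximal N f \<in> borel_measurable borel"
proof (rule borel_measurableI_greater)
 fix l show "{x \<in> space borel. l < grand_maximal N f x} \<in> sets borel" using grand_maximal_lsc[OF assms, of l N] by simp
qed

section \<open>A compactly supported mollifier\<close>

text \<open>The factors u^(-k) make the family closed under differentiation up to linear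
  combinations; \<open>flat 0\<close> is the usual smooth function that vanishes to infinite order
  at 0.\<close>

definition flat :: "nat => real => real" where
 "flat k u = (if u > 0 then exp (- 1 / u) / u ^ k else 0)"

text \<open>exp (1 / u) dominates (1 / (m u)) ^ m with m = k + 2. Of these powers k cancel the
  denominator, and the two left over give the quadratic vanishing that forces the derivative 0 at
  the origin.\<close>

lemma flat_le: "\<bar>flat k u\<bar> <= real (k + 2) ^ (k + 2) * u\<^sup>2"
proof (cases "u > 0")
 case True
 let ?m = "k + 2"
 have "(1 / u / real ?m) ^ ?m <= (1 + (1 / u) / real ?m) ^ ?m" using True by (intro power_mono) auto
 also have "... <= exp (1 / u)" using True by (intro exp_ge_one_plus_x_over_n_power_n) (auto intro: order_trans[of _ 0])
 finally have "1 / (u ^ ?m * real ?m ^ ?m) <= exp (1 / u)" by (simp only: divide_divide_eq_left power_divide power_one power_mult_distrib)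
 moreover have "u ^ ?m * real ?m ^ ?m > 0" using True by simp
 ultimately have "exp (- 1 / u) <= u ^ ?m * real ?m ^ ?m" by (simp add: exp_minus field_simps)
 also have "... = (real ?m ^ ?m * u\<^sup>2) * u ^ k" by (simp only: power_add mult_ac)
 finally show ?thesis using True by (simp add: flat_def divide_le_eq)
qed (simp add: flat_def)

lemma flat_deriv: "(flat k has_real_derivative (- real k * flat (k + 1) u + flat (k + 2) u)) (at u)"
proof -
 consider "u > 0" | "u < 0" | "u = 0" by linarith
 then show ?thesis
 proof cases
  case 1
  have "((%u. exp (- 1 / u) * inverse u ^ k) has_real_derivative (- real k * flat (k + 1) u + flat (k + 2) u)) (at u)"
  proof (cases k)
   case 0
   then show ?thesis using 1 by (auto intro!: derivative_eq_intros simp: flat_def power2_eq_square field_simps)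
  next
   case (Suc m)
   show ?thesis using 1 by (auto intro!: derivative_eq_intros simp: flat_def power2_eq_square Suc field_simps power_Suc simp del: power_Suc)
     (simp add: field_simps)?
  qed
  then show ?thesis by (rule has_field_derivative_transform_within_open[of _ _ _ "{0<..}"])
    (use 1 in \<open>auto simp: flat_def divide_inverse power_inverse\<close>)
 next
  case 2
  have "((%u. 0) has_real_derivative 0) (at u)" by simp
  then have "(flat k has_real_derivative 0) (at u)" by (rule has_field_derivative_transform_within_open[of _ _ _ "{..<0}"])
    (use 2 in \<open>auto simp: flat_def\<close>)
  then show ?thesis using 2 by (simp add: flat_def)
 next
  case 3
  let ?C = "real (k + 2) ^ (k + 2)"
  have "(%h. flat k h / h) \<midarrow>0\<rightarrow> 0"
  proof (rule tendsto_rabs_zero_cancel, rule tendsto_sandwich[of "%_. 0" _ _ "%h. ?C * \<bar>h\<bar>"])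
   have "\<bar>flat k h / h\<bar> <= ?C * \<bar>h\<bar>" for h
   proof (cases "h = 0")
    case False
    have "\<bar>flat k h\<bar> <= (?C * \<bar>h\<bar>) * \<bar>h\<bar>" using flat_le[of k h] by (simp only: power2_eq_square abs_mult_self_eq mult.assoc)
    then show ?thesis using False by (simp add: divide_le_eq)
   qed simp
   then show "\<forall>\<^sub>F h in at 0. \<bar>flat k h / h\<bar> <= ?C * \<bar>h\<bar>" by (intro always_eventually allI)
   show "(%h. ?C * \<bar>h\<bar>) \<midarrow>0\<rightarrow> 0" by (auto intro!: tendsto_eq_intros)
  qed auto
  then show ?thesis using 3 by (simp add: DERIV_def flat_def)
 qed
qed

text \<open>Differentiating through 1 - x \<bullet> x produces coordinate factors and real
  multiples; admitting these makes the class closed under \<open>coord_deriv\<close>, as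
  \<open>smooth_coinduct\<close> wants.\<close>

inductive_set flat_span :: "('n::finite cfun) set" where
 flat_base: "(%x. cplx (flat k (1 - x \<bullet> x))) \<in> flat_span"
| flat_add: "u \<in> flat_span ==> v \<in> flat_span ==> (%x. u x + v x) \<in> flat_span"
| flat_cmult: "u \<in> flat_span ==> (%x. cplx c * u x) \<in> flat_span"
| flat_coord: "u \<in> flat_span ==> (%x. cplx (x $ i) * u x) \<in> flat_span"

lemma flat_span_deriv:
 fixes h :: "'n::finite cfun"
 assumes "h \<in> flat_span"
 shows "(\<forall>x. h differentiable (at x)) \<and> (\<forall>i. coord_deriv i h \<in> flat_span)" using assms
proof induction
 case (flat_base k)
 have d: "((%x. cplx (flat k (1 - x \<bullet> x))) has_derivative
   (%h. cplx (- 2 * (x \<bullet> h) * (- real k * flat (k + 1) (1 - x \<bullet> x) + flat (k + 2) (1 - x \<bullet> x))))) (at x)" for x :: "real ^ 'n"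
 proof -
  have "((%x. 1 - x \<bullet> x) has_derivative (%h. - 2 * (x \<bullet> h))) (at x)" by (auto intro!: derivative_eq_intros simp: inner_commute)
  from has_derivative_compose[OF this flat_deriv[unfolded has_field_derivative_def]]
  have "((%x. flat k (1 - x \<bullet> x)) has_derivative (%h. (- real k * flat (k + 1) (1 - x \<bullet> x) + flat (k + 2) (1 - x \<bullet> x)) * (- 2 * (x \<bullet> h)))) (at x)" .
  from has_derivative_of_real[OF this] show ?thesis by (simp add: mult_ac)
 qed
 have "coord_deriv i (%x. cplx (flat k (1 - x \<bullet> x))) =
  (%x. cplx (- 2) * (cplx (x $ i) * (cplx (- real k) * cplx (flat (k + 1) (1 - x \<bullet> x)) + cplx (flat (k + 2) (1 - x \<bullet> x)))))" for i :: 'n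
  by (rule ext, subst coord_deriv_eqI[OF d]) (simp add: inner_axis algebra_simps)
 then have "coord_deriv i (%x. cplx (flat k (1 - x \<bullet> x))) \<in> flat_span" for i :: 'n by (simp only:) (intro flat_span.intros)
 then show ?case using d by (auto simp: differentiable_def)
next
 case (flat_add u v)
 have d: "((%x. u x + v x) has_derivative (%h. frechet_derivative u (at x) h + frechet_derivative v (at x) h)) (at x)" for x
  using flat_add by (intro has_derivative_add) (simp_all add: frechet_derivative_works)
 have "coord_deriv i (%x. u x + v x) = (%x. coord_deriv i u x + coord_deriv i v x)" for i by (rule ext, subst coord_deriv_eqI[OF d]) (simp add: coord_deriv_def)
 then show ?case using flat_add d by (auto simp: differentiable_def intro: flat_span.flat_add)
next
 case (flat_cmult u c)
 have d: "((%x. cplx c * u x) has_derivative (%h. cplx c * frechet_derivative u (at x) h)) (at x)" for x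
  using flat_cmult by (intro has_derivative_mult_right) (simp_all add: frechet_derivative_works)
 have "coord_deriv i (%x. cplx c * u x) = (%x. cplx c * coord_deriv i u x)" for i by (rule ext, subst coord_deriv_eqI[OF d]) (simp add: coord_deriv_def)
 then show ?case using flat_cmult d by (auto simp: differentiable_def intro: flat_span.flat_cmult)
next
 case (flat_coord u j)
 have d: "((%x. cplx (x $ j) * u x) has_derivative (%h. cplx (x $ j) * frechet_derivative u (at x) h + cplx (h $ j) * u x)) (at x)" for x using flat_coord
  by (intro has_derivative_mult has_derivative_of_real bounded_linear_imp_has_derivative bounded_linear_vec_nth) (simp_all add: frechet_derivative_works)
 have "coord_deriv i (%x. cplx (x $ j) * u x) = (%x. cplx (x $ j) * coord_deriv i u x + cplx (if i = j then 1 else 0) * u x)" for i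
  by (rule ext, subst coord_deriv_eqI[OF d]) (simp add: coord_deriv_def axis_def)
 then show ?case using flat_coord d by (auto simp: differentiable_def intro!: flat_span.intros simp del: of_real_0 of_real_1)
qed

lemma flat_span_smooth: "h \<in> flat_span ==> smooth h" by (rule smooth_coinduct[of h flat_span])
  (use flat_span_deriv in \<open>auto simp: differentiable_on_def intro: differentiable_at_withinI\<close>)

lemma compact_support_schwartz:
 fixes f :: "'n::finite cfun"
 assumes "smooth f" "!!x. norm x > R ==> f x = 0"
 shows "f \<in> schwartz" unfolding schwartz_iff
proof (intro conjI assms allI)
 fix k and "is" :: "'n list"
 have "continuous_on (cball 0 R) (%x. (1 + norm x) ^ k * cmod (Dl is f x))" using smooth_continuous[OF smooth_Dl[OF assms(1)]] by (intro continuous_intros)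
 then have "bounded ((%x. (1 + norm x) ^ k * cmod (Dl is f x)) ` cball 0 R)" by (intro compact_imp_bounded compact_continuous_image) auto
 then obtain B where B: "!!x. x \<in> cball 0 R ==> (1 + norm x) ^ k * cmod (Dl is f x) <= B" unfolding bounded_iff by fastforce
 have "open {x :: real ^ 'n. norm x > R}" by (intro open_Collect_less continuous_intros)
 then have z: "Dl is f x = 0" if "norm x > R" for x using that assms(2) by (intro Dl_eq_0_open[of "{x. norm x > R}"]) auto
 have "(1 + norm x) ^ k * cmod (Dl is f x) <= max B 0" for x using B[of x] z[of x] by (cases "norm x > R") (auto simp: le_max_iff_disj)
 then show "\<exists>B. \<forall>x. (1 + norm x) ^ k * cmod (Dl is f x) <= B" by blast
qed

section \<open>Integrals over Euclidean space\<close>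

lemma nn_integral_affine:
 fixes a :: "'a::euclidean_space"
 assumes [measurable]: "f \<in> borel_measurable borel" and c: "c ~= 0"
 shows "(NN x. f x) = ennreal (\<bar>c\<bar> ^ DIM('a)) * (NN x. f (a + c *R x))" by (subst lborel_affine[OF c, of a])
  (simp add: nn_integral_density nn_integral_distr nn_integral_cmult)

lemma integrable_affine:
 fixes f :: "'a::euclidean_space => 'b::{banach, second_countable_topology}"
 assumes f: "integrable lborel f" and c: "c ~= 0"
 shows "integrable lborel (%x. f (a + c *R x))"
proof -
 have [measurable]: "f \<in> borel_measurable borel" using f by simp
 have "(NN x. norm (f x)) < \<infinity>" using f by (simp add: integrable_iff_bounded)
 then have "ennreal (\<bar>c\<bar> ^ DIM('a)) * (NN x. norm (f (a + c *R x))) < \<infinity>" by (subst (asm) nn_integral_affine[OF _ c, of _ a]) auto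
 then have "(NN x. norm (f (a + c *R x))) < \<infinity>" using c by (auto simp: ennreal_mult_less_top)
 then show ?thesis by (simp add: integrable_iff_bounded)
qed

lemma integral_affine:
 fixes f :: "'a::euclidean_space => 'b::{banach, second_countable_topology}"
 assumes f[measurable]: "f \<in> borel_measurable borel" and c: "c ~= 0"
 shows "(LL x. f x) = \<bar>c\<bar> ^ DIM('a) *R (LL x. f (a + c *R x))"
proof (cases "integrable lborel f")
 case True
 then show ?thesis using c integrable_affine[OF True c, of a] by (subst lborel_affine[OF c, of a]) (simp add: integral_density integral_distr)
next
 case False
 have "\<not> integrable lborel (%x. f (a + c *R x))"
 proof
  assume "integrable lborel (%x. f (a + c *R x))"
  from integrable_affine[OF this, of "1 / c" "- (1 / c) *R a"] c have "integrable lborel f" by (simp add: scaleR_diff_right)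
  with False show False by simp
 qed
 with False show ?thesis by (simp add: not_integrable_integral_eq)
qed

text \<open>Dyadic balls around \<open>a\<close>: where norm (x - a) lies between 2 ^ j * R and 2 ^
  Suc j * R the integrand is at most 1 / (2 ^ j * R) ^ N, and the surplus N - DIM('a) >= 1 of decay
  makes the series geometric with ratio at most 1/2.\<close>

lemma nn_integral_tail_le:
 fixes a :: "'a::euclidean_space"
 assumes "DIM('a) < N" "R > 0"
 shows "(NN x. indicator {x. R <= norm (x - a)} x * ennreal (1 / norm (x - a) ^ N))
  <= ennreal (2 * (unit_ball_vol DIM('a) * 2 ^ DIM('a)) / R ^ (N - DIM('a)))"
proof -
 let ?n = "DIM('a)"
 define V where "V = unit_ball_vol (real ?n) * 2 ^ ?n"
 have V: "V >= 0" by (simp add: V_def unit_ball_vol_nonneg)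
 define g where "g = (%j x. ennreal (1 / (2 ^ j * R) ^ N) * indicator (cball a (2 ^ Suc j * R)) x)"
 have pt: "indicator {x. R <= norm (x - a)} x * ennreal (1 / norm (x - a) ^ N) <= (\<Sum>j. g j x)" for x
 proof (cases "R <= norm (x - a)")
  case True
  obtain j0 where "norm (x - a) / R < 2 ^ j0" using real_arch_pow[of 2] by auto
  then have "norm (x - a) < R * 2 ^ j0" using assms(2) by (simp add: field_simps)
  moreover have "R * 2 ^ j0 <= 2 ^ Suc j0 * R" using assms(2) by (simp add: mult.commute[of R])
  ultimately have "norm (x - a) <= 2 ^ Suc j0 * R" by (rule order_trans[OF less_imp_le])
  define j where "j = (LEAST j. norm (x - a) <= 2 ^ Suc j * R)"
  have j: "norm (x - a) <= 2 ^ Suc j * R" unfolding j_def by (rule LeastI) fact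
  have j': "2 ^ j * R <= norm (x - a)"
  proof (cases j)
   case 0 then show ?thesis using True by simp
  next
   case (Suc i)
   then have "\<not> norm (x - a) <= 2 ^ Suc i * R" unfolding j_def by (intro not_less_Least) simp
   then show ?thesis using Suc by simp
  qed
  have "ennreal (1 / norm (x - a) ^ N) <= g j x"
   using j j' assms by (auto simp: g_def dist_norm norm_minus_commute intro!: ennreal_leI divide_left_mono power_mono mult_pos_pos zero_less_power)
    (smt (verit) mult_pos_pos zero_less_power)+
  also have "... <= (\<Sum>j. g j x)" using sum_le_suminf[of "%j. g j x" "{j}"] by auto
  finally show ?thesis using True by simp
 qed simp
 have "(NN x. indicator {x. R <= norm (x - a)} x * ennreal (1 / norm (x - a) ^ N)) <= (NN x. (\<Sum>j. g j x))" by (intro nn_integral_mono pt)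
 also have "... = (\<Sum>j. NN x. g j x)"
  by (rule nn_integral_suminf) (unfold g_def, intro borel_measurable_times_ennreal borel_measurable_indicator borel_measurable_const, simp)
 also have "... <= (\<Sum>j. ennreal (V / R ^ (N - ?n) * (1 / 2) ^ j))"
 proof (intro suminf_le allI)
  fix j
  have "(NN x. g j x) = ennreal (1 / (2 ^ j * R) ^ N) * emeasure lborel (cball a (2 ^ Suc j * R))" unfolding g_def by (rule nn_integral_cmult_indicator) simp
  also have "... = ennreal (1 / (2 ^ j * R) ^ N * (unit_ball_vol (real ?n) * (2 ^ Suc j * R) ^ ?n))"
  proof -
   have "emeasure lborel (cball a (2 ^ Suc j * R)) = ennreal (unit_ball_vol (real ?n) * (2 ^ Suc j * R) ^ ?n)" using assms by (intro emeasure_cball) auto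
   then show ?thesis using assms by (simp only:) (intro ennreal_mult[symmetric], auto simp: unit_ball_vol_nonneg)
  qed
  also have "1 / (2 ^ j * R) ^ N * (unit_ball_vol (real ?n) * (2 ^ Suc j * R) ^ ?n) = V / R ^ (N - ?n) * (1 / 2 ^ (N - ?n)) ^ j"
  proof -
   have N: "N = ?n + (N - ?n)" using assms by simp
   have "(2 ^ j * R) ^ N = (2 ^ j * R) ^ ?n * (2 ^ j * R) ^ (N - ?n)" by (subst N) (rule power_add)
   moreover have "(2 ^ Suc j * R) ^ ?n = 2 ^ ?n * (2 ^ j * R) ^ ?n" by (simp add: power_mult_distrib)
   moreover have "(2 ^ j * R) ^ ?n > 0" using assms by simp
   ultimately show ?thesis using assms by (simp add: V_def power_mult_distrib power_divide field_simps flip: power_mult)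
  qed
  also have "ennreal ... <= ennreal (V / R ^ (N - ?n) * (1 / 2) ^ j)"
  proof (intro ennreal_leI mult_left_mono power_mono)
   have "(2::real) ^ 1 <= 2 ^ (N - ?n)" using assms by (intro power_increasing) auto
   then show "1 / 2 ^ (N - ?n) <= (1 / 2 :: real)" by (intro divide_left_mono) auto
  qed (use V assms in auto)
  finally show "(NN x. g j x) <= ennreal (V / R ^ (N - ?n) * (1 / 2) ^ j)" .
 qed auto
 also have "... = ennreal (\<Sum>j. V / R ^ (N - ?n) * (1 / 2) ^ j)" using V assms by (intro suminf_ennreal2 summable_mult summable_geometric) auto
 also have "(\<Sum>j. V / R ^ (N - ?n) * (1 / 2) ^ j) = 2 * V / R ^ (N - ?n)" by (subst suminf_mult) (auto simp: summable_geometric suminf_geometric)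
 finally show ?thesis by (simp add: V_def)
qed

lemma integrable_inverse_power:
 assumes "DIM('a::euclidean_space) < N"
 shows "integrable lborel (%x :: 'a. 1 / (1 + norm x) ^ N)"
proof (rule integrableI_bounded)
 have "(NN x. norm (1 / (1 + norm (x::'a)) ^ N)) <=
  (NN x. indicator (cball 0 1) x + indicator {x. 1 <= norm (x - (0::'a))} x * ennreal (1 / norm (x - (0::'a)) ^ N))"
 proof (intro nn_integral_mono)
  fix x :: 'a
  show "ennreal (norm (1 / (1 + norm (x::'a)) ^ N)) <= indicator (cball 0 1) x + indicator {x. 1 <= norm (x - (0::'a))} x * ennreal (1 / norm (x - (0::'a)) ^ N)"
  proof (cases "norm x <= 1")
   case True
   have "1 / a <= 1" if "a >= 1" for a :: real using that by simp
   from this[OF one_le_power[of "1 + norm x" N]] have "1 / (1 + norm x) ^ N <= 1" by simp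
   then have "ennreal (norm (1 / (1 + norm (x::'a)) ^ N)) <= 1" by (simp add: ennreal_le_1)
   then show ?thesis using True by (simp add: add_increasing2)
  next
   case False
   then have "1 / (1 + norm x) ^ N <= 1 / norm x ^ N"
    using False by (intro divide_left_mono power_mono mult_pos_pos zero_less_power) (auto intro: add_pos_nonneg)
   then show ?thesis using False by (auto intro!: ennreal_leI)
  qed
 qed
 also have "... = emeasure lborel (cball (0::'a) 1) + (NN x. indicator {x. 1 <= norm (x - (0::'a))} x * ennreal (1 / norm (x - (0::'a)) ^ N))"
  by (subst nn_integral_add) (auto intro: borel_measurable_indicator)
 also have "... < \<infinity>" using nn_integral_tail_le[OF assms, of 1 "0::'a"] emeasure_lborel_cball_finite[of "0::'a" 1]
  by (auto simp: top.not_eq_extremum intro: le_less_trans)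
 finally show "(NN x. norm (1 / (1 + norm (x::'a)) ^ N)) < \<infinity>" .
qed simp

lemma schwartz_integrable:
 fixes ph :: "'n::finite cfun"
 assumes "ph \<in> schwartz"
 shows "integrable lborel (%x. (1 + norm x) ^ k * cmod (Dl is ph x))"
proof -
 let ?N = "CARD('n) + 1"
 obtain B where B: "!!x. (1 + norm x) ^ (k + ?N) * cmod (Dl is ph x) <= B" using assms unfolding schwartz_iff by blast
 have i: "integrable lborel (%x :: real ^ 'n. B * (1 / (1 + norm x) ^ ?N))" by (intro integrable_mult_right integrable_inverse_power) auto
 have m: "Dl is ph \<in> borel_measurable borel" by (intro smooth_measurable smooth_Dl schwartz_smooth assms)
 show ?thesis
 proof (rule Bochner_Integration.integrable_bound[OF i])
  show "AE x in lborel. norm ((1 + norm x) ^ k * cmod (Dl is ph x)) <= norm (B * (1 / (1 + norm x) ^ ?N))"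
  proof (rule AE_I2)
   fix x :: "real ^ 'n"
   have p: "(1 + norm x) ^ ?N > 0" by (intro zero_less_power) (auto intro: add_pos_nonneg)
   have "(1 + norm x) ^ k * cmod (Dl is ph x) <= B / (1 + norm x) ^ ?N" using B[of x] p by (simp add: power_add field_simps)
   also have "... <= \<bar>B / (1 + norm x) ^ ?N\<bar>" by (rule abs_ge_self)
   finally show "norm ((1 + norm x) ^ k * cmod (Dl is ph x)) <= norm (B * (1 / (1 + norm x) ^ ?N))" by simp
  qed
 qed (use m in measurable)
qed

lemma schwartz_integrable0:
 assumes "ph \<in> schwartz"
 shows "integrable lborel ph"
proof -
 have m: "ph \<in> borel_measurable lborel" using smooth_measurable[OF schwartz_smooth[OF assms]] by simp
 have "integrable lborel (%x. cmod (ph x))" using schwartz_integrable[OF assms, of 0 "[]"] by simp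
 then show ?thesis using m by (simp add: integrable_norm_iff)
qed

section \<open>Convolutions\<close>

lemma LINT_norm_bound:
 fixes f :: "'a => 'b::{banach, second_countable_topology}"
 assumes "integrable M f" "integrable M g" "!!x. norm (f x) <= g x"
 shows "norm (integral\<^sup>L M f) <= integral\<^sup>L M g"
 by (rule order_trans[OF integral_norm_bound]) (use assms in \<open>intro integral_mono integrable_norm\<close>)

lemma onorm_frechet_le:
 fixes c :: "'n::finite => complex" and B :: real
 assumes "!!i. cmod (c i) <= B"
 shows "onorm (%h :: real ^ 'n. \<Sum>i\<in>UNIV. (h $ i) *R c i) <= CARD('n) * B"
proof (rule onorm_le)
 fix h :: "real ^ 'n"
 have "norm (\<Sum>i\<in>UNIV. (h $ i) *R c i) <= (\<Sum>i\<in>(UNIV :: 'n set). norm h * B)"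
 proof (rule sum_norm_le)
  fix i
  show "norm ((h $ i) *R c i) <= norm h * B" using component_le_norm_cart[of h i] assms[of i] by (simp add: mult_mono)
 qed
 then show "norm (\<Sum>i\<in>UNIV. (h $ i) *R c i) <= CARD('n) * B * norm h" by (simp add: mult_ac)
qed

lemma smooth_lipschitz_on:
 fixes f :: "'n::finite cfun" and B :: real
 assumes "smooth f" "convex S" "!!i x. x \<in> S ==> cmod (coord_deriv i f x) <= B" "a \<in> S" "b \<in> S"
 shows "cmod (f a - f b) <= CARD('n) * B * norm (a - b)"
proof (rule differentiable_bound[OF assms(2)])
 fix x assume "x \<in> S"
 show "(f has_derivative (%h. \<Sum>i\<in>UNIV. (h $ i) *R coord_deriv i f x)) (at x within S)"
  by (rule has_derivative_at_withinI[OF smooth_has_derivative_sum[OF assms(1)]])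
 show "onorm (%h. \<Sum>i\<in>UNIV. (h $ i) *R coord_deriv i f x) <= CARD('n) * B" using assms(3) \<open>x \<in> S\<close> by (intro onorm_frechet_le) auto
qed (use assms in auto)

text \<open>The remainder is quadratic uniformly in the base point. Integrated against an integrable
  weight it yields the total differentiability of a convolution, which \<open>smooth\<close>
  demands, and not only partial derivatives.\<close>

lemma ubd_taylor:
 fixes K :: "'n::finite cfun"
 assumes "ubd K"
 obtains C where "C >= 0"
  "!!a h. cmod (K (a + h) - K a - (\<Sum>i\<in>UNIV. (h $ i) *R coord_deriv i K a)) <= C * norm h * norm h"
proof -
 obtain B where B: "B >= 0" "!!is x. length is <= 2 ==> cmod (Dl is K x) <= B" using ubd_boundE[OF assms, of 2] by metis
 have B2: "cmod (coord_deriv j (coord_deriv i K) x) <= B" for i j x using B(2)[of "[j, i]" x] by simp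
 have K: "smooth K" using assms by (rule ubd_smooth)
 define n where "n = real CARD('n)"
 have n: "n >= 0" by (simp add: n_def)
 have lip: "cmod (coord_deriv i K x - coord_deriv i K a) <= n * B * norm (x - a)" for i x a
  unfolding n_def by (rule smooth_lipschitz_on[where S=UNIV and f="coord_deriv i K"]) (auto intro: smooth_coord_deriv K B2)
 show ?thesis
 proof (rule that[of "n * (n * B)"])
  fix a h :: "real ^ 'n"
  let ?f' = "%x h. \<Sum>i\<in>UNIV. (h $ i) *R coord_deriv i K x"
  have "norm (K (a + h) - K a - ?f' a (a + h - a)) <= norm (a + h - a) * (n * (n * B * norm h))"
  proof (rule differentiable_bound_linearization[where S="cball a (norm h)"])
   fix t :: real assume "t \<in> {0..1}"
   then show "a + t *R (a + h - a) \<in> cball a (norm h)" by (simp add: dist_norm mult_left_le_one_le)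
  next
   fix x assume x: "x \<in> cball a (norm h)"
   show "(K has_derivative ?f' x) (at x within cball a (norm h))" by (rule has_derivative_at_withinI[OF smooth_has_derivative_sum[OF K]])
   have "?f' x - ?f' a = (%h. \<Sum>i\<in>UNIV. (h $ i) *R (coord_deriv i K x - coord_deriv i K a))" by (rule ext) (simp add: scaleR_diff_right sum_subtractf)
   moreover have "cmod (coord_deriv i K x - coord_deriv i K a) <= n * B * norm h" for i
   proof -
    have "norm (x - a) <= norm h" using x by (simp add: dist_norm norm_minus_commute)
    then have "n * B * norm (x - a) <= n * B * norm h" using n B by (intro mult_left_mono) auto
    then show ?thesis using lip[of i x a] by linarith
   qed
   ultimately show "onorm (?f' x - ?f' a) <= n * (n * B * norm h)" unfolding n_def by (simp only:) (rule onorm_frechet_le)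
  qed simp
  then show "cmod (K (a + h) - K a - ?f' a h) <= n * (n * B) * norm h * norm h" by (simp add: mult_ac)
 qed (use n B in auto)
qed

text \<open>The factors play different roles: \<open>K\<close> carries the regularity and takes the
  derivatives, \<open>w\<close> need only be integrable, such as the indicator of a set.
  \<open>cnv_commute\<close> swaps them when derivatives should fall on the other one.\<close>

definition cnv :: "('n::finite cfun) => ('n cfun) => 'n cfun" where
 "cnv K w y = (LL u. K (y - u) * w u)"

lemma cnv_integrable:
 assumes "ubd K" "integrable lborel w"
 shows "integrable lborel (%u. K (y - u) * w u)"
proof -
 obtain B where B: "B >= 0" "!!is x. length is <= 0 ==> cmod (Dl is K x) <= B" using ubd_boundE[OF assms(1), of 0] by metis
 have K: "cmod (K x) <= B" for x using B(2)[of "[]" x] by simp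
 have [measurable]: "K \<in> borel_measurable borel" using assms(1) by (intro smooth_measurable ubd_smooth)
 have [measurable]: "w \<in> borel_measurable borel" using assms(2) by simp
 show ?thesis
 proof (rule Bochner_Integration.integrable_bound)
  show "integrable lborel (%u. B * cmod (w u))" using assms(2) by simp
  show "AE u in lborel. norm (K (y - u) * w u) <= norm (B * cmod (w u))" using K B(1) by (intro AE_I2) (simp add: norm_mult mult_right_mono)
 qed measurable
qed

lemma cnv_bound:
 assumes "ubd K" "integrable lborel w" "!!x. cmod (K x) <= B"
 shows "cmod (cnv K w y) <= B * (LL u. cmod (w u))"
proof -
 have "cmod (cnv K w y) <= (LL u. cmod (K (y - u) * w u))" unfolding cnv_def by (rule integral_norm_bound)
 also have "... <= (LL u. B * cmod (w u))" using assms(2,3) by (intro integral_mono integrable_norm cnv_integrable assms) (auto simp: norm_mult mult_right_mono)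
 finally show ?thesis by simp
qed

lemma cnv_has_derivative:
 fixes K :: "'n::finite cfun"
 assumes K: "ubd K" and w: "integrable lborel w"
 shows "(cnv K w has_derivative (%h. \<Sum>i\<in>UNIV. (h $ i) *R cnv (coord_deriv i K) w y)) (at y)" unfolding has_derivative_at_alt
proof (intro conjI allI impI)
 show "bounded_linear (%h :: real ^ 'n. \<Sum>i\<in>UNIV. (h $ i) *R cnv (coord_deriv i K) w y)"
  by (intro bounded_linear_sum bounded_linear_scaleR_left[THEN bounded_linear_compose] bounded_linear_vec_nth)
 fix e :: real assume e: "e > 0"
 obtain C where C: "C >= 0"
  "!!a h. cmod (K (a + h) - K a - (\<Sum>i\<in>UNIV. (h $ i) *R coord_deriv i K a)) <= C * norm h * norm h" using ubd_taylor[OF K] by metis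
 define W where "W = (LL u. cmod (w u))"
 have W: "W >= 0" unfolding W_def by (intro integral_nonneg_AE) auto
 define d where "d = e / (C * W + 1)"
 have d: "d > 0" using e C W unfolding d_def by (intro divide_pos_pos add_nonneg_pos mult_nonneg_nonneg) auto
 show "\<exists>d>0. \<forall>z. norm (z - y) < d --> norm (cnv K w z - cnv K w y - (\<Sum>i\<in>UNIV. ((z - y) $ i) *R cnv (coord_deriv i K) w y)) <= e * norm (z - y)"
 proof (intro exI[of _ d] conjI d allI impI)
  fix z assume z: "norm (z - y) < d"
  define h where "h = z - y"
  have eh: "(y - u) + h = z - u" for u by (simp add: h_def)
  have i1: "integrable lborel (%u. K (z - u) * w u)" "integrable lborel (%u. K (y - u) * w u)"
   "!!i. integrable lborel (%u. coord_deriv i K (y - u) * w u)" by (intro cnv_integrable K w ubd_coord_deriv)+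
  have "cnv K w z - cnv K w y - (\<Sum>i\<in>UNIV. (h $ i) *R cnv (coord_deriv i K) w y) =
   (LL u. K (z - u) * w u - K (y - u) * w u - (\<Sum>i\<in>UNIV. (h $ i) *R (coord_deriv i K (y - u) * w u)))" unfolding cnv_def using i1 by simp
  also have "(%u. K (z - u) * w u - K (y - u) * w u - (\<Sum>i\<in>UNIV. (h $ i) *R (coord_deriv i K (y - u) * w u))) =
   (%u. (K ((y - u) + h) - K (y - u) - (\<Sum>i\<in>UNIV. (h $ i) *R coord_deriv i K (y - u))) * w u)"
   by (rule ext) (simp add: eh left_diff_distrib sum_distrib_right)
  finally have eq: "cnv K w z - cnv K w y - (\<Sum>i\<in>UNIV. (h $ i) *R cnv (coord_deriv i K) w y) =
   (LL u. (K ((y - u) + h) - K (y - u) - (\<Sum>i\<in>UNIV. (h $ i) *R coord_deriv i K (y - u))) * w u)" .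
  have "norm ... <= (LL u. (C * norm h * norm h) * cmod (w u))"
  proof (rule LINT_norm_bound)
   show "integrable lborel (%u. (K ((y - u) + h) - K (y - u) - (\<Sum>i\<in>UNIV. (h $ i) *R coord_deriv i K (y - u))) * w u)"
    unfolding eh left_diff_distrib sum_distrib_right mult_scaleR_left
    by (intro Bochner_Integration.integrable_diff Bochner_Integration.integrable_sum integrable_scaleR_right i1)
   show "integrable lborel (%u. (C * norm h * norm h) * cmod (w u))" using w by simp
  qed (use C in \<open>simp add: norm_mult mult_right_mono\<close>)
  also have "... = C * W * norm h * norm h" by (simp add: W_def)
  also have "... <= C * W * norm h * d" using z C W unfolding h_def by (intro mult_left_mono mult_nonneg_nonneg) auto
  also have "... = (C * W * d) * norm h" by simp
  also have "... <= e * norm h"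
  proof (intro mult_right_mono)
   have "C * W >= 0" using C W by simp
   then have "C * W / (C * W + 1) <= 1" by simp
   then have "e * (C * W / (C * W + 1)) <= e * 1" using e by (intro mult_left_mono) auto
   then show "C * W * d <= e" unfolding d_def by (simp add: mult.commute)
  qed simp
  finally show "norm (cnv K w z - cnv K w y - (\<Sum>i\<in>UNIV. ((z - y) $ i) *R cnv (coord_deriv i K) w y)) <= e * norm (z - y)"
   using eq unfolding h_def by simp
 qed
qed

lemma coord_deriv_cnv:
 assumes "ubd K" "integrable lborel w"
 shows "coord_deriv i (cnv K w) = cnv (coord_deriv i K) w"
proof
 fix y
 have "coord_deriv i (cnv K w) y = (\<Sum>j\<in>UNIV. (axis i 1 $ j) *R cnv (coord_deriv j K) w y)" by (rule coord_deriv_eqI[OF cnv_has_derivative[OF assms]])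
 also have "... = (\<Sum>j\<in>UNIV. if j = i then cnv (coord_deriv j K) w y else 0)" by (intro sum.cong) (auto simp: axis_def)
 finally show "coord_deriv i (cnv K w) y = cnv (coord_deriv i K) w y" by simp
qed

lemma smooth_cnv:
 assumes "ubd K" "integrable lborel w"
 shows "smooth (cnv K w)"
proof (rule smooth_coinduct[where G="{cnv K w |K. ubd K}"])
 fix f i assume "f \<in> {cnv K w |K. ubd K}"
 then obtain K where K: "f = cnv K w" "ubd K" by blast
 show "f differentiable_on UNIV" using cnv_has_derivative[OF K(2) assms(2)] unfolding K(1) differentiable_on_def differentiable_def by auto
 show "coord_deriv i f \<in> {cnv K w |K. ubd K}" using K coord_deriv_cnv[OF K(2) assms(2)] ubd_coord_deriv by blast
qed (use assms in blast)

lemma Dl_cnv: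
 assumes "ubd K" "integrable lborel w"
 shows "Dl is (cnv K w) = cnv (Dl is K) w" by (induction "is") (simp_all add: coord_deriv_cnv ubd_Dl assms)

lemma ubd_cnv:
 assumes "ubd K" "integrable lborel w"
 shows "ubd (cnv K w)" unfolding ubd_def
proof (intro conjI smooth_cnv assms allI)
 fix "is"
 obtain B where "!!x. cmod (Dl is K x) <= B" using assms(1) unfolding ubd_def by blast
 then show "\<exists>B. \<forall>x. cmod (Dl is (cnv K w) x) <= B" unfolding Dl_cnv[OF assms] using cnv_bound[OF ubd_Dl[OF assms(1)] assms(2)] by blast
qed

lemma cnv_commute:
 fixes K w :: "'n::finite cfun"
 assumes [measurable]: "K \<in> borel_measurable borel" "w \<in> borel_measurable borel"
 shows "cnv K w y = cnv w K y"
proof -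
 have "cnv K w y = (LL u. K (y - (y + (-1) *R u)) * w (y + (-1) *R u))" unfolding cnv_def by (subst integral_affine[of _ "-1" y]) auto
 then show ?thesis by (simp add: cnv_def mult.commute)
qed

section \<open>The mollifier\<close>

text \<open>Radial on purpose: integrating its dilates over all scales then gives a multiple of a
  power of the norm, the Riesz kernel. Nonnegativity and total mass 1 make \<open>moll\<close> an
  averaging operator.\<close>

definition theta :: "real ^ 'n::finite => real" where
 "theta x = flat 0 (1 - x \<bullet> x) / (LL x. flat 0 (1 - (x :: real ^ 'n) \<bullet> x))"

definition mol :: "real => 'n::finite cfun" where
 "mol t y = cplx (theta (y /\<^sub>R t) / t ^ CARD('n))"

definition moll :: "real => ('n::finite cfun) => 'n cfun" where
 "moll t ph = cnv (mol t) ph"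

lemma flat_nonneg: "flat k u >= 0" by (simp add: flat_def)

lemma flat0_schwartz: "(%x :: real ^ 'n::finite. cplx (flat 0 (1 - x \<bullet> x))) \<in> schwartz"
proof (rule compact_support_schwartz[where R=1])
 show "smooth (%x :: real ^ 'n. cplx (flat 0 (1 - x \<bullet> x)))" by (intro flat_span_smooth flat_base)
 fix x :: "real ^ 'n" assume "norm x > 1"
 then have "x \<bullet> x > 1" by (simp add: dot_square_norm)
 then show "cplx (flat 0 (1 - x \<bullet> x)) = 0" by (simp add: flat_def)
qed

lemma flat0_integral_pos:
 "integrable lborel (%x :: real ^ 'n::finite. flat 0 (1 - x \<bullet> x))"
 "(LL x. flat 0 (1 - (x :: real ^ 'n) \<bullet> x)) > 0"
proof -
 show i: "integrable lborel (%x :: real ^ 'n::finite. flat 0 (1 - x \<bullet> x))"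
  using schwartz_integrable0[OF flat0_schwartz] by (simp add: complex_of_real_integrable_eq)
 let ?A = "cball (0 :: real ^ 'n) (1/2)"
 have A: "?A \<in> sets lborel" "emeasure lborel ?A < \<infinity>" using emeasure_lborel_cball_finite[of "0 :: real ^ 'n" "1/2"] by auto
 have "0 < exp (- 2) * measure lborel ?A" using content_cball_pos[of "1/2" "0 :: real ^ 'n"] by simp
 also have "... = (LL x. exp (- 2) * indicator ?A x)" by simp
 also have "... <= (LL x. flat 0 (1 - (x :: real ^ 'n) \<bullet> x))"
 proof (intro integral_mono i)
  show "integrable lborel (%x. exp (- 2) * indicator ?A x :: real)" using A by simp
  fix x :: "real ^ 'n"
  show "exp (- 2) * indicator ?A x <= flat 0 (1 - x \<bullet> x)"
  proof (cases "x \<in> ?A")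
   case True
   then have "norm x <= 1/2" by simp
   then have "(norm x)\<^sup>2 <= (1/2)\<^sup>2" by (intro power_mono) auto
   then have x: "x \<bullet> x <= 1/4" by (simp add: dot_square_norm power2_eq_square)
   then have "1 / (1 - x \<bullet> x) <= 2" by (simp add: divide_le_eq)
   then show ?thesis using True x by (simp add: flat_def)
  qed (simp add: flat_nonneg)
 qed
 finally show "(LL x. flat 0 (1 - (x :: real ^ 'n) \<bullet> x)) > 0" .
qed

lemma theta_nonneg: "theta x >= 0" unfolding theta_def using flat0_integral_pos(2) by (intro divide_nonneg_pos flat_nonneg)

lemma theta_eq_0: assumes "norm x >= 1" shows "theta x = 0" using power_mono[OF assms, of 2] by (simp add: theta_def flat_def dot_square_norm)

lemma theta_integrable: "integrable lborel (theta :: real ^ 'n::finite => real)" unfolding theta_def[abs_def] by (intro integrable_divide flat0_integral_pos(1))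

lemma theta_integral: "(LL x. theta (x :: real ^ 'n::finite)) = 1" using flat0_integral_pos(2)[where 'n='n] unfolding theta_def by simp

lemma theta_schwartz: "(%x. cplx (theta x)) \<in> schwartz"
proof -
 have eq: "(%x :: real ^ 'a. cplx (theta x)) = (%x. cplx (1 / (LL x. flat 0 (1 - (x :: real ^ 'a) \<bullet> x))) * cplx (flat 0 (1 - x \<bullet> x)))"
  by (auto simp: theta_def)
 show ?thesis unfolding eq by (rule schwartz_cmult[OF flat0_schwartz])
qed

lemma theta_radial: fixes x y :: "real ^ 'n::finite" shows "norm x = norm y ==> theta x = theta y"
 unfolding theta_def dot_square_norm[of x] dot_square_norm[of y] by simp

lemma theta_measurable [measurable]: "(theta :: real ^ 'n::finite => real) \<in> borel_measurable borel" using theta_integrable[where 'n='n] by simp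

lemma mol_eq_cmult:
 "mol t = (%y :: real ^ 'n::finite. cplx (1 / t ^ CARD('n)) * (%x. cplx (theta x)) (0 + (1 / t) *R y))" by (auto simp: mol_def divide_inverse)

lemma mol_schwartz: "t > 0 ==> mol t \<in> schwartz" unfolding mol_eq_cmult by (intro schwartz_cmult schwartz_affine[OF theta_schwartz]) auto

lemma mol_eq_0: "t > 0 ==> norm y >= t ==> mol t y = 0" by (simp add: mol_def theta_eq_0 divide_inverse[symmetric] mult.commute[of "inverse t"])

lemma Dl_mol_eq_0:
 assumes "t > 0" "norm y > t" shows "Dl is (mol t) y = 0"
proof (rule Dl_eq_0_open[of "{y. norm y > t}"])
 show "open {y :: real ^ 'a. norm y > t}" by (intro open_Collect_less continuous_intros)
qed (use assms in \<open>auto intro: mol_eq_0\<close>)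

lemma Dl_mol_bound:
 obtains B where "B >= 0" "!!is t y. length is <= M ==> t > 0 ==> cmod (Dl is (mol t :: 'n::finite cfun) y) * t ^ (CARD('n) + length is) <= B"
proof -
 obtain B where B: "B >= 0" "!!is (x :: real ^ 'n). length is <= M ==> cmod (Dl is (%x. cplx (theta x)) x) <= B"
  using ubd_boundE[OF schwartz_ubd[OF theta_schwartz], of M] by metis
 have "cmod (Dl is (mol t) y) * t ^ (CARD('n) + length is) <= B" if "length is <= M" "t > 0" for "is" t and y :: "real ^ 'n"
 proof -
  have h: "(%y :: real ^ 'n. (%x. cplx (theta x)) (0 + (1 / t) *R y)) \<in> schwartz" using that by (intro schwartz_affine[OF theta_schwartz]) auto
  have "cmod (Dl is (mol t) y) = cmod (Dl is (%x. cplx (theta x)) (0 + (1 / t) *R y)) / t ^ (CARD('n) + length is)"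
   unfolding mol_eq_cmult Dl_cmult[OF schwartz_smooth[OF h]] Dl_affine[OF schwartz_smooth[OF theta_schwartz]] norm_mult norm_of_real
   using that by (simp add: power_add power_divide power_abs[symmetric])
  then show ?thesis using B(2)[OF that(1), of "0 + (1 / t) *R y"] that(2) by simp
 qed
 with B(1) show ?thesis using that by blast
qed

lemma mol_measurable [measurable]: "mol t \<in> borel_measurable borel" unfolding mol_def[abs_def] by measurable

lemma moll_eq:
 fixes ph :: "'n::finite cfun"
 assumes [measurable]: "ph \<in> borel_measurable borel" and t: "t > 0"
 shows "moll t ph y = (LL z. cplx (theta z) * ph (y - t *R z))"
proof -
 have "moll t ph y = (LL u. mol t (y - u) * ph u)" by (simp add: moll_def cnv_def)
 also have "... = \<bar>- t\<bar> ^ DIM(real ^ 'n) *R (LL z. mol t (y - (y + (- t) *R z)) * ph (y + (- t) *R z))"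
  by (rule integral_affine) (measurable, use t in simp)
 also have "... = (LL z. cplx (t ^ CARD('n)) * (mol t (t *R z) * ph (y - t *R z)))" using t by (simp add: scaleR_conv_of_real)
 also have "... = (LL z. cplx (theta z) * ph (y - t *R z))" using t by (intro Bochner_Integration.integral_cong) (auto simp: mol_def)
 finally show ?thesis .
qed

lemma moll_integrable:
 fixes ph :: "'n::finite cfun"
 assumes "ubd ph"
 shows "integrable lborel (%z. cplx (theta z) * ph (y - t *R z))"
proof -
 obtain B where B: "B >= 0" "!!is x. length is <= 0 ==> cmod (Dl is ph x) <= B" using ubd_boundE[OF assms(1), of 0] by metis
 have K: "cmod (ph x) <= B" for x using B(2)[of "[]" x] by simp
 have [measurable]: "ph \<in> borel_measurable borel" using assms(1) by (intro smooth_measurable ubd_smooth)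
 show ?thesis
 proof (rule Bochner_Integration.integrable_bound)
  show "integrable lborel (%z :: real ^ 'n. B * theta z)" by (intro integrable_mult_right theta_integrable)
  show "AE z in lborel. norm (cplx (theta z) * ph (y - t *R z)) <= norm (B * theta z)"
   using K B(1) by (intro AE_I2) (simp add: norm_mult mult.commute[of B] theta_nonneg mult_left_mono)
 qed measurable
qed

lemma moll_avg_bound:
 fixes g :: "'n::finite cfun"
 assumes "!!z. norm z < 1 ==> cmod (g z) <= B"
 shows "cmod (LL z. cplx (theta z) * g z) <= B"
proof (cases "integrable lborel (%z. cplx (theta z) * g z)")
 case True
 have "cmod (LL z. cplx (theta z) * g z) <= (LL z. theta (z :: real ^ 'n) * B)"
 proof (rule LINT_norm_bound[OF True])
  show "integrable lborel (%z :: real ^ 'n. theta z * B)" by (intro integrable_mult_left theta_integrable)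
  fix z :: "real ^ 'n"
  show "norm (cplx (theta z) * g z) <= theta z * B"
  proof (cases "norm z < 1")
   case True
   then show ?thesis using assms[OF True] theta_nonneg[of z] by (simp add: norm_mult mult_left_mono)
  qed (simp add: theta_eq_0)
 qed
 then show ?thesis by (simp add: theta_integral)
next
 case False
 have "B >= 0" using order_trans[OF norm_ge_zero assms[of 0]] by simp
 then show ?thesis using False by (simp add: not_integrable_integral_eq)
qed

lemma moll_bound:
 fixes ph :: "'n::finite cfun"
 assumes "ph \<in> borel_measurable borel" "t > 0" "!!z. norm (z - y) <= t ==> cmod (ph z) <= B"
 shows "cmod (moll t ph y) <= B" unfolding moll_eq[OF assms(1,2)]
 by (rule moll_avg_bound, rule assms(3)) (use assms(2) in \<open>simp add: mult_left_le\<close>)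

lemma schwartz_Dl: assumes "ph \<in> schwartz" shows "Dl is ph \<in> schwartz" unfolding schwartz_iff
proof (intro conjI allI smooth_Dl schwartz_smooth assms)
 fix k js
 show "\<exists>B. \<forall>x. (1 + norm x) ^ k * cmod (Dl js (Dl is ph) x) <= B" using assms unfolding schwartz_iff foldr_append[symmetric] by blast
qed

lemma schwartz_measurable: "ph \<in> schwartz ==> ph \<in> borel_measurable borel" by (intro smooth_measurable schwartz_smooth)

lemma moll_smooth: "ph \<in> schwartz ==> t > 0 ==> smooth (moll t ph)" unfolding moll_def by (intro smooth_cnv schwartz_ubd mol_schwartz schwartz_integrable0)

lemma Dl_moll:
 assumes "ph \<in> schwartz" "t > 0"
 shows "Dl is (moll t ph) = moll t (Dl is ph)"
proof -
 have c: "moll t \<psi> = cnv \<psi> (mol t)" if "\<psi> \<in> schwartz" for \<psi> :: "real ^ 'a => complex"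
  unfolding moll_def using that by (intro ext cnv_commute mol_measurable schwartz_measurable)
 show ?thesis unfolding c[OF assms(1)] c[OF schwartz_Dl[OF assms(1)]] by (intro Dl_cnv schwartz_ubd schwartz_integrable0 mol_schwartz assms)
qed

lemma Dl_moll_bound:
 assumes "ph \<in> schwartz" "t > 0" "!!z. norm (z - y) <= t ==> cmod (Dl is ph z) <= B"
 shows "cmod (Dl is (moll t ph) y) <= B" unfolding Dl_moll[OF assms(1,2)] by (intro moll_bound assms schwartz_measurable schwartz_Dl)

lemma moll_schwartz:
 fixes ph :: "'n::finite cfun"
 assumes "ph \<in> schwartz" "t > 0"
 shows "moll t ph \<in> schwartz" unfolding schwartz_iff
proof (intro conjI allI moll_smooth assms)
 fix k and "is" :: "'n list"
 obtain B where B: "!!x. (1 + norm x) ^ k * cmod (Dl is ph x) <= B" using assms unfolding schwartz_iff by blast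
 have "(1 + norm y) ^ k * cmod (Dl is (moll t ph) y) <= (1 + t) ^ k * B" for y
 proof -
  have p: "(1 + norm y) ^ k > 0" for y :: "real ^ 'n" by (intro zero_less_power) (auto intro: add_pos_nonneg)
  have "cmod (Dl is (moll t ph) y) <= (1 + t) ^ k * B / (1 + norm y) ^ k"
  proof (rule Dl_moll_bound[OF assms])
   fix z assume z: "norm (z - y) <= t"
   have "1 + norm y <= (1 + t) * (1 + norm z)"
   proof -
    have "norm y <= norm z + t" using norm_triangle_ineq4[of z "z - y"] z by simp
    moreover have "t * norm z >= 0" using assms(2) by simp
    ultimately show ?thesis by (simp add: algebra_simps)
   qed
   then have "(1 + norm y) ^ k <= (1 + t) ^ k * (1 + norm z) ^ k" by (metis power_mono power_mult_distrib norm_ge_zero add_nonneg_nonneg zero_le_one)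
   then have "(1 + norm y) ^ k * cmod (Dl is ph z) <= (1 + t) ^ k * (1 + norm z) ^ k * cmod (Dl is ph z)" by (intro mult_right_mono) auto
   also have "... = (1 + t) ^ k * ((1 + norm z) ^ k * cmod (Dl is ph z))" by simp
   also have "... <= (1 + t) ^ k * B" using assms(2) by (intro mult_left_mono B) auto
   finally show "cmod (Dl is ph z) <= (1 + t) ^ k * B / (1 + norm y) ^ k" using p[of y] by (simp add: field_simps)
  qed
  then show ?thesis using p[of y] by (simp add: field_simps)
 qed
 then show "\<exists>B. \<forall>x. (1 + norm x) ^ k * cmod (Dl is (moll t ph) x) <= B" by blast
qed

text \<open>Provides the measurability of the integrand of the Riesz operator in the scale. In each
  seminorm \<open>moll t ph\<close> is locally Lipschitz in \<open>t\<close>, because the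
  derivatives of \<open>ph\<close> are Lipschitz with decay.\<close>

lemma moll_continuous:
 fixes ph :: "'n::finite cfun"
 assumes f: "f \<in> tempered" and ph: "ph \<in> schwartz"
 shows "continuous_on {0<..} (%t. f (moll t ph))"
proof (rule continuous_at_imp_continuous_on, intro ballI)
 fix t :: real assume t: "t \<in> {0<..}"
 obtain M C where C: "C >= 0"
  "!!ph B. ph \<in> schwartz ==> (!!is x. length is <= M ==> (1 + norm x) ^ M * cmod (Dl is ph x) <= B) ==> cmod (f ph) <= C * B"
  using tempered_bound[OF f] by metis
 obtain B where B: "B >= 0" "!!is x. length is <= M + 1 ==> (1 + norm x) ^ M * cmod (Dl is ph x) <= B" using schwartz_boundE[OF ph, of "M + 1" M] by metis
 define T where "T = 2 * t"
 define Q where "Q = CARD('n) * ((1 + T) ^ M * B)"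
 have T: "T > 0" using t by (simp add: T_def)
 have bd: "cmod (f (moll s ph) - f (moll t ph)) <= C * (Q * \<bar>s - t\<bar>)" if s: "0 < s" "s < T" for s
 proof -
  have "cmod (f (%x. moll s ph x - moll t ph x)) <= C * (Q * \<bar>s - t\<bar>)"
  proof (rule C(2))
   show "(%x. moll s ph x - moll t ph x) \<in> schwartz" using s t ph by (intro schwartz_diff moll_schwartz) auto
   fix "is" :: "'n list" and y :: "real ^ 'n" assume l: "length is <= M"
   have sc: "Dl is ph \<in> schwartz" by (intro schwartz_Dl ph)
   have p: "(1 + norm y) ^ M > 0" by (intro zero_less_power) (auto intro: add_pos_nonneg)
   have "Dl is (%x. moll s ph x - moll t ph x) y = moll s (Dl is ph) y - moll t (Dl is ph) y" using s t ph by (simp add: Dl_diff moll_smooth Dl_moll)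
   also have "... = (LL z. cplx (theta z) * (Dl is ph (y - s *R z) - Dl is ph (y - t *R z)))" using s t sc schwartz_ubd[OF sc]
    by (simp add: moll_eq schwartz_measurable right_diff_distrib moll_integrable)
   also have "cmod ... <= Q * \<bar>s - t\<bar> / (1 + norm y) ^ M"
   proof (rule moll_avg_bound)
    fix z :: "real ^ 'n" assume z: "norm z < 1"
    have in1: "y - r *R z \<in> cball y T" if "0 < r" "r < T" for r
    proof -
     have "r * norm z <= T * 1" using that z by (intro mult_mono) auto
     then show ?thesis using that by (simp add: dist_norm)
    qed
    have "cmod (Dl is ph (y - s *R z) - Dl is ph (y - t *R z)) <=
     CARD('n) * ((1 + T) ^ M * B / (1 + norm y) ^ M) * norm ((y - s *R z) - (y - t *R z))"
    proof (rule smooth_lipschitz_on[where S="cball y T"])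
     fix i x assume x: "x \<in> cball y T"
     have "norm y <= norm x + T" using norm_triangle_ineq4[of x "x - y"] x by (simp add: dist_norm norm_minus_commute)
     moreover have "T * norm x >= 0" using T by simp
     ultimately have "1 + norm y <= (1 + T) * (1 + norm x)" by (simp add: algebra_simps)
     then have "(1 + norm y) ^ M <= (1 + T) ^ M * (1 + norm x) ^ M" by (metis power_mono power_mult_distrib norm_ge_zero add_nonneg_nonneg zero_le_one)
     then have "(1 + norm y) ^ M * cmod (Dl (i # is) ph x) <= (1 + T) ^ M * (1 + norm x) ^ M * cmod (Dl (i # is) ph x)" by (intro mult_right_mono) auto
     also have "... = (1 + T) ^ M * ((1 + norm x) ^ M * cmod (Dl (i # is) ph x))" by simp
     also have "... <= (1 + T) ^ M * B" using T l by (intro mult_left_mono B(2)) auto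
     finally show "cmod (coord_deriv i (Dl is ph) x) <= (1 + T) ^ M * B / (1 + norm y) ^ M" using p by (simp add: field_simps)
    qed (use in1[of s] in1[of t] s t in \<open>auto simp: T_def intro: smooth_Dl schwartz_smooth ph\<close>)
    also have "... <= CARD('n) * ((1 + T) ^ M * B / (1 + norm y) ^ M) * \<bar>s - t\<bar>"
    proof (rule mult_left_mono)
     have "(y - s *R z) - (y - t *R z) = (t - s) *R z" by (simp add: scaleR_diff_left)
     then show "norm ((y - s *R z) - (y - t *R z)) <= \<bar>s - t\<bar>" using z by (simp add: abs_minus_commute mult_left_le)
    qed (use B T p in simp)
    also have "CARD('n) * ((1 + T) ^ M * B / (1 + norm y) ^ M) * \<bar>s - t\<bar> = Q * \<bar>s - t\<bar> / (1 + norm y) ^ M" by (simp add: Q_def)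
    finally show "cmod (Dl is ph (y - s *R z) - Dl is ph (y - t *R z)) <= Q * \<bar>s - t\<bar> / (1 + norm y) ^ M" .
   qed
   finally show "(1 + norm y) ^ M * cmod (Dl is (%x. moll s ph x - moll t ph x) y) <= Q * \<bar>s - t\<bar>" using p by (simp add: field_simps)
  qed
  then show ?thesis using s t ph by (simp add: tempered_diff[OF f] moll_schwartz)
 qed
 have "((%s. C * (Q * \<bar>s - t\<bar>)) \<longlongrightarrow> C * (Q * \<bar>t - t\<bar>)) (at t)" by (intro tendsto_intros)
 then have l0: "((%s. C * (Q * \<bar>s - t\<bar>)) \<longlongrightarrow> 0) (at t)" by simp
 have "\<forall>\<^sub>F s in at t. s \<in> {0<..<T}" using t T by (intro eventually_at_in_open') (auto simp: T_def)
 then have "\<forall>\<^sub>F s in at t. norm (f (moll s ph) - f (moll t ph)) <= C * (Q * \<bar>s - t\<bar>)" by eventually_elim (use bd in auto)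
 then have "((%s. f (moll s ph) - f (moll t ph)) \<longlongrightarrow> 0) (at t)" by (rule Lim_null_comparison[OF _ l0])
 then show "continuous (at t) (%t. f (moll t ph))" unfolding continuous_at by (simp add: LIM_zero_iff)
qed

section \<open>Mollification of adapted test functions\<close>

definition decay_mass :: "'n::finite itself => nat => real" where
 "decay_mass _ N = (LL v. 1 / (1 + norm (v :: real ^ 'n)) ^ N)"

lemma decay_mass_nonneg: "decay_mass TYPE('n::finite) N >= 0" unfolding decay_mass_def by (intro integral_nonneg_AE) auto

lemma decay_integral:
 fixes x :: "real ^ 'n::finite"
 assumes "CARD('n) < N" "s > 0"
 shows "integrable lborel (%u. 1 / (s ^ CARD('n) * (1 + norm (u - x) / s) ^ N))"
  "(LL u. 1 / (s ^ CARD('n) * (1 + norm (u - x) / s) ^ N)) = decay_mass TYPE('n) N"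
proof -
 let ?f = "%u :: real ^ 'n. 1 / (s ^ CARD('n) * (1 + norm (u - x) / s) ^ N)"
 have e: "?f (x + s *R v) = (1 / s ^ CARD('n)) * (1 / (1 + norm v) ^ N)" for v using assms(2) by simp
 have i: "integrable lborel (%v. ?f (x + s *R v))" unfolding e by (intro integrable_mult_right integrable_inverse_power) (use assms in simp)
 from integrable_affine[OF this, of "1 / s" "- (1 / s) *R x"] assms(2)
 show "integrable lborel ?f" by (simp add: scaleR_diff_right)
 have "(LL u. ?f u) = \<bar>s\<bar> ^ DIM(real ^ 'n) *R (LL v. ?f (x + s *R v))" by (rule integral_affine) (measurable, use assms in simp)
 also have "... = decay_mass TYPE('n) N" unfolding e decay_mass_def integral_mult_right_zero using assms(2) by simp
 finally show "(LL u. ?f u) = decay_mass TYPE('n) N" .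
qed

lemma bump_abs_integral:
 fixes x :: "real ^ 'n::finite"
 assumes "CARD('n) < N" "s > 0" "bump N c x s ph"
 shows "(LL u. cmod (ph u)) <= c * decay_mass TYPE('n) N"
proof -
 have "(LL u. cmod (ph u)) <= (LL u. c * (1 / (s ^ CARD('n) * (1 + norm (u - x) / s) ^ N)))"
 proof (intro integral_mono integrable_norm schwartz_integrable0 integrable_mult_right decay_integral assms)
  show "ph \<in> schwartz" using assms(3) by (rule bump_schwartz)
  fix u show "cmod (ph u) <= c * (1 / (s ^ CARD('n) * (1 + norm (u - x) / s) ^ N))" using bumpD'[OF assms(3), of "[]" u] assms(2) by simp
 qed
 then show ?thesis by (simp only: integral_mult_right_zero decay_integral[OF assms(1,2)])
qed

lemma power_le_scaled: "0 <= a ==> a <= k * b ==> a ^ N <= k ^ N * b ^ N" for a b k :: real by (metis power_mono power_mult_distrib)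

lemma one_plus_le_double: "a <= c ==> c = b + 1 ==> 0 <= b ==> 1 + a <= 2 * (1 + b)" for a b c :: real by simp

text \<open>Here \<rho> is the distance to the centre. For \<rho> <= t the weight at scale
  \<open>t\<close> is at most 2 ^ N; beyond, the ratio of the weights is at most (2 s / t) ^ N, and
  n of the factors s / t turn s^(-n) into t^(-n). Both terms on the right have bounded integral over
  a ball of radius \<open>t\<close>.\<close>

lemma bump_ratio:
 fixes s t \<rho> :: real
 assumes "CARD('n::finite) < N" "0 < s" "s <= t" "\<rho> >= 0"
 shows "(1 + \<rho> / t) ^ N / (s ^ CARD('n) * (1 + \<rho> / s) ^ N) <=
  2 ^ N * (1 / (s ^ CARD('n) * (1 + \<rho> / s) ^ N) + 1 / t ^ CARD('n))"
proof (cases "\<rho> <= t")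
 case True
 have p: "s ^ CARD('n) * (1 + \<rho> / s) ^ N > 0" using assms by (intro mult_pos_pos zero_less_power add_pos_nonneg) auto
 have "1 + \<rho> / t <= 2" using True assms by (simp add: divide_le_eq)
 then have "(1 + \<rho> / t) ^ N <= 2 ^ N" using assms by (intro power_mono) auto
 then have "(1 + \<rho> / t) ^ N / (s ^ CARD('n) * (1 + \<rho> / s) ^ N) <= 2 ^ N / (s ^ CARD('n) * (1 + \<rho> / s) ^ N)"
  using p by (intro divide_right_mono) auto
 also have "... <= 2 ^ N * (1 / (s ^ CARD('n) * (1 + \<rho> / s) ^ N) + 1 / t ^ CARD('n))" using assms by (simp add: distrib_left)
 finally show ?thesis .
next
 case False
 let ?n = "CARD('n)"
 have "(1 + \<rho> / t) * s <= 2 * (s / t) * (\<rho> + s)"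
 proof -
  define w q where "w = s * (\<rho> / t)" and "q = 2 * (s / t) * s"
  have "s <= w" using False assms by (simp add: w_def le_divide_eq)
  moreover have "q >= 0" using assms by (simp add: q_def)
  moreover have "(1 + \<rho> / t) * s = s + w" "2 * (s / t) * (\<rho> + s) = 2 * w + q" by (simp_all add: w_def q_def algebra_simps add_divide_distrib)
  ultimately show ?thesis by simp
 qed
 then have "(1 + \<rho> / t) * s / (\<rho> + s) <= 2 * (s / t)" using assms by (subst pos_divide_le_eq) auto
 moreover have "1 + \<rho> / s = (\<rho> + s) / s" using assms by (simp add: add_divide_distrib)
 ultimately have "(1 + \<rho> / t) / (1 + \<rho> / s) <= 2 * (s / t)" by simp
 then have "((1 + \<rho> / t) / (1 + \<rho> / s)) ^ N <= (2 * (s / t)) ^ N" using assms by (intro power_mono divide_nonneg_nonneg add_nonneg_nonneg) auto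
 then have "(1 + \<rho> / t) ^ N / (1 + \<rho> / s) ^ N <= 2 ^ N * (s / t) ^ N" by (simp add: power_divide power_mult_distrib)
 also have "... <= 2 ^ N * (s / t) ^ ?n" using assms by (intro mult_left_mono power_decreasing) auto
 finally have "(1 + \<rho> / t) ^ N / (1 + \<rho> / s) ^ N / s ^ ?n <= 2 ^ N * (s / t) ^ ?n / s ^ ?n" using assms by (intro divide_right_mono) auto
 also have "... = 2 ^ N * (1 / t ^ ?n)" using assms by (simp add: power_divide)
 also have "... <= 2 ^ N * (1 / (s ^ CARD('n) * (1 + \<rho> / s) ^ N) + 1 / t ^ CARD('n))" using assms by (intro mult_left_mono) auto
 finally show ?thesis by (simp add: mult.commute)
qed

lemma moll_bump_le:
 fixes x :: "real ^ 'n::finite"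
 assumes "bump N c x s ph" "0 < t" "t <= s"
 shows "bump N (2 ^ N * c) x s (moll t ph)" unfolding bump_def
proof (intro conjI allI impI moll_schwartz bump_schwartz[OF assms(1)] assms(2))
 fix "is" :: "'n list" and y assume l: "length is <= N"
 have s: "s > 0" using assms by simp
 let ?n = "CARD('n)"
 have p: "s ^ (?n + length is) * (1 + norm (z - x) / s) ^ N > 0" for z using s by (intro mult_pos_pos zero_less_power add_pos_nonneg) auto
 have "cmod (Dl is (moll t ph) y) <= 2 ^ N * c / (s ^ (?n + length is) * (1 + norm (y - x) / s) ^ N)"
 proof (rule Dl_moll_bound[OF bump_schwartz[OF assms(1)] assms(2)])
  fix z assume z: "norm (z - y) <= t"
  have "norm (y - x) <= norm (z - x) + s" using norm_triangle_ineq4[of "z - x" "z - y"] z assms by simp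
  then have "norm (y - x) / s <= (norm (z - x) + s) / s" using s by (intro divide_right_mono) auto
  moreover have "(norm (z - x) + s) / s = norm (z - x) / s + 1" using s by (simp add: add_divide_distrib)
  moreover have "norm (z - x) / s >= 0" using s by simp
  ultimately have "1 + norm (y - x) / s <= 2 * (1 + norm (z - x) / s)" by (rule one_plus_le_double)
  then have q: "(1 + norm (y - x) / s) ^ N <= 2 ^ N * (1 + norm (z - x) / s) ^ N" using s by (intro power_le_scaled) auto
  have "cmod (Dl is ph z) * (s ^ (?n + length is) * (1 + norm (y - x) / s) ^ N) <=
   cmod (Dl is ph z) * (s ^ (?n + length is) * (2 ^ N * (1 + norm (z - x) / s) ^ N))" using q s by (intro mult_left_mono) auto
  also have "... = 2 ^ N * (cmod (Dl is ph z) * s ^ (?n + length is) * (1 + norm (z - x) / s) ^ N)" by simp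
  also have "... <= 2 ^ N * c" by (intro mult_left_mono bumpD[OF assms(1) l]) auto
  finally show "cmod (Dl is ph z) <= 2 ^ N * c / (s ^ (?n + length is) * (1 + norm (y - x) / s) ^ N)" unfolding pos_le_divide_eq[OF p[of y]] .
 qed
 then have "cmod (Dl is (moll t ph) y) * (s ^ (?n + length is) * (1 + norm (y - x) / s) ^ N) <= 2 ^ N * c" unfolding pos_le_divide_eq[OF p[of y]] .
 then show "cmod (Dl is (moll t ph) y) * s ^ (?n + length is) * (1 + norm (y - x) / s) ^ N <= 2 ^ N * c" by (simp only: mult.assoc)
qed

text \<open>For t >= s all derivatives are put on the mollifier, and \<open>ph\<close> enters only
  through integrals of its decay, which do not depend on \<open>s\<close>. The result lives at the
  coarser scale \<open>t\<close>.\<close>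

lemma moll_bump_ge:
 assumes N: "CARD('n::finite) < N"
 obtains C where "C >= 0" "!!c (x :: real ^ 'n) s t ph. bump N c x s ph ==> 0 < s ==> s <= t ==> bump N (C * c) x t (moll t ph)"
proof -
 let ?n = "CARD('n)"
 obtain B where B: "B >= 0" "!!is t y. length is <= N ==> t > 0 ==> cmod (Dl is (mol t :: 'n cfun) y) * t ^ (?n + length is) <= B"
  using Dl_mol_bound[of N] by metis
 define V where "V = unit_ball_vol (real ?n)"
 define I where "I = decay_mass TYPE('n) N"
 have V: "V >= 0" and I: "I >= 0" by (auto simp: V_def I_def unit_ball_vol_nonneg decay_mass_nonneg)
 show ?thesis
 proof (rule that[of "B * 4 ^ N * (I + V)"])
  fix c s t and x :: "real ^ 'n" and ph :: "'n cfun"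
  assume b: "bump N c x s ph" and s: "0 < s" "s <= t"
  have t: "t > 0" using s by simp
  have c: "c >= 0" by (rule bump_nonneg[OF b s(1)])
  have ph: "ph \<in> schwartz" using b by (rule bump_schwartz)
  show "bump N (B * 4 ^ N * (I + V) * c) x t (moll t ph)" unfolding bump_def
  proof (intro conjI allI impI moll_schwartz ph t)
   fix "is" :: "'n list" and y assume l: "length is <= N"
   define W where "W = t ^ (?n + length is) * (1 + norm (y - x) / t) ^ N"
   have W: "W >= 0" unfolding W_def using t by simp
   define g where "g = (%u. B * 4 ^ N * c * (1 / (s ^ ?n * (1 + norm (u - x) / s) ^ N) + 1 / t ^ ?n * indicator (cball y t) u))"
   have gi: "integrable lborel (%u :: real ^ 'n. 1 / (s ^ ?n * (1 + norm (u - x) / s) ^ N))" by (rule decay_integral[OF N s(1)])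
   have ci: "integrable lborel (%u :: real ^ 'n. 1 / t ^ ?n * indicator (cball y t) u :: real)"
    using emeasure_lborel_cball_finite[of y t] by (intro integrable_mult_right) auto
   have K: "ubd (Dl is (mol t :: 'n cfun))" using t by (intro ubd_Dl schwartz_ubd mol_schwartz)
   have "cmod (Dl is (moll t ph) y) * W = cmod (LL u. of_real W * (Dl is (mol t) (y - u) * ph u))" unfolding moll_def using W t ph
    by (simp add: Dl_cnv schwartz_ubd mol_schwartz schwartz_integrable0 cnv_def norm_mult mult.commute)
   also have "... <= (LL u. g u)"
   proof (rule LINT_norm_bound)
    show "integrable lborel (%u. of_real W * (Dl is (mol t) (y - u) * ph u))" by (intro integrable_mult_right cnv_integrable K schwartz_integrable0 ph)
    show "integrable lborel g" unfolding g_def by (intro integrable_mult_right Bochner_Integration.integrable_add gi ci)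
    fix u
    have g0: "g u >= 0" unfolding g_def using B c s t by (intro mult_nonneg_nonneg add_nonneg_nonneg divide_nonneg_nonneg) auto
    show "norm (of_real W * (Dl is (mol t) (y - u) * ph u)) <= g u"
    proof (cases "norm (y - u) <= t")
     case False
     then show ?thesis using Dl_mol_eq_0[OF t, of "y - u"] g0 by simp
    next
     case True
     let ?\<rho> = "norm (u - x)"
     have "norm (y - x) <= norm (u - x) + t" using norm_triangle_ineq[of "y - u" "u - x"] True by simp
     then have "norm (y - x) / t <= (?\<rho> + t) / t" using t by (intro divide_right_mono) auto
     moreover have "(?\<rho> + t) / t = ?\<rho> / t + 1" using t by (simp add: add_divide_distrib)
     moreover have "?\<rho> / t >= 0" using t by simp
     ultimately have "1 + norm (y - x) / t <= 2 * (1 + ?\<rho> / t)" by (rule one_plus_le_double)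
     then have q: "(1 + norm (y - x) / t) ^ N <= 2 ^ N * (1 + ?\<rho> / t) ^ N" using t by (intro power_le_scaled) auto
     have f: "cmod (ph u) <= c * (1 / (s ^ ?n * (1 + ?\<rho> / s) ^ N))" using bumpD'[OF b, of "[]" u] s by simp
     have "norm (of_real W * (Dl is (mol t) (y - u) * ph u)) =
      (cmod (Dl is (mol t) (y - u)) * t ^ (?n + length is)) * ((1 + norm (y - x) / t) ^ N * cmod (ph u))"
     proof -
      have "norm (of_real W * (Dl is (mol t) (y - u) * ph u)) = W * (cmod (Dl is (mol t) (y - u)) * cmod (ph u))" using W by (simp add: norm_mult)
      then show ?thesis by (simp add: W_def)
     qed
     also have "... <= B * ((2 ^ N * (1 + ?\<rho> / t) ^ N) * (c * (1 / (s ^ ?n * (1 + ?\<rho> / s) ^ N))))"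
      using B l t q f c s by (intro mult_mono mult_nonneg_nonneg) auto
     also have "... = B * 2 ^ N * c * ((1 + ?\<rho> / t) ^ N / (s ^ ?n * (1 + ?\<rho> / s) ^ N))" by simp
     also have "... <= B * 2 ^ N * c * (2 ^ N * (1 / (s ^ ?n * (1 + ?\<rho> / s) ^ N) + 1 / t ^ ?n))" using B c s by (intro mult_left_mono bump_ratio N) auto
     also have "... = g u" using True unfolding g_def by (simp add: dist_norm mult_ac flip: power_mult_distrib)
     finally show ?thesis .
    qed
   qed
   also have "... = B * 4 ^ N * c * (I + 1 / t ^ ?n * measure lborel (cball y t))"
    unfolding g_def using gi ci decay_integral(2)[OF N s(1), of x] by (simp add: I_def)
   also have "measure lborel (cball y t) = V * t ^ ?n" unfolding V_def using t content_cball[of t y] by simp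
   also have "B * 4 ^ N * c * (I + 1 / t ^ ?n * (V * t ^ ?n)) = B * 4 ^ N * (I + V) * c" using t by simp
   finally show "cmod (Dl is (moll t ph) y) * t ^ (?n + length is) * (1 + norm (y - x) / t) ^ N <= B * 4 ^ N * (I + V) * c" by (simp add: W_def mult.assoc)
  qed
 qed (use B V I in auto)
qed

text \<open>\<open>moll t ph\<close> is a test function of scale max s t around \<open>x\<close>, so
  each point \<open>z\<close> within that distance is an equally good centre. This freedom produces
  the infimum over balls in the Hedberg estimate.\<close>

lemma moll_maximal:
 assumes N: "CARD('n::finite) < N"
 obtains C where "C > 0" "!!c (x :: real ^ 'n) s t ph f z. f \<in> tempered ==> bump N c x s ph ==> 0 < s ==> 0 < t ==>
  norm (z - x) <= max s t ==> ennreal (cmod (f (moll t ph))) <= ennreal (C * c) * grand_maximal N f z"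
proof -
 obtain C0 where C0: "C0 >= 0" "!!c (x :: real ^ 'n) s t ph. bump N c x s ph ==> 0 < s ==> s <= t ==> bump N (C0 * c) x t (moll t ph)"
  using moll_bump_ge[OF N] by metis
 define C1 where "C1 = C0 + 2 ^ N"
 have C1: "C1 > 0" "C1 >= C0" "C1 >= 2 ^ N" using C0 by (auto simp: C1_def add_nonneg_pos)
 show ?thesis
 proof (rule that[of "mi_card TYPE('n) N * (C1 * (1 + 1) ^ N)"])
  show "0 < mi_card TYPE('n) N * (C1 * (1 + 1) ^ N)" using C1 mi_card_pos[where 'n='n, of N] by simp
  fix c s t f and ph :: "'n cfun" and x z :: "real ^ 'n"
  assume f: "(f :: ('n cfun) => complex) \<in> tempered" and b: "bump N c x s ph" and s: "0 < s" "0 < t" and z: "norm (z - x) <= max s t"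
  have c: "c >= 0" by (rule bump_nonneg[OF b s(1)])
  have "bump N (C1 * c) x (max s t) (moll t ph)"
  proof (cases "t <= s")
   case True
   then show ?thesis using bump_mono[OF moll_bump_le[OF b s(2) True], of "C1 * c"] C1 c by (simp add: max_absorb1 mult_right_mono)
  next
   case False
   then show ?thesis using bump_mono[OF C0(2)[OF b s(1), of t], of "C1 * c"] C1 c by (simp add: max_absorb2 mult_right_mono)
  qed
  from bump_shift[OF this, of z 1] z s have "bump N (C1 * c * (1 + 1) ^ N) z (max s t) (moll t ph)" by simp
  from bump_le_grand_maximal[OF f this] s
  show "ennreal (cmod (f (moll t ph))) <= ennreal (mi_card TYPE('n) N * (C1 * (1 + 1) ^ N) * c) * grand_maximal N f z" by (simp add: mult_ac)
 qed
qed

section \<open>Log-Hoelder exponents\<close>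

text \<open>The Hoelder conditions are in product form, the local one with an upper bound
  \<open>t\<close> for the distance: this makes sense at t = 1, where the logarithm vanishes, and
  applies to all points of a ball of radius \<open>t\<close> at once.\<close>

locale log_holder =
 fixes p :: "real ^ 'n::finite => real" and pm pp pinf A B :: real
 assumes p_meas [measurable]: "p \<in> borel_measurable lebesgue"
  and pm_pos: "0 < pm" and p_ge: "!!x. pm <= p x" and p_le: "!!x. p x <= pp"
  and pinf_ge: "pm <= pinf" and pinf_le: "pinf <= pp"
  and holder_local: "!!x y t. norm (x - y) <= t ==> 0 < t ==> t <= 1 ==> \<bar>p x - p y\<bar> * ln (1 / t) <= A"
  and holder_inf: "!!x. \<bar>p x - pinf\<bar> * ln (exp 1 + norm x) <= B"
begin

lemma p_pos: "p x > 0" using pm_pos p_ge[of x] by linarith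

lemma pp_pos: "pp > 0" using p_pos p_le order_less_le_trans by blast

lemma A_nonneg: "A >= 0" using holder_local[of 0 0 1] by simp

end

section \<open>Powers of extended nonnegative numbers and the change of exponents\<close>

lemma ennpowr_measurable [measurable]:
 assumes [measurable]: "a \<in> borel_measurable M" "p \<in> borel_measurable M"
 shows "(%x. ennpowr (a x) (p x)) \<in> borel_measurable M" unfolding ennpowr_def by measurable

lemma ennpowr_mono: "a <= b ==> r >= 0 ==> ennpowr a r <= ennpowr b r" unfolding ennpowr_def
 by (auto simp: top_unique intro!: ennreal_leI powr_mono2 enn2real_mono simp: top.not_eq_extremum)

lemma ennpowr_ennreal: "x >= 0 ==> ennpowr (ennreal x) r = ennreal (x powr r)" by (simp add: ennpowr_def)

lemma ennreal_le_realI: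
 assumes "!!\<mu>. 0 <= \<mu> ==> ennreal \<mu> <= m ==> \<mu> <= Q"
 shows "m <= ennreal Q"
proof (cases m)
 case (real r)
 then show ?thesis using assms[of r] by (simp add: ennreal_leI)
next
 case top
 then have "max Q 0 + 1 <= Q" by (intro assms) auto
 then show ?thesis by simp
qed

text \<open>If - ln a is at most k / e times ln (exp 1 + norm x), changing \<open>e1\<close> to
  \<open>e2\<close> costs a bounded factor by the hypothesis with \<open>B\<close>. Otherwise
  \<open>a powr e1\<close> is at most the k-th power of 1 / (exp 1 + norm x) and goes into the error
  term, integrable for k > n.\<close>

lemma decay_compare:
 fixes x :: "'a::real_normed_vector"
 assumes a: "0 <= a" "a <= 1" and e: "0 < e" "e <= e1" and d: "\<bar>e1 - e2\<bar> * ln (exp 1 + norm x) <= B"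
 shows "a powr e1 <= exp (real k / e * B) * a powr e2 + 1 / (1 + norm x) ^ k"
proof (cases "a = 0")
 case False
 define L where "L = ln (exp 1 + norm x)"
 have pos: "exp 1 + norm x > 0" by (intro add_pos_nonneg) auto
 have "1 <= exp 1 + norm x" using exp_ge_add_one_self[of 1] by (smt (verit) norm_ge_zero)
 then have L: "L >= 0" by (simp add: L_def)
 show ?thesis
 proof (cases "- ln a <= real k / e * L")
  case True
  have "(e1 - e2) * ln a <= \<bar>e1 - e2\<bar> * (- ln a)"
  proof -
   have "ln a <= 0" using a False by (simp add: ln_le_zero_iff)
   then show ?thesis using mult_right_mono_neg[of "- \<bar>e1 - e2\<bar>" "e1 - e2" "ln a"] by simp
  qed
  also have "... <= \<bar>e1 - e2\<bar> * (real k / e * L)" using True by (intro mult_left_mono) auto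
  also have "... = real k / e * (\<bar>e1 - e2\<bar> * L)" by simp
  also have "... <= real k / e * B" using d e by (intro mult_left_mono) (auto simp: L_def)
  finally have "a powr (e1 - e2) <= exp (real k / e * B)" using a False by (simp add: powr_def)
  then have "a powr e2 * a powr (e1 - e2) <= a powr e2 * exp (real k / e * B)" by (intro mult_left_mono) auto
  then have "a powr e1 <= exp (real k / e * B) * a powr e2" using a False by (simp add: mult.commute flip: powr_add)
  then show ?thesis by (simp add: add_increasing2)
 next
  case False': False
  have "a powr e1 <= a powr e" using a e by (intro powr_mono') auto
  also have "... = exp (e * ln a)" using a False by (simp add: powr_def)
  also have "... <= exp (- (real k * L))"
  proof -
   have "real k * L = e * (real k / e * L)" using e by simp
   also have "... <= e * (- ln a)" using False' e by (intro mult_left_mono) auto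
   finally show ?thesis by simp
  qed
  also have "... = 1 / (exp 1 + norm x) ^ k" using pos by (simp add: L_def exp_minus exp_of_nat_mult divide_inverse)
  also have "... <= 1 / (1 + norm x) ^ k"
   using exp_ge_add_one_self[of 1] by (intro divide_left_mono power_mono mult_pos_pos zero_less_power add_pos_nonneg) auto
  finally show ?thesis by (simp add: add_increasing)
 qed
qed simp

text \<open>Replaces the averages over balls in the usual Hedberg argument; an infimum needs no
  maximal theorem.\<close>

definition infball :: "(real ^ 'n::finite => ennreal) => real ^ 'n => real => ennreal" where
 "infball a x t = (INF z\<in>cball x t. a z)"

lemma infball_le: "z \<in> cball x t ==> infball a x t <= a z" unfolding infball_def by (rule INF_lower)

context log_holder
begin

definition mass1 :: "(real ^ 'n => ennreal) => bool" where
 "mass1 a \<longleftrightarrow> a \<in> borel_measurable lebesgue \<and> (\<integral>\<^sup>+ z. ennpowr (a z) (p z) \<partial>lebesgue) <= 1"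

text \<open>The pointwise bound is integrated over the ball, where \<mu> lies below
  \<open>a\<close>, and the modular of \<open>a\<close> is at most 1. The function \<open>E\<close>
  absorbs the error of exchanging exponents.\<close>

lemma ball_mass:
 assumes a: "mass1 a" and \<mu>: "0 <= \<mu>" "ennreal \<mu> <= infball a x t" and t: "t > 0"
  and le: "!!z. z \<in> cball x t ==> v <= D * \<mu> powr p z + E z"
  and E: "E \<in> borel_measurable borel" "!!z. E z >= 0" "(NN z. ennreal (E z)) <= ennreal E0" "E0 >= 0"
  and D: "D >= 0" and v: "v >= 0"
 shows "v * (unit_ball_vol (real CARD('n)) * t ^ CARD('n)) <= D + E0"
proof -
 have am[measurable]: "a \<in> borel_measurable lebesgue" and a1: "(\<integral>\<^sup>+ z. ennpowr (a z) (p z) \<partial>lebesgue) <= 1"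
  using a by (auto simp: mass1_def)
 have Em[measurable]: "(%z. ennreal (E z)) \<in> borel_measurable lebesgue" using E(1) by (intro measurable_completion) simp
 let ?V = "unit_ball_vol (real CARD('n)) * t ^ CARD('n)"
 have em: "emeasure lebesgue (cball x t) = ennreal ?V" using emeasure_cball[of t x] t by simp
 have "ennreal (v * ?V) = ennreal v * emeasure lebesgue (cball x t)" unfolding em using v t by (intro ennreal_mult) (auto simp: unit_ball_vol_nonneg)
 also have "... = (\<integral>\<^sup>+ z. ennreal v * indicator (cball x t) z \<partial>lebesgue)" by (rule nn_integral_cmult_indicator[symmetric]) simp
 also have "... <= (\<integral>\<^sup>+ z. ennreal D * ennpowr (a z) (p z) + ennreal (E z) \<partial>lebesgue)"
 proof (rule nn_integral_mono)
  fix z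
  show "ennreal v * indicator (cball x t) z <= ennreal D * ennpowr (a z) (p z) + ennreal (E z)"
  proof (cases "z \<in> cball x t")
   case True
   have "ennreal \<mu> <= a z" using \<mu>(2) infball_le[OF True] by (rule order_trans)
   then have "ennreal (\<mu> powr p z) <= ennpowr (a z) (p z)"
    using ennpowr_mono[of "ennreal \<mu>" "a z" "p z"] \<mu>(1) p_pos[of z] by (simp add: ennpowr_ennreal)
   then have "ennreal D * ennreal (\<mu> powr p z) <= ennreal D * ennpowr (a z) (p z)" by (intro mult_left_mono) auto
   moreover have "ennreal v <= ennreal D * ennreal (\<mu> powr p z) + ennreal (E z)"
    using ennreal_leI[OF le[OF True]] D E(2)[of z] by (simp add: ennreal_plus ennreal_mult)
   ultimately show ?thesis using True by (simp add: add_right_mono order_trans)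
  qed simp
 qed
 also have "... = ennreal D * (\<integral>\<^sup>+ z. ennpowr (a z) (p z) \<partial>lebesgue) + (\<integral>\<^sup>+ z. ennreal (E z) \<partial>lebesgue)"
  by (subst nn_integral_add) (auto simp: nn_integral_cmult)
 also have "(\<integral>\<^sup>+ z. ennreal (E z) \<partial>lebesgue) = (NN z. ennreal (E z))" by (simp add: nn_integral_completion)
 also have "ennreal D * (\<integral>\<^sup>+ z. ennpowr (a z) (p z) \<partial>lebesgue) + ... <= ennreal D * 1 + ennreal E0"
  by (intro add_mono mult_left_mono a1 E) auto
 also have "... = ennreal (D + E0)" using D E by (simp add: ennreal_plus)
 finally have "ennreal (v * ?V) <= ennreal (D + E0)" .
 then show ?thesis by (rule iffD1[OF ennreal_le_iff, rotated]) (use D E in simp)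
qed

text \<open>For \<mu> >= 1 the smallest exponent is allowed at every point of the ball. The outcome
  is not sharp, but for small \<open>t\<close> it bounds ln \<mu> by a constant plus a multiple of
  ln (1 / t), which is what the local Hoelder condition needs.\<close>

lemma crude_mass:
 assumes a: "mass1 a" and \<mu>: "1 <= \<mu>" "ennreal \<mu> <= infball a x t" and t: "t > 0"
 shows "\<mu> powr pm * (unit_ball_vol (real CARD('n)) * t ^ CARD('n)) <= 1"
proof -
 have "\<mu> powr pm * (unit_ball_vol (real CARD('n)) * t ^ CARD('n)) <= 1 + 0"
  by (rule ball_mass[OF a _ \<mu>(2) t, where E="%_. 0"]) (use \<mu> p_ge in \<open>auto intro: powr_mono\<close>)
 then show ?thesis by simp
qed

text \<open>The inverse volume of the unit ball, raised to at least 1 so that larger exponents give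
  larger powers.\<close>

definition K1 :: real where "K1 = max 1 (1 / unit_ball_vol (real CARD('n)))"

lemma K1: "K1 >= 1" "y * (unit_ball_vol (real CARD('n)) * t ^ CARD('n)) <= z ==> t > 0 ==> z >= 0 ==> y <= z * K1 * t powr (- real CARD('n))"
proof -
 show "K1 >= 1" by (simp add: K1_def)
 assume h: "y * (unit_ball_vol (real CARD('n)) * t ^ CARD('n)) <= z" and t: "t > 0" and z: "z >= 0"
 have V: "unit_ball_vol (real CARD('n)) > 0" by simp
 then have "y <= z * (1 / unit_ball_vol (real CARD('n))) * (1 / t ^ CARD('n))" using h t by (simp add: field_simps)
 also have "... <= z * K1 * (1 / t ^ CARD('n))" using t z by (intro mult_right_mono mult_left_mono) (auto simp: K1_def)
 also have "1 / t ^ CARD('n) = t powr (- real CARD('n))" using t by (simp add: powr_minus powr_realpow divide_inverse)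
 finally show "y <= z * K1 * t powr (- real CARD('n))" .
qed

lemma powr_root_le:
 assumes "\<mu> powr e <= Q * t powr (- r)" "\<mu> >= 0" "t > 0" "Q >= 1" "pm <= e"
 shows "\<mu> <= Q powr (1 / pm) * t powr (- (r / e))"
proof -
 have e: "e > 0" using assms pm_pos by linarith
 have "\<mu> = (\<mu> powr e) powr (1 / e)" using e assms(2) by (simp add: powr_powr)
 also have "... <= (Q * t powr (- r)) powr (1 / e)" using assms e by (intro powr_mono2) auto
 also have "... = Q powr (1 / e) * t powr (- (r / e))" using assms by (simp add: powr_mult powr_powr)
 also have "... <= Q powr (1 / pm) * t powr (- (r / e))" using assms e pm_pos by (intro mult_right_mono powr_mono) (auto simp: frac_le)
 finally show ?thesis .
qed

text \<open>By the crude bound ln \<mu> is at most of order ln (1 / t), while \<open>p\<close>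
  oscillates on the ball by at most A / ln (1 / t). So the exponent p z can be frozen at the centre,
  which gives the sharp rate n / p x.\<close>

lemma infball_small:
 obtains C where "C >= 1" "!!a x t. mass1 a ==> 0 < t ==> t <= 1 ==> infball a x t <= ennreal (C * t powr (- (real CARD('n) / p x)))"
proof -
 let ?n = "real CARD('n)"
 \<comment> \<open>Bound for |p x - p z| ln \<mu>: the crude estimate reads pm ln \<mu> <= ln K1 + n
   ln (1 / t), where the first term meets |p x - p z| <= pp and the second the Hoelder constant
   \<open>A\<close>.\<close>
 define G where "G = (pp * ln K1 + ?n * A) / pm"
 have G: "G >= 0" unfolding G_def using pm_pos pp_pos K1(1) A_nonneg by (intro divide_nonneg_pos add_nonneg_nonneg mult_nonneg_nonneg) auto
 define Q where "Q = exp G * K1"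
 have Q: "Q >= 1" unfolding Q_def using G K1(1) mult_mono[of 1 "exp G" 1 K1] by simp
 show ?thesis
 proof (rule that[of "Q powr (1 / pm)"])
  show C: "Q powr (1 / pm) >= 1" using Q pm_pos by (simp add: ge_one_powr_ge_zero)
  fix a x and t :: real assume a: "mass1 a" and t: "0 < t" "t <= 1"
  show "infball a x t <= ennreal (Q powr (1 / pm) * t powr (- (?n / p x)))"
  proof (rule ennreal_le_realI)
   fix \<mu> :: real assume \<mu>: "0 <= \<mu>" "ennreal \<mu> <= infball a x t"
   show "\<mu> <= Q powr (1 / pm) * t powr (- (?n / p x))"
   proof (cases "\<mu> <= 1")
    case True
    have "1 <= (1 / t) powr (?n / p x)" using t p_pos[of x] by (intro ge_one_powr_ge_zero) auto
    then have "1 <= t powr (- (?n / p x))" using t by (simp add: powr_minus_divide powr_divide)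
    then show ?thesis using True C mult_mono[of 1 "Q powr (1 / pm)" 1 "t powr (- (?n / p x))"] by simp
   next
    case False
    then have \<mu>1: "\<mu> >= 1" by simp
    have "\<mu> powr pm <= 1 * K1 * t powr (- ?n)" by (rule K1(2)[OF crude_mass[OF a \<mu>1 \<mu>(2) t(1)] t(1)]) simp
    then have "ln (\<mu> powr pm) <= ln (K1 * t powr (- ?n))" using \<mu>1 K1(1) t by (subst ln_le_cancel_iff) auto
    then have lnm: "pm * ln \<mu> <= ln K1 + ?n * ln (1 / t)" using \<mu>1 K1(1) t by (simp add: ln_powr ln_mult ln_div)
    have ge: "\<mu> powr p x <= exp G * \<mu> powr p z + 0" if z: "z \<in> cball x t" for z
    proof -
     have d1: "\<bar>p x - p z\<bar> <= pp" using p_pos[of x] p_pos[of z] p_le[of x] p_le[of z] by linarith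
     have d2: "\<bar>p x - p z\<bar> * ln (1 / t) <= A" using z t by (intro holder_local) (auto simp: dist_norm)
     have "\<bar>p x - p z\<bar> * (pm * ln \<mu>) <= \<bar>p x - p z\<bar> * (ln K1 + ?n * ln (1 / t))" using lnm by (intro mult_left_mono) auto
     also have "... = \<bar>p x - p z\<bar> * ln K1 + ?n * (\<bar>p x - p z\<bar> * ln (1 / t))" by (simp add: algebra_simps)
     also have "... <= pp * ln K1 + ?n * A" using d1 d2 K1(1) by (intro add_mono mult_right_mono mult_left_mono) auto
     finally have "\<bar>p x - p z\<bar> * ln \<mu> <= G" using pm_pos unfolding G_def by (simp add: le_divide_eq mult_ac)
     moreover have "(p x - p z) * ln \<mu> <= \<bar>p x - p z\<bar> * ln \<mu>" using \<mu>1 by (intro mult_right_mono) auto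
     ultimately have "\<mu> powr (p x - p z) <= exp G" using \<mu>1 by (simp add: powr_def)
     then have "\<mu> powr p z * \<mu> powr (p x - p z) <= \<mu> powr p z * exp G" by (intro mult_left_mono) auto
     then show ?thesis using \<mu>1 by (simp add: mult.commute flip: powr_add)
    qed
    have "\<mu> powr p x * (unit_ball_vol ?n * t ^ CARD('n)) <= exp G + 0" by (rule ball_mass[OF a \<mu> t(1) ge]) auto
    then have "\<mu> powr p x <= exp G * K1 * t powr (- ?n)" by (intro K1(2) t) auto
    then show ?thesis using \<mu> t Q p_ge by (intro powr_root_le) (auto simp: Q_def)
   qed
  qed
 qed
qed

definition E0 :: real where "E0 = decay_mass TYPE('n) (CARD('n) + 1)"

lemma E0: "(NN z. ennreal (1 / (1 + norm (z :: real ^ 'n)) ^ (CARD('n) + 1))) = ennreal E0" "E0 >= 0" unfolding E0_def decay_mass_def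
 by (intro nn_integral_eq_integral integrable_inverse_power) (auto intro!: integral_nonneg_AE)

text \<open>On a large ball the exponent cannot be frozen at the centre; it is compared with
  \<open>pinf\<close> point by point, at the price of the integrable error of
  \<open>decay_compare\<close>.\<close>

lemma infball_large:
 obtains C where "C >= 1" "!!a x t. mass1 a ==> 1 <= t ==> infball a x t <= ennreal (C * t powr (- (real CARD('n) / pinf)))"
proof -
 let ?n = "real CARD('n)"
 define D where "D = exp (real (CARD('n) + 1) / pm * B)"
 have B: "B >= 0" using holder_inf[of 0] by (simp add: order_trans[OF abs_ge_zero])
 have D: "D >= 1" unfolding D_def using B pm_pos by simp
 define Q where "Q = (D + E0) * K1"
 have Q: "Q >= 1" unfolding Q_def using D E0(2) K1(1) mult_mono[of 1 "D + E0" 1 K1] by simp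
 define C0 where "C0 = K1 powr (1 / pm)"
 have C0: "C0 >= 1" unfolding C0_def using K1(1) pm_pos by (simp add: ge_one_powr_ge_zero)
 define C where "C = C0 * Q powr (1 / pm)"
 have Qp: "Q powr (1 / pm) >= 1" using Q pm_pos by (simp add: ge_one_powr_ge_zero)
 show ?thesis
 proof (rule that[of C])
  show "C >= 1" unfolding C_def using C0 Qp mult_mono[of 1 C0 1 "Q powr (1 / pm)"] by simp
  fix a x and t :: real assume a: "mass1 a" and t: "1 <= t"
  have t0: "t > 0" using t by simp
  show "infball a x t <= ennreal (C * t powr (- (?n / pinf)))"
  proof (rule ennreal_le_realI)
   fix \<mu> :: real assume \<mu>: "0 <= \<mu>" "ennreal \<mu> <= infball a x t"
   \<comment> \<open>\<open>decay_compare\<close> requires values in [0, 1]. Truncation loses only a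
     constant, since the crude bound with t >= 1 gives \<mu> <= C0 whenever \<mu> > 1.\<close>
   define \<nu> where "\<nu> = min \<mu> 1"
   have \<nu>: "0 <= \<nu>" "\<nu> <= 1" "ennreal \<nu> <= infball a x t"
    using \<mu> order_trans[OF ennreal_leI[of "min \<mu> 1" \<mu>] \<mu>(2)] by (auto simp: \<nu>_def)
   have "\<nu> powr pinf * (unit_ball_vol ?n * t ^ CARD('n)) <= D + E0"
   proof (rule ball_mass[OF a \<nu>(1,3) t0])
    fix z :: "real ^ 'n"
    show "\<nu> powr pinf <= D * \<nu> powr p z + 1 / (1 + norm z) ^ (CARD('n) + 1)" unfolding D_def using \<nu> pm_pos pinf_ge holder_inf[of z]
     by (intro decay_compare) (auto simp: abs_minus_commute)
    show "(NN z. ennreal (1 / (1 + norm (z :: real ^ 'n)) ^ (CARD('n) + 1))) <= ennreal E0" using E0(1) by simp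
   qed (use D E0 in auto)
   then have "\<nu> powr pinf <= (D + E0) * K1 * t powr (- ?n)" using D E0 by (intro K1(2) t0) auto
   then have n: "\<nu> <= Q powr (1 / pm) * t powr (- (?n / pinf))" using \<nu> t0 Q pinf_ge by (intro powr_root_le) (auto simp: Q_def)
   have "\<mu> <= C0 * \<nu>"
   proof (cases "\<mu> <= 1")
    case True
    then show ?thesis using C0 \<mu>(1) mult_right_mono[of 1 C0 \<mu>] by (simp add: \<nu>_def)
   next
    case False
    then have "\<mu> powr pm <= 1 * K1 * t powr (- ?n)" by (intro K1(2)[OF crude_mass[OF a _ \<mu>(2) t0] t0]) auto
    also have "t powr (- ?n) <= 1" using t by (simp add: powr_minus powr_realpow inverse_le_1_iff)
    finally have "\<mu> powr pm <= K1 * 1 powr (- ?n)" using K1(1) by simp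
    then have "\<mu> <= K1 powr (1 / pm) * 1 powr (- (?n / pm))" using \<mu> K1(1) by (intro powr_root_le) auto
    then show ?thesis using False by (simp add: \<nu>_def C0_def)
   qed
   also have "... <= C0 * (Q powr (1 / pm) * t powr (- (?n / pinf)))" using n C0 by (intro mult_left_mono) auto
   finally show "\<mu> <= C * t powr (- (?n / pinf))" by (simp add: C_def)
  qed
 qed
qed

end

section \<open>A Hedberg type inequality\<close>

lemma nn_integral_powr_0:
 assumes "\<alpha> > 0" "T >= 0"
 shows "(NN t. ennreal (t powr (\<alpha> - 1)) * indicator {0..T} t) = ennreal (T powr \<alpha> / \<alpha>)"
 using nn_integral_has_integral_lebesgue'[OF _ has_integral_powr_from_0[of "\<alpha> - 1" T]] assms by simp

lemma nn_integral_powr_inf: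
 assumes "\<beta> > 0" "T > 0"
 shows "(NN t. ennreal (t powr (- \<beta> - 1)) * indicator {T..} t) = ennreal (T powr (- \<beta>) / \<beta>)"
 using nn_integral_has_integral_lebesgue'[OF _ has_integral_powr_to_inf[of "- \<beta> - 1" T]] assms by simp

lemma ennreal_lin3:
 assumes "b >= 0" "c >= 0" "d >= 0" "x >= 0" "y >= 0" "z >= 0"
 shows "ennreal b * ennreal x + ennreal c * ennreal y + ennreal d * ennreal z = ennreal (b * x + c * y + d * z)"
 using assms by (simp add: ennreal_plus ennreal_mult)

definition riesz_majorant :: "real => (real ^ 'n::finite => ennreal) => real ^ 'n => ennreal" where
 "riesz_majorant \<alpha> a x = (NN t. ennreal (t powr (\<alpha> - 1)) * infball a x t * indicator {0<..} t)"

locale riesz_exponents = log_holder p pm pp pinf A B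
 for p :: "real ^ 'n::finite => real" and pm pp pinf A B +
 fixes \<alpha> :: real and q :: "real ^ 'n => real"
 assumes \<alpha>_pos: "0 < \<alpha>" and pp_less: "\<alpha> * pp < real CARD('n)"
  and q_def: "!!x. 1 / q x = 1 / p x - \<alpha> / real CARD('n)"
begin

text \<open>Uniform margins. For exponents s between pm and pp, \<gamma> bounds n / s - \<alpha>
  from below, the decay rate of the tail of the scale integral; \<delta> does the same for 1 -
  \<alpha> s / n, which for s = p x is the quotient p x / q x.\<close>

definition \<gamma> :: real where "\<gamma> = real CARD('n) / pp - \<alpha>"
definition \<delta> :: real where "\<delta> = 1 - \<alpha> * pp / real CARD('n)"

lemma \<gamma>_pos: "\<gamma> > 0" using pp_less pp_pos by (simp add: \<gamma>_def less_divide_eq mult.commute)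

lemma \<delta>_pos: "\<delta> > 0" using pp_less by (simp add: \<delta>_def divide_less_eq)

lemma beta_ge: "pm <= s ==> s <= pp ==> real CARD('n) / s - \<alpha> >= \<gamma>" using pm_pos by (simp add: \<gamma>_def frac_le)

lemma exponent_ge: "s <= pp ==> 1 - \<alpha> * s / real CARD('n) >= \<delta>" using \<alpha>_pos by (simp add: \<delta>_def divide_right_mono)

lemma q_mult: "(1 - \<alpha> * p x / real CARD('n)) * q x = p x" and q_pos: "q x > 0"
proof -
 have e: "1 / q x = (1 - \<alpha> * p x / real CARD('n)) / p x" using p_pos[of x] by (simp add: q_def diff_divide_distrib)
 have "1 - \<alpha> * p x / real CARD('n) > 0" using exponent_ge[OF p_le[of x]] \<delta>_pos by linarith
 then have "1 / q x > 0" unfolding e using p_pos by simp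
 then show "q x > 0" by simp
 then show "(1 - \<alpha> * p x / real CARD('n)) * q x = p x" using e p_pos[of x] by (simp add: field_simps)
qed

lemma q_le: "q x <= pp / \<delta>"
proof -
 have "\<delta> * q x <= p x" using q_mult[of x] mult_right_mono[OF exponent_ge[OF p_le[of x]], of "q x"] q_pos[of x] by simp
 then show ?thesis using p_le[of x] \<delta>_pos by (simp add: le_divide_eq mult.commute)
qed

lemma q_ge: "pm <= q x"
proof -
 have "(1 - \<alpha> * p x / real CARD('n)) * q x <= 1 * q x" using \<alpha>_pos p_pos[of x] q_pos[of x] by (intro mult_right_mono) auto
 then show ?thesis using q_mult[of x] p_ge[of x] by simp
qed

text \<open>Hedberg's splitting at a free scale \<open>T\<close>: below it the constant
  \<open>b\<close> is used, above it one of two decay rates, with a slot each for the local exponent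
  and the exponent at infinity.\<close>

lemma riesz_majorant_split:
 assumes "T >= 0" "b >= 0" "C1 >= 0" "C2 >= 0" "\<beta>1 > 0" "\<beta>2 > 0" "T1 > 0" "T2 > 0"
  and 1: "!!t. 0 < t ==> t <= T ==> infball a x t <= ennreal b"
  and 2: "!!t. 0 < t ==> T < t ==> (T1 <= t \<and> infball a x t <= ennreal (C1 * t powr (- (\<beta>1 + \<alpha>)))) \<or> (T2 <= t \<and> infball a x t <= ennreal (C2 * t powr (- (\<beta>2 + \<alpha>))))"
 shows "riesz_majorant \<alpha> a x <= ennreal (b * (T powr \<alpha> / \<alpha>) + C1 * (T1 powr (- \<beta>1) / \<beta>1) + C2 * (T2 powr (- \<beta>2) / \<beta>2))"
proof -
 let ?g0 = "%t :: real. ennreal b * (ennreal (t powr (\<alpha> - 1)) * indicator {0..T} t)"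
 let ?g1 = "%t :: real. ennreal C1 * (ennreal (t powr (- \<beta>1 - 1)) * indicator {T1..} t)"
 let ?g2 = "%t :: real. ennreal C2 * (ennreal (t powr (- \<beta>2 - 1)) * indicator {T2..} t)"
 have "riesz_majorant \<alpha> a x <= (NN t. ?g0 t + ?g1 t + ?g2 t)" unfolding riesz_majorant_def
 proof (rule nn_integral_mono)
  fix t :: real
  have pw: "t powr (\<alpha> - 1) * t powr (- (\<beta> + \<alpha>)) = t powr (- \<beta> - 1)" for \<beta>
   by (subst powr_add[symmetric], rule arg_cong[where f="%e. t powr e"]) simp
  have tail: "ennreal (t powr (\<alpha> - 1)) * infball a x t <= ennreal C * ennreal (t powr (- \<beta> - 1))"
   if "infball a x t <= ennreal (C * t powr (- (\<beta> + \<alpha>)))" "C >= 0" for C \<beta>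
  proof -
   have "ennreal (t powr (\<alpha> - 1)) * infball a x t <= ennreal (t powr (\<alpha> - 1)) * ennreal (C * t powr (- (\<beta> + \<alpha>)))"
    by (intro mult_left_mono that) auto
   also have "... = ennreal (C * (t powr (\<alpha> - 1) * t powr (- (\<beta> + \<alpha>))))" using that(2) by (simp add: ennreal_mult[symmetric] mult_ac)
   also have "... = ennreal C * ennreal (t powr (- \<beta> - 1))" unfolding pw using that(2) by (simp add: ennreal_mult)
   finally show ?thesis .
  qed
  show "ennreal (t powr (\<alpha> - 1)) * infball a x t * indicator {0<..} t <= ?g0 t + ?g1 t + ?g2 t"
  proof (cases "0 < t")
   case t: True
   show ?thesis
   proof (cases "t <= T")
    case True
    have "ennreal (t powr (\<alpha> - 1)) * infball a x t <= ennreal b * ennreal (t powr (\<alpha> - 1))"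
     using mult_left_mono[OF 1[OF t True], of "ennreal (t powr (\<alpha> - 1))"] by (simp add: mult.commute)
    then show ?thesis using t True by (simp add: add_increasing2 add.assoc)
   next
    case False
    then consider "T1 <= t" "infball a x t <= ennreal (C1 * t powr (- (\<beta>1 + \<alpha>)))" | "T2 <= t" "infball a x t <= ennreal (C2 * t powr (- (\<beta>2 + \<alpha>)))"
     using 2[OF t] by force
    then show ?thesis
    proof cases
     case 1
     have "ennreal (t powr (\<alpha> - 1)) * infball a x t <= ?g1 t" using tail[OF 1(2) assms(3)] 1(1) by simp
     then show ?thesis using t by (simp add: add_increasing add_increasing2)
    next
     case 2
     have "ennreal (t powr (\<alpha> - 1)) * infball a x t <= ?g2 t" using tail[OF 2(2) assms(4)] 2(1) by simp
     then show ?thesis using t by (simp add: add_increasing)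
    qed
   qed
  qed simp
 qed
 also have "... = ennreal b * ennreal (T powr \<alpha> / \<alpha>) + ennreal C1 * ennreal (T1 powr (- \<beta>1) / \<beta>1) + ennreal C2 * ennreal (T2 powr (- \<beta>2) / \<beta>2)"
  using assms \<alpha>_pos by (simp add: nn_integral_add nn_integral_cmult nn_integral_powr_0 nn_integral_powr_inf)
 also have "... = ennreal (b * (T powr \<alpha> / \<alpha>) + C1 * (T1 powr (- \<beta>1) / \<beta>1) + C2 * (T2 powr (- \<beta>2) / \<beta>2))"
  by (rule ennreal_lin3) (use assms \<alpha>_pos in auto)
 finally show ?thesis .
qed

lemma riesz_majorant_powr:
 obtains C where "C > 0" "!!a x. mass1 a ==> ennpowr (riesz_majorant \<alpha> a x) (q x) <=
  ennreal C * (ennpowr (a x) (p x) + ennreal (1 / (1 + norm x) ^ (CARD('n) + 1)))"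
proof -
 let ?n = "real CARD('n)"
 obtain C1 where C1: "C1 >= 1" "!!a x t. mass1 a ==> 0 < t ==> t <= 1 ==> infball a x t <= ennreal (C1 * t powr (- (?n / p x)))" using infball_small by metis
 obtain C2 where C2: "C2 >= 1" "!!a x t. mass1 a ==> 1 <= t ==> infball a x t <= ennreal (C2 * t powr (- (?n / pinf)))" using infball_large by metis
 define G where "G = max 1 (1 / \<alpha> + C1 / \<gamma> + C2 / \<gamma>)"
 have G: "G >= 1" by (simp add: G_def)
 define Q where "Q = pp / \<delta>"
 define D where "D = exp (real (CARD('n) + 1) / (\<delta> * pm) * (\<alpha> / ?n * Q * B))"
 define C where "C = G powr Q * max 1 D"
 have C: "C > 0" using G by (simp add: C_def D_def)
 have Gq: "G powr q x <= G powr Q" for x using G q_le[of x] by (intro powr_mono) (auto simp: Q_def)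
 show ?thesis
 proof (rule that[OF C])
  fix a and x :: "real ^ 'n" assume a: "mass1 a"
  let ?E = "1 / (1 + norm x) ^ (CARD('n) + 1)"
  show "ennpowr (riesz_majorant \<alpha> a x) (q x) <= ennreal C * (ennpowr (a x) (p x) + ennreal ?E)"
  proof (cases "a x")
   case top
   then show ?thesis using C by (simp add: ennpowr_def ennreal_mult_top)
  next
   case (real b)
   have infb: "infball a x t <= ennreal b" if "t > 0" for t using infball_le[of x x t a] that real by simp
   have qx: "q x > 0" by (rule q_pos)
   define \<beta>2 where "\<beta>2 = ?n / pinf - \<alpha>"
   have \<beta>2: "\<beta>2 >= \<gamma>" unfolding \<beta>2_def by (intro beta_ge pinf_ge pinf_le)
   consider "b = 0" | "0 < b" "b < 1" | "b >= 1" using real(1) by linarith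
   then show ?thesis
   proof cases
    case 1
    then have "infball a x t = 0" if "t > 0" for t using infb[OF that] by simp
    then have "riesz_majorant \<alpha> a x = (\<integral>\<^sup>+ t. 0 \<partial>(lborel :: real measure))"
     unfolding riesz_majorant_def by (intro nn_integral_cong) (auto simp: indicator_def)
    then show ?thesis by (simp add: ennpowr_def)
   next
    case 2
    \<comment> \<open>The scale where \<open>b\<close> and the decay t^(-n / pinf) coincide. As b <
      1 it is at least 1, so only the rate at infinity occurs beyond it, and both parts equal b^e up
      to constants.\<close>
    define T where "T = b powr (- (pinf / ?n))"
    have pinf: "pinf > 0" using pinf_ge pm_pos by linarith
    have T: "T >= 1"
    proof -
     have "1 <= (1 / b) powr (pinf / ?n)" using 2 pinf by (intro ge_one_powr_ge_zero) auto
     then show ?thesis using 2 by (simp add: T_def powr_minus_divide powr_divide)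
    qed
    define e where "e = 1 - \<alpha> * pinf / ?n"
    have T1: "b * T powr \<alpha> = b powr e"
    proof -
     have "b * T powr \<alpha> = b powr 1 * b powr (- (pinf / ?n) * \<alpha>)" using 2 by (simp add: T_def powr_powr)
     also have "... = b powr e" unfolding powr_add[symmetric] by (simp add: e_def mult.commute)
     finally show ?thesis .
    qed
    have T2: "T powr (- \<beta>2) = b powr e"
    proof -
     have "- (pinf / ?n) * (- \<beta>2) = e" using pinf by (simp add: \<beta>2_def e_def right_diff_distrib mult.commute)
     then show ?thesis by (simp only: T_def powr_powr)
    qed
    \<comment> \<open>The slot of the local exponent is left empty by C1 = 0, with dummy values 1
      for its rate and threshold.\<close>
    have "riesz_majorant \<alpha> a x <= ennreal (b * (T powr \<alpha> / \<alpha>) + 0 * (1 powr (- 1) / 1) + C2 * (T powr (- \<beta>2) / \<beta>2))"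
    proof (rule riesz_majorant_split)
     fix t assume t: "0 < t" "T < t"
     have "infball a x t <= ennreal (C2 * t powr (- (\<beta>2 + \<alpha>)))" using C2(2)[OF a, of t x] t T by (simp add: \<beta>2_def)
     then show "1 <= t \<and> infball a x t <= ennreal (0 * t powr - (1 + \<alpha>)) \<or> T <= t \<and> infball a x t <= ennreal (C2 * t powr - (\<beta>2 + \<alpha>))"
      using t by simp
    qed (use infb T 2 C2(1) \<beta>2 \<gamma>_pos in auto)
    also have "... <= ennreal (G * b powr e)"
    proof (rule ennreal_leI)
     have "b * (T powr \<alpha> / \<alpha>) + 0 * (1 powr (- 1) / 1) + C2 * (T powr (- \<beta>2) / \<beta>2) = (1 / \<alpha> + C2 / \<beta>2) * b powr e"
      using T1 unfolding T2 by (simp add: algebra_simps)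
     also have "... <= G * b powr e"
     proof (rule mult_right_mono)
      have "C2 / \<beta>2 <= C2 / \<gamma>" using \<beta>2 \<gamma>_pos C2(1) by (intro divide_left_mono) auto
      moreover have "C1 / \<gamma> >= 0" using C1(1) \<gamma>_pos by simp
      ultimately show "1 / \<alpha> + C2 / \<beta>2 <= G" by (simp add: G_def)
     qed simp
     finally show "b * (T powr \<alpha> / \<alpha>) + 0 * (1 powr (- 1) / 1) + C2 * (T powr (- \<beta>2) / \<beta>2) <= G * b powr e" .
    qed
    finally have "ennpowr (riesz_majorant \<alpha> a x) (q x) <= ennpowr (ennreal (G * b powr e)) (q x)" using qx by (intro ennpowr_mono) auto
    also have "... = ennreal (G powr q x * b powr (e * q x))" using G by (simp add: ennpowr_ennreal powr_mult powr_powr)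
    also have "... <= ennreal (C * (b powr p x + ?E))"
    proof (rule ennreal_leI)
     have "e >= \<delta>" unfolding e_def by (rule exponent_ge[OF pinf_le])
     then have e1: "e * q x >= \<delta> * pm" using q_ge[of x] \<delta>_pos pm_pos by (intro mult_mono) auto
     \<comment> \<open>With \<open>e\<close> built from \<open>pinf\<close>, the exponent e * q x
       misses p x by a multiple of p x - pinf, which \<open>decay_compare\<close> can
       repair.\<close>
     have "e * q x - p x = \<alpha> / ?n * q x * (p x - pinf)" using q_mult[of x] by (simp add: e_def algebra_simps diff_divide_distrib)
     then have "\<bar>e * q x - p x\<bar> = \<alpha> / ?n * q x * \<bar>p x - pinf\<bar>" using \<alpha>_pos qx by (simp add: abs_mult)
     also have "... <= \<alpha> / ?n * Q * \<bar>p x - pinf\<bar>" using q_le[of x] \<alpha>_pos by (intro mult_right_mono mult_left_mono) (auto simp: Q_def)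
     finally have d: "\<bar>e * q x - p x\<bar> <= \<alpha> / ?n * Q * \<bar>p x - pinf\<bar>" .
     have Q0: "Q >= 0" using q_le[of x] qx by (simp add: Q_def)
     have l0: "ln (exp 1 + norm x) >= 0" using exp_ge_add_one_self[of 1] by (intro ln_ge_zero) (smt (verit) norm_ge_zero)
     have "\<bar>e * q x - p x\<bar> * ln (exp 1 + norm x) <= \<alpha> / ?n * Q * \<bar>p x - pinf\<bar> * ln (exp 1 + norm x)"
      using d l0 by (rule mult_right_mono)
     also have "... = \<alpha> / ?n * Q * (\<bar>p x - pinf\<bar> * ln (exp 1 + norm x))" by simp
     also have "... <= \<alpha> / ?n * Q * B" using \<alpha>_pos Q0 by (intro mult_left_mono holder_inf) auto
     finally have "b powr (e * q x) <= D * b powr p x + ?E" unfolding D_def using 2 e1 \<delta>_pos pm_pos by (intro decay_compare) auto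
     also have "... <= max 1 D * (b powr p x + ?E)"
     proof -
      have "D * b powr p x <= max 1 D * b powr p x" by (intro mult_right_mono) auto
      moreover have "1 * ?E <= max 1 D * ?E" by (intro mult_right_mono) auto
      ultimately show ?thesis by (simp add: distrib_left)
     qed
     finally have "G powr q x * b powr (e * q x) <= G powr Q * (max 1 D * (b powr p x + ?E))" using Gq[of x] by (intro mult_mono) auto
     then show "G powr q x * b powr (e * q x) <= C * (b powr p x + ?E)" by (simp add: C_def mult.assoc)
    qed
    also have "... = ennreal C * (ennpowr (a x) (p x) + ennreal ?E)" using C 2 real by (simp add: ennreal_mult ennreal_plus ennpowr_ennreal)
    finally show ?thesis .
   next
    case 3
    \<comment> \<open>Now b >= 1, so the balancing scale is at most 1: the local rate governs (T, 1]
      and the rate at infinity the rest. The latter contributes a constant, absorbed since b^e >=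
      1.\<close>
    define T where "T = b powr (- (p x / ?n))"
    have px: "p x > 0" by (rule p_pos)
    have T: "T > 0" "T <= 1"
    proof -
     have "1 <= b powr (p x / ?n)" using 3 px by (intro ge_one_powr_ge_zero) auto
     then show "T <= 1" by (simp add: T_def powr_minus inverse_le_1_iff)
     show "T > 0" using 3 by (simp add: T_def)
    qed
    define e where "e = 1 - \<alpha> * p x / ?n"
    define \<beta>1 where "\<beta>1 = ?n / p x - \<alpha>"
    have \<beta>1: "\<beta>1 >= \<gamma>" unfolding \<beta>1_def by (intro beta_ge p_ge p_le)
    have T1: "b * T powr \<alpha> = b powr e"
    proof -
     have "b * T powr \<alpha> = b powr 1 * b powr (- (p x / ?n) * \<alpha>)" using 3 by (simp add: T_def powr_powr)
     also have "... = b powr e" unfolding powr_add[symmetric] by (simp add: e_def mult.commute)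
     finally show ?thesis .
    qed
    have T2: "T powr (- \<beta>1) = b powr e"
    proof -
     have "- (p x / ?n) * (- \<beta>1) = e" using px by (simp add: \<beta>1_def e_def right_diff_distrib mult.commute)
     then show ?thesis by (simp only: T_def powr_powr)
    qed
    have e0: "e >= 0" unfolding e_def by (rule order_trans[OF less_imp_le[OF \<delta>_pos] exponent_ge[OF p_le]])
    have "riesz_majorant \<alpha> a x <= ennreal (b * (T powr \<alpha> / \<alpha>) + C1 * (T powr (- \<beta>1) / \<beta>1) + C2 * (1 powr (- \<beta>2) / \<beta>2))"
    proof (rule riesz_majorant_split)
     fix t assume t: "0 < t" "T < t"
     show "T <= t \<and> infball a x t <= ennreal (C1 * t powr - (\<beta>1 + \<alpha>)) \<or> 1 <= t \<and> infball a x t <= ennreal (C2 * t powr - (\<beta>2 + \<alpha>))"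
      using C1(2)[OF a t(1), of x] C2(2)[OF a, of t x] t by (cases "t <= 1") (auto simp: \<beta>1_def \<beta>2_def)
    qed (use infb T 3 C1(1) C2(1) \<beta>1 \<beta>2 \<gamma>_pos in auto)
    also have "... <= ennreal (G * b powr e)"
    proof (rule ennreal_leI)
     have be: "b powr e >= 1" using 3 e0 by (intro ge_one_powr_ge_zero) auto
     have "b * (T powr \<alpha> / \<alpha>) + C1 * (T powr (- \<beta>1) / \<beta>1) + C2 * (1 powr (- \<beta>2) / \<beta>2) = (1 / \<alpha> + C1 / \<beta>1) * b powr e + C2 / \<beta>2 * 1"
      using T1 unfolding T2 by (simp add: algebra_simps)
     also have "... <= (1 / \<alpha> + C1 / \<gamma>) * b powr e + C2 / \<gamma> * b powr e"
      using \<beta>1 \<beta>2 \<gamma>_pos C1(1) C2(1) be \<alpha>_pos by (intro add_mono mult_mono divide_left_mono) auto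
     also have "... = (1 / \<alpha> + C1 / \<gamma> + C2 / \<gamma>) * b powr e" by (simp add: algebra_simps)
     also have "... <= G * b powr e" by (intro mult_right_mono) (auto simp: G_def)
     finally show "b * (T powr \<alpha> / \<alpha>) + C1 * (T powr (- \<beta>1) / \<beta>1) + C2 * (1 powr (- \<beta>2) / \<beta>2) <= G * b powr e" .
    qed
    finally have "ennpowr (riesz_majorant \<alpha> a x) (q x) <= ennpowr (ennreal (G * b powr e)) (q x)" using qx by (intro ennpowr_mono) auto
    also have "... = ennreal (G powr q x * b powr (e * q x))" using G by (simp add: ennpowr_ennreal powr_mult powr_powr)
    also have "e * q x = p x" unfolding e_def by (rule q_mult)
    also have "ennreal (G powr q x * b powr p x) <= ennreal (C * (b powr p x + ?E))"
    proof (rule ennreal_leI)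
     have "G powr q x * b powr p x <= G powr Q * max 1 D * b powr p x" using Gq[of x] mult_mono[OF Gq[of x], of 1 "max 1 D"] by (intro mult_right_mono) auto
     also have "... <= C * (b powr p x + ?E)" unfolding C_def[symmetric] using C by (intro mult_left_mono) auto
     finally show "G powr q x * b powr p x <= C * (b powr p x + ?E)" .
    qed
    also have "... = ennreal C * (ennpowr (a x) (p x) + ennreal ?E)" using C 3 real by (simp add: ennreal_mult ennreal_plus ennpowr_ennreal)
    finally show ?thesis .
   qed
  qed
 qed
qed

text \<open>Since q >= pm and K >= 1, dividing by \<open>K\<close> shrinks the modular at least by
  the factor K^(-pm); \<open>K\<close> is chosen to bring C * (1 + E0) down to 1.\<close>

lemma riesz_majorant_mass:
 obtains K where "K >= 1" "!!a. mass1 a ==> (\<integral>\<^sup>+ x. ennpowr (riesz_majorant \<alpha> a x / ennreal K) (q x) \<partial>lebesgue) <= 1"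
proof -
 obtain C where C: "C > 0" "!!a x. mass1 a ==> ennpowr (riesz_majorant \<alpha> a x) (q x) <=
  ennreal C * (ennpowr (a x) (p x) + ennreal (1 / (1 + norm x) ^ (CARD('n) + 1)))" using riesz_majorant_powr by metis
 define C' where "C' = max 1 (C * (1 + E0))"
 define K where "K = C' powr (1 / pm)"
 have K: "K >= 1" using pm_pos unfolding K_def by (intro ge_one_powr_ge_zero) (auto simp: C'_def)
 have Kpm: "K powr (- pm) * (C * (1 + E0)) <= 1"
 proof -
  have "K powr pm = C'" using pm_pos by (simp add: K_def powr_powr C'_def)
  then have "K powr (- pm) = 1 / C'" by (simp add: powr_minus divide_inverse)
  moreover have "C * (1 + E0) <= C'" "C' > 0" by (auto simp: C'_def)
  ultimately show ?thesis by (simp add: divide_le_eq)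
 qed
 have scale: "ennpowr (y / ennreal K) (q x) <= ennreal (K powr (- pm)) * ennpowr y (q x)" for x y
 proof (cases y)
  case (real r)
  have "K powr (- q x) <= K powr (- pm)" using K q_ge[of x] by (intro powr_mono) auto
  then have "r powr q x * K powr (- q x) <= r powr q x * K powr (- pm)" by (intro mult_left_mono) auto
  moreover have "(r / K) powr q x = r powr q x * K powr (- q x)" using real K by (simp add: powr_divide powr_minus_divide)
  ultimately have "(r / K) powr q x <= K powr (- pm) * r powr q x" by (simp add: mult.commute)
  then have "ennreal ((r / K) powr q x) <= ennreal (K powr (- pm) * r powr q x)" by (rule ennreal_leI)
  then show ?thesis using real K by (simp add: ennpowr_ennreal divide_ennreal ennreal_mult)
 next
  case top
  then show ?thesis using K by (simp add: ennpowr_def ennreal_mult_top)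
 qed
 show ?thesis
 proof (rule that[OF K])
  fix a assume a: "mass1 a"
  then have [measurable]: "a \<in> borel_measurable lebesgue" and a1: "(\<integral>\<^sup>+ z. ennpowr (a z) (p z) \<partial>lebesgue) <= 1"
   by (auto simp: mass1_def)
  define w where "w = (%z :: real ^ 'n. ennreal (1 / (1 + norm z) ^ (CARD('n) + 1)))"
  have [measurable]: "w \<in> borel_measurable lebesgue" unfolding w_def by (intro measurable_completion) simp
  have "(\<integral>\<^sup>+ x. ennpowr (riesz_majorant \<alpha> a x / ennreal K) (q x) \<partial>lebesgue) <=
   (\<integral>\<^sup>+ x. ennreal (K powr (- pm)) * (ennreal C * (ennpowr (a x) (p x) + w x)) \<partial>lebesgue)"
   unfolding w_def by (intro nn_integral_mono order_trans[OF scale] mult_left_mono C a) auto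
  also have "... = ennreal (K powr (- pm)) * (ennreal C * ((\<integral>\<^sup>+ x. ennpowr (a x) (p x) \<partial>lebesgue) + (\<integral>\<^sup>+ x. w x \<partial>lebesgue)))"
   by (simp add: nn_integral_cmult nn_integral_add)
  also have "(\<integral>\<^sup>+ x. w x \<partial>lebesgue) = ennreal E0" unfolding w_def using E0(1) by (simp only: nn_integral_completion)
  also have "ennreal (K powr (- pm)) * (ennreal C * ((\<integral>\<^sup>+ x. ennpowr (a x) (p x) \<partial>lebesgue) + ennreal E0)) <= ennreal (K powr (- pm)) * (ennreal C * (1 + ennreal E0))"
   by (intro mult_left_mono add_mono a1) auto
  also have "... = ennreal (K powr (- pm) * (C * (1 + E0)))" using C E0(2) by (simp add: ennreal_mult ennreal_plus)
  also have "... <= 1" using Kpm by (simp add: ennreal_le_1)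
  finally show "(\<integral>\<^sup>+ x. ennpowr (riesz_majorant \<alpha> a x / ennreal K) (q x) \<partial>lebesgue) <= 1" .
 qed
qed

end

section \<open>The Riesz operator\<close>

text \<open>
 By homogeneity \<open>\<integral>\<^sub>0\<^sup>\<infinity> t\<^sup>\<alpha>\<^sup>-\<^sup>1 theta\<^sub>t dt\<close> is a multiple of the Riesz kernel;
 \<open>riesz_const\<close> is the factor, evaluated at a unit vector.
\<close>

definition riesz_const :: "'n::finite itself => real => ennreal" where
 "riesz_const _ \<alpha> = (NN t. ennreal (t powr (\<alpha> - 1) * (theta ((axis undefined 1 :: real ^ 'n) /\<^sub>R t) / t ^ CARD('n))) * indicator {0<..} t)"

text \<open>Defined at once on every functional, so that boundedness and the integral formula are
  two statements about one operator and no extension by density has to be carried out. The value 0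
  outside the Schwartz space is the normalization in \<open>tempered\<close>.\<close>

definition riesz_op :: "real => (('n::finite cfun) => complex) => ('n cfun) => complex" where
 "riesz_op \<alpha> f ph = (if ph \<in> schwartz then
  cplx (1 / enn2real (riesz_const TYPE('n) \<alpha>)) *
   (LL t. indicator {0<..} t *R (cplx (t powr (\<alpha> - 1)) * f (moll t ph)))
  else 0)"

text \<open>At a unit vector theta vanishes for scales below 1, so there is no singularity at 0; at
  infinity the integrand decays like t^(\<alpha> - n - 1). By radiality all unit vectors give the
  same value, so \<open>undefined\<close> may pick the coordinate.\<close>

lemma riesz_const_finite:
 assumes "0 < \<alpha>" "\<alpha> < real CARD('n::finite)"
 shows "riesz_const TYPE('n) \<alpha> < \<infinity>"
proof -
 obtain B where B: "B >= 0" "!!is x. length is <= 0 ==> cmod (Dl is (%x :: real ^ 'n. cplx (theta x)) x) <= B"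
  using ubd_boundE[OF schwartz_ubd[OF theta_schwartz], of 0] by metis
 have B': "theta (x :: real ^ 'n) <= B" for x using B(2)[of "[]" x] theta_nonneg[of x] by simp
 let ?e = "axis undefined 1 :: real ^ 'n"
 let ?\<beta> = "real CARD('n) - \<alpha>"
 have "riesz_const TYPE('n) \<alpha> <= (\<integral>\<^sup>+ t. ennreal B * (ennreal (t powr (- ?\<beta> - 1)) * indicator {1..} t) \<partial>(lborel :: real measure))"
  unfolding riesz_const_def
 proof (rule nn_integral_mono)
  fix t :: real
  show "ennreal (t powr (\<alpha> - 1) * (theta (?e /\<^sub>R t) / t ^ CARD('n))) * indicator {0<..} t <= ennreal B * (ennreal (t powr (- ?\<beta> - 1)) * indicator {1..} t)"
  proof (cases "1 <= t")
   case True
   have "t powr (\<alpha> - 1) / t ^ CARD('n) = t powr (- ?\<beta> - 1)" using True by (simp add: powr_realpow[symmetric] powr_diff[symmetric] algebra_simps)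
   then have "t powr (\<alpha> - 1) * (theta (?e /\<^sub>R t) / t ^ CARD('n)) = theta (?e /\<^sub>R t) * t powr (- ?\<beta> - 1)"
    by (metis times_divide_eq_right mult.commute)
   also have "... <= B * t powr (- ?\<beta> - 1)" by (intro mult_right_mono B') auto
   finally show ?thesis using True B(1) by (simp add: ennreal_mult[symmetric] ennreal_leI)
  next
   case False
   have "theta (?e /\<^sub>R t) = 0" if "t > 0" using False that by (intro theta_eq_0) (simp add: one_le_inverse)
   then show ?thesis by (auto simp: indicator_def)
  qed
 qed
 also have "... = ennreal B * ennreal (1 powr (- ?\<beta>) / ?\<beta>)" using assms nn_integral_powr_inf[of ?\<beta> 1] by (subst nn_integral_cmult) auto
 also have "... < \<infinity>" by (simp add: ennreal_mult_less_top)
 finally show ?thesis .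
qed

lemma theta_pos: "norm x < 1 ==> theta x > 0"
proof -
 assume "norm x < 1"
 then have "(norm x)\<^sup>2 < 1" by (simp add: power_less_one_iff abs_square_less_1)
 then show ?thesis unfolding theta_def using flat0_integral_pos(2) by (intro divide_pos_pos) (simp_all add: flat_def dot_square_norm)
qed

lemma riesz_const_pos: "riesz_const TYPE('n::finite) \<alpha> > 0"
proof (rule ccontr)
 let ?e = "axis undefined 1 :: real ^ 'n"
 let ?g = "%t :: real. ennreal (t powr (\<alpha> - 1) * (theta (?e /\<^sub>R t) / t ^ CARD('n))) * indicator {0<..} t"
 assume "\<not> riesz_const TYPE('n) \<alpha> > 0"
 then have "(NN t. ?g t) = 0" by (simp add: riesz_const_def)
 then have "AE t in lborel. ?g t = 0" by (subst (asm) nn_integral_0_iff_AE) auto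
 then have "AE t in lborel. t \<in> {1<..<2 :: real} --> t \<in> ({} :: real set)"
 proof eventually_elim
  case (elim t)
  have "?g t > 0" if "1 < t"
  proof -
   have "theta (?e /\<^sub>R t) > 0" using that by (intro theta_pos) (simp add: inverse_less_1_iff)
   then show ?thesis using that by simp
  qed
  then show ?case using elim by auto
 qed
 then have "emeasure lborel {1<..<2 :: real} <= emeasure lborel ({} :: real set)" by (rule emeasure_mono_AE) auto
 then show False by simp
qed

lemma riesz_const_real:
 assumes "0 < \<alpha>" "\<alpha> < real CARD('n::finite)"
 shows "enn2real (riesz_const TYPE('n) \<alpha>) > 0" "ennreal (enn2real (riesz_const TYPE('n) \<alpha>)) = riesz_const TYPE('n) \<alpha>"
 using riesz_const_finite[OF assms] riesz_const_pos[where 'n='n, of \<alpha>] by (auto simp: enn2real_positive_iff)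

text \<open>Substituting norm x * t for t and using that theta is radial reduces the integral to the
  unit vector of \<open>riesz_const\<close>.\<close>

lemma riesz_kernel_integral:
 fixes x :: "real ^ 'n::finite"
 assumes "x ~= 0"
 shows "(NN t. ennreal (t powr (\<alpha> - 1) * (theta (x /\<^sub>R t) / t ^ CARD('n))) * indicator {0<..} t) =
  ennreal (norm x powr (\<alpha> - real CARD('n))) * riesz_const TYPE('n) \<alpha>"
proof -
 let ?e = "axis undefined 1 :: real ^ 'n"
 let ?g = "%y t. ennreal (t powr (\<alpha> - 1) * (theta (y /\<^sub>R t) / t ^ CARD('n))) * indicator {0<..} t"
 have r: "norm x > 0" using assms by simp
 have "(NN t. ?g x t) = \<bar>norm x\<bar> * (NN t. ?g x (0 + norm x * t))" by (rule nn_integral_real_affine) (use r in auto)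
 also have "(NN t. ?g x (0 + norm x * t)) = (NN t. ennreal (norm x powr (\<alpha> - 1) / norm x ^ CARD('n)) * ?g ?e t)"
 proof (rule nn_integral_cong)
  fix t :: real
  show "?g x (0 + norm x * t) = ennreal (norm x powr (\<alpha> - 1) / norm x ^ CARD('n)) * ?g ?e t"
  proof (cases "t > 0")
   case True
   have "theta (x /\<^sub>R (norm x * t)) = theta (?e /\<^sub>R t)" using r True by (intro theta_radial) simp
   then have "(norm x * t) powr (\<alpha> - 1) * (theta (x /\<^sub>R (norm x * t)) / (norm x * t) ^ CARD('n)) =
    norm x powr (\<alpha> - 1) / norm x ^ CARD('n) * (t powr (\<alpha> - 1) * (theta (?e /\<^sub>R t) / t ^ CARD('n)))"
    using r True by (simp add: powr_mult power_mult_distrib)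
   note eq = this
   have i: "indicator {0<..} (0 + norm x * t) = (1 :: ennreal)" "indicator {0<..} t = (1 :: ennreal)" using r True by auto
   show ?thesis unfolding i mult_1_right unfolding add_0_left eq using r True theta_nonneg by (intro ennreal_mult divide_nonneg_nonneg mult_nonneg_nonneg) auto
  next
   case False
   then show ?thesis using r by (simp add: zero_less_mult_iff)
  qed
 qed
 also have "... = ennreal (norm x powr (\<alpha> - 1) / norm x ^ CARD('n)) * riesz_const TYPE('n) \<alpha>"
  unfolding riesz_const_def by (subst nn_integral_cmult) auto
 also have "ennreal \<bar>norm x\<bar> * (ennreal (norm x powr (\<alpha> - 1) / norm x ^ CARD('n)) * riesz_const TYPE('n) \<alpha>) =
  ennreal (norm x * (norm x powr (\<alpha> - 1) / norm x ^ CARD('n))) * riesz_const TYPE('n) \<alpha>"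
  by (subst ennreal_mult) (use r in \<open>auto simp: mult.assoc\<close>)
 also have "norm x * (norm x powr (\<alpha> - 1) / norm x ^ CARD('n)) = norm x powr (\<alpha> - real CARD('n))"
 proof -
  have "norm x * (norm x powr (\<alpha> - 1) / norm x ^ CARD('n)) = norm x powr 1 * norm x powr (\<alpha> - 1) / norm x powr real CARD('n)"
   using r by (simp add: powr_realpow)
  also have "... = norm x powr (1 + (\<alpha> - 1) - real CARD('n))" by (simp only: powr_add powr_diff)
  finally show ?thesis by simp
 qed
 finally show ?thesis .
qed

text \<open>Larger balls have smaller infima, so superlevel sets are downward closed sets of reals,
  hence intervals, whatever \<open>a\<close> is.\<close>

lemma infball_measurable: "infball a x \<in> borel_measurable borel"
proof (rule borel_measurableI_greater)
 fix y
 define S where "S = {t. y < infball a x t}"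
 have down: "s \<in> S" if "t \<in> S" "s <= t" for s t
 proof -
  have "infball a x t <= infball a x s" unfolding infball_def using that(2) by (intro INF_superset_mono) auto
  then show ?thesis using that by (auto simp: S_def)
 qed
 have "S \<in> sets borel"
 proof (cases "S = {} \<or> \<not> bdd_above S")
  case True
  have "S = UNIV" if nb: "\<not> bdd_above S"
  proof -
   have "t \<in> S" for t
   proof -
    obtain s where "s \<in> S" "t < s" using nb by (auto simp: bdd_above_def not_le)
    then show ?thesis using down[of s t] by simp
   qed
   then show ?thesis by auto
  qed
  then show ?thesis using True by auto
 next
  case False
  have "S \<subseteq> {..Sup S}" using False by (auto intro: cSup_upper)
  moreover have "{..<Sup S} \<subseteq> S"
  proof
   fix s assume "s \<in> {..<Sup S}"
   then obtain t where "t \<in> S" "s < t" using False by (auto simp: less_cSup_iff)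
   then show "s \<in> S" using down[of t s] by simp
  qed
  ultimately have "S = (if Sup S \<in> S then {..Sup S} else {..<Sup S})" by (auto simp: subset_eq le_less)
  moreover have "(if Sup S \<in> S then {..Sup S} else {..<Sup S}) \<in> sets borel" by auto
  ultimately show ?thesis by metis
 qed
 then show "{t \<in> space borel. y < infball a x t} \<in> sets borel" by (simp add: S_def)
qed

lemma le_mult_INF:
 fixes v :: ennreal
 assumes "!!z. z \<in> S ==> v <= ennreal k * a z" "S ~= {}" "k >= 0"
 shows "v <= ennreal k * (INF z\<in>S. a z)"
proof (cases "k = 0")
 case True
 then show ?thesis using assms by auto
next
 case False
 then have k: "k > 0" using assms by simp
 have one: "ennreal k * ennreal (1 / k) = 1" using k by (simp flip: ennreal_mult)
 have "ennreal (1 / k) * v <= a z" if "z \<in> S" for z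
 proof -
  have "ennreal (1 / k) * v <= ennreal (1 / k) * (ennreal k * a z)" by (intro mult_left_mono assms that) auto
  also have "... = a z" using one by (metis mult.assoc mult.commute mult_1)
  finally show ?thesis .
 qed
 then have "ennreal (1 / k) * v <= (INF z\<in>S. a z)" by (rule INF_greatest)
 then have "ennreal k * (ennreal (1 / k) * v) <= ennreal k * (INF z\<in>S. a z)" by (intro mult_left_mono) auto
 then show ?thesis using one by (simp flip: mult.assoc)
qed

lemma ennreal_mult_divide_cancel: "l > 0 ==> ennreal l * (y / ennreal l) = y"
proof -
 assume l: "l > 0"
 have "ennreal l * (y / ennreal l) = y * (ennreal l / ennreal l)" by (simp add: ennreal_times_divide mult.commute)
 also have "ennreal l / ennreal l = 1" using l by (simp add: divide_ennreal)
 finally show ?thesis by simp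
qed

lemma ennreal_divide_scale:
 assumes "c > 0" "l > 0"
 shows "ennreal c * y / (ennreal (c * l)) = y / ennreal l"
proof -
 have "ennreal c * y / (ennreal (c * l)) = (ennreal c / ennreal (c * l)) * y" by (simp add: ennreal_times_divide mult.commute)
 also have "ennreal c / ennreal (c * l) = inverse (ennreal l)" using assms by (simp add: divide_ennreal inverse_ennreal divide_inverse)
 finally show ?thesis by (simp add: divide_ennreal_def mult.commute)
qed

definition modular_set :: "(real ^ 'n::finite => real) => (real ^ 'n => ennreal) => real set" where
 "modular_set p g = {l. 0 < l \<and> (\<integral>\<^sup>+ x. ennpowr (g x / ennreal l) (p x) \<partial>lebesgue) <= 1}"

lemma var_norm_eq: "var_norm p g = (INF l\<in>modular_set p g. ennreal l)"
 by (simp add: var_norm_def modular_set_def image_def Collect_conj_eq) (intro arg_cong[where f=Inf], blast)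

lemma var_norm_le: "l \<in> modular_set p g ==> var_norm p g <= ennreal l" unfolding var_norm_eq by (rule INF_lower)

lemma var_norm_finite: "var_norm p g < \<infinity> \<longleftrightarrow> modular_set p g ~= {}"
 unfolding var_norm_eq by (auto simp: INF_less_iff top.not_eq_extremum)

section \<open>Boundedness of the Riesz operator on the Hardy space\<close>

context riesz_exponents
begin

lemma \<alpha>_less: assumes "1 <= pp" shows "\<alpha> < real CARD('n)" using pp_less \<alpha>_pos assms by (smt (verit) mult_left_le mult_le_cancel_left1)

lemma mass1_grand_maximal:
 assumes "f \<in> tempered" "l \<in> modular_set p (grand_maximal N f)"
 shows "mass1 (%z. grand_maximal N f z / ennreal l)"
proof -
 have "grand_maximal N f \<in> borel_measurable lebesgue" using grand_maximal_measurable[OF assms(1)] by (intro measurable_completion) simp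
 then show ?thesis using assms(2) by (simp add: mass1_def modular_set_def)
qed

text \<open>\<open>moll_maximal\<close> holds for all points of the ball at once, so its right side
  may be replaced by an infimum; the division by \<open>l\<close> brings the maximal function into
  the form that \<open>mass1\<close> expects.\<close>

lemma riesz_integrand_bound:
 assumes N: "CARD('n) < N"
 obtains C where "C > 0" "!!f l c (x :: real ^ 'n) s ph. f \<in> tempered ==> 0 < l ==> bump N c x s ph ==> 0 < s ==>
  (NN t. norm (indicator {0<..} t *R (cplx (t powr (\<alpha> - 1)) * f (moll t ph)))) <=
   ennreal (C * c * l) * riesz_majorant \<alpha> (%z. grand_maximal N f z / ennreal l) x"
proof -
 obtain C where C: "C > 0" "!!c (x :: real ^ 'n) s t ph f z. f \<in> tempered ==> bump N c x s ph ==> 0 < s ==> 0 < t ==>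
  norm (z - x) <= max s t ==> ennreal (cmod (f (moll t ph))) <= ennreal (C * c) * grand_maximal N f z" using moll_maximal[OF N] by metis
 show ?thesis
 proof (rule that[OF C(1)])
  fix f :: "('n cfun) => complex" and l c s :: real and ph :: "'n cfun" and x :: "real ^ 'n"
  assume f: "f \<in> tempered" and l: "0 < l" and b: "bump N c x s ph" and s: "0 < s"
  let ?a = "%z. grand_maximal N f z / ennreal l"
  have c: "c >= 0" by (rule bump_nonneg[OF b s])
  have 1: "ennreal (cmod (f (moll t ph))) <= ennreal (C * c * l) * infball ?a x t" if t: "t > 0" for t unfolding infball_def
  proof (rule le_mult_INF)
   fix z assume z: "z \<in> cball x t"
   have "ennreal (cmod (f (moll t ph))) <= ennreal (C * c) * grand_maximal N f z" using C(2)[OF f b s t, of z] z by (simp add: dist_norm norm_minus_commute)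
   also have "grand_maximal N f z = ennreal l * ?a z" using ennreal_mult_divide_cancel[OF l] by simp
   also have "ennreal (C * c) * (ennreal l * ?a z) = ennreal (C * c * l) * ?a z" using C(1) c l by (simp add: ennreal_mult mult.assoc)
   finally show "ennreal (cmod (f (moll t ph))) <= ennreal (C * c * l) * ?a z" .
  qed (use t C c l in auto)
  have "(NN t. norm (indicator {0<..} t *R (cplx (t powr (\<alpha> - 1)) * f (moll t ph)))) <=
   (NN t. ennreal (C * c * l) * (ennreal (t powr (\<alpha> - 1)) * infball ?a x t * indicator {0<..} t))"
  proof (rule nn_integral_mono)
   fix t :: real
   show "ennreal (norm (indicator {0<..} t *R (cplx (t powr (\<alpha> - 1)) * f (moll t ph)))) <=
    ennreal (C * c * l) * (ennreal (t powr (\<alpha> - 1)) * infball ?a x t * indicator {0<..} t)"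
   proof (cases "t > 0")
    case True
    have "ennreal (norm (indicator {0<..} t *R (cplx (t powr (\<alpha> - 1)) * f (moll t ph)))) =
      ennreal (t powr (\<alpha> - 1)) * ennreal (cmod (f (moll t ph)))" using True by (simp add: norm_mult ennreal_mult)
    also have "... <= ennreal (t powr (\<alpha> - 1)) * (ennreal (C * c * l) * infball ?a x t)" by (intro mult_left_mono 1 True) auto
    finally show ?thesis using True by (simp add: mult_ac)
   qed simp
  qed
  also have "... <= ennreal (C * c * l) * riesz_majorant \<alpha> ?a x" unfolding riesz_majorant_def
  proof (cases "C * c * l = 0")
   case True
   show "(NN t. ennreal (C * c * l) * (ennreal (t powr (\<alpha> - 1)) * infball ?a x t * indicator {0<..} t))
    <= ennreal (C * c * l) * (NN t. ennreal (t powr (\<alpha> - 1)) * infball ?a x t * indicator {0<..} t)" unfolding True by simp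
  next
   case False
   then have "C * c * l > 0" using C c l by (simp add: less_le)
   then show "(NN t. ennreal (C * c * l) * (ennreal (t powr (\<alpha> - 1)) * infball ?a x t * indicator {0<..} t))
    <= ennreal (C * c * l) * (NN t. ennreal (t powr (\<alpha> - 1)) * infball ?a x t * indicator {0<..} t)"
    using infball_measurable[of ?a x] by (subst nn_integral_cmult) auto
  qed
  finally show "(NN t. norm (indicator {0<..} t *R (cplx (t powr (\<alpha> - 1)) * f (moll t ph)))) <=
   ennreal (C * c * l) * riesz_majorant \<alpha> ?a x" .
 qed
qed

text \<open>One point suffices: every Schwartz function is a \<open>bump\<close> around any centre,
  so finiteness at a single \<open>x\<close> makes the scale integral converge for all test
  functions and bounds it by one seminorm.\<close>

lemma riesz_majorant_finite_somewhere:
 assumes "mass1 a"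
 obtains x where "riesz_majorant \<alpha> a x < \<infinity>"
proof (rule ccontr)
 assume nt: "\<not> thesis"
 have inf: "riesz_majorant \<alpha> a x = \<infinity>" for x
 proof (rule ccontr)
  assume "riesz_majorant \<alpha> a x ~= \<infinity>"
  then have "riesz_majorant \<alpha> a x < \<infinity>" by (simp add: less_top)
  then show False using that nt by blast
 qed
 obtain K where K: "K >= 1" "!!a. mass1 a ==> (\<integral>\<^sup>+ x. ennpowr (riesz_majorant \<alpha> a x / ennreal K) (q x) \<partial>lebesgue) <= 1"
  using riesz_majorant_mass by metis
 have "ennpowr (riesz_majorant \<alpha> a x / ennreal K) (q x) = \<infinity>" for x
  unfolding inf by (simp add: ennreal_divide_eq_top_iff ennpowr_def ennreal_top_divide)
 then have "(\<integral>\<^sup>+ x. \<infinity> \<partial>(lebesgue :: (real ^ 'n) measure)) <= 1" using K(2)[OF assms] by simp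
 then show False by (simp add: ennreal_top_mult top_unique)
qed

lemma riesz_integrable:
 assumes N: "CARD('n) < N" and f: "f \<in> hardy N p" and ph: "ph \<in> schwartz"
 shows "integrable lborel (%t. indicator {0<..} t *R (cplx (t powr (\<alpha> - 1)) * f (moll t ph)))"
proof (rule integrableI_bounded)
 have ft: "f \<in> tempered" using f by (simp add: hardy_def)
 obtain l where l: "l \<in> modular_set p (grand_maximal N f)" using f var_norm_finite[of p "grand_maximal N f"] by (auto simp: hardy_def hardy_norm_def)
 then have l0: "l > 0" by (simp add: modular_set_def)
 obtain x where x: "riesz_majorant \<alpha> (%z. grand_maximal N f z / ennreal l) x < \<infinity>"
  using riesz_majorant_finite_somewhere[OF mass1_grand_maximal[OF ft l]] by blast
 obtain c where c: "bump N c x 1 ph" using schwartz_bump[OF ph, of 1 N x] by auto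
 obtain C where C: "C > 0" "!!f l c (x :: real ^ 'n) s ph. f \<in> tempered ==> 0 < l ==> bump N c x s ph ==> 0 < s ==>
  (NN t. norm (indicator {0<..} t *R (cplx (t powr (\<alpha> - 1)) * f (moll t ph)))) <=
   ennreal (C * c * l) * riesz_majorant \<alpha> (%z. grand_maximal N f z / ennreal l) x" by (rule riesz_integrand_bound[OF N]) (rule that)
 have "(NN t. norm (indicator {0<..} t *R (cplx (t powr (\<alpha> - 1)) * f (moll t ph)))) <=
   ennreal (C * c * l) * riesz_majorant \<alpha> (%z. grand_maximal N f z / ennreal l) x" by (rule C(2)[OF ft l0 c]) simp
 also have "... < \<infinity>" using x by (simp add: ennreal_mult_less_top)
 finally show "(NN t. norm (indicator {0<..} t *R (cplx (t powr (\<alpha> - 1)) * f (moll t ph)))) < \<infinity>" .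
 have "continuous_on {0<..} (%t. cplx (t powr (\<alpha> - 1)) * f (moll t ph))" by (intro continuous_intros moll_continuous ft ph) auto
 then have "(%t. indicator {0<..} t *R (cplx (t powr (\<alpha> - 1)) * f (moll t ph))) \<in> borel_measurable borel"
  by (intro borel_measurable_continuous_on_indicator) auto
 then show "(%t. indicator {0<..} t *R (cplx (t powr (\<alpha> - 1)) * f (moll t ph))) \<in> borel_measurable lborel" by simp
qed

lemma moll_add: "ph \<in> schwartz ==> \<psi> \<in> schwartz ==> t > 0 ==> moll t (%x. ph x + \<psi> x) = (%x. moll t ph x + moll t \<psi> x)"
 for ph \<psi> :: "'n cfun" by (rule ext) (simp add: moll_def cnv_def distrib_left cnv_integrable schwartz_ubd mol_schwartz schwartz_integrable0)

lemma moll_cmult: "moll t (%x. k * ph x) = (%x. k * moll t ph x)"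
 for ph :: "'n cfun"
proof
 fix y
 have "moll t (%x. k * ph x) y = (LL u. k * (mol t (y - u) * ph u))" unfolding moll_def cnv_def by (simp only: mult.left_commute)
 then show "moll t (%x. k * ph x) y = k * moll t ph y" unfolding moll_def cnv_def by (simp only: integral_mult_right_zero)
qed

lemma riesz_op_bound:
 assumes N: "CARD('n) < N" and \<alpha>n: "\<alpha> < real CARD('n)"
 obtains C where "C > 0" "!!f l c (x :: real ^ 'n) s ph. f \<in> tempered ==> 0 < l ==> bump N c x s ph ==> 0 < s ==>
  ennreal (cmod (riesz_op \<alpha> f ph)) <= ennreal (C * c * l) * riesz_majorant \<alpha> (%z. grand_maximal N f z / ennreal l) x"
proof -
 obtain C where C: "C > 0" "!!f l c (x :: real ^ 'n) s ph. f \<in> tempered ==> 0 < l ==> bump N c x s ph ==> 0 < s ==>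
  (NN t. norm (indicator {0<..} t *R (cplx (t powr (\<alpha> - 1)) * f (moll t ph)))) <=
   ennreal (C * c * l) * riesz_majorant \<alpha> (%z. grand_maximal N f z / ennreal l) x" by (rule riesz_integrand_bound[OF N]) (rule that)
 define k where "k = enn2real (riesz_const TYPE('n) \<alpha>)"
 have k: "k > 0" unfolding k_def by (rule riesz_const_real(1)[OF \<alpha>_pos \<alpha>n])
 show ?thesis
 proof (rule that[of "C / k"])
  show "C / k > 0" using C k by simp
  fix f :: "('n cfun) => complex" and l c s :: real and ph :: "'n cfun" and x :: "real ^ 'n"
  assume f: "f \<in> tempered" and l: "0 < l" and b: "bump N c x s ph" and s: "0 < s"
  let ?g = "%t. indicator {0<..} t *R (cplx (t powr (\<alpha> - 1)) * f (moll t ph))"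
  let ?R = "riesz_majorant \<alpha> (%z. grand_maximal N f z / ennreal l) x"
  have c: "c >= 0" by (rule bump_nonneg[OF b s])
  \<comment> \<open>For a general tempered \<open>f\<close> integrability is not known, but without
    it the Bochner integral is 0 and the bound is trivial.\<close>
  have "ennreal (cmod (LL t. ?g t)) <= (NN t. norm (?g t))"
  proof (cases "integrable lborel ?g")
   case True
   show ?thesis by (rule integral_norm_bound_ennreal[OF True])
  qed (simp add: not_integrable_integral_eq)
  also have "... <= ennreal (C * c * l) * ?R" by (rule C(2)[OF f l b s])
  finally have "ennreal (1 / k) * ennreal (cmod (LL t. ?g t)) <= ennreal (1 / k) * (ennreal (C * c * l) * ?R)" by (intro mult_left_mono) auto
  moreover have "ennreal (cmod (riesz_op \<alpha> f ph)) = ennreal (1 / k) * ennreal (cmod (LL t. ?g t))"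
   using k bump_schwartz[OF b] by (simp add: riesz_op_def k_def[symmetric] norm_divide ennreal_mult[symmetric])
  moreover have "ennreal (1 / k) * (ennreal (C * c * l) * ?R) = ennreal (C / k * c * l) * ?R"
  proof -
   have "ennreal (1 / k) * ennreal (C * c * l) = ennreal (1 / k * (C * c * l))" using k C c l by (intro ennreal_mult[symmetric]) auto
   then show ?thesis by (simp add: mult.assoc[symmetric])
  qed
  ultimately show "ennreal (cmod (riesz_op \<alpha> f ph)) <= ennreal (C / k * c * l) * ?R" by simp
 qed
qed

lemma riesz_op_tempered:
 assumes N: "CARD('n) < N" and \<alpha>n: "\<alpha> < real CARD('n)" and f: "f \<in> hardy N p"
 shows "riesz_op \<alpha> f \<in> tempered"
proof -
 have ft: "f \<in> tempered" using f by (simp add: hardy_def)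
 obtain l where l: "l \<in> modular_set p (grand_maximal N f)" using f var_norm_finite[of p "grand_maximal N f"] by (auto simp: hardy_def hardy_norm_def)
 then have l0: "l > 0" by (simp add: modular_set_def)
 obtain x where x: "riesz_majorant \<alpha> (%z. grand_maximal N f z / ennreal l) x < \<infinity>"
  using riesz_majorant_finite_somewhere[OF mass1_grand_maximal[OF ft l]] by blast
 define R where "R = enn2real (riesz_majorant \<alpha> (%z. grand_maximal N f z / ennreal l) x)"
 have R: "riesz_majorant \<alpha> (%z. grand_maximal N f z / ennreal l) x = ennreal R" "R >= 0" using x by (auto simp: R_def)
 obtain C where C: "C > 0" "!!f l c (x :: real ^ 'n) s ph. f \<in> tempered ==> 0 < l ==> bump N c x s ph ==> 0 < s ==>
  ennreal (cmod (riesz_op \<alpha> f ph)) <= ennreal (C * c * l) * riesz_majorant \<alpha> (%z. grand_maximal N f z / ennreal l) x"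
  by (rule riesz_op_bound[OF N \<alpha>n]) (rule that)
 show ?thesis
 proof (rule temperedI[where N=N and C="C * (1 + norm x) ^ N * l * R"])
  fix ph \<psi> :: "'n cfun" assume ph: "ph \<in> schwartz" and \<psi>: "\<psi> \<in> schwartz"
  have "(LL t. indicator {0<..} t *R (cplx (t powr (\<alpha> - 1)) * f (moll t (%x. ph x + \<psi> x)))) =
   (LL t. indicator {0<..} t *R (cplx (t powr (\<alpha> - 1)) * f (moll t ph)) + indicator {0<..} t *R (cplx (t powr (\<alpha> - 1)) * f (moll t \<psi>)))"
   using ph \<psi> by (intro Bochner_Integration.integral_cong)
    (auto simp: indicator_def moll_add tempered_add[OF ft] moll_schwartz algebra_simps)
  also have "... = (LL t. indicator {0<..} t *R (cplx (t powr (\<alpha> - 1)) * f (moll t ph))) + (LL t. indicator {0<..} t *R (cplx (t powr (\<alpha> - 1)) * f (moll t \<psi>)))"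
   by (intro Bochner_Integration.integral_add riesz_integrable[OF N f] ph \<psi>)
  finally show "riesz_op \<alpha> f (%x. ph x + \<psi> x) = riesz_op \<alpha> f ph + riesz_op \<alpha> f \<psi>"
   using ph \<psi> by (simp add: riesz_op_def schwartz_add distrib_left add_divide_distrib)
 next
  fix k and ph :: "'n cfun" assume ph: "ph \<in> schwartz"
  have "(LL t. indicator {0<..} t *R (cplx (t powr (\<alpha> - 1)) * f (moll t (%x. k * ph x)))) =
   (LL t. k * (indicator {0<..} t *R (cplx (t powr (\<alpha> - 1)) * f (moll t ph))))" using ph by (intro Bochner_Integration.integral_cong)
    (auto simp: indicator_def moll_cmult tempered_cmult[OF ft] moll_schwartz)
  also have "... = k * (LL t. indicator {0<..} t *R (cplx (t powr (\<alpha> - 1)) * f (moll t ph)))" by (rule integral_mult_right_zero)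
  finally show "riesz_op \<alpha> f (%x. k * ph x) = k * riesz_op \<alpha> f ph" by (simp only: riesz_op_def schwartz_cmult[OF ph] ph if_True mult.left_commute)
 next
  fix ph :: "'n cfun" assume "ph \<notin> schwartz"
  then show "riesz_op \<alpha> f ph = 0" by (simp add: riesz_op_def)
 next
  fix ph :: "'n cfun" assume ph: "ph \<in> schwartz"
  have b: "bump N (schwartz_norm N ph * (1 + norm x) ^ N) x 1 ph" using bump_shift[OF schwartz_norm_bump[OF ph, of N], of x "norm x"] by simp
  have "ennreal (cmod (riesz_op \<alpha> f ph)) <= ennreal (C * (schwartz_norm N ph * (1 + norm x) ^ N) * l) * ennreal R" using C(2)[OF ft l0 b] R by simp
  also have "... = ennreal (C * (1 + norm x) ^ N * l * R * schwartz_norm N ph)"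
   using C(1) l0 R(2) schwartz_norm_nonneg[OF ph, of N] by (simp add: ennreal_mult[symmetric] mult_ac)
  finally show "cmod (riesz_op \<alpha> f ph) <= C * (1 + norm x) ^ N * l * R * schwartz_norm N ph"
   using C(1) l0 R(2) schwartz_norm_nonneg[OF ph, of N] by (subst (asm) ennreal_le_iff) auto
 qed
qed

lemma riesz_op_hardy_norm:
 assumes N: "CARD('n) < N" and \<alpha>n: "\<alpha> < real CARD('n)"
 obtains C where "C > 0" "!!f. f \<in> hardy N p ==> hardy_norm N q (riesz_op \<alpha> f) <= ennreal C * hardy_norm N p f"
proof -
 obtain C where C: "C > 0" "!!f l c (x :: real ^ 'n) s ph. f \<in> tempered ==> 0 < l ==> bump N c x s ph ==> 0 < s ==>
  ennreal (cmod (riesz_op \<alpha> f ph)) <= ennreal (C * c * l) * riesz_majorant \<alpha> (%z. grand_maximal N f z / ennreal l) x"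
  by (rule riesz_op_bound[OF N \<alpha>n]) (rule that)
 obtain K where K: "K >= 1" "!!a. mass1 a ==> (\<integral>\<^sup>+ x. ennpowr (riesz_majorant \<alpha> a x / ennreal K) (q x) \<partial>lebesgue) <= 1"
  using riesz_majorant_mass by metis
 show ?thesis
 proof (rule that[of "C * K"])
  show "C * K > 0" using C K by simp
  fix f assume f: "f \<in> hardy N p"
  then have ft: "f \<in> tempered" by (simp add: hardy_def)
  have ne: "modular_set p (grand_maximal N f) ~= {}" using f var_norm_finite[of p "grand_maximal N f"] by (simp add: hardy_def hardy_norm_def)
  show "hardy_norm N q (riesz_op \<alpha> f) <= ennreal (C * K) * hardy_norm N p f" unfolding hardy_norm_def var_norm_eq[of p]
  proof (rule le_mult_INF[OF _ ne])
   \<comment> \<open>The quasi-norm is an infimum over admissible \<open>l\<close>; each of them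
     makes C * K * l admissible for the image.\<close>
   fix l assume l: "l \<in> modular_set p (grand_maximal N f)"
   then have l0: "l > 0" by (simp add: modular_set_def)
   let ?a = "%z. grand_maximal N f z / ennreal l"
   have le: "grand_maximal N (riesz_op \<alpha> f) x <= ennreal (C * l) * riesz_majorant \<alpha> ?a x" for x
    by (rule grand_maximal_le) (use C(2)[OF ft l0, of 1] in simp)
   have "(\<integral>\<^sup>+ x. ennpowr (grand_maximal N (riesz_op \<alpha> f) x / ennreal (C * K * l)) (q x) \<partial>lebesgue) <=
    (\<integral>\<^sup>+ x. ennpowr (riesz_majorant \<alpha> ?a x / ennreal K) (q x) \<partial>lebesgue)"
   proof (intro nn_integral_mono ennpowr_mono)
    fix x
    have "grand_maximal N (riesz_op \<alpha> f) x / ennreal (C * K * l) <= ennreal (C * l) * riesz_majorant \<alpha> ?a x / ennreal (C * l * K)"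
     by (simp add: mult_ac divide_right_mono_ennreal le)
    also have "... = riesz_majorant \<alpha> ?a x / ennreal K" using C K l0 by (intro ennreal_divide_scale) auto
    finally show "grand_maximal N (riesz_op \<alpha> f) x / ennreal (C * K * l) <= riesz_majorant \<alpha> ?a x / ennreal K" .
   qed (use q_pos less_imp_le in auto)
   also have "... <= 1" by (rule K(2)[OF mass1_grand_maximal[OF ft l]])
   finally have "C * K * l \<in> modular_set q (grand_maximal N (riesz_op \<alpha> f))" using C K l0 by (simp add: modular_set_def)
   then have "var_norm q (grand_maximal N (riesz_op \<alpha> f)) <= ennreal (C * K * l)" by (rule var_norm_le)
   also have "... = ennreal (C * K) * ennreal l" using C K l0 by (simp add: ennreal_mult)
   finally show "var_norm q (grand_maximal N (riesz_op \<alpha> f)) <= ennreal (C * K) * ennreal l" .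
  qed (use C K in auto)
 qed
qed

lemma riesz_op_bounded:
 assumes N: "CARD('n) < N" and \<alpha>n: "\<alpha> < real CARD('n)"
 shows "bounded_hardy_operator N p q (riesz_op \<alpha>)" unfolding bounded_hardy_operator_def
proof (intro conjI ballI allI)
 obtain C where C: "C > 0" "!!f. f \<in> hardy N p ==> hardy_norm N q (riesz_op \<alpha> f) <= ennreal C * hardy_norm N p f"
  using riesz_op_hardy_norm[OF N \<alpha>n] by metis
 then show "\<exists>C::real. \<forall>f\<in>hardy N p. hardy_norm N q (riesz_op \<alpha> f) <= ennreal C * hardy_norm N p f" by blast
 fix f assume f: "f \<in> hardy N p"
 have "hardy_norm N q (riesz_op \<alpha> f) <= ennreal C * hardy_norm N p f" by (rule C(2)[OF f])
 also have "... < \<infinity>" using f by (simp add: hardy_def ennreal_mult_less_top)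
 finally show "riesz_op \<alpha> f \<in> hardy N q" using riesz_op_tempered[OF N \<alpha>n f] by (simp add: hardy_def)
next
 fix f g assume f: "f \<in> hardy N p" and g: "g \<in> hardy N p"
 have "(LL t. indicator {0<..} t *R (cplx (t powr (\<alpha> - 1)) * (f (moll t ph) + g (moll t ph)))) =
  (LL t. indicator {0<..} t *R (cplx (t powr (\<alpha> - 1)) * f (moll t ph))) + (LL t. indicator {0<..} t *R (cplx (t powr (\<alpha> - 1)) * g (moll t ph)))"
  if "ph \<in> schwartz" for ph unfolding distrib_left scaleR_add_right by (intro Bochner_Integration.integral_add riesz_integrable[OF N] f g that)
 then show "riesz_op \<alpha> (%ph. f ph + g ph) = (%ph. riesz_op \<alpha> f ph + riesz_op \<alpha> g ph)"
  by (auto simp: riesz_op_def distrib_left add_divide_distrib)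
next
 fix c f assume f: "f \<in> hardy N p"
 have "(LL t. indicator {0<..} t *R (cplx (t powr (\<alpha> - 1)) * (c * f (moll t ph)))) =
  c * (LL t. indicator {0<..} t *R (cplx (t powr (\<alpha> - 1)) * f (moll t ph)))" for ph
 proof -
  have "(LL t. indicator {0<..} t *R (cplx (t powr (\<alpha> - 1)) * (c * f (moll t ph)))) =
   (LL t. c * (indicator {0<..} t *R (cplx (t powr (\<alpha> - 1)) * f (moll t ph))))" by (intro Bochner_Integration.integral_cong) (auto simp: indicator_def)
  also have "... = c * (LL t. indicator {0<..} t *R (cplx (t powr (\<alpha> - 1)) * f (moll t ph)))" by (rule integral_mult_right_zero)
  finally show ?thesis .
 qed
 note eq = this
 show "riesz_op \<alpha> (%ph. c * f ph) = (%ph. c * riesz_op \<alpha> f ph)"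
 proof
  fix ph show "riesz_op \<alpha> (%ph. c * f ph) ph = c * riesz_op \<alpha> f ph"
  proof (cases "ph \<in> schwartz")
   case True
   show ?thesis by (simp only: riesz_op_def True if_True eq) (rule mult.left_commute)
  next
   case False
   then show ?thesis by (simp only: riesz_op_def False if_False mult_zero_right)
  qed
 qed
qed

end

section \<open>Agreement with the integral formula\<close>

text \<open>Fubini is run on \<open>lborel\<close>, whereas \<open>Lp_fun\<close> speaks of Lebesgue
  measurable functions; a Borel representative bridges the two.\<close>

lemma completion_ex_borel_measurable_complex:
 fixes g :: "'a => complex"
 assumes "g \<in> borel_measurable (completion M)"
 obtains g' where "g' \<in> borel_measurable M" "AE x in M. g x = g' x"
proof -
 have "(%x. Re (g x)) \<in> borel_measurable (completion M)" "(%x. Im (g x)) \<in> borel_measurable (completion M)" using assms by measurable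
 then obtain r i where r: "r \<in> borel_measurable M" "AE x in M. Re (g x) = r x"
  and i: "i \<in> borel_measurable M" "AE x in M. Im (g x) = i x" using completion_ex_borel_measurable_real by metis
 show ?thesis
 proof (rule that[of "%x. Complex (r x) (i x)"])
  have "(%x. Complex (r x) (i x)) = (%x. cplx (r x) + \<i> * cplx (i x))" by (auto simp: complex_eq_iff)
  then show "(%x. Complex (r x) (i x)) \<in> borel_measurable M" using r i by simp
  show "AE x in M. g x = Complex (r x) (i x)" using r(2) i(2) by eventually_elim (simp add: complex_eq_iff)
 qed
qed

lemma cmod_mol: "t > 0 ==> cmod (mol t y) = theta (y /\<^sub>R t) / t ^ CARD('n)" for y :: "real ^ 'n::finite"
 by (simp add: mol_def norm_divide norm_power theta_nonneg)

lemma mol_integral_fst: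
 fixes x :: "real ^ 'n::finite"
 assumes t: "t > 0"
 shows "(NN y. ennreal (cmod (mol t (y - x)))) = 1" "(NN y. ennreal (cmod (mol t (x - y)))) = 1"
proof -
 have th: "(NN z. ennreal (theta (z :: real ^ 'n))) = 1" using nn_integral_eq_integral[OF theta_integrable AE_I2[OF theta_nonneg]] by (simp add: theta_integral)
 have "(NN y. ennreal (cmod (mol t (y - x)))) = ennreal (\<bar>t\<bar> ^ DIM(real ^ 'n)) * (NN z. ennreal (cmod (mol t ((x + t *R z) - x))))"
  by (rule nn_integral_affine) (measurable, use t in simp)
 also have "... = (NN z. ennreal (t ^ CARD('n)) * ennreal (cmod (mol t ((x + t *R z) - x))))" using t by (subst nn_integral_cmult) auto
 also have "... = (NN z. ennreal (theta (z :: real ^ 'n)))" using t theta_nonneg by (intro nn_integral_cong) (simp add: cmod_mol ennreal_mult'[symmetric])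
 finally show "(NN y. ennreal (cmod (mol t (y - x)))) = 1" using th by simp
 moreover have "cmod (mol t (x - y)) = cmod (mol t (y - x))" for y
 proof -
  have "theta ((x - y) /\<^sub>R t) = theta ((y - x) /\<^sub>R t)" by (rule theta_radial) (simp add: norm_minus_commute)
  then show ?thesis using t by (simp add: cmod_mol)
 qed
 ultimately show "(NN y. ennreal (cmod (mol t (x - y)))) = 1" by simp
qed

text \<open>The bound a <= u a^p0 + v stands in for Hoelder's inequality: one part uses the integral
  of |g|^p0 and a uniform bound for the mollified test function, the other the integral of |ph|. The
  weights \<open>u\<close> and \<open>v\<close> are left free to be tuned to the scale.\<close>

lemma mol_double_bound:
 fixes g ph :: "'n::finite cfun"
 assumes t: "t > 0" and [measurable]: "g \<in> borel_measurable borel" "ph \<in> borel_measurable borel"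
  and u: "u > 0" and v: "v >= 0" and y: "!!a. a >= 0 ==> a <= u * a powr p0 + v"
  and P: "(NN y. ennreal (cmod (g y) powr p0)) <= ennreal P" "P >= 0"
  and F: "(NN x. ennreal (cmod (ph x))) <= ennreal F" "F >= 0"
  and S: "!!y. (NN x. ennreal (cmod (mol t (y - x)) * cmod (ph x))) <= ennreal S" "S >= 0"
 shows "(NN y. (NN x. ennreal (cmod (g y * (mol t (y - x) * ph x))))) <= ennreal (u * P * S + v * F)"
proof -
 let ?m = "%y x. ennreal (cmod (mol t (y - x)) * cmod (ph x))"
 have "(NN y. (NN x. ennreal (cmod (g y * (mol t (y - x) * ph x))))) <=
  (NN y. ennreal u * (ennreal (cmod (g y) powr p0) * (NN x. ?m y x)) + ennreal v * (NN x. ?m y x))"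
 proof (rule nn_integral_mono)
  fix y
  have "(NN x. ennreal (cmod (g y * (mol t (y - x) * ph x)))) = ennreal (cmod (g y)) * (NN x. ?m y x)"
   by (subst nn_integral_cmult[symmetric]) (auto simp: norm_mult ennreal_mult)
  also have "... <= (ennreal u * ennreal (cmod (g y) powr p0) + ennreal v) * (NN x. ?m y x)"
  proof (intro mult_right_mono)
   have "ennreal (cmod (g y)) <= ennreal (u * cmod (g y) powr p0 + v)" by (intro ennreal_leI assms(6)) simp
   then show "ennreal (cmod (g y)) <= ennreal u * ennreal (cmod (g y) powr p0) + ennreal v" using u v by (simp add: ennreal_plus ennreal_mult)
  qed simp
  finally show "(NN x. ennreal (cmod (g y * (mol t (y - x) * ph x)))) <=
   ennreal u * (ennreal (cmod (g y) powr p0) * (NN x. ?m y x)) + ennreal v * (NN x. ?m y x)" by (simp add: distrib_right mult.assoc)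
 qed
 also have "... <= (NN y. ennreal (u * S) * ennreal (cmod (g y) powr p0) + ennreal v * (NN x. ?m y x))"
 proof (intro nn_integral_mono add_right_mono)
  fix y
  have "ennreal u * (ennreal (cmod (g y) powr p0) * (NN x. ?m y x)) <= ennreal u * (ennreal (cmod (g y) powr p0) * ennreal S)" by (intro mult_left_mono S) auto
  then show "ennreal u * (ennreal (cmod (g y) powr p0) * (NN x. ?m y x)) <= ennreal (u * S) * ennreal (cmod (g y) powr p0)"
   using u S(2) by (simp add: ennreal_mult mult_ac)
 qed
 also have "... = ennreal (u * S) * (NN y. ennreal (cmod (g y) powr p0)) + ennreal v * (NN y. (NN x. ?m y x))" by (simp add: nn_integral_add nn_integral_cmult)
 also have "(NN y. (NN x. ?m y x)) = (NN x. (NN y. ?m y x))" by (rule lborel_pair.Fubini'[symmetric]) measurable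
 also have "... = (NN x. ennreal (cmod (ph x)))"
 proof (rule nn_integral_cong)
  fix x
  have "(NN y. ?m y x) = (NN y. ennreal (cmod (mol t (y - x))) * ennreal (cmod (ph x)))" by (simp add: ennreal_mult)
  also have "... = (NN y. ennreal (cmod (mol t (y - x)))) * ennreal (cmod (ph x))" by (rule nn_integral_multc) measurable
  finally show "(NN y. ?m y x) = ennreal (cmod (ph x))" by (simp add: mol_integral_fst[OF t])
 qed
 also have "ennreal (u * S) * (NN y. ennreal (cmod (g y) powr p0)) + ennreal v * (NN x. ennreal (cmod (ph x)))
  <= ennreal (u * S) * ennreal P + ennreal v * ennreal F" by (intro add_mono mult_left_mono P F) auto
 also have "... = ennreal (u * P * S + v * F)" using u v P S F by (simp add: ennreal_mult ennreal_plus mult_ac)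
 finally show ?thesis .
qed

lemma mol_S_bound:
 fixes ph :: "'n::finite cfun"
 assumes "ph \<in> schwartz"
 obtains S F where "S >= 0" "F >= 0" "(NN x. ennreal (cmod (ph x))) <= ennreal F"
  "!!t y. 0 < t ==> (NN x. ennreal (cmod (mol t (y - x)) * cmod (ph x))) <= ennreal S"
  "!!t y. 0 < t ==> (NN x. ennreal (cmod (mol t (y - x)) * cmod (ph x))) <= ennreal (S / t ^ CARD('n))"
proof -
 have [measurable]: "ph \<in> borel_measurable borel" by (rule schwartz_measurable[OF assms])
 obtain S1 where S1: "S1 >= 0" "!!is x. length is <= 0 ==> cmod (Dl is ph x) <= S1" using ubd_boundE[OF schwartz_ubd[OF assms], of 0] by metis
 have S1': "cmod (ph x) <= S1" for x using S1(2)[of "[]" x] by simp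
 obtain B where B: "B >= 0" "!!is t y. length is <= 0 ==> t > 0 ==> cmod (Dl is (mol t :: 'n cfun) y) * t ^ (CARD('n) + length is) <= B"
  using Dl_mol_bound[of 0] by metis
 have B': "cmod (mol t (y :: real ^ 'n)) <= B / t ^ CARD('n)" if "t > 0" for t y using B(2)[of "[]" t y] that by (simp add: field_simps)
 define F where "F = (LL x. cmod (ph x))"
 have F: "F >= 0" unfolding F_def by (intro integral_nonneg_AE) auto
 have Fe: "(NN x. ennreal (cmod (ph x))) = ennreal F" unfolding F_def using schwartz_integrable0[OF assms] by (intro nn_integral_eq_integral) auto
 define S where "S = S1 + B * F"
 have BF: "B * F >= 0" using B F by simp
 show ?thesis
 proof (rule that[of S F])
  show "S >= 0" using S1 BF by (simp add: S_def)
  fix t :: real and y :: "real ^ 'n" assume t: "0 < t"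
  have "(NN x. ennreal (cmod (mol t (y - x)) * cmod (ph x))) <= (NN x. ennreal S1 * ennreal (cmod (mol t (y - x))))"
   using S1' S1(1) by (intro nn_integral_mono) (simp add: ennreal_mult[symmetric] ennreal_leI mult.commute mult_right_mono)
  also have "... = ennreal S1" by (subst nn_integral_cmult) (auto simp: mol_integral_fst[OF t])
  also have "... <= ennreal S" using BF by (intro ennreal_leI) (simp add: S_def)
  finally show "(NN x. ennreal (cmod (mol t (y - x)) * cmod (ph x))) <= ennreal S" .
  have "(NN x. ennreal (cmod (mol t (y - x)) * cmod (ph x))) <= (NN x. ennreal (B / t ^ CARD('n)) * ennreal (cmod (ph x)))"
   using B'[OF t] B(1) t by (intro nn_integral_mono) (simp only: ennreal_mult[symmetric] divide_nonneg_nonneg norm_ge_zero zero_le_power less_imp_le ennreal_leI mult_right_mono)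
  also have "... = ennreal (B / t ^ CARD('n)) * ennreal F" by (subst nn_integral_cmult) (auto simp: Fe)
  also have "... = ennreal (B / t ^ CARD('n) * F)" using B F t by (intro ennreal_mult[symmetric]) auto
  also have "... <= ennreal (S / t ^ CARD('n))" using S1 t by (intro ennreal_leI) (simp add: S_def divide_right_mono)
  finally show "(NN x. ennreal (cmod (mol t (y - x)) * cmod (ph x))) <= ennreal (S / t ^ CARD('n))" .
 qed (use F Fe in auto)
qed

text \<open>Absolute integrability over the scale and both space variables, the licence for Fubini
  in \<open>riesz_agreement\<close>. Small scales are integrable by \<alpha> > 0, large ones by n /
  p0 > \<alpha>.\<close>

lemma riesz_triple_integrable:
 fixes g ph :: "'n::finite cfun"
 assumes \<alpha>: "0 < \<alpha>" and p0: "1 <= p0" "\<alpha> * p0 < real CARD('n)"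
  and g[measurable]: "g \<in> borel_measurable borel" and P: "(NN y. ennreal (cmod (g y) powr p0)) < \<infinity>"
  and ph: "ph \<in> schwartz"
 shows "integrable (lborel \<Otimes>\<^sub>M (lborel \<Otimes>\<^sub>M lborel))
  (%(t, y, x). indicator {0<..} t *R (cplx (t powr (\<alpha> - 1)) * (g y * (mol t (y - x) * ph x))))"
proof (rule integrableI_bounded)
 have [measurable]: "ph \<in> borel_measurable borel" by (rule schwartz_measurable[OF ph])
 have [measurable]: "(%w :: real \<times> (real ^ 'n) \<times> (real ^ 'n). mol (fst w) (fst (snd w) - snd (snd w))) \<in> borel_measurable (borel \<Otimes>\<^sub>M (borel \<Otimes>\<^sub>M borel))"
  unfolding mol_def[abs_def] by measurable
 show m[measurable]: "(%(t, y, x). indicator {0<..} t *R (cplx (t powr (\<alpha> - 1)) * (g y * (mol t (y - x) * ph x))))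
  \<in> borel_measurable (lborel \<Otimes>\<^sub>M (lborel \<Otimes>\<^sub>M lborel))" unfolding split_beta' by measurable
 let ?n = "real CARD('n)"
 obtain S F where S: "S >= 0" "F >= 0" "(NN x. ennreal (cmod (ph x))) <= ennreal F"
  "!!t y. 0 < t ==> (NN x. ennreal (cmod (mol t (y - x)) * cmod (ph x))) <= ennreal S"
  "!!t y. 0 < t ==> (NN x. ennreal (cmod (mol t (y - x)) * cmod (ph x))) <= ennreal (S / t ^ CARD('n))" by (rule mol_S_bound[OF ph]) (rule that)
 obtain P1 where P1: "P1 >= 0" "(NN y. ennreal (cmod (g y) powr p0)) = ennreal P1" using P by (cases "(NN y. ennreal (cmod (g y) powr p0))") auto
 define Q where "Q = P1 * S + F"
 have Q: "Q >= 0" using P1 S by (simp add: Q_def)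
 define \<beta> where "\<beta> = ?n / p0 - \<alpha>"
 have \<beta>: "\<beta> > 0" using p0 by (simp add: \<beta>_def less_divide_eq)
 let ?h = "%t y x. indicator {0<..} t *R (cplx (t powr (\<alpha> - 1)) * (g y * (mol t (y - x) * ph x)))"
 have inner: "(NN y. (NN x. ennreal (cmod (g y * (mol t (y - x) * ph x))))) <= ennreal (Q * (if t <= 1 then 1 else t powr (- (?n / p0))))"
  if t: "t > 0" for t
 proof (cases "t <= 1")
  case True
  have "a <= 1 * a powr p0 + 1" if "a >= 0" for a
  proof (cases "a <= 1")
   case False
   then have "a powr 1 <= a powr p0" using p0 by (intro powr_mono) auto
   then show ?thesis using False by simp
  next
   case True
   then show ?thesis using add_mono[of 0 "a powr p0" a 1] by simp
  qed
  then have "(NN y. (NN x. ennreal (cmod (g y * (mol t (y - x) * ph x))))) <= ennreal (1 * P1 * S + 1 * F)"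
   using P1 S t by (intro mol_double_bound[where ?p0.0=p0]) auto
  then show ?thesis using True by (simp add: Q_def)
 next
  case False
  \<comment> \<open>The threshold between the two parts: here u = v^(1 - p0), and with the bound S /
    t^n for the mollified test function both parts become of size t^(-n / p0).\<close>
  let ?v = "t powr (- (?n / p0))" and ?u = "t powr (?n - ?n / p0)"
  have "a <= ?u * a powr p0 + ?v" if a: "a >= 0" for a
  proof (cases "a <= ?v")
   case True then show ?thesis using t by (simp add: add_increasing)
  next
   case False
   then have a0: "a > 0" using t by (smt (verit) powr_ge_zero)
   have "1 <= a / ?v" using False t by (simp add: le_divide_eq)
   then have "(a / ?v) powr 1 <= (a / ?v) powr p0" using p0 by (intro powr_mono) auto
   also have "... = a powr p0 * t powr ?n"
   proof -
    have "?n / p0 * p0 = ?n" using p0 by simp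
    then show ?thesis using a0 t by (simp add: powr_mult powr_powr powr_minus divide_inverse mult.assoc)
   qed
   finally have "a <= a powr p0 * t powr ?n * ?v" using \<open>1 <= a / ?v\<close> a0 t by (simp add: divide_le_eq)
   also have "... = ?u * a powr p0" using t by (simp add: powr_diff powr_minus divide_inverse mult_ac)
   finally show ?thesis by (simp add: add_increasing2)
  qed
  then have "(NN y. (NN x. ennreal (cmod (g y * (mol t (y - x) * ph x))))) <= ennreal (?u * P1 * (S / t ^ CARD('n)) + ?v * F)"
   using P1 S t by (intro mol_double_bound[where ?p0.0=p0]) auto
  also have "?u * P1 * (S / t ^ CARD('n)) + ?v * F = Q * ?v" using t by (simp add: Q_def powr_diff powr_minus powr_realpow field_simps)
  finally show ?thesis using False by simp
 qed
 have "(\<integral>\<^sup>+ w. ennreal (norm (case w of (t, y, x) => ?h t y x)) \<partial>(lborel \<Otimes>\<^sub>M (lborel \<Otimes>\<^sub>M lborel))) =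
  (NN t. (NN y. (NN x. ennreal (norm (?h t y x)))))"
 proof -
  have M2: "sigma_finite_measure (lborel \<Otimes>\<^sub>M lborel :: ((real ^ 'n) \<times> (real ^ 'n)) measure)"
   by (intro sigma_finite_pair_measure sigma_finite_lborel)
  have m': "(%w. ennreal (norm (case w of (t, y, x) => ?h t y x))) \<in> borel_measurable (lborel \<Otimes>\<^sub>M (lborel \<Otimes>\<^sub>M lborel))"
   by (rule measurable_compose[OF m]) measurable
  have "(\<integral>\<^sup>+ w. ennreal (norm (case w of (t, y, x) => ?h t y x)) \<partial>(lborel \<Otimes>\<^sub>M (lborel \<Otimes>\<^sub>M lborel))) =
   (NN t. (\<integral>\<^sup>+ z. ennreal (norm (case (t, z) of (t, y, x) => ?h t y x)) \<partial>(lborel \<Otimes>\<^sub>M lborel)))"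
   by (rule sigma_finite_measure.nn_integral_fst[OF M2 m', symmetric])
  also have "... = (NN t. (NN y. (NN x. ennreal (norm (case (t, y, x) of (t, y, x) => ?h t y x)))))"
  proof (rule nn_integral_cong)
   fix t :: real
   have "(%z. ennreal (norm (case (t, z) of (t, y, x) => ?h t y x))) \<in> borel_measurable (lborel \<Otimes>\<^sub>M lborel)"
    by (rule measurable_compose[OF measurable_Pair1' m']) simp
   from lborel.nn_integral_fst[OF this, symmetric]
   show "(\<integral>\<^sup>+ z. ennreal (norm (case (t, z) of (t, y, x) => ?h t y x)) \<partial>(lborel \<Otimes>\<^sub>M lborel)) =
    (NN y. (NN x. ennreal (norm (case (t, y, x) of (t, y, x) => ?h t y x))))" .
  qed
  finally show ?thesis by (simp only: prod.case)
 qed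
 also have "... <= (NN t. ennreal Q * (ennreal (t powr (\<alpha> - 1)) * indicator {0..1} t) + ennreal Q * (ennreal (t powr (- \<beta> - 1)) * indicator {1..} t))"
 proof (rule nn_integral_mono)
  fix t :: real
  show "(NN y. (NN x. ennreal (norm (?h t y x)))) <=
   ennreal Q * (ennreal (t powr (\<alpha> - 1)) * indicator {0..1} t) + ennreal Q * (ennreal (t powr (- \<beta> - 1)) * indicator {1..} t)"
  proof (cases "t > 0")
   case True
   have "(NN y. (NN x. ennreal (norm (?h t y x)))) =
    (NN y. (NN x. ennreal (t powr (\<alpha> - 1)) * ennreal (cmod (g y * (mol t (y - x) * ph x)))))" using True by (simp add: norm_mult ennreal_mult)
   also have "... = ennreal (t powr (\<alpha> - 1)) * (NN y. (NN x. ennreal (cmod (g y * (mol t (y - x) * ph x)))))" by (simp add: nn_integral_cmult)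
   also have "... <= ennreal (t powr (\<alpha> - 1)) * ennreal (Q * (if t <= 1 then 1 else t powr (- (?n / p0))))" by (intro mult_left_mono inner True) auto
   also have "... = ennreal Q * ennreal (t powr (\<alpha> - 1) * (if t <= 1 then 1 else t powr (- (?n / p0))))"
    using Q by (simp add: ennreal_mult[symmetric] mult_ac)
   also have "t powr (\<alpha> - 1) * (if t <= 1 then 1 else t powr (- (?n / p0))) = (if t <= 1 then t powr (\<alpha> - 1) else t powr (- \<beta> - 1))"
    by (auto simp: \<beta>_def diff_diff_eq add.commute simp flip: powr_add)
   finally show ?thesis using True by (cases "t <= 1") (auto simp: add_increasing2)
  qed simp
 qed
 also have "... = ennreal Q * ennreal (1 powr \<alpha> / \<alpha>) + ennreal Q * ennreal (1 powr (- \<beta>) / \<beta>)"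
  using \<alpha> \<beta> by (simp add: nn_integral_add nn_integral_cmult nn_integral_powr_0 nn_integral_powr_inf)
 also have "... < \<infinity>" by (simp add: ennreal_mult_less_top)
 finally show "(\<integral>\<^sup>+ w. ennreal (norm (case w of (t, y, x) => ?h t y x)) \<partial>(lborel \<Otimes>\<^sub>M (lborel \<Otimes>\<^sub>M lborel))) < \<infinity>" .
qed

text \<open>Both sides are the same triple integral: integration over the scale produces the Riesz
  kernel, integration over space produces the values of \<open>f\<close> on
  \<open>moll t ph\<close>.\<close>

lemma riesz_agreement:
 fixes g :: "'n::finite cfun"
 assumes \<alpha>: "0 < \<alpha>" "\<alpha> < real CARD('n)" and p0: "1 <= p0" "\<alpha> * p0 < real CARD('n)"
  and g: "g \<in> Lp_fun p0" and rep: "represents g f"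
 shows "represents (riesz_potential \<alpha> g) (riesz_op \<alpha> f)"
proof -
 let ?n = "real CARD('n)"
 have gm: "g \<in> borel_measurable lebesgue" and gi: "integrable lebesgue (%x. cmod (g x) powr p0)" using g by (auto simp: Lp_fun_def)
 obtain h where hm[measurable]: "h \<in> borel_measurable lborel" and h0: "AE x in lborel. g x = h x"
  using completion_ex_borel_measurable_complex[OF gm] by metis
 have [measurable]: "h \<in> borel_measurable borel" using hm by simp
 have hl[measurable]: "h \<in> borel_measurable lebesgue" using hm by (intro measurable_completion) simp
 have h: "AE x in lebesgue. g x = h x" by (rule AE_completion[OF h0])
 have "integrable lebesgue (%x. cmod (h x) powr p0)"
 proof (rule iffD1[OF integrable_cong_AE gi])
  show "AE x in lebesgue. cmod (g x) powr p0 = cmod (h x) powr p0" using h by eventually_elim simp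
 qed (use gm hl in measurable)
 then have "integrable lborel (%x. cmod (h x) powr p0)" by (subst (asm) integrable_completion) auto
 then have P: "(NN y. ennreal (cmod (h y) powr p0)) < \<infinity>" by (simp add: integrable_iff_bounded)
 have fh: "f \<psi> = (LL y. h y * \<psi> y)" if \<psi>: "\<psi> \<in> schwartz" for \<psi>
 proof -
  have [measurable]: "\<psi> \<in> borel_measurable borel" by (rule schwartz_measurable[OF \<psi>])
  have [measurable]: "\<psi> \<in> borel_measurable lebesgue" by (intro measurable_completion) simp
  have "f \<psi> = (LINT y|lebesgue. g y * \<psi> y)" using rep \<psi> by (simp add: represents_def)
  also have "... = (LINT y|lebesgue. h y * \<psi> y)"
  proof (rule integral_cong_AE)
   show "AE x in lebesgue. g x * \<psi> x = h x * \<psi> x" using h by eventually_elim simp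
  qed (use gm in measurable)
  also have "... = (LL y. h y * \<psi> y)" by (rule integral_completion) measurable
  finally show ?thesis .
 qed
 have rp: "riesz_potential \<alpha> g x = (LL y. cplx (1 / norm (x - y) powr (?n - \<alpha>)) * h y)" for x
 proof -
  have [measurable]: "(%y :: real ^ 'n. cplx (1 / norm (x - y) powr (?n - \<alpha>))) \<in> borel_measurable lebesgue" by (intro measurable_completion) simp
  have "riesz_potential \<alpha> g x = (LINT y|lebesgue. cplx (1 / norm (x - y) powr (?n - \<alpha>)) * h y)" unfolding riesz_potential_def
  proof (rule integral_cong_AE)
   show "AE y in lebesgue. cplx (1 / norm (x - y) powr (?n - \<alpha>)) * g y = cplx (1 / norm (x - y) powr (?n - \<alpha>)) * h y"
    using h by eventually_elim simp
  qed (use gm in measurable)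
  also have "... = (LL y. cplx (1 / norm (x - y) powr (?n - \<alpha>)) * h y)" by (rule integral_completion) measurable
  finally show ?thesis .
 qed
 define k where "k = enn2real (riesz_const TYPE('n) \<alpha>)"
 have k: "k > 0" "ennreal k = riesz_const TYPE('n) \<alpha>" unfolding k_def by (rule riesz_const_real[OF \<alpha>])+
 show ?thesis unfolding represents_def
 proof
  fix ph :: "'n cfun" assume ph: "ph \<in> schwartz"
  have [measurable]: "ph \<in> borel_measurable borel" by (rule schwartz_measurable[OF ph])
  let ?M2 = "lborel \<Otimes>\<^sub>M lborel :: ((real ^ 'n) \<times> (real ^ 'n)) measure"
  interpret M2: sigma_finite_measure ?M2 by (intro sigma_finite_pair_measure sigma_finite_lborel)
  interpret P: pair_sigma_finite "lborel :: real measure" ?M2 ..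
  let ?G = "%t w. indicator {0<..} t *R (cplx (t powr (\<alpha> - 1)) * (h (fst w) * (mol t (fst w - snd w) * ph (snd w))))"
  have Gi: "integrable (lborel \<Otimes>\<^sub>M ?M2) (case_prod ?G)" using riesz_triple_integrable[OF \<alpha>(1) p0 _ P ph] by (simp add: split_beta')
  define K where "K = (%w. LL t. ?G t w)"
  have Ki: "integrable ?M2 K" unfolding K_def by (rule P.integrable_snd[OF Gi])
  have Ki': "integrable ?M2 (case_prod (%y x. K (y, x)))" using Ki by simp
  have Kval: "K (y, x) = cplx (k * norm (y - x) powr (\<alpha> - ?n)) * (h y * ph x)" if "y ~= x" for y x
  proof -
   let ?r = "%t. indicator {0<..} t * (t powr (\<alpha> - 1) * (theta ((y - x) /\<^sub>R t) / t ^ CARD('n)))"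
   have "(%t. ?G t (y, x)) = (%t. cplx (?r t) * (h y * ph x))" by (auto simp: mol_def indicator_def)
   then have "K (y, x) = (LL t. cplx (?r t)) * (h y * ph x)" unfolding K_def by (simp only: integral_mult_left_zero)
   moreover have "(LL t. ?r t) = k * norm (y - x) powr (\<alpha> - ?n)"
   proof -
    have "(LL t. ?r t) = enn2real (NN t. ennreal (?r t))" by (intro integral_eq_nn_integral AE_I2) (auto simp: indicator_def theta_nonneg)
    also have "(NN t. ennreal (?r t)) = (NN t. ennreal (t powr (\<alpha> - 1) * (theta ((y - x) /\<^sub>R t) / t ^ CARD('n))) * indicator {0<..} t)"
     by (intro nn_integral_cong) (auto simp: indicator_def)
    also have "... = ennreal (norm (y - x) powr (\<alpha> - ?n)) * ennreal k" unfolding k(2) using that by (intro riesz_kernel_integral) simp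
    also have "enn2real ... = k * norm (y - x) powr (\<alpha> - ?n)" using k by (simp add: enn2real_mult mult.commute)
    finally show ?thesis .
   qed
   ultimately show ?thesis by (simp only: integral_complex_of_real)
  qed
  have inner: "(LL y. K (y, x)) = cplx k * (riesz_potential \<alpha> g x * ph x)" for x
  proof -
   have Km[measurable]: "K \<in> borel_measurable (borel \<Otimes>\<^sub>M borel)" using Ki by simp
   have "(LL y. K (y, x)) = (LL y. (cplx k * ph x) * (cplx (1 / norm (x - y) powr (?n - \<alpha>)) * h y))"
   proof (rule integral_cong_AE)
    \<comment> \<open>The kernel formula excludes the diagonal, which is a single point for fixed
      \<open>x\<close>.\<close>
    show "AE y in lborel. K (y, x) = (cplx k * ph x) * (cplx (1 / norm (x - y) powr (?n - \<alpha>)) * h y)" using AE_lborel_singleton[of x]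
    proof eventually_elim
     case (elim y)
     have "norm (y - x) powr (\<alpha> - ?n) = 1 / norm (x - y) powr (?n - \<alpha>)"
      using powr_minus_divide[of "norm (x - y)" "?n - \<alpha>"] by (simp add: norm_minus_commute)
     then show ?case using Kval[OF elim] by simp
    qed
   qed measurable
   also have "... = (cplx k * ph x) * riesz_potential \<alpha> g x" unfolding rp by (rule integral_mult_right_zero)
   finally show ?thesis by simp
  qed
  have "integrable lborel (%x. LL y. K (y, x))" by (rule lborel_pair.integrable_snd[OF Ki'])
  then have "integrable lborel (%x. cplx (1 / k) * (cplx k * (riesz_potential \<alpha> g x * ph x)))" unfolding inner by (rule integrable_mult_right)
  then have Ri: "integrable lborel (%x. riesz_potential \<alpha> g x * ph x)" using k by simp
  have Rm: "(%x. riesz_potential \<alpha> g x * ph x) \<in> borel_measurable lborel" using Ri by (rule borel_measurable_integrable)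
  have "(LL t. indicator {0<..} t *R (cplx (t powr (\<alpha> - 1)) * f (moll t ph))) = (LL t. LINT w|?M2. ?G t w)"
  proof (rule integral_cong_AE)
   show m2: "(%t. LINT w|?M2. ?G t w) \<in> borel_measurable lborel" using P.integrable_fst[OF Gi] by (rule borel_measurable_integrable)
   show ae: "AE t in lborel. indicator {0<..} t *R (cplx (t powr (\<alpha> - 1)) * f (moll t ph)) = (LINT w|?M2. ?G t w)" using P.AE_integrable_fst[OF Gi]
   proof eventually_elim
    case (elim t)
    have e: "(LINT w|?M2. ?G t w) = (LL y. LL x. ?G t (y, x))" by (rule lborel_pair.integral_fst'[OF elim, symmetric])
    show ?case
    proof (cases "t > 0")
     case True
     have "(LL x. ?G t (y, x)) = cplx (t powr (\<alpha> - 1)) * (h y * moll t ph y)" for y using True by (simp add: moll_def cnv_def)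
     then have "(LINT w|?M2. ?G t w) = (LL y. cplx (t powr (\<alpha> - 1)) * (h y * moll t ph y))" unfolding e by (simp only:)
     also have "... = cplx (t powr (\<alpha> - 1)) * f (moll t ph)" unfolding fh[OF moll_schwartz[OF ph True]] by (rule integral_mult_right_zero)
     finally show ?thesis using True by simp
    qed simp
   qed
   have Gm: "(%t. LL y. h y * moll t ph y) \<in> borel_measurable borel"
   proof -
    have [measurable]: "(%w :: real \<times> (real ^ 'n) \<times> (real ^ 'n). mol (fst w) (fst (snd w) - snd (snd w))) \<in> borel_measurable (borel \<Otimes>\<^sub>M (borel \<Otimes>\<^sub>M borel))"
     unfolding mol_def[abs_def] by measurable
    have "(%w :: (real \<times> (real ^ 'n)) \<times> (real ^ 'n). (fst (fst w), snd (fst w), snd w)) \<in> ((borel \<Otimes>\<^sub>M borel) \<Otimes>\<^sub>M borel) \<rightarrow>\<^sub>M (borel \<Otimes>\<^sub>M (borel \<Otimes>\<^sub>M borel))"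
     by measurable
    from measurable_compose[OF this, of "%w. mol (fst w) (fst (snd w) - snd (snd w))"]
    have [measurable]: "(%w :: (real \<times> (real ^ 'n)) \<times> (real ^ 'n). mol (fst (fst w)) (snd (fst w) - snd w)) \<in> borel_measurable ((borel \<Otimes>\<^sub>M borel) \<Otimes>\<^sub>M borel)"
     by simp
    have "(%w :: real \<times> (real ^ 'n). LL u. mol (fst w) (snd w - u) * ph u) \<in> borel_measurable (borel \<Otimes>\<^sub>M borel)"
     by (intro lborel.borel_measurable_lebesgue_integral) (simp add: split_beta')
    then have [measurable]: "(%w :: real \<times> (real ^ 'n). moll (fst w) ph (snd w)) \<in> borel_measurable (borel \<Otimes>\<^sub>M borel)"
     by (simp add: moll_def cnv_def)
    show ?thesis by (intro lborel.borel_measurable_lebesgue_integral) (simp add: split_beta')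
   qed
   have "(%t. indicator {0<..} t *R (cplx (t powr (\<alpha> - 1)) * f (moll t ph))) =
    (%t. indicator {0<..} t *R (cplx (t powr (\<alpha> - 1)) * (LL y. h y * moll t ph y)))"
   proof
    fix t :: real
    show "indicator {0<..} t *R (cplx (t powr (\<alpha> - 1)) * f (moll t ph)) =
     indicator {0<..} t *R (cplx (t powr (\<alpha> - 1)) * (LL y. h y * moll t ph y))" by (cases "t > 0") (simp_all add: fh[OF moll_schwartz[OF ph]])
   qed
   then show "(%t. indicator {0<..} t *R (cplx (t powr (\<alpha> - 1)) * f (moll t ph))) \<in> borel_measurable lborel" using Gm by simp
  qed
  also have "... = (LINT w|?M2. K w)" unfolding K_def by (rule P.Fubini_integral[OF Gi, symmetric])
  also have "... = (LL x. LL y. K (y, x))" using lborel_pair.integral_snd[OF Ki'] by simp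
  also have "... = cplx k * (LL x. riesz_potential \<alpha> g x * ph x)" unfolding inner by (rule integral_mult_right_zero)
  finally have "riesz_op \<alpha> f ph = (LL x. riesz_potential \<alpha> g x * ph x)" using k ph by (simp add: riesz_op_def k_def[symmetric])
  then show "integrable lebesgue (%x. riesz_potential \<alpha> g x * ph x) \<and> riesz_op \<alpha> f ph = (LINT x|lebesgue. riesz_potential \<alpha> g x * ph x)"
   using Ri Rm by (simp add: integrable_completion integral_completion)
 qed
qed

section \<open>Distributions and parameter integrals\<close>

text \<open>Modulus for the dependence of a test function on a parameter: Lipschitz for close
  parameters, bounded for distant ones, with a polynomial growth that the weight of the integral has
  to beat.\<close>

definition gauge :: "nat => 'a::real_normed_vector => 'a => real" where
 "gauge j u v = (1 + norm u) ^ j * (1 + norm v) ^ j * min 1 (norm (u - v))"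

lemma gauge_nonneg: "gauge j u v >= 0" by (simp add: gauge_def)

lemma gauge_dominated:
 assumes "norm v <= 2 * norm u"
 shows "gauge j v u <= 2 ^ j * (1 + norm u) ^ (2 * j)"
proof -
 have "(1 + norm v) ^ j <= 2 ^ j * (1 + norm u) ^ j" using assms by (intro power_le_scaled) auto
 then have "(1 + norm v) ^ j * (1 + norm u) ^ j <= 2 ^ j * (1 + norm u) ^ j * (1 + norm u) ^ j" by (rule mult_right_mono) auto
 then have "(1 + norm v) ^ j * (1 + norm u) ^ j * min 1 (norm (v - u)) <= (2 ^ j * (1 + norm u) ^ j * (1 + norm u) ^ j) * 1" by (rule mult_mono) auto
 then show ?thesis unfolding gauge_def by (simp add: mult_2 power_add mult.assoc)
qed

lemma gauge_bounded_continuous: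
 fixes g :: "'a::real_normed_vector => complex"
 assumes "!!u v :: 'a. cmod (g u - g v) <= B * gauge j u v"
 shows "continuous_on UNIV g"
proof (intro continuous_at_imp_continuous_on ballI)
 fix u :: 'a
 have "((%v. B * gauge j v u) \<longlongrightarrow> B * gauge j u u) (at u)" unfolding gauge_def by (intro tendsto_intros)
 then have "((%v. B * gauge j v u) \<longlongrightarrow> 0) (at u)" by (simp add: gauge_def)
 then have "((%v. g v - g u) \<longlongrightarrow> 0) (at u)" by (rule Lim_null_comparison[rotated]) (simp add: assms)
 then show "isCont g u" unfolding isCont_def by (simp add: LIM_zero_iff)
qed

text \<open>Replacing the parameter by a simple function turns the integral into a finite sum, with
  an error that depends on \<open>g\<close> through \<open>B\<close> and \<open>j\<close> alone. The
  same estimate thus serves the scalar function f (k u) and each derivative of k u at a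
  point.\<close>

lemma gauge_simple_approx:
 fixes g w :: "'a::euclidean_space => complex"
 assumes g: "!!u v :: 'a. cmod (g u - g v) <= B * gauge j u v" and B: "B >= 0"
  and w: "w \<in> borel_measurable borel" "integrable lborel (%u. (1 + norm u) ^ (2 * j) * cmod (w u))"
  and F: "simple_function lborel F" "!!u. norm (F u) <= 2 * norm u"
 shows "integrable lborel (%u. g u * w u)"
  and "cmod ((\<Sum>c\<in>range F. g c * (LL u. indicator {u. F u = c} u *R w u)) - (LL u. g u * w u)) <= B * (LL u. gauge j (F u) u * cmod (w u))"
proof -
 note [measurable] = w(1)
 have [measurable]: "g \<in> borel_measurable borel" by (intro borel_measurable_continuous_onI gauge_bounded_continuous[OF g])
 have [measurable]: "F \<in> borel_measurable borel" using borel_measurable_simple_function[OF F(1)] by simp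
 have fin: "finite (range F)" using simple_functionD(1)[OF F(1)] by simp
 have w0: "integrable lborel w"
 proof (rule Bochner_Integration.integrable_bound[OF w(2)])
  have "1 * cmod (w u) <= (1 + norm u) ^ (2 * j) * cmod (w u)" for u by (intro mult_right_mono one_le_power) auto
  then show "AE u in lborel. norm (w u) <= norm ((1 + norm u) ^ (2 * j) * cmod (w u))" by simp
 qed simp
 have gb: "cmod (g u) <= (cmod (g 0) + B) * (1 + norm u) ^ (2 * j)" for u
 proof -
  have 1: "1 <= (1 + norm u) ^ (2 * j)" by (intro one_le_power) auto
  have "gauge j u 0 <= (1 + norm u) ^ j * 1" unfolding gauge_def by (intro mult_mono) auto
  also have "... <= (1 + norm u) ^ (2 * j)" using power_increasing[of j "2 * j" "1 + norm u"] by simp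
  finally have "B * gauge j u 0 <= B * (1 + norm u) ^ (2 * j)" using B by (intro mult_left_mono)
  moreover have "cmod (g 0) * 1 <= cmod (g 0) * (1 + norm u) ^ (2 * j)" using 1 by (intro mult_left_mono) auto
  moreover have "cmod (g u) <= cmod (g 0) + B * gauge j u 0" using g[of u 0] norm_triangle_sub[of "g u" "g 0"] by linarith
  ultimately show ?thesis by (simp add: distrib_right)
 qed
 show gi: "integrable lborel (%u. g u * w u)"
 proof (rule Bochner_Integration.integrable_bound)
  show "integrable lborel (%u. (cmod (g 0) + B) * ((1 + norm u) ^ (2 * j) * cmod (w u)))" using w(2) by simp
  show "AE u in lborel. norm (g u * w u) <= norm ((cmod (g 0) + B) * ((1 + norm u) ^ (2 * j) * cmod (w u)))"
   using gb B by (intro AE_I2) (simp add: norm_mult mult_right_mono flip: mult.assoc)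
 qed measurable
 have ii: "integrable lborel (%u. indicator {u. F u = c} u *R w u)" for c by (rule Bochner_Integration.integrable_bound[OF w0]) (auto simp: indicator_def)
 have s: "(\<Sum>c\<in>range F. g c * (indicator {u. F u = c} u *R w u)) = g (F u) * w u" for u
 proof -
  have "(\<Sum>c\<in>range F. g c * (indicator {u. F u = c} u *R w u)) = (\<Sum>c\<in>range F. if c = F u then g c * w u else 0)"
   by (intro sum.cong) (auto simp: indicator_def)
  then show ?thesis using fin by simp
 qed
 have si: "integrable lborel (%u. g (F u) * w u)" unfolding s[symmetric] by (intro Bochner_Integration.integrable_sum integrable_mult_right ii)
 have "(\<Sum>c\<in>range F. g c * (LL u. indicator {u. F u = c} u *R w u)) = (LL u. g (F u) * w u)"
 proof -
  have "(LL u. g (F u) * w u) = (\<Sum>c\<in>range F. LL u. g c * (indicator {u. F u = c} u *R w u))"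
   unfolding s[symmetric] by (rule Bochner_Integration.integral_sum) (intro integrable_mult_right ii)
  then show ?thesis by (simp only: integral_mult_right_zero)
 qed
 then have "(\<Sum>c\<in>range F. g c * (LL u. indicator {u. F u = c} u *R w u)) - (LL u. g u * w u) = (LL u. (g (F u) - g u) * w u)"
  using gi si by (simp add: left_diff_distrib)
 also have "cmod ... <= (LL u. B * (gauge j (F u) u * cmod (w u)))"
 proof (rule LINT_norm_bound)
  show "integrable lborel (%u. (g (F u) - g u) * w u)" unfolding left_diff_distrib using gi si by simp
  show "integrable lborel (%u. B * (gauge j (F u) u * cmod (w u)))"
  proof (rule integrable_mult_right, rule Bochner_Integration.integrable_bound)
   show "integrable lborel (%u. 2 ^ j * ((1 + norm u) ^ (2 * j) * cmod (w u)))" using w(2) by simp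
   show "AE u in lborel. norm (gauge j (F u) u * cmod (w u)) <= norm (2 ^ j * ((1 + norm u) ^ (2 * j) * cmod (w u)))"
    using gauge_dominated[OF F(2)] by (intro AE_I2) (simp add: abs_mult mult_right_mono gauge_nonneg flip: mult.assoc)
  qed (simp add: gauge_def)
  show "norm ((g (F u) - g u) * w u) <= B * (gauge j (F u) u * cmod (w u))" for u using g[of "F u" u] by (simp add: norm_mult mult_right_mono flip: mult.assoc)
 qed
 finally show "cmod ((\<Sum>c\<in>range F. g c * (LL u. indicator {u. F u = c} u *R w u)) - (LL u. g u * w u)) <= B * (LL u. gauge j (F u) u * cmod (w u))"
  by simp
qed

text \<open>Interchanges \<open>f\<close> with an integral over a parameter. The finite sums
  \<open>S\<close> converge to \<open>K\<close> in the seminorm that controls \<open>f\<close>,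
  while their values f S converge to the integral of f (k u) * w u; both errors are governed by the
  same \<open>D i\<close>.\<close>

lemma tempered_integral:
 fixes k :: "real ^ 'n::finite => 'n cfun" and w :: "'n cfun"
 assumes f: "f \<in> tempered" and k: "!!u. k u \<in> schwartz" and K: "K \<in> schwartz"
  and lip: "!!M. \<exists>B j. B >= 0 \<and> integrable lborel (%u. (1 + norm u) ^ (2 * j) * cmod (w u)) \<and>
   (\<forall>is u v (y :: real ^ 'n). length is <= M --> (1 + norm y) ^ M * cmod (Dl is (k u) y - Dl is (k v) y) <= B * gauge j u v)"
  and w: "w \<in> borel_measurable borel"
  and DK: "!!is (y :: real ^ 'n). Dl is K y = (LL u. Dl is (k u) y * w u)"
 shows "integrable lborel (%u. f (k u) * w u)" and "f K = (LL u. f (k u) * w u)"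
  and "continuous_on UNIV (%u. f (k u))"
proof -
 obtain M C where C: "C >= 0"
  "!!ph B. ph \<in> schwartz ==> (!!is x. length is <= M ==> (1 + norm x) ^ M * cmod (Dl is ph x) <= B) ==> cmod (f ph) <= C * B"
  using tempered_bound[OF f] by metis
 obtain B j where B: "B >= 0" "integrable lborel (%u. (1 + norm u) ^ (2 * j) * cmod (w u))"
  and lip': "!!is u v (y :: real ^ 'n). length is <= M ==> (1 + norm y) ^ M * cmod (Dl is (k u) y - Dl is (k v) y) <= B * gauge j u v" using lip[of M] by auto
 have fk: "cmod (f (k u) - f (k v)) <= (C * B) * gauge j u v" for u v
 proof -
  have "cmod (f (%y. k u y - k v y)) <= C * (B * gauge j u v)" using lip' k by (intro C(2) schwartz_diff) (auto simp: Dl_diff schwartz_smooth)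
  then show ?thesis using k by (simp add: tempered_diff[OF f] mult.assoc)
 qed
 show "continuous_on UNIV (%u. f (k u))" by (rule gauge_bounded_continuous[OF fk])
 have CB: "C * B >= 0" using C B by simp
 obtain F where F: "!!i. simple_function lborel (F i)" "!!u. (%i. F i u) \<longlonglongrightarrow> u" "!!i u. norm (F i u) <= 2 * norm (u :: real ^ 'n)"
  using borel_measurable_implies_sequence_metric[of "%u :: real ^ 'n. u" lborel 0] by auto
 show "integrable lborel (%u. f (k u) * w u)" by (rule gauge_simple_approx(1)[OF fk CB w B(2) F(1,3)])
 have [measurable]: "F i \<in> borel_measurable borel" for i using borel_measurable_simple_function[OF F(1)] by simp
 note [measurable] = w
 define D where "D = (%i. LL u. gauge j (F i u) u * cmod (w u))"
 have "D \<longlonglongrightarrow> (LINT u|(lborel :: (real ^ 'n) measure). 0)" unfolding D_def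
 proof (rule integral_dominated_convergence)
  show "integrable lborel (%u. 2 ^ j * ((1 + norm u) ^ (2 * j) * cmod (w u)))" using B(2) by simp
  show "AE u in lborel. (%i. gauge j (F i u) u * cmod (w u)) \<longlonglongrightarrow> 0"
  proof (rule AE_I2)
   fix u
   have "(%i. gauge j (F i u) u * cmod (w u)) \<longlonglongrightarrow> gauge j u u * cmod (w u)" unfolding gauge_def by (intro tendsto_intros F)
   then show "(%i. gauge j (F i u) u * cmod (w u)) \<longlonglongrightarrow> 0" by (simp add: gauge_def)
  qed
  show "AE u in lborel. norm (gauge j (F i u) u * cmod (w u)) <= 2 ^ j * ((1 + norm u) ^ (2 * j) * cmod (w u))" for i
   using gauge_dominated[OF F(3)] by (intro AE_I2) (simp add: abs_mult mult_right_mono gauge_nonneg flip: mult.assoc)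
 qed (simp_all add: gauge_def)
 then have D0: "D \<longlonglongrightarrow> 0" by simp
 have Dn: "D i >= 0" for i unfolding D_def by (intro integral_nonneg_AE) (auto simp: gauge_nonneg)
 have key: "cmod (f K - (LL u. f (k u) * w u)) <= 2 * (C * B) * D i" for i
 proof -
  define W where "W = (%c. LL u. indicator {u. F i u = c} u *R w u)"
  have fin: "finite (range (F i))" using simple_functionD(1)[OF F(1)[of i]] by simp
  define S where "S = (%y. \<Sum>c\<in>range (F i). W c * k c y)"
  have S: "S \<in> schwartz" unfolding S_def by (intro schwartz_sum schwartz_cmult k)
  have fS: "f S = (\<Sum>c\<in>range (F i). f (k c) * W c)"
   unfolding S_def by (subst tempered_sum[OF f]) (auto simp: tempered_cmult[OF f] k schwartz_cmult mult.commute)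
  have 1: "cmod (f S - (LL u. f (k u) * w u)) <= (C * B) * D i" unfolding fS W_def D_def by (rule gauge_simple_approx(2)[OF fk CB w B(2) F(1,3)])
  have "cmod (f (%y. S y - K y)) <= C * (B * D i)"
  proof (rule C(2)[OF schwartz_diff[OF S K]])
   fix "is" :: "'n list" and y :: "real ^ 'n" assume l: "length is <= M"
   have p: "(1 + norm y) ^ M > 0" by (intro zero_less_power) (auto intro: add_pos_nonneg)
   have g: "cmod (Dl is (k u) y - Dl is (k v) y) <= (B / (1 + norm y) ^ M) * gauge j u v" for u v using lip'[OF l, of y u v] p by (simp add: field_simps)
   have "Dl is S y = (\<Sum>c\<in>range (F i). Dl is (k c) y * W c)"
    unfolding S_def using fin by (simp add: Dl_sum smooth_cmult schwartz_smooth k Dl_cmult mult.commute)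
   then have "Dl is (%y. S y - K y) y = (\<Sum>c\<in>range (F i). Dl is (k c) y * W c) - (LL u. Dl is (k u) y * w u)"
    using S K by (simp add: Dl_diff schwartz_smooth DK)
   also have "cmod ... <= (B / (1 + norm y) ^ M) * D i" unfolding W_def D_def by (rule gauge_simple_approx(2)[OF g _ w B(2) F(1,3)]) (use B p in simp)
   finally show "(1 + norm y) ^ M * cmod (Dl is (%y. S y - K y) y) <= B * D i" using p by (simp add: field_simps)
  qed
  then have 2: "cmod (f S - f K) <= (C * B) * D i" using S K by (simp add: tempered_diff[OF f] mult.assoc)
  have "f K - (LL u. f (k u) * w u) = (f S - (LL u. f (k u) * w u)) - (f S - f K)" by simp
  then show ?thesis using 1 2 norm_triangle_ineq4[of "f S - (LL u. f (k u) * w u)" "f S - f K"] by simp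
 qed
 have "(%i. 2 * (C * B) * D i) \<longlonglongrightarrow> 2 * (C * B) * 0" by (intro tendsto_intros D0)
 then have "cmod (f K - (LL u. f (k u) * w u)) <= 2 * (C * B) * 0" by (rule LIMSEQ_le_const) (use key in auto)
 then show "f K = (LL u. f (k u) * w u)" by simp
qed

lemma smooth_shift: "smooth K ==> smooth (%y. K (y - u))" for K :: "'n::finite cfun" using smooth_affine[of K "- u" 1] by simp

lemma ubd_shift: "ubd K ==> ubd (%y. K (y - u))" for K :: "'n::finite cfun" using ubd_affine[of K "- u" 1] by simp

lemma schwartz_shift: "K \<in> schwartz ==> (%y. K (y - u)) \<in> schwartz" for K :: "'n::finite cfun" using schwartz_affine[of K 1 "- u"] by simp

lemma Dl_shift: "smooth K ==> Dl is (%y. K (y - u)) = (%y. Dl is K (y - u))" for K :: "'n::finite cfun" using Dl_affine[of K "is" "- u" 1] by simp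

lemma Dl_mult_cnv:
 fixes \<rho> K w :: "'n::finite cfun"
 assumes w: "integrable lborel w" and "ubd \<rho>" "ubd K"
 shows "integrable lborel (%u. Dl is (%y. \<rho> y * K (y - u)) y * w u) \<and>
  Dl is (%y. \<rho> y * cnv K w y) y = (LL u. Dl is (%y. \<rho> y * K (y - u)) y * w u)" using assms(2,3)
proof (induction "is" arbitrary: \<rho> K rule: rev_induct)
 case Nil
 have "integrable lborel (%u. \<rho> y * (K (y - u) * w u))" by (intro integrable_mult_right cnv_integrable Nil w)
 moreover have "\<rho> y * cnv K w y = (LL u. \<rho> y * (K (y - u) * w u))" unfolding cnv_def by (rule integral_mult_right_zero[symmetric])
 ultimately show ?case by (simp add: mult.assoc)
next
 case (snoc i "is")
 have s: "smooth \<rho>" "smooth K" using snoc.prems ubd_smooth by auto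
 have 1: "Dl (is @ [i]) (%y. \<rho> y * K (y - u)) =
   (%y. Dl is (%y. coord_deriv i \<rho> y * K (y - u)) y + Dl is (%y. \<rho> y * coord_deriv i K (y - u)) y)" for u
 proof -
  have e: "coord_deriv i (%y. K (y - u)) = (%y. coord_deriv i K (y - u))" using Dl_shift[OF s(2), of "[i]" u] by simp
  show ?thesis unfolding Dl_snoc coord_deriv_mult[OF s(1) smooth_shift[OF s(2)]] e by (rule Dl_add) (intro smooth_mult smooth_coord_deriv smooth_shift s)+
 qed
 have sc: "smooth (cnv K w)" by (rule smooth_cnv[OF snoc.prems(2) w])
 have 2: "Dl (is @ [i]) (%y. \<rho> y * cnv K w y) =
   (%y. Dl is (%y. coord_deriv i \<rho> y * cnv K w y) y + Dl is (%y. \<rho> y * cnv (coord_deriv i K) w y) y)"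
  unfolding Dl_snoc coord_deriv_mult[OF s(1) sc] coord_deriv_cnv[OF snoc.prems(2) w]
  by (rule Dl_add) (intro smooth_mult smooth_coord_deriv s smooth_cnv ubd_coord_deriv snoc.prems w)+
 have A: "integrable lborel (%u. Dl is (%y. coord_deriv i \<rho> y * K (y - u)) y * w u)"
   "Dl is (%y. coord_deriv i \<rho> y * cnv K w y) y = (LL u. Dl is (%y. coord_deriv i \<rho> y * K (y - u)) y * w u)"
  using snoc.IH[OF ubd_coord_deriv[OF snoc.prems(1), of i] snoc.prems(2)] by auto
 have B: "integrable lborel (%u. Dl is (%y. \<rho> y * coord_deriv i K (y - u)) y * w u)"
   "Dl is (%y. \<rho> y * cnv (coord_deriv i K) w y) y = (LL u. Dl is (%y. \<rho> y * coord_deriv i K (y - u)) y * w u)"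
  using snoc.IH[OF snoc.prems(1) ubd_coord_deriv[OF snoc.prems(2), of i]] by auto
 show ?case unfolding 1 2 A(2) B(2) distrib_right using A(1) B(1) by simp
qed

lemma ubd_lipschitz:
 fixes K :: "'n::finite cfun"
 assumes "ubd K"
 obtains L where "L >= 0" "!!is a b. length is <= M ==> cmod (Dl is K a - Dl is K b) <= L * min 1 (norm (a - b))"
proof -
 obtain B where B: "B >= 0" "!!is x. length is <= Suc M ==> cmod (Dl is K x) <= B" using ubd_boundE[OF assms, of "Suc M"] by metis
 define L where "L = CARD('n) * B + 2 * B"
 have "cmod (Dl is K a - Dl is K b) <= L * min 1 (norm (a - b))" if l: "length is <= M" for "is" a b
 proof (cases "norm (a - b) <= 1")
  case True
  have "cmod (Dl is K a - Dl is K b) <= CARD('n) * B * norm (a - b)"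
  proof (rule smooth_lipschitz_on[where S=UNIV])
   fix i x show "cmod (coord_deriv i (Dl is K) x) <= B" using B(2)[of "i # is" x] l by simp
  qed (use assms in \<open>auto intro: smooth_Dl ubd_smooth\<close>)
  also have "... <= L * norm (a - b)" using B(1) by (intro mult_right_mono) (auto simp: L_def)
  finally show ?thesis using True by (simp add: min_absorb2)
 next
  case False
  have "cmod (Dl is K a - Dl is K b) <= B + B" using norm_triangle_ineq4[of "Dl is K a" "Dl is K b"] B(2)[of "is" a] B(2)[of "is" b] l by linarith
  also have "... <= L * 1" using B(1) by (simp add: L_def)
  finally show ?thesis using False by (simp add: min_absorb1)
 qed
 moreover have "L >= 0" using B(1) by (simp add: L_def)
 ultimately show ?thesis using that by blast
qed

lemma Dl_mult_shift_diff:
 fixes \<rho> K :: "'n::finite cfun"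
 assumes "ubd \<rho>" "ubd K" "length is <= M"
  and A: "!!js. length js <= M ==> cmod (Dl js \<rho> y) <= A" and A0: "A >= 0"
  and L: "!!js. length js <= M ==> cmod (Dl js K (y - u) - Dl js K (y - v)) <= L"
 shows "cmod (Dl is (%y. \<rho> y * K (y - u)) y - Dl is (%y. \<rho> y * K (y - v)) y) <= 2 ^ M * (A * L)"
proof -
 have s: "smooth \<rho>" "smooth K" using assms ubd_smooth by auto
 have L0: "L >= 0" by (rule order_trans[OF norm_ge_zero L[of "[]"]]) simp
 have e: "(%y. \<rho> y * (K (y - u) - K (y - v))) = (%y. \<rho> y * K (y - u) - \<rho> y * K (y - v))" by (simp add: right_diff_distrib)
 have "Dl is (%y. \<rho> y * K (y - u)) y - Dl is (%y. \<rho> y * K (y - v)) y = Dl is (%y. \<rho> y * (K (y - u) - K (y - v))) y"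
  unfolding e by (subst Dl_diff) (intro smooth_mult smooth_shift s refl)+
 also have "cmod ... <= 2 ^ length is * (A * L)"
 proof (rule Dl_mult_le)
  fix js ks :: "'n list" assume l: "length js + length ks = length is"
  have "Dl ks (%y. K (y - u) - K (y - v)) y = Dl ks K (y - u) - Dl ks K (y - v)" by (simp add: Dl_diff smooth_shift Dl_shift s)
  then show "cmod (Dl js \<rho> y) * cmod (Dl ks (%y. K (y - u) - K (y - v)) y) <= A * L" using A[of js] L[of ks] l assms(3) A0 by (auto intro!: mult_mono)
 qed (intro smooth_diff smooth_shift s)+
 also have "... <= 2 ^ M * (A * L)" using assms(3) A0 L0 by (intro mult_right_mono power_increasing) auto
 finally show ?thesis .
qed

text \<open>Exhibits the density of ph \<mapsto> f (\<rho> moll t ph). As \<rho> need not decay,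
  decay in y comes from the compact support of the mollifier around u or v, and is paid for by the
  growth in \<open>gauge M\<close>.\<close>

lemma tempered_moll:
 fixes \<rho> ph :: "'n::finite cfun"
 assumes f: "f \<in> tempered" and \<rho>: "ubd \<rho>" and ph: "ph \<in> schwartz" and t: "t > 0"
 shows "integrable lborel (%u. f (%y. \<rho> y * mol t (y - u)) * ph u)"
  and "f (%y. \<rho> y * moll t ph y) = (LL u. f (%y. \<rho> y * mol t (y - u)) * ph u)"
  and "continuous_on UNIV (%u. f (%y. \<rho> y * mol t (y - u)))"
proof -
 have K: "mol t \<in> (schwartz :: ('n cfun) set)" by (rule mol_schwartz[OF t])
 have k: "(%y. \<rho> y * mol t (y - u)) \<in> schwartz" for u by (intro schwartz_mult_ubd \<rho> schwartz_shift K)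
 have KK: "(%y. \<rho> y * moll t ph y) \<in> schwartz" by (intro schwartz_mult_ubd \<rho> moll_schwartz ph t)
 have DK: "Dl is (%y. \<rho> y * moll t ph y) y = (LL u. Dl is (%y. \<rho> y * mol t (y - u)) y * ph u)" for "is" y
  unfolding moll_def using Dl_mult_cnv[OF schwartz_integrable0[OF ph] \<rho> schwartz_ubd[OF K]] by blast
 have lip: "\<exists>B j. B >= 0 \<and> integrable lborel (%u. (1 + norm u) ^ (2 * j) * cmod (ph u)) \<and>
   (\<forall>is u v y. length is <= M --> (1 + norm y) ^ M * cmod (Dl is (%y. \<rho> y * mol t (y - u)) y - Dl is (%y. \<rho> y * mol t (y - v)) y) <= B * gauge j u v)" for M
 proof -
  obtain A where A: "A >= 0" "!!is x. length is <= M ==> cmod (Dl is \<rho> x) <= A" using ubd_boundE[OF \<rho>, of M] by metis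
  obtain L where L: "L >= 0" "!!is (a :: real ^ 'n) b. length is <= M ==> cmod (Dl is (mol t) a - Dl is (mol t) b) <= L * min 1 (norm (a - b))"
   using ubd_lipschitz[OF schwartz_ubd[OF K], of M] by metis
  define B where "B = (1 + t) ^ M * (2 ^ M * (A * L))"
  have "(1 + norm y) ^ M * cmod (Dl is (%y. \<rho> y * mol t (y - u)) y - Dl is (%y. \<rho> y * mol t (y - v)) y) <= B * gauge M u v"
   if l: "length is <= M" for "is" u v y
  proof (cases "norm (y - u) <= t \<or> norm (y - v) <= t")
   case True
   have "1 + norm y <= (1 + t) * ((1 + norm u) * (1 + norm v))"
   proof -
    have "norm y <= t + (norm u + norm v)" using True norm_triangle_sub[of y u] norm_triangle_sub[of y v] norm_ge_zero[of u] norm_ge_zero[of v] by linarith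
    moreover have "(1 + norm u) * (1 + norm v) >= 1 + norm u + norm v" by (simp add: algebra_simps)
    moreover have "t * ((1 + norm u) * (1 + norm v)) >= t * 1" using t mult_mono[of 1 "1 + norm u" 1 "1 + norm v"] by (intro mult_left_mono) auto
    ultimately show ?thesis by (simp add: distrib_right)
   qed
   then have "(1 + norm y) ^ M <= (1 + t) ^ M * ((1 + norm u) * (1 + norm v)) ^ M" by (intro power_le_scaled) auto
   then have 1: "(1 + norm y) ^ M <= (1 + t) ^ M * ((1 + norm u) ^ M * (1 + norm v) ^ M)" by (simp add: power_mult_distrib)
   have "cmod (Dl is (%y. \<rho> y * mol t (y - u)) y - Dl is (%y. \<rho> y * mol t (y - v)) y) <= 2 ^ M * (A * (L * min 1 (norm (u - v))))"
   proof (rule Dl_mult_shift_diff[OF \<rho> schwartz_ubd[OF K] l A(2) A(1)])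
    fix js :: "'n list" assume "length js <= M"
    then show "cmod (Dl js (mol t) (y - u) - Dl js (mol t) (y - v)) <= L * min 1 (norm (u - v))"
     using L(2)[of js "y - u" "y - v"] by (simp add: norm_minus_commute)
   qed
   then have "(1 + norm y) ^ M * cmod (Dl is (%y. \<rho> y * mol t (y - u)) y - Dl is (%y. \<rho> y * mol t (y - v)) y) <=
    ((1 + t) ^ M * ((1 + norm u) ^ M * (1 + norm v) ^ M)) * (2 ^ M * (A * (L * min 1 (norm (u - v)))))" using 1 t by (intro mult_mono) auto
   then show ?thesis by (simp add: B_def gauge_def mult_ac)
  next
   case False
   have z: "Dl is (%y. \<rho> y * mol t (y - u)) y = 0" if "norm (y - u) > t" for u
   proof (rule Dl_eq_0_open[of "{y. norm (y - u) > t}"])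
    show "open {y. norm (y - u) > t}" by (intro open_Collect_less continuous_intros)
   qed (use that t in \<open>auto intro: mol_eq_0\<close>)
   show ?thesis using False z A(1) L(1) t by (simp add: B_def gauge_nonneg)
  qed
  moreover have "B >= 0" using A(1) L(1) t by (simp add: B_def)
  moreover have "integrable lborel (%u. (1 + norm u) ^ (2 * M) * cmod (ph u))" using schwartz_integrable[OF ph, of "2 * M" "[]"] by simp
  ultimately show ?thesis by blast
 qed
 note T = tempered_integral[OF f k KK lip schwartz_measurable[OF ph] DK]
 show "integrable lborel (%u. f (%y. \<rho> y * mol t (y - u)) * ph u)"
  and "f (%y. \<rho> y * moll t ph y) = (LL u. f (%y. \<rho> y * mol t (y - u)) * ph u)"
  and "continuous_on UNIV (%u. f (%y. \<rho> y * mol t (y - u)))" by (rule T)+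
qed

text \<open>Here the decay in y comes from \<rho>, so the parameter needs no growth and
  \<open>gauge 0\<close> is enough. With a mollifier for \<open>K\<close> and an indicator for
  \<open>w\<close> it splits a test function into localized ones.\<close>

lemma tempered_partition:
 fixes \<rho> K w :: "'n::finite cfun"
 assumes f: "f \<in> tempered" and \<rho>: "\<rho> \<in> schwartz" and K: "ubd K" and w: "integrable lborel w"
 shows "integrable lborel (%u. f (%y. \<rho> y * K (y - u)) * w u)"
  and "f (%y. \<rho> y * cnv K w y) = (LL u. f (%y. \<rho> y * K (y - u)) * w u)"
proof -
 have comm: "(%y. \<rho> y * g y) \<in> schwartz" if "ubd g" for g using schwartz_mult_ubd[OF that \<rho>] by (simp add: mult.commute)
 have k: "(%y. \<rho> y * K (y - u)) \<in> schwartz" for u by (intro comm ubd_shift K)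
 have KK: "(%y. \<rho> y * cnv K w y) \<in> schwartz" by (intro comm ubd_cnv K w)
 have DK: "Dl is (%y. \<rho> y * cnv K w y) y = (LL u. Dl is (%y. \<rho> y * K (y - u)) y * w u)" for "is" y
  using Dl_mult_cnv[OF w schwartz_ubd[OF \<rho>] K] by blast
 have lip: "\<exists>B j. B >= 0 \<and> integrable lborel (%u. (1 + norm u) ^ (2 * j) * cmod (w u)) \<and>
   (\<forall>is u v y. length is <= M --> (1 + norm y) ^ M * cmod (Dl is (%y. \<rho> y * K (y - u)) y - Dl is (%y. \<rho> y * K (y - v)) y) <= B * gauge j u v)" for M
 proof -
  obtain A where A: "A >= 0" "!!is x. length is <= M ==> (1 + norm x) ^ M * cmod (Dl is \<rho> x) <= A" using schwartz_boundE[OF \<rho>, of M M] by metis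
  obtain L where L: "L >= 0" "!!is (a :: real ^ 'n) b. length is <= M ==> cmod (Dl is K a - Dl is K b) <= L * min 1 (norm (a - b))"
   using ubd_lipschitz[OF K, of M] by metis
  have "(1 + norm y) ^ M * cmod (Dl is (%y. \<rho> y * K (y - u)) y - Dl is (%y. \<rho> y * K (y - v)) y) <= (2 ^ M * (A * L)) * gauge 0 u v"
   if l: "length is <= M" for "is" u v y
  proof -
   have p: "(1 + norm y) ^ M > 0" by (intro zero_less_power) (auto intro: add_pos_nonneg)
   have "cmod (Dl is (%y. \<rho> y * K (y - u)) y - Dl is (%y. \<rho> y * K (y - v)) y) <= 2 ^ M * (A / (1 + norm y) ^ M * (L * min 1 (norm (u - v))))"
   proof (rule Dl_mult_shift_diff[OF schwartz_ubd[OF \<rho>] K l])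
    fix js :: "'n list" assume j: "length js <= M"
    show "cmod (Dl js \<rho> y) <= A / (1 + norm y) ^ M" using A(2)[OF j, of y] p by (simp add: field_simps)
    show "cmod (Dl js K (y - u) - Dl js K (y - v)) <= L * min 1 (norm (u - v))" using L(2)[OF j, of "y - u" "y - v"] by (simp add: norm_minus_commute)
   qed (use A p in simp)
   then have "(1 + norm y) ^ M * cmod (Dl is (%y. \<rho> y * K (y - u)) y - Dl is (%y. \<rho> y * K (y - v)) y) <=
    (1 + norm y) ^ M * (2 ^ M * (A / (1 + norm y) ^ M * (L * min 1 (norm (u - v)))))" using p by (intro mult_left_mono) auto
   also have "... = (2 ^ M * (A * L)) * gauge 0 u v" using p by (simp add: gauge_def del: power_eq_0_iff)
   finally show ?thesis .
  qed
  moreover have "2 ^ M * (A * L) >= 0" using A(1) L(1) by simp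
  moreover have "integrable lborel (%u. (1 + norm u) ^ (2 * 0) * cmod (w u))" using w by simp
  ultimately show ?thesis by blast
 qed
 have wm: "w \<in> borel_measurable borel" using w by simp
 note T = tempered_integral[OF f k KK lip wm DK]
 show "integrable lborel (%u. f (%y. \<rho> y * K (y - u)) * w u)"
  and "f (%y. \<rho> y * cnv K w y) = (LL u. f (%y. \<rho> y * K (y - u)) * w u)" by (rule T)+
qed

section \<open>Higher order smoothing\<close>

definition fdiff :: "'a::real_vector => ('a => complex) => 'a => complex" where
 "fdiff h ph = (%y. ph y - ph (y - h))"

lemma alternating_binomial_sum:
 fixes a :: "nat => complex"
 shows "(\<Sum>j\<le>Suc L. (- 1) ^ j * of_nat (Suc L choose j) * a j) = (\<Sum>j\<le>L. (- 1) ^ j * of_nat (L choose j) * (a j - a (Suc j)))"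
proof -
 let ?c = "%L j. (- 1) ^ j * of_nat (L choose j) :: complex"
 have "(\<Sum>j\<le>Suc L. ?c (Suc L) j * a j) = a 0 + (\<Sum>j\<le>L. ?c (Suc L) (Suc j) * a (Suc j))" by (subst sum.atMost_Suc_shift) simp
 also have "(\<Sum>j\<le>L. ?c (Suc L) (Suc j) * a (Suc j)) = (\<Sum>j\<le>L. ?c L (Suc j) * a (Suc j) - ?c L j * a (Suc j))"
  by (intro sum.cong refl) (simp add: algebra_simps)
 also have "... = (\<Sum>j\<le>L. ?c L (Suc j) * a (Suc j)) - (\<Sum>j\<le>L. ?c L j * a (Suc j))" by (rule sum_subtractf)
 also have "a 0 + ((\<Sum>j\<le>L. ?c L (Suc j) * a (Suc j)) - (\<Sum>j\<le>L. ?c L j * a (Suc j))) =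
   (a 0 + (\<Sum>j\<le>L. ?c L (Suc j) * a (Suc j))) - (\<Sum>j\<le>L. ?c L j * a (Suc j))" by simp
 also have "a 0 + (\<Sum>j\<le>L. ?c L (Suc j) * a (Suc j)) = (\<Sum>j\<le>Suc L. ?c L j * a j)" by (subst sum.atMost_Suc_shift) simp
 also have "... = (\<Sum>j\<le>L. ?c L j * a j)" by simp
 finally show ?thesis by (simp add: right_diff_distrib sum_subtractf)
qed

lemma fdiff_power_eq:
 "(fdiff h ^^ L) ph y = (\<Sum>j\<le>L. (- 1) ^ j * of_nat (L choose j) * ph (y - real j *R h))"
proof (induction L arbitrary: ph)
 case (Suc L)
 have "(fdiff h ^^ Suc L) ph y = (fdiff h ^^ L) (fdiff h ph) y" by (simp only: funpow_Suc_right o_apply)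
 also have "... = (\<Sum>j\<le>L. (- 1) ^ j * of_nat (L choose j) * (ph (y - real j *R h) - ph (y - real (Suc j) *R h)))"
  unfolding Suc fdiff_def by (intro sum.cong refl) (simp add: algebra_simps)
 also have "... = (\<Sum>j\<le>Suc L. (- 1) ^ j * of_nat (Suc L choose j) * ph (y - real j *R h))" by (rule alternating_binomial_sum[symmetric])
 finally show ?case .
qed simp

lemma fdiff_smooth: "smooth ph ==> smooth (fdiff h ph)" for ph :: "'n::finite cfun" unfolding fdiff_def by (intro smooth_diff smooth_shift)

lemma Dl_fdiff: "smooth ph ==> Dl is (fdiff h ph) = fdiff h (Dl is ph)" for ph :: "'n::finite cfun"
 unfolding fdiff_def by (simp add: Dl_diff smooth_shift Dl_shift)

lemma fdiff_power_deriv_bound: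
 fixes ph :: "'n::finite cfun" and B :: real
 assumes "smooth ph" "!!js y'. length js = a ==> norm (y' - y) <= real a * norm h ==> cmod (Dl js ph y') <= B"
 shows "cmod ((fdiff h ^^ a) ph y) <= (real CARD('n) * norm h) ^ a * B" using assms
proof (induction a arbitrary: ph B)
 case 0
 then show ?case using "0.prems"(2)[of "[]" y] by simp
next
 case (Suc a)
 have "cmod ((fdiff h ^^ a) (fdiff h ph) y) <= (real CARD('n) * norm h) ^ a * (real CARD('n) * norm h * B)"
 proof (rule Suc.IH)
  fix js :: "'n list" and y' assume l: "length js = a" "norm (y' - y) <= real a * norm h"
  have "cmod (Dl js ph y' - Dl js ph (y' - h)) <= real CARD('n) * B * norm (y' - (y' - h))"
  proof (rule smooth_lipschitz_on[where S="cball y' (norm h)"])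
   fix i z assume "z \<in> cball y' (norm h)"
   then have "norm (z - y) <= real (Suc a) * norm h"
    using l(2) norm_triangle_ineq[of "z - y'" "y' - y"] by (simp add: dist_norm norm_minus_commute algebra_simps)
   then show "cmod (coord_deriv i (Dl js ph) z) <= B" using Suc.prems(2)[of "i # js" z] l(1) by simp
  qed (use Suc.prems(1) in \<open>auto intro: smooth_Dl\<close>)
  then show "cmod (Dl js (fdiff h ph) y') <= real CARD('n) * norm h * B" by (simp add: Dl_fdiff[OF Suc.prems(1)] mult_ac) (simp add: fdiff_def mult_ac)
 qed (rule fdiff_smooth[OF Suc.prems(1)])
 then show ?case by (simp only: funpow_Suc_right o_apply power_Suc mult_ac)
qed

lemma fdiff_power_bound:
 fixes g :: "'a::real_normed_vector => complex"
 assumes "!!y'. norm (y' - y) <= real b * norm h ==> cmod (g y') <= B"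
 shows "cmod ((fdiff h ^^ b) g y) <= 2 ^ b * B" using assms
proof (induction b arbitrary: y)
 case (Suc b)
 have 1: "cmod ((fdiff h ^^ b) g y) <= 2 ^ b * B"
 proof (rule Suc.IH)
  fix y' assume "norm (y' - y) <= real b * norm h"
  moreover have "real b * norm h <= real (Suc b) * norm h" by (intro mult_right_mono) auto
  ultimately show "cmod (g y') <= B" by (intro Suc.prems) linarith
 qed
 have 2: "cmod ((fdiff h ^^ b) g (y - h)) <= 2 ^ b * B"
 proof (rule Suc.IH)
  fix y' assume "norm (y' - (y - h)) <= real b * norm h"
  then show "cmod (g y') <= B" using norm_triangle_ineq4[of "y' - (y - h)" h] by (intro Suc.prems) (simp add: distrib_right)
 qed
 have "cmod ((fdiff h ^^ Suc b) g y) <= cmod ((fdiff h ^^ b) g y) + cmod ((fdiff h ^^ b) g (y - h))" by (simp add: fdiff_def norm_triangle_ineq4)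
 then show ?case using 1 2 by simp
qed simp

text \<open>Of the \<open>L\<close> differences \<open>j\<close> are traded for derivatives, each
  giving a factor norm h, and the others are estimated trivially.\<close>

lemma fdiff_power_mixed_bound:
 fixes ph :: "'n::finite cfun" and B :: real
 assumes ph: "smooth ph" and j: "j <= L"
  and B: "!!js y'. length js = j ==> norm (y' - y) <= real L * norm h ==> cmod (Dl js ph y') <= B"
 shows "cmod ((fdiff h ^^ L) ph y) <= 2 ^ (L - j) * ((real CARD('n) * norm h) ^ j * B)"
proof -
 have "fdiff h ^^ L = fdiff h ^^ (L - j) \<circ> fdiff h ^^ j" using j by (simp flip: funpow_add)
 then have "(fdiff h ^^ L) ph y = (fdiff h ^^ (L - j)) ((fdiff h ^^ j) ph) y" by simp
 also have "cmod ... <= 2 ^ (L - j) * ((real CARD('n) * norm h) ^ j * B)"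
 proof (rule fdiff_power_bound, rule fdiff_power_deriv_bound[OF ph])
  fix y' y'' and js :: "'n list"
  assume a: "norm (y' - y) <= real (L - j) * norm h" "length js = j" "norm (y'' - y') <= real j * norm h"
  have "norm (y'' - y) <= real (L - j) * norm h + real j * norm h" using a norm_triangle_ineq[of "y'' - y'" "y' - y"] by simp
  also have "... = real L * norm h" using j by (simp add: of_nat_diff algebra_simps)
  finally show "cmod (Dl js ph y'') <= B" by (rule B[OF a(2)])
 qed
 finally show ?thesis .
qed

text \<open>With this step all scales j * step L r with j <= L stay within r / 8, so smoothing at
  scale \<open>r\<close> sees only points within r / 8.\<close>

definition step :: "nat => real => real" where "step L r = r / (8 * real L)"

definition coef :: "nat => nat => complex" where "coef L j = - ((- 1) ^ j * of_nat (L choose j))"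

text \<open>A combination of mollifications chosen so that the identity minus it is an average of
  L-th differences. It reproduces smooth functions up to order \<open>L\<close> in \<open>r\<close>,
  unlike a single mollification.\<close>

definition smoothing :: "nat => real => ('n::finite cfun) => 'n cfun" where
 "smoothing L r ph = (%y. \<Sum>j=1..L. coef L j * moll (real j * step L r) ph y)"

definition resid :: "nat => real => ('n::finite cfun) => 'n cfun" where
 "resid L r ph = (%y. ph y - smoothing L r ph y)"

lemma step_le: "1 <= j ==> j <= L ==> 0 < r ==> real j * step L r <= r / 8" by (simp add: step_def field_simps)

lemma step_mult_pos: "1 <= j ==> j <= L ==> 0 < r ==> real j * step L r > 0" by (simp add: step_def)

lemma smoothing_schwartz: "ph \<in> schwartz ==> 0 < r ==> smoothing L r ph \<in> schwartz"
 unfolding smoothing_def by (intro schwartz_sum schwartz_cmult moll_schwartz) (auto intro: step_mult_pos)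

lemma resid_schwartz: "ph \<in> schwartz ==> 0 < r ==> resid L r ph \<in> schwartz" unfolding resid_def by (intro schwartz_diff smoothing_schwartz)

lemma Dl_resid:
 fixes ph :: "real ^ 'a::finite => complex"
 assumes "ph \<in> schwartz" "0 < r"
 shows "Dl is (resid L r ph) = resid L r (Dl is ph)"
proof -
 have "Dl is (smoothing L r ph) = smoothing L r (Dl is ph)"
 proof -
  have p: "0 < real j * step L r" if "j \<in> {1..L}" for j using that assms by (intro step_mult_pos) auto
  have "Dl is (smoothing L r ph) = (%y. \<Sum>j=1..L. Dl is (%y. coef L j * moll (real j * step L r) ph y) y)"
   unfolding smoothing_def using p by (intro Dl_sum) (auto intro: smooth_cmult moll_smooth assms)
  also have "... = smoothing L r (Dl is ph)" unfolding smoothing_def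
  proof (intro ext sum.cong refl)
   fix y :: "real ^ 'a" and j assume "j \<in> {1..L}"
   then show "Dl is (%y. coef L j * moll (real j * step L r) ph y) y = coef L j * moll (real j * step L r) (Dl is ph) y"
    using p by (simp only: Dl_cmult[OF moll_smooth[OF assms(1)]] Dl_moll[OF assms(1)])
  qed
  finally show ?thesis .
 qed
 then show ?thesis unfolding resid_def using assms by (simp add: Dl_diff schwartz_smooth smoothing_schwartz)
qed

text \<open>The term j = 0 of the L-th difference is \<open>ph\<close> itself because theta has mass
  1; the terms with j >= 1 are the mollifications with the signs of \<open>coef\<close>.\<close>

lemma resid_eq:
 fixes ph :: "'n::finite cfun"
 assumes ph: "ph \<in> schwartz" and "0 < r" "0 < L"
 shows "resid L r ph y = (LL z. cplx (theta z) * (fdiff (step L r *R z) ^^ L) ph y)"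
proof -
 let ?c = "%j. (- 1) ^ j * of_nat (L choose j) :: complex"
 let ?I = "%j. LL z. cplx (theta z) * ph (y - (real j * step L r) *R z)"
 have int: "integrable lborel (%z. cplx (theta z) * ph (y - (real j * step L r) *R z))" for j by (rule moll_integrable[OF schwartz_ubd[OF ph]])
 have "(LL z. cplx (theta z) * (fdiff (step L r *R z) ^^ L) ph y) =
  (LL z. (\<Sum>j\<le>L. ?c j * (cplx (theta z) * ph (y - (real j * step L r) *R z))))"
  unfolding fdiff_power_eq by (intro Bochner_Integration.integral_cong refl) (simp add: sum_distrib_left mult_ac)
 also have "... = (\<Sum>j\<le>L. LL z. ?c j * (cplx (theta z) * ph (y - (real j * step L r) *R z)))"
  by (rule Bochner_Integration.integral_sum) (intro integrable_mult_right int)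
 also have "... = (\<Sum>j\<le>L. ?c j * ?I j)" by (simp only: integral_mult_right_zero)
 also have "{..L} = insert 0 {1..L}" by auto
 also have "(\<Sum>j\<in>insert 0 {1..L}. ?c j * ?I j) = ?I 0 + (\<Sum>j=1..L. ?c j * ?I j)" by simp
 also have "?I 0 = ph y" using integral_complex_of_real[of lborel "theta :: real ^ 'n => real"] by (simp add: theta_integral)
 also have "(\<Sum>j=1..L. ?c j * ?I j) = (\<Sum>j=1..L. ?c j * moll (real j * step L r) ph y)"
  using assms by (intro sum.cong refl) (simp add: moll_eq schwartz_measurable step_mult_pos)
 finally show ?thesis by (simp add: resid_def smoothing_def coef_def sum_negf)
qed

lemma resid_bound:
 fixes ph :: "'n::finite cfun" and B :: real
 assumes ph: "ph \<in> schwartz" and r: "0 < r" "0 < L" and j: "j <= L"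
  and B: "!!js y'. length js = length is + j ==> norm (y' - y) <= r / 8 ==> cmod (Dl js ph y') <= B"
 shows "cmod (Dl is (resid L r ph) y) <= 2 ^ L * (real CARD('n) ^ j * r ^ j * B)"
proof -
 obtain js0 :: "'n list" where "length js0 = length is + j" by (rule that[of "replicate (length is + j) undefined"]) simp
 then have B0: "B >= 0" using B[of js0 y] r by (intro order_trans[OF norm_ge_zero]) auto
 have st: "0 < step L r" "step L r <= r" using r by (auto simp: step_def field_simps)
 show ?thesis unfolding Dl_resid[OF ph r(1)] resid_eq[OF schwartz_Dl[OF ph] r]
 proof (rule moll_avg_bound)
  fix z :: "real ^ 'n" assume z: "norm z < 1"
  let ?h = "step L r *R z"
  have h: "norm ?h <= step L r" using z st by (simp add: mult_left_le)
  have "cmod ((fdiff ?h ^^ L) (Dl is ph) y) <= 2 ^ (L - j) * ((real CARD('n) * norm ?h) ^ j * B)"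
  proof (rule fdiff_power_mixed_bound[OF smooth_Dl[OF schwartz_smooth[OF ph]] j])
   fix js :: "'n list" and y' assume a: "length js = j" "norm (y' - y) <= real L * norm ?h"
   have "real L * norm ?h <= real L * step L r" using h by (intro mult_left_mono) auto
   also have "... = r / 8" using r by (simp add: step_def)
   finally have "cmod (Dl (js @ is) ph y') <= B" using a by (intro B) auto
   then show "cmod (Dl js (Dl is ph) y') <= B" by simp
  qed
  also have "... <= 2 ^ L * ((real CARD('n) * r) ^ j * B)"
   using order_trans[OF h st(2)] st B0 r by (intro mult_mono power_mono power_increasing mult_nonneg_nonneg) (auto simp del: norm_scaleR)
  finally show "cmod ((fdiff ?h ^^ L) (Dl is ph) y) <= 2 ^ L * (real CARD('n) ^ j * r ^ j * B)" by (simp add: power_mult_distrib)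
 qed
qed

definition resid_const :: "'n::finite itself => nat => nat => real" where
 "resid_const _ L P = 2 ^ L * real CARD('n) ^ P * 2 ^ P"

lemma resid_const_pos: "resid_const TYPE('n::finite) L P > 0" by (simp add: resid_const_def)

text \<open>The residual at y sees points within r / 8. The condition \<open>near\<close> keeps the
  decay weights there comparable with the one at y, and \<open>j\<close> derivatives are traded for
  the factor (r / s) ^ j.\<close>

lemma resid_bump_bound:
 fixes x y :: "real ^ 'n::finite"
 assumes b: "bump P c x s ph" and s: "0 < s" and r: "0 < r" "0 < L" and P: "length is + j <= P" "P <= L"
  and near: "r <= s \<or> r <= norm (y - x)"
 shows "cmod (Dl is (resid L r ph) y) * s ^ (CARD('n) + length is + j) * (1 + norm (y - x) / s) ^ P
  <= resid_const TYPE('n) L P * c * r ^ j"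
proof -
 define w where "w = 1 + norm (y - x) / s"
 have w: "w > 0" using s by (simp add: w_def add_pos_nonneg)
 have c: "c >= 0" by (rule bump_nonneg[OF b s])
 define S where "S = s ^ (CARD('n) + length is + j)"
 have S: "S > 0" using s by (simp add: S_def)
 have "cmod (Dl is (resid L r ph) y) <= 2 ^ L * (real CARD('n) ^ j * r ^ j * (2 ^ P * c / (S * w ^ P)))"
 proof (rule resid_bound[OF bump_schwartz[OF b] r])
  fix js :: "'n list" and y' assume a: "length js = length is + j" "norm (y' - y) <= r / 8"
  define w' where "w' = 1 + norm (y' - x) / s"
  have w': "w' > 0" using s by (simp add: w'_def add_pos_nonneg)
  have t: "norm (y - x) <= norm (y' - x) + r / 8" using a(2) norm_triangle_ineq[of "y - y'" "y' - x"] by (simp add: norm_minus_commute)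
  have "norm (y - x) <= 2 * norm (y' - x) + s" using near
  proof
   assume "r <= s" then show ?thesis using t norm_ge_zero[of "y' - x"] s by linarith
  next
   assume "r <= norm (y - x)" then show ?thesis using t norm_ge_zero[of "y' - x"] s by linarith
  qed
  then have "norm (y - x) / s <= (2 * norm (y' - x) + s) / s" using s by (intro divide_right_mono) auto
  then have "w <= 2 * w'" using s by (simp add: w_def w'_def add_divide_distrib)
  then have "w ^ P <= 2 ^ P * w' ^ P" using w by (intro power_le_scaled) auto
  have e: "S = s ^ (CARD('n) + length js)" by (simp add: S_def a(1) add.assoc)
  have c': "cmod (Dl js ph y') * S * w' ^ P <= c" using bumpD[OF b, of js y'] a(1) P(1) by (simp add: e w'_def)
  have "cmod (Dl js ph y') * (S * w ^ P) <= cmod (Dl js ph y') * (S * (2 ^ P * w' ^ P))" using \<open>w ^ P <= _\<close> S by (intro mult_left_mono) auto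
  also have "... = 2 ^ P * (cmod (Dl js ph y') * S * w' ^ P)" by (simp add: mult_ac)
  also have "... <= 2 ^ P * c" by (intro mult_left_mono) (simp_all add: c')
  finally show "cmod (Dl js ph y') <= 2 ^ P * c / (S * w ^ P)" using S w by (simp add: pos_le_divide_eq)
 qed (use P in auto)
 then have "cmod (Dl is (resid L r ph) y) * (S * w ^ P) <= 2 ^ L * (real CARD('n) ^ j * r ^ j * (2 ^ P * c / (S * w ^ P))) * (S * w ^ P)"
  using S w by (intro mult_right_mono) auto
 also have "... = (2 ^ L * 2 ^ P * c * r ^ j) * real CARD('n) ^ j" using S w by simp
 also have "... <= (2 ^ L * 2 ^ P * c * r ^ j) * real CARD('n) ^ P" using P c r by (intro mult_left_mono power_increasing) (auto simp: Suc_le_eq)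
 finally show ?thesis by (simp add: S_def w_def resid_const_def mult_ac)
qed

text \<open>Each derivative that falls on the cutoff costs 1 / r; it is repaid by extracting one
  more power of \<open>r\<close> from the residual, in addition to the \<open>a\<close> powers
  wanted. Hence the order length js + a.\<close>

lemma cutoff_resid_bound:
 fixes x y :: "real ^ 'n::finite"
 assumes \<rho>: "smooth \<rho>" "!!js. length js <= length is ==> cmod (Dl js \<rho> y) * r ^ length js <= A"
  and b: "bump P c x s ph" and s: "0 < s" and r: "0 < r" "0 < L" and P: "length is + a <= P" "P <= L"
  and near: "r <= s \<or> r <= norm (y - x)"
 shows "cmod (Dl is (%y. \<rho> y * resid L r ph y) y) * s ^ (CARD('n) + length is + a) * (1 + norm (y - x) / s) ^ P
  <= 2 ^ length is * (A * (resid_const TYPE('n) L P * c * r ^ a))"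
proof -
 define K where "K = resid_const TYPE('n) L P * c"
 define W where "W = s ^ (CARD('n) + length is + a) * (1 + norm (y - x) / s) ^ P"
 have W: "W > 0" using s by (simp add: W_def add_pos_nonneg)
 have K: "K >= 0" using bump_nonneg[OF b s] resid_const_pos[where 'n='n, of L P] by (simp add: K_def)
 have "cmod (Dl is (%y. \<rho> y * resid L r ph y) y) <= 2 ^ length is * (A * (K * r ^ a) / W)"
 proof (rule Dl_mult_le[OF \<rho>(1) schwartz_smooth[OF resid_schwartz[OF bump_schwartz[OF b] r(1)]]])
  fix js ks :: "'n list" assume l: "length js + length ks = length is"
  have 1: "cmod (Dl js \<rho> y) * r ^ length js <= A" using l by (intro \<rho>(2)) auto
  have "CARD('n) + length ks + (length js + a) = CARD('n) + length is + a" using l by simp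
  then have W': "W = s ^ (CARD('n) + length ks + (length js + a)) * (1 + norm (y - x) / s) ^ P" by (simp only: W_def)
  have 2: "cmod (Dl ks (resid L r ph) y) * W <= K * r ^ (length js + a)"
   using resid_bump_bound[OF b s r, of ks "length js + a" y] P near l unfolding W' by (simp add: K_def mult_ac)
  have "(cmod (Dl js \<rho> y) * r ^ length js) * (cmod (Dl ks (resid L r ph) y) * W) <= A * (K * r ^ (length js + a))"
  proof (rule mult_mono[OF 1 2])
   show "0 <= A" using r by (intro order_trans[OF _ 1]) auto
  qed (use W in auto)
  then have "(cmod (Dl js \<rho> y) * cmod (Dl ks (resid L r ph) y) * W) * r ^ length js <= (A * (K * r ^ a)) * r ^ length js" by (simp add: power_add mult_ac)
  then have "cmod (Dl js \<rho> y) * cmod (Dl ks (resid L r ph) y) * W <= A * (K * r ^ a)" using r by (simp only: mult_le_cancel_right_pos zero_less_power)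
  then show "cmod (Dl js \<rho> y) * cmod (Dl ks (resid L r ph) y) <= A * (K * r ^ a) / W" using W by (simp add: pos_le_divide_eq)
 qed
 then have "cmod (Dl is (%y. \<rho> y * resid L r ph y) y) * W <= 2 ^ length is * (A * (K * r ^ a) / W) * W" using W by (intro mult_right_mono) auto
 also have "... = 2 ^ length is * (A * (K * r ^ a))" using W by simp
 finally show ?thesis by (simp only: W_def K_def mult.assoc)
qed

section \<open>Cutoffs adapted to a closed set\<close>

text \<open>Chosen once by \<open>SOME\<close>, so that the constants built from it are closed terms
  in the dimension and \<open>N\<close>; they must not depend on the distribution or on the height
  of the level set.\<close>

definition mol_const :: "'n::finite itself => nat => real" where
 "mol_const _ M = (SOME B. B >= 0 \<and> (\<forall>is t (y :: real ^ 'n). length is <= M --> t > 0 -->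
  cmod (Dl is (mol t) y) * t ^ (CARD('n) + length is) <= B))"

lemma mol_const:
 fixes y :: "real ^ 'n::finite"
 shows "mol_const TYPE('n) M >= 0"
  and "length is <= M ==> t > 0 ==> cmod (Dl is (mol t) y) * t ^ (CARD('n) + length is) <= mol_const TYPE('n) M"
proof -
 have "\<exists>B. B >= 0 \<and> (\<forall>is t (y :: real ^ 'n). length is <= M --> t > 0 -->
  cmod (Dl is (mol t) y) * t ^ (CARD('n) + length is) <= B)" by (rule Dl_mol_bound[where 'n='n, of M]) blast
 from someI_ex[OF this] show "mol_const TYPE('n) M >= 0"
  and "length is <= M ==> t > 0 ==> cmod (Dl is (mol t) y) * t ^ (CARD('n) + length is) <= mol_const TYPE('n) M" unfolding mol_const_def by blast+
qed

lemma indicator_integrable: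
 assumes "S \<in> sets borel" "emeasure lborel S < \<infinity>"
 shows "integrable lborel (indicator S :: 'n::finite cfun)"
proof -
 have "integrable lborel (%u. cplx (indicator S u :: real))" using assms by (intro integrable_of_real integrable_real_indicator) auto
 moreover have "(%u. cplx (indicator S u)) = indicator S" by (auto simp: indicator_def)
 ultimately show ?thesis by simp
qed

lemma moll_indicator_eq_1:
 fixes S :: "(real ^ 'n::finite) set"
 assumes S: "S \<in> sets borel" and t: "t > 0" and y: "!!u. norm (u - y) <= t ==> u \<in> S"
 shows "moll t (indicator S) y = 1"
proof -
 have "moll t (indicator S) y = (LL z. cplx (theta z) * indicator S (y - t *R z))" using S by (intro moll_eq t) auto
 also have "... = (LL z. cplx (theta (z :: real ^ 'n)))"
 proof (intro Bochner_Integration.integral_cong refl)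
  fix z :: "real ^ 'n"
  show "cplx (theta z) * indicator S (y - t *R z) = cplx (theta z)"
  proof (cases "norm z >= 1")
   case False
   then have "y - t *R z \<in> S" using t by (intro y) simp
   then show ?thesis by simp
  qed (simp add: theta_eq_0)
 qed
 also have "... = 1" using integral_complex_of_real[of lborel "theta :: real ^ 'n => real"] by (simp add: theta_integral)
 finally show ?thesis .
qed

lemma moll_indicator_eq_0:
 fixes S :: "(real ^ 'n::finite) set"
 assumes S: "S \<in> sets borel" and t: "t > 0" and y: "!!u. norm (u - y) <= t ==> u \<notin> S"
 shows "moll t (indicator S) y = 0"
proof -
 have "cmod (moll t (indicator S) y) <= 0" using S y by (intro moll_bound t) auto
 then show ?thesis by simp
qed

definition cutoff_const :: "'n::finite itself => nat => real" where
 "cutoff_const _ M = mol_const TYPE('n) M * unit_ball_vol (real CARD('n))"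

lemma cutoff_const_nonneg: "cutoff_const TYPE('n::finite) M >= 0" by (simp add: cutoff_const_def mol_const)

text \<open>The bound is the same for all sets, since an indicator is at most 1 and a derivative of
  the mollifier has absolute integral of order t^(-length is).\<close>

lemma moll_indicator_deriv:
 fixes S :: "(real ^ 'n::finite) set"
 assumes S: "S \<in> sets borel" "emeasure lborel S < \<infinity>" and t: "t > 0" and l: "length is <= M"
 shows "cmod (Dl is (moll t (indicator S)) y) * t ^ length is <= cutoff_const TYPE('n) M"
proof -
 let ?B = "mol_const TYPE('n) M" and ?V = "unit_ball_vol (real CARD('n))"
 note int = indicator_integrable[OF S]
 have u: "ubd (mol t :: 'n cfun)" by (rule schwartz_ubd[OF mol_schwartz[OF t]])
 define b where "b = ?B / t ^ (CARD('n) + length is)"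
 have "Dl is (moll t (indicator S)) y = (LL u. Dl is (mol t) (y - u) * indicator S u)" unfolding moll_def Dl_cnv[OF u int] cnv_def ..
 also have "cmod ... <= (LL u. b * indicator (cball y t) u)"
 proof (rule LINT_norm_bound)
  show "integrable lborel (%u. Dl is (mol t) (y - u) * indicator S u)" by (rule cnv_integrable[OF ubd_Dl[OF u] int])
  show "integrable lborel (%u. b * indicator (cball y t) u)"
   by (intro integrable_mult_right integrable_real_indicator) (use emeasure_lborel_cball_finite[of y t] in auto)
  fix u
  have b0: "b >= 0" using t mol_const(1)[where 'n='n] by (simp add: b_def)
  show "cmod (Dl is (mol t) (y - u) * indicator S u) <= b * indicator (cball y t) u"
  proof (cases "norm (y - u) > t")
   case True
   then show ?thesis using t b0 by (simp add: Dl_mol_eq_0)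
  next
   case False
   have "cmod (Dl is (mol t) (y - u)) <= b" using mol_const(2)[OF l t, of "y - u"] t by (simp add: b_def pos_le_divide_eq)
   then show ?thesis using False b0 by (auto simp: indicator_def dist_norm norm_mult)
  qed
 qed
 also have "(LL u. b * indicator (cball y t) u) = b * (?V * t ^ CARD('n))" using t by (simp add: content_cball)
 finally have "cmod (Dl is (moll t (indicator S)) y) * t ^ length is <= b * (?V * t ^ CARD('n)) * t ^ length is" using t by (intro mult_right_mono) auto
 also have "... = cutoff_const TYPE('n) M" using t by (simp add: b_def cutoff_const_def power_add)
 finally show ?thesis .
qed

definition rad :: "nat => real" where "rad k = (1 / 2) ^ k"

lemma rad_pos: "rad k > 0" by (simp add: rad_def)

lemma rad_Suc: "rad k = 2 * rad (Suc k)" by (simp add: rad_def)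

lemma rad_tendsto: "rad \<longlonglongrightarrow> 0" unfolding rad_def[abs_def] by (rule LIMSEQ_realpow_zero) auto

text \<open>The admissible radii lie between v / 7 and 2 v, a ratio of 14 < 2 ^ 4.\<close>

lemma rad_overlap:
 assumes "v > 0"
 shows "finite {k. rad (Suc k) / 2 <= v \<and> v <= 7 * rad (Suc k)} \<and> card {k. rad (Suc k) / 2 <= v \<and> v <= 7 * rad (Suc k)} <= 4"
proof (cases "{k. rad (Suc k) / 2 <= v \<and> v <= 7 * rad (Suc k)} = {}")
 case False
 define m where "m = (LEAST k. rad (Suc k) / 2 <= v)"
 obtain k0 where "rad (Suc k0) / 2 <= v" using False by auto
 then have m: "rad (Suc m) / 2 <= v" unfolding m_def by (rule LeastI)
 have sub: "{k. rad (Suc k) / 2 <= v \<and> v <= 7 * rad (Suc k)} \<subseteq> {m..<m + 4}"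
 proof
  fix k assume "k \<in> {k. rad (Suc k) / 2 <= v \<and> v <= 7 * rad (Suc k)}"
  then have k: "rad (Suc k) / 2 <= v" "v <= 7 * rad (Suc k)" by auto
  have "m <= k" unfolding m_def by (rule Least_le) (rule k)
  moreover have "k < m + 4"
  proof (rule ccontr)
   assume "\<not> k < m + 4"
   then have "rad (Suc k) <= rad (Suc m + 4)" unfolding rad_def by (intro power_decreasing) auto
   also have "... = rad (Suc m) / 16" by (simp add: rad_def power_add power_divide)
   finally show False using k m rad_pos[of "Suc m"] by linarith
  qed
  ultimately show "k \<in> {m..<m + 4}" by simp
 qed
 show ?thesis using finite_subset[OF sub] card_mono[OF _ sub] by simp
next
 case True
 show ?thesis unfolding True by simp
qed

definition cut_const :: "'n::finite itself => nat => real" where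
 "cut_const _ M = 2 * cutoff_const TYPE('n) M + 1"

lemma cut_const_pos: "cut_const TYPE('n::finite) M > 0" using cutoff_const_nonneg[where 'n='n, of M] by (simp add: cut_const_def)

text \<open>\<open>E\<close> plays the part of {M f <= lam}. Its complement is too small to contain
  a unit ball, so every point has distance below 1 from \<open>E\<close> and the dyadic scales may
  start at \<open>rad 0\<close>, which is 1.\<close>

locale exceptional_set =
 fixes E :: "(real ^ 'n::finite) set"
 assumes closed: "closed E" and nonempty: "E ~= {}"
  and small: "emeasure lborel (- E) < emeasure lborel (ball (0 :: real ^ 'n) 1)"
begin

definition d :: "real ^ 'n => real" where "d u = infdist u E"

lemma d_nonneg: "d u >= 0" by (simp add: d_def infdist_nonneg)

lemma d_continuous: "continuous_on A d" unfolding d_def[abs_def] by (intro continuous_intros)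

lemma d_measurable [measurable]: "d \<in> borel_measurable borel" by (rule borel_measurable_continuous_onI[OF d_continuous])

lemma d_lipschitz: "d u <= d v + norm (u - v)" unfolding d_def using infdist_triangle[of u E v] by (simp add: dist_norm)

lemma d_eq_0: "u \<in> E \<longleftrightarrow> d u = 0" using closed nonempty by (simp add: d_def in_closed_iff_infdist_zero)

lemma d_pos: "u \<notin> E \<longleftrightarrow> d u > 0" using d_eq_0[of u] d_nonneg[of u] by auto

lemma d_le: "z \<in> E ==> d u <= norm (u - z)" using d_lipschitz[of u z] d_eq_0[of z] by simp

lemma nearest: obtains z where "z \<in> E" "norm (z - u) = d u"
proof -
 obtain z where "z \<in> E" "infdist u E = dist u z" using infdist_attains_inf[OF closed nonempty] by metis
 then show ?thesis using that[of z] by (simp add: d_def dist_norm norm_minus_commute)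
qed

lemma emeasure_finite: "emeasure lborel (- E) < \<infinity>" by (rule less_trans[OF small]) (use emeasure_lborel_ball_finite[of 0 1] in auto)

lemma d_less_1: "d u < 1"
proof (rule ccontr)
 assume "\<not> d u < 1"
 have "ball u 1 \<subseteq> - E"
 proof
  fix z assume "z \<in> ball u 1"
  then have "norm (u - z) < 1" by (simp add: dist_norm)
  then show "z \<in> - E" using d_le[of z u] \<open>\<not> d u < 1\<close> by auto
 qed
 then have "emeasure lborel (ball u 1) <= emeasure lborel (- E)" using closed by (intro emeasure_mono) auto
 then show False using small by (simp add: emeasure_ball)
qed

text \<open>A smooth version of the indicator of d > 2 * rad k: it is 0 where d < rad k and 1 where
  d > 3 * rad k. Since \<open>zeta 0\<close> vanishes, the differences \<open>cut\<close> telescope: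
  cut 0, ..., cut (m - 1) and rest m add up to 1, with \<open>rest m\<close> covering
  \<open>E\<close> and a thin neighbourhood.\<close>

definition zeta :: "nat => 'n cfun" where
 "zeta k = moll (rad k) (indicator {u. 2 * rad k < d u})"

definition cut :: "nat => 'n cfun" where
 "cut k = (%y. zeta (Suc k) y - zeta k y)"

definition rest :: "nat => 'n cfun" where
 "rest k = (%y. 1 - zeta k y)"

lemma level_set:
 assumes "0 < a" "S \<in> sets borel" "!!u. u \<in> S ==> a <= d u"
 shows "emeasure lborel S < \<infinity>"
proof -
 have "S \<subseteq> - E" using assms d_eq_0 by force
 then have "emeasure lborel S <= emeasure lborel (- E)" using closed by (intro emeasure_mono) auto
 then show ?thesis using emeasure_finite by (rule le_less_trans)
qed

lemma zeta_set: "{u. 2 * rad k < d u} \<in> sets borel" "emeasure lborel {u. 2 * rad k < d u} < \<infinity>"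
proof -
 show "{u. 2 * rad k < d u} \<in> sets borel" by measurable
 then show "emeasure lborel {u. 2 * rad k < d u} < \<infinity>" using rad_pos[of k] by (intro level_set[of "2 * rad k"]) auto
qed

lemma zeta_ubd: "ubd (zeta k)" unfolding zeta_def moll_def by (intro ubd_cnv schwartz_ubd mol_schwartz rad_pos indicator_integrable zeta_set)

lemma zeta_deriv: "length is <= M ==> cmod (Dl is (zeta k) y) * rad k ^ length is <= cutoff_const TYPE('n) M"
 unfolding zeta_def by (intro moll_indicator_deriv zeta_set rad_pos)

lemma zeta_eq_1: "3 * rad k < d y ==> zeta k y = 1" unfolding zeta_def
proof (rule moll_indicator_eq_1[OF zeta_set(1) rad_pos])
 fix u assume "3 * rad k < d y" "norm (u - y) <= rad k"
 then show "u \<in> {u. 2 * rad k < d u}" using d_lipschitz[of y u] by (simp add: norm_minus_commute)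
qed

lemma zeta_eq_0: "d y < rad k ==> zeta k y = 0" unfolding zeta_def
proof (rule moll_indicator_eq_0[OF zeta_set(1) rad_pos])
 fix u assume "d y < rad k" "norm (u - y) <= rad k"
 then show "u \<notin> {u. 2 * rad k < d u}" using d_lipschitz[of u y] by simp
qed

lemma zeta_0: "zeta 0 y = 0" using d_less_1 by (intro zeta_eq_0) (simp add: rad_def)

lemma cut_sum: "(\<Sum>k<m. cut k y) = zeta m y" unfolding cut_def using sum_lessThan_telescope[of "%k. zeta k y" m] by (simp add: zeta_0)

lemma cut_ubd: "ubd (cut k)" unfolding cut_def by (intro ubd_diff zeta_ubd)

lemma rest_ubd: "ubd (rest k)" unfolding rest_def by (intro ubd_diff zeta_ubd ubd_const)

lemma cut_deriv: assumes "length is <= M" shows "cmod (Dl is (cut k) y) * rad (Suc k) ^ length is <= cut_const TYPE('n) M"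
proof -
 have "cmod (Dl is (cut k) y) <= cmod (Dl is (zeta (Suc k)) y) + cmod (Dl is (zeta k) y)"
  unfolding cut_def by (simp add: Dl_diff ubd_smooth zeta_ubd norm_triangle_ineq4)
 then have "cmod (Dl is (cut k) y) * rad (Suc k) ^ length is <=
  (cmod (Dl is (zeta (Suc k)) y) + cmod (Dl is (zeta k) y)) * rad (Suc k) ^ length is" using rad_pos[of "Suc k"] by (intro mult_right_mono) auto
 also have "... = cmod (Dl is (zeta (Suc k)) y) * rad (Suc k) ^ length is + cmod (Dl is (zeta k) y) * rad (Suc k) ^ length is" by (rule distrib_right)
 also have "cmod (Dl is (zeta k) y) * rad (Suc k) ^ length is <= cmod (Dl is (zeta k) y) * rad k ^ length is"
  using rad_Suc[of k] rad_pos[of "Suc k"] by (intro mult_left_mono power_mono) auto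
 finally show ?thesis using zeta_deriv[OF assms, of k y] zeta_deriv[OF assms, of "Suc k" y] by (simp add: cut_const_def)
qed

lemma rest_deriv: assumes "length is <= M" shows "cmod (Dl is (rest k) y) * rad k ^ length is <= cut_const TYPE('n) M"
proof -
 have "cmod (Dl is (%y :: real ^ 'n. 1) y) * rad k ^ length is <= 1" by (cases "is = []") (auto simp: Dl_const)
 moreover have "cmod (Dl is (rest k) y) * rad k ^ length is <= (cmod (Dl is (%y :: real ^ 'n. 1) y) + cmod (Dl is (zeta k) y)) * rad k ^ length is"
  unfolding rest_def using rad_pos[of k] by (intro mult_right_mono) (auto simp: Dl_diff ubd_smooth zeta_ubd smooth_const norm_triangle_ineq4)
 ultimately show ?thesis using zeta_deriv[OF assms, of k y] cutoff_const_nonneg[where 'n='n, of M] by (simp add: cut_const_def distrib_right)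
qed

lemma cut_eq_0:
 assumes "d y < rad (Suc k) \<or> 6 * rad (Suc k) < d y" shows "Dl is (cut k) y = 0"
proof (rule Dl_eq_0_open)
 let ?U = "{y. d y < rad (Suc k)} \<union> {y. 6 * rad (Suc k) < d y}"
 show "open ?U" by (intro open_Un open_Collect_less d_continuous continuous_on_const)
 show "y \<in> ?U" using assms by simp
 fix x assume "x \<in> ?U"
 then show "cut k x = 0"
 proof
  assume "x \<in> {y. d y < rad (Suc k)}"
  then have "zeta (Suc k) x = 0" "zeta k x = 0" using rad_Suc[of k] rad_pos[of "Suc k"] by (auto intro!: zeta_eq_0)
  then show ?thesis by (simp add: cut_def)
 next
  assume "x \<in> {y. 6 * rad (Suc k) < d y}"
  then have "zeta (Suc k) x = 1" "zeta k x = 1" using rad_Suc[of k] rad_pos[of "Suc k"] by (auto intro!: zeta_eq_1)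
  then show ?thesis by (simp add: cut_def)
 qed
qed

lemma rest_eq_0:
 assumes "3 * rad k < d y" shows "Dl is (rest k) y = 0"
proof (rule Dl_eq_0_open)
 let ?U = "{y. 3 * rad k < d y}"
 show "open ?U" by (intro open_Collect_less d_continuous continuous_on_const)
 show "y \<in> ?U" using assms by simp
 fix x assume "x \<in> ?U"
 then show "rest k x = 0" by (simp add: rest_def zeta_eq_1)
qed

text \<open>The region where \<open>cut k\<close> lives, enlarged by a margin so that smoothing at
  distance rad (Suc k) / 8 stays inside.\<close>

definition shell :: "nat => (real ^ 'n) set" where
 "shell k = {u. rad (Suc k) / 2 <= d u \<and> d u <= 7 * rad (Suc k)}"

lemma shell_measurable [measurable]: "shell k \<in> sets borel" unfolding shell_def by measurable

lemma shell_integrable: "integrable lborel (indicator (shell k) :: 'n cfun)"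
proof (rule indicator_integrable[OF shell_measurable])
 show "emeasure lborel (shell k) < \<infinity>" using rad_pos[of "Suc k"] by (intro level_set[of "rad (Suc k) / 2"] shell_measurable) (auto simp: shell_def)
qed

lemma shell_overlap:
 "(\<Sum>k. indicator (shell k) u :: ennreal) <= 4 * indicator (- E) u"
proof (cases "u \<in> E")
 case True
 have "u \<notin> shell k" for k using True d_eq_0[of u] rad_pos[of "Suc k"] by (auto simp: shell_def)
 then show ?thesis by simp
next
 case False
 let ?I = "{k. rad (Suc k) / 2 <= d u \<and> d u <= 7 * rad (Suc k)}"
 have I: "finite ?I" "card ?I <= 4" using rad_overlap[of "d u"] False d_pos by auto
 have "(\<Sum>k. indicator (shell k) u :: ennreal) = (\<Sum>k\<in>?I. indicator (shell k) u)" by (rule suminf_finite[OF I(1)]) (auto simp: shell_def)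
 also have "... = of_nat (card ?I)" by (simp add: shell_def)
 also have "... <= of_nat 4" using I(2) by (simp only: of_nat_le_iff)
 finally show ?thesis using False by simp
qed

text \<open>Multiplying \<open>piece k ph\<close> by this function changes nothing, and since it is
  a convolution, the piece splits into localized functions indexed by the points u of the
  shell.\<close>

lemma moll_shell:
 assumes "rad (Suc k) <= d y" "d y <= 6 * rad (Suc k)"
 shows "cnv (mol (rad (Suc k) / 8)) (indicator (shell k)) y = 1" unfolding moll_def[symmetric]
proof (rule moll_indicator_eq_1)
 fix u assume "norm (u - y) <= rad (Suc k) / 8"
 then show "u \<in> shell k" using d_lipschitz[of y u] d_lipschitz[of u y] assms rad_pos[of "Suc k"] by (auto simp: shell_def norm_minus_commute)
qed (auto simp: rad_pos)

end

section \<open>The good part of a distribution\<close>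

lemma Dl_mult_eq_0:
 assumes "smooth f" "smooth g" "!!js. Dl js f y = 0"
 shows "Dl is (%x. f x * g x) y = 0"
proof -
 have "cmod (Dl is (%x. f x * g x) y) <= 2 ^ length is * 0" by (rule Dl_mult_le[OF assms(1,2)]) (simp add: assms(3))
 then show ?thesis by simp
qed

text \<open>The mollifier may be finer than the cutoff by the factor \<open>q\<close>: derivatives
  then cost powers of \<open>q\<close> but still scale like \<open>r\<close>.\<close>

lemma cutoff_mult_mol:
 fixes y :: "real ^ 'n::finite"
 assumes \<rho>: "smooth \<rho>" "!!js. length js <= N ==> cmod (Dl js \<rho> y) * r ^ length js <= A"
  and r: "0 < r" and t: "r / q <= t" "q >= 1" and l: "length is <= N"
 shows "cmod (Dl is (%y. \<rho> y * mol t (y - u)) y) * r ^ (CARD('n) + length is) <=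
  2 ^ N * (A * (mol_const TYPE('n) N * q ^ (CARD('n) + N)))"
proof -
 have t0: "t > 0" using r t by (intro less_le_trans[OF _ t(1)] divide_pos_pos) auto
 have A0: "A >= 0" using r \<rho>(2)[of "[]"] by (auto intro: order_trans[OF norm_ge_zero])
 have s: "smooth (mol t :: 'n cfun)" by (rule schwartz_smooth[OF mol_schwartz[OF t0]])
 let ?B = "A * (mol_const TYPE('n) N * q ^ (CARD('n) + N))"
 define R where "R = r ^ (CARD('n) + length is)"
 have R: "R > 0" using r by (simp add: R_def)
 have rq: "r <= q * t" using t by (simp add: divide_le_eq mult.commute)
 have "cmod (Dl is (%y. \<rho> y * mol t (y - u)) y) <= 2 ^ length is * (?B / R)"
 proof (rule Dl_mult_le[OF \<rho>(1) smooth_shift[OF s]])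
  fix js ks :: "'n list" assume jk: "length js + length ks = length is"
  have e: "R = r ^ length js * r ^ (CARD('n) + length ks)" unfolding R_def jk[symmetric] by (simp add: power_add mult_ac)
  have "r ^ (CARD('n) + length ks) <= q ^ (CARD('n) + length ks) * t ^ (CARD('n) + length ks)" using r rq by (intro power_le_scaled) auto
  also have "... <= q ^ (CARD('n) + N) * t ^ (CARD('n) + length ks)" using jk l t t0 by (intro mult_right_mono power_increasing) auto
  finally have "cmod (Dl ks (mol t) (y - u)) * r ^ (CARD('n) + length ks) <=
   cmod (Dl ks (mol t) (y - u)) * (q ^ (CARD('n) + N) * t ^ (CARD('n) + length ks))" by (intro mult_left_mono) auto
  also have "... = (cmod (Dl ks (mol t) (y - u)) * t ^ (CARD('n) + length ks)) * q ^ (CARD('n) + N)" by (simp only: mult_ac)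
  also have "... <= mol_const TYPE('n) N * q ^ (CARD('n) + N)" using jk l t t0 by (intro mult_right_mono mol_const(2)) auto
  finally have m: "cmod (Dl ks (mol t) (y - u)) * r ^ (CARD('n) + length ks) <= mol_const TYPE('n) N * q ^ (CARD('n) + N)" .
  have "(cmod (Dl js \<rho> y) * r ^ length js) * (cmod (Dl ks (mol t) (y - u)) * r ^ (CARD('n) + length ks)) <= ?B"
   by (rule mult_mono[OF \<rho>(2) m]) (use jk l r A0 in auto)
  then have "cmod (Dl js \<rho> y) * cmod (Dl ks (%y. mol t (y - u)) y) * R <= ?B" unfolding e Dl_shift[OF s] by (simp only: mult_ac)
  then show "cmod (Dl js \<rho> y) * cmod (Dl ks (%y. mol t (y - u)) y) <= ?B / R" using R by (simp only: pos_le_divide_eq)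
 qed
 also have "... <= 2 ^ N * (?B / R)"
  using l R A0 mol_const(1)[where 'n='n, of N] t by (intro mult_right_mono power_increasing divide_nonneg_pos mult_nonneg_nonneg) auto
 finally have "cmod (Dl is (%y. \<rho> y * mol t (y - u)) y) * R <= 2 ^ N * (?B / R) * R" using R by (intro mult_right_mono) auto
 also have "... = 2 ^ N * ?B" using R by simp
 finally show ?thesis by (simp only: R_def)
qed

locale good_part = exceptional_set E for E :: "(real ^ 'n::finite) set" +
 fixes f :: "('n cfun) => complex" and N :: nat and lam :: real
 assumes f: "f \<in> tempered" and N: "CARD('n) < N" and lam: "lam > 0"
  and E: "E = {x. grand_maximal N f x <= ennreal lam}"
begin

lemma f_bump:
 assumes "z \<in> E" "bump N c z s \<psi>" "s > 0"
 shows "cmod (f \<psi>) <= mi_card TYPE('n) N * c * lam"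
proof -
 have c: "c >= 0" by (rule bump_nonneg[OF assms(2,3)])
 have "ennreal (cmod (f \<psi>)) <= ennreal (mi_card TYPE('n) N * c) * grand_maximal N f z" by (rule bump_le_grand_maximal[OF f assms(2,3)])
 also have "... <= ennreal (mi_card TYPE('n) N * c) * ennreal lam" using assms(1) E by (intro mult_left_mono) auto
 also have "... = ennreal (mi_card TYPE('n) N * c * lam)" using c lam mi_card_pos[where 'n='n, of N] by (simp add: ennreal_mult)
 finally show ?thesis using c lam mi_card_pos[where 'n='n, of N] by (subst (asm) ennreal_le_iff) auto
qed

text \<open>The decomposition on the side of test functions: \<open>f\<close> applied to
  \<open>approx m\<close> has a bounded density, and what it misses consists of pieces living off
  \<open>E\<close> and a tail on which \<open>f\<close> tends to 0.\<close>

definition piece :: "nat => ('n cfun) => 'n cfun" where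
 "piece k ph = (%y. cut k y * resid (Suc N) (rad (Suc k)) ph y)"

definition tail :: "nat => ('n cfun) => 'n cfun" where
 "tail m ph = (%y. rest m y * resid (Suc N) (rad m) ph y)"

definition approx :: "nat => ('n cfun) => 'n cfun" where
 "approx m ph = (%y. (\<Sum>k<m. cut k y * smoothing (Suc N) (rad (Suc k)) ph y) + rest m y * smoothing (Suc N) (rad m) ph y)"

lemma piece_schwartz: "ph \<in> schwartz ==> piece k ph \<in> schwartz" unfolding piece_def by (intro schwartz_mult_ubd cut_ubd resid_schwartz rad_pos)

lemma tail_schwartz: "ph \<in> schwartz ==> tail k ph \<in> schwartz" unfolding tail_def by (intro schwartz_mult_ubd rest_ubd resid_schwartz rad_pos)

lemma approx_schwartz: "ph \<in> schwartz ==> approx k ph \<in> schwartz"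
 unfolding approx_def by (intro schwartz_add schwartz_sum schwartz_mult_ubd cut_ubd rest_ubd smoothing_schwartz rad_pos)

lemma approx_eq: "approx m ph = (%y. ph y - ((\<Sum>k<m. piece k ph y) + tail m ph y))"
proof
 fix y
 have "(\<Sum>k<m. piece k ph y) + tail m ph y = (\<Sum>k<m. cut k y) * ph y + rest m y * ph y - approx m ph y"
  unfolding piece_def tail_def approx_def resid_def by (simp add: right_diff_distrib sum_subtractf sum_distrib_right)
 also have "(\<Sum>k<m. cut k y) * ph y + rest m y * ph y = ph y" unfolding cut_sum by (simp add: rest_def left_diff_distrib)
 finally show "approx m ph y = ph y - ((\<Sum>k<m. piece k ph y) + tail m ph y)" by simp
qed

definition piece_const :: real where
 "piece_const = 2 ^ N * (cut_const TYPE('n) N * resid_const TYPE('n) (Suc N) N)"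

lemma piece_const_pos: "piece_const > 0" using cut_const_pos[where 'n='n] resid_const_pos[where 'n='n] by (simp add: piece_const_def)

lemma cut_nonzero:
 assumes "Dl is (cut k) y ~= 0" shows "rad (Suc k) <= d y" "d y <= 6 * rad (Suc k)" "y \<in> shell k"
 using assms cut_eq_0[of y k "is"] rad_pos[of "Suc k"] by (force simp: shell_def)+

lemma power_two_bound: "length is <= N ==> 2 ^ length is * (a * (b * c)) <= 2 ^ N * (a * b) * c" if "0 <= a" "0 <= b" "0 <= c" for a b c :: real
 using that by (simp add: mult.assoc mult_right_mono)

text \<open>Where \<open>cut k\<close> does not vanish the distance to \<open>E\<close> is at least
  rad (Suc k), so a centre \<open>x\<close> in \<open>E\<close> is at least that far away. This is
  the second alternative of the hypothesis \<open>near\<close>.\<close>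

lemma piece_bound:
 assumes x: "x \<in> E" and b: "bump N c x s ph" and s: "s > 0" and l: "length is <= N"
 shows "cmod (Dl is (piece k ph) y) * s ^ (CARD('n) + length is) * (1 + norm (y - x) / s) ^ N <=
  piece_const * c * indicator (shell k) y"
proof (cases "\<exists>js. Dl js (cut k) y ~= 0")
 case False
 then have "Dl is (piece k ph) y = 0" unfolding piece_def using bump_schwartz[OF b]
  by (intro Dl_mult_eq_0 ubd_smooth cut_ubd schwartz_smooth resid_schwartz rad_pos) auto
 then show ?thesis using piece_const_pos bump_nonneg[OF b s] by simp
next
 case True
 then have sh: "rad (Suc k) <= d y" "y \<in> shell k" using cut_nonzero by auto
 have "cmod (Dl is (piece k ph) y) * s ^ (CARD('n) + length is + 0) * (1 + norm (y - x) / s) ^ N <=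
  2 ^ length is * (cut_const TYPE('n) N * (resid_const TYPE('n) (Suc N) N * c * rad (Suc k) ^ 0))" unfolding piece_def
 proof (rule cutoff_resid_bound[OF ubd_smooth[OF cut_ubd] _ b s rad_pos])
  show "rad (Suc k) <= s \<or> rad (Suc k) <= norm (y - x)" using sh(1) d_le[OF x, of y] by simp
  show "cmod (Dl js (cut k) y) * rad (Suc k) ^ length js <= cut_const TYPE('n) N" if "length js <= length is" for js using that l by (intro cut_deriv) simp
 qed (use l in auto)
 also have "... <= piece_const * c" using power_two_bound[OF _ _ _ l, of "cut_const TYPE('n) N" "resid_const TYPE('n) (Suc N) N" c]
   cut_const_pos[where 'n='n, of N] resid_const_pos[where 'n='n, of "Suc N" N] bump_nonneg[OF b s] by (simp add: piece_const_def)
 finally show ?thesis using sh by simp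
qed

text \<open>Used with a = 0 for a bound uniform in \<open>m\<close>, and with a = 1 for the gain rad
  m / s, which takes one more order of decay of \<open>ph\<close>. As \<open>rest m\<close> is 1
  close to points of \<open>E\<close>, the first alternative of \<open>near\<close> has to hold,
  hence rad m <= s.\<close>

lemma tail_bound:
 assumes b: "bump P c x s ph" and s: "s > 0" and l: "length is <= N" and r: "rad m <= s" and P: "P = N + a" "a <= 1"
 shows "cmod (Dl is (tail m ph) y) * s ^ (CARD('n) + length is + a) * (1 + norm (y - x) / s) ^ P <=
  2 ^ N * (cut_const TYPE('n) N * resid_const TYPE('n) (Suc N) P) * (c * rad m ^ a)"
proof -
 have "cmod (Dl is (tail m ph) y) * s ^ (CARD('n) + length is + a) * (1 + norm (y - x) / s) ^ P <=
  2 ^ length is * (cut_const TYPE('n) N * (resid_const TYPE('n) (Suc N) P * c * rad m ^ a))" unfolding tail_def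
 proof (rule cutoff_resid_bound[OF ubd_smooth[OF rest_ubd] _ b s rad_pos])
  show "cmod (Dl js (rest m) y) * rad m ^ length js <= cut_const TYPE('n) N" if "length js <= length is" for js using that l by (intro rest_deriv) simp
 qed (use l r P in auto)
 also have "... = 2 ^ length is * (cut_const TYPE('n) N * (resid_const TYPE('n) (Suc N) P * (c * rad m ^ a)))" by (simp only: mult.assoc)
 also have "... <= 2 ^ N * (cut_const TYPE('n) N * resid_const TYPE('n) (Suc N) P) * (c * rad m ^ a)"
  using cut_const_pos[where 'n='n, of N] resid_const_pos[where 'n='n, of "Suc N" P] bump_nonneg[OF b s] rad_pos[of m] by (intro power_two_bound l) auto
 finally show ?thesis .
qed

lemma shell_overlap_sum: "(\<Sum>k<m. indicator (shell k) y) <= (4 :: real)"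
proof (cases "y \<in> E")
 case True
 have "y \<notin> shell k" for k using True d_eq_0[of y] rad_pos[of "Suc k"] by (auto simp: shell_def)
 then show ?thesis by simp
next
 case False
 let ?I = "{k. rad (Suc k) / 2 <= d y \<and> d y <= 7 * rad (Suc k)}"
 have I: "finite ?I" "card ?I <= 4" using rad_overlap[of "d y"] False d_pos by auto
 have "(\<Sum>k\<in>{..<m} \<inter> ?I. 1 :: real) = (\<Sum>k<m. if k \<in> ?I then 1 else 0)" by (rule sum.inter_restrict) simp
 also have "... = (\<Sum>k<m. indicator (shell k) y)" by (intro sum.cong) (auto simp: shell_def indicator_def)
 finally have "(\<Sum>k<m. indicator (shell k) y) = (\<Sum>k\<in>{..<m} \<inter> ?I. 1 :: real)" by (rule sym)
 also have "... = real (card ({..<m} \<inter> ?I))" by simp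
 also have "... <= real 4" using I by (intro of_nat_mono order_trans[OF card_mono I(2)]) auto
 finally show ?thesis by simp
qed

text \<open>The smoothed function keeps its centre and scale. In 1 + 5 * piece_const the 1 is for
  \<open>ph\<close>; of the 5, the overlap of the shells takes 4 and the tail 1.\<close>

lemma approx_bump:
 assumes x: "x \<in> E" and b: "bump N c x s ph" and s: "s > 0" and r: "rad m <= s"
 shows "bump N ((1 + 5 * piece_const) * c) x s (approx m ph)" unfolding bump_def
proof (intro conjI allI impI)
 have ph: "ph \<in> schwartz" by (rule bump_schwartz[OF b])
 show "approx m ph \<in> schwartz" by (rule approx_schwartz[OF ph])
 fix "is" :: "'n list" and y assume l: "length is <= N"
 define W where "W = s ^ (CARD('n) + length is) * (1 + norm (y - x) / s) ^ N"
 have W: "W > 0" using s by (simp add: W_def add_pos_nonneg)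
 have c: "c >= 0" by (rule bump_nonneg[OF b s])
 have sm: "smooth (piece k ph)" "smooth (tail m ph)" "smooth ph" for k using ph by (auto intro: schwartz_smooth piece_schwartz tail_schwartz)
 have "Dl is (approx m ph) y = Dl is ph y - ((\<Sum>k<m. Dl is (piece k ph) y) + Dl is (tail m ph) y)"
  unfolding approx_eq by (simp add: Dl_diff Dl_add Dl_sum sm smooth_add smooth_sum)
 then have "cmod (Dl is (approx m ph) y) <= cmod (Dl is ph y) + ((\<Sum>k<m. cmod (Dl is (piece k ph) y)) + cmod (Dl is (tail m ph) y))"
  by (auto intro!: order_trans[OF norm_triangle_ineq4] order_trans[OF norm_triangle_ineq] add_mono norm_sum)
 then have "cmod (Dl is (approx m ph) y) * W <= (cmod (Dl is ph y) + ((\<Sum>k<m. cmod (Dl is (piece k ph) y)) + cmod (Dl is (tail m ph) y))) * W"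
  using W by (intro mult_right_mono) auto
 also have "... = cmod (Dl is ph y) * W + ((\<Sum>k<m. cmod (Dl is (piece k ph) y) * W) + cmod (Dl is (tail m ph) y) * W)"
  by (simp add: distrib_right sum_distrib_right)
 also have "... <= c + ((\<Sum>k<m. piece_const * c * indicator (shell k) y) + piece_const * c)"
 proof (intro add_mono sum_mono)
  show "cmod (Dl is ph y) * W <= c" using bumpD[OF b l, of y] by (simp add: W_def mult.assoc)
  show "cmod (Dl is (piece k ph) y) * W <= piece_const * c * indicator (shell k) y" for k using piece_bound[OF x b s l, of k y] by (simp add: W_def mult.assoc)
  show "cmod (Dl is (tail m ph) y) * W <= piece_const * c" using tail_bound[OF b s l r, of 0 y] by (simp add: W_def piece_const_def mult.assoc)
 qed
 also have "(\<Sum>k<m. piece_const * c * indicator (shell k) y) <= piece_const * c * 4"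
  unfolding sum_distrib_left[symmetric] using c piece_const_pos by (intro mult_left_mono shell_overlap_sum) auto
 finally show "cmod (Dl is (approx m ph) y) * s ^ (CARD('n) + length is) * (1 + norm (y - x) / s) ^ N <= (1 + 5 * piece_const) * c"
  by (simp add: W_def mult.assoc algebra_simps)
qed

lemma tail_small:
 assumes x: "x \<in> E" and b: "bump (Suc N) c x s ph" and s: "s > 0"
 shows "(%m. f (tail m ph)) \<longlonglongrightarrow> 0"
proof -
 define Q where "Q = 2 ^ N * (cut_const TYPE('n) N * resid_const TYPE('n) (Suc N) (Suc N))"
 have c: "c >= 0" by (rule bump_nonneg[OF b s])
 have Q: "Q > 0" using cut_const_pos[where 'n='n, of N] resid_const_pos[where 'n='n] by (simp add: Q_def)
 have *: "cmod (f (tail m ph)) <= mi_card TYPE('n) N * (Q * c * rad m / s) * lam" if r: "rad m <= s" for m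
 proof (rule f_bump[OF x _ s])
  show "bump N (Q * c * rad m / s) x s (tail m ph)" unfolding bump_def
  proof (intro conjI allI impI)
   show "tail m ph \<in> schwartz" by (rule tail_schwartz[OF bump_schwartz[OF b]])
   fix "is" :: "'n list" and y assume l: "length is <= N"
   let ?w = "1 + norm (y - x) / s" and ?D = "cmod (Dl is (tail m ph) y)"
   have "?w ^ N <= ?w ^ Suc N" using s by (intro power_increasing) auto
   then have "?D * s ^ (CARD('n) + length is + 1) * ?w ^ N <= ?D * s ^ (CARD('n) + length is + 1) * ?w ^ Suc N" using s by (intro mult_left_mono) auto
   also have "... <= Q * (c * rad m)" using tail_bound[OF b s l r, of 1 y] by (simp add: Q_def)
   finally have "(?D * s ^ (CARD('n) + length is) * ?w ^ N) * s <= Q * c * rad m" by (simp add: mult_ac)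
   then show "?D * s ^ (CARD('n) + length is) * ?w ^ N <= Q * c * rad m / s" using s by (simp only: pos_le_divide_eq)
  qed
 qed
 have "(%m. mi_card TYPE('n) N * (Q * c * rad m / s) * lam) \<longlonglongrightarrow> mi_card TYPE('n) N * (Q * c * 0 / s) * lam"
  using s by (intro tendsto_intros rad_tendsto) auto
 then have lim: "(%m. mi_card TYPE('n) N * (Q * c * rad m / s) * lam) \<longlonglongrightarrow> 0" by simp
 have "\<forall>\<^sub>F m in sequentially. rad m < s" using order_tendstoD(2)[OF rad_tendsto s] .
 then have "\<forall>\<^sub>F m in sequentially. norm (f (tail m ph)) <= mi_card TYPE('n) N * (Q * c * rad m / s) * lam"
  by (rule eventually_mono) (intro *, simp)
 then show ?thesis by (rule Lim_null_comparison[OF _ lim])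
qed

text \<open>The base 8 is r / t for the mollifier at scale t = r / 8. In \<open>far_const\<close> 36
  is 2 * 9 * 2: from norm (x - u) <= 2 s w, from 1 + 8 r / m <= 9 r / m, and from r <= 2 d
  u.\<close>

definition local_const :: real where
 "local_const = 2 ^ N * (cut_const TYPE('n) N * (mol_const TYPE('n) N * 8 ^ (CARD('n) + N)))"

definition far_const :: real where
 "far_const = mi_card TYPE('n) N * (36 ^ N * (2 ^ N * (local_const * resid_const TYPE('n) (Suc N) N)))"

lemma local_const_nonneg: "local_const >= 0" using cut_const_pos[where 'n='n, of N] mol_const(1)[where 'n='n, of N] by (simp add: local_const_def)

lemma far_const_nonneg: "far_const >= 0"
 using local_const_nonneg resid_const_pos[where 'n='n, of "Suc N" N] mi_card_pos[where 'n='n, of N] by (simp add: far_const_def)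

text \<open>The localized piece lives within 8 r of the point \<open>z\<close> of \<open>E\<close>
  nearest to u, so it can be tested there instead of at \<open>x\<close>. The factor (r / norm (x -
  u)) ^ N arises from powers of \<open>r\<close> in the residual if r <= s, and from the decay of
  \<open>ph\<close> if s < r. Multiplication by r ^ CARD('n) compensates the height of the
  mollifier.\<close>

lemma localized_bump:
 assumes x: "x \<in> E" and b: "bump N c x s ph" and s: "s > 0" and r: "r = rad (Suc k)" and u: "u \<in> shell k"
  and z: "norm (z - u) = d u"
 shows "bump N (18 ^ N * (2 ^ N * (local_const * (resid_const TYPE('n) (Suc N) N * c))) * (r / norm (x - u)) ^ N) z (min r s)
  (%y. cplx (r ^ CARD('n)) * (cut k y * mol (r / 8) (y - u)) * resid (Suc N) r ph y)" unfolding bump_def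
proof (intro conjI allI impI)
 have r0: "r > 0" using r rad_pos by simp
 have du: "r / 2 <= d u" "d u <= 7 * r" using u r by (auto simp: shell_def)
 have xu: "norm (x - u) > 0" using d_le[OF x, of u] du r0 by (subst norm_minus_commute) linarith
 define \<rho> where "\<rho> = (%y. cplx (r ^ CARD('n)) * (cut k y * mol (r / 8) (y - u)))"
 have ph: "ph \<in> schwartz" by (rule bump_schwartz[OF b])
 have ub: "ubd (%y. cut k y * mol (r / 8) (y - u))" using r0 by (intro ubd_mult cut_ubd ubd_shift schwartz_ubd mol_schwartz) auto
 have \<rho>u: "ubd \<rho>" unfolding \<rho>_def by (rule ubd_cmult[OF ub])
 have c: "c >= 0" by (rule bump_nonneg[OF b s])
 define Q where "Q = 2 ^ N * (local_const * (resid_const TYPE('n) (Suc N) N * c))"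
 have Q: "Q >= 0" using local_const_nonneg resid_const_pos[where 'n='n, of "Suc N" N] c by (simp add: Q_def)
 show "(%y. cplx (r ^ CARD('n)) * (cut k y * mol (r / 8) (y - u)) * resid (Suc N) r ph y) \<in> schwartz"
  using schwartz_mult_ubd[OF \<rho>u resid_schwartz[OF ph r0]] by (simp add: \<rho>_def)
 fix "is" :: "'n list" and y assume l: "length is <= N"
 let ?D = "cmod (Dl is (%y. \<rho> y * resid (Suc N) r ph y) y)" and ?v = "r / norm (x - u)"
 have "?D * (min r s) ^ (CARD('n) + length is) * (1 + norm (y - z) / min r s) ^ N <= 18 ^ N * Q * ?v ^ N"
 proof (cases "r <= d y \<and> norm (y - u) <= r / 8")
  case False
  have "Dl js \<rho> y = 0" for js
  proof (rule Dl_eq_0_open)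
   let ?U = "{y. d y < r} \<union> {y. r / 8 < norm (y - u)}"
   show "open ?U" by (intro open_Un open_Collect_less d_continuous continuous_intros)
   show "y \<in> ?U" using False by auto
   fix v assume "v \<in> ?U"
   then have "cut k v = 0 \<or> mol (r / 8) (v - u) = 0" using cut_eq_0[of v k "[]"] r r0 by (auto intro: mol_eq_0)
   then show "\<rho> v = 0" by (auto simp: \<rho>_def)
  qed
  then have "?D = 0" using ubd_smooth[OF \<rho>u] schwartz_smooth[OF resid_schwartz[OF ph r0]] by (simp only: Dl_mult_eq_0 norm_zero)
  then show ?thesis using Q r0 by simp
 next
  case True
  have yx: "r <= norm (y - x)" using True d_le[OF x, of y] by simp
  have xu2: "norm (x - u) <= 2 * norm (y - x)" using norm_triangle_ineq[of "x - y" "y - u"] True yx r0 by (simp add: norm_minus_commute)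
  have yz: "norm (y - z) <= 8 * r" using norm_triangle_ineq[of "y - u" "u - z"] True du z r0 by (simp add: norm_minus_commute)
  have \<rho>b: "cmod (Dl js \<rho> y) * r ^ length js <= local_const" if "length js <= N" for js
  proof -
   have "cmod (Dl js (%y. cut k y * mol (r / 8) (y - u)) y) * r ^ (CARD('n) + length js) <= local_const" unfolding local_const_def
    by (rule cutoff_mult_mol[OF ubd_smooth[OF cut_ubd] _ r0 _ _ that]) (use cut_deriv r in auto)
   then show ?thesis unfolding \<rho>_def Dl_cmult[OF ubd_smooth[OF ub]] using r0 by (simp add: norm_mult norm_power power_add mult_ac)
  qed
  define w where "w = 1 + norm (y - x) / s"
  have w: "w > 0" using s by (simp add: w_def add_pos_nonneg)
  have sw: "norm (x - u) <= 2 * (s * w)" using xu2 s by (simp add: w_def distrib_left)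
  then have swN: "norm (x - u) ^ N <= 2 ^ N * (s * w) ^ N" using xu by (intro power_le_scaled) auto
  have main: "?D * s ^ (CARD('n) + length is + a) * w ^ N <= Q * r ^ a" if a: "length is + a <= N" for a
  proof -
   have "?D * s ^ (CARD('n) + length is + a) * w ^ N <= 2 ^ length is * (local_const * (resid_const TYPE('n) (Suc N) N * c * r ^ a))"
    unfolding w_def by (rule cutoff_resid_bound[OF ubd_smooth[OF \<rho>u] \<rho>b b s r0]) (use l a yx in auto)
   also have "... <= 2 ^ N * (local_const * (resid_const TYPE('n) (Suc N) N * c)) * r ^ a"
    using local_const_nonneg resid_const_pos[where 'n='n, of "Suc N" N] c r0 by (intro power_two_bound l) auto
   also have "... = Q * r ^ a" by (simp only: Q_def)
   finally show ?thesis .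
  qed
  have fin: "?D * m ^ (CARD('n) + length is) * (1 + norm (y - z) / m) ^ N <= 18 ^ N * Q * ?v ^ N"
   if m: "m > 0" "m <= r" and K: "?D * m ^ (CARD('n) + length is) * norm (x - u) ^ N <= 2 ^ N * Q * m ^ N" for m
  proof -
   have "norm (y - z) / m <= 8 * r / m" using yz m by (intro divide_right_mono) auto
   moreover have "1 <= r / m" using m by simp
   ultimately have "1 + norm (y - z) / m <= 9 * (r / m)" by simp
   then have "(1 + norm (y - z) / m) ^ N <= 9 ^ N * (r / m) ^ N" using m by (intro power_le_scaled) auto
   then have "?D * m ^ (CARD('n) + length is) * (1 + norm (y - z) / m) ^ N <= ?D * m ^ (CARD('n) + length is) * (9 ^ N * (r / m) ^ N)"
    using m by (intro mult_left_mono) auto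
   also have "... = (?D * m ^ (CARD('n) + length is) * norm (x - u) ^ N) * (9 ^ N * (r / m) ^ N / norm (x - u) ^ N)" using xu by simp
   also have "... <= (2 ^ N * Q * m ^ N) * (9 ^ N * (r / m) ^ N / norm (x - u) ^ N)" using m r0 by (intro mult_right_mono K) auto
   also have "... = (2 ^ N * 9 ^ N) * Q * ?v ^ N" using m by (simp add: power_divide)
   also have "2 ^ N * 9 ^ N = (18 ^ N :: real)" by (simp flip: power_mult_distrib)
   finally show ?thesis .
  qed
  show ?thesis
  proof (cases "r <= s")
   case True
   \<comment> \<open>All orders not spent on derivatives are taken as powers of \<open>r\<close>
     from the residual.\<close>
   obtain a where a: "N = length is + a" using l le_Suc_ex by blast
   have e: "CARD('n) + length is + a = CARD('n) + N" using a by simp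
   have "?D * s ^ (CARD('n) + N) * w ^ N <= Q * r ^ a" using main[of a] a by (simp only: e)
   then have 1: "?D * s ^ CARD('n) * (s * w) ^ N <= Q * r ^ a" by (simp add: power_add power_mult_distrib mult_ac)
   have "?D * r ^ (CARD('n) + length is) * norm (x - u) ^ N <= ?D * (s ^ CARD('n) * r ^ length is) * (2 ^ N * (s * w) ^ N)"
    unfolding power_add using True r0 swN s by (intro mult_mono mult_left_mono power_mono mult_nonneg_nonneg) auto
   also have "... = 2 ^ N * r ^ length is * (?D * s ^ CARD('n) * (s * w) ^ N)" by (simp only: mult_ac)
   also have "... <= 2 ^ N * r ^ length is * (Q * r ^ a)" using r0 by (intro mult_left_mono 1) auto
   also have "... = 2 ^ N * Q * r ^ N" by (simp add: a power_add)
   finally show ?thesis using True r0 fin[of r] by (simp add: min_absorb1)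
  next
   case False
   have 1: "?D * s ^ (CARD('n) + length is) * w ^ N <= Q" using main[of 0] l by simp
   have "?D * s ^ (CARD('n) + length is) * norm (x - u) ^ N <= ?D * s ^ (CARD('n) + length is) * (2 ^ N * (s * w) ^ N)"
    using s swN by (intro mult_left_mono) auto
   also have "... = 2 ^ N * s ^ N * (?D * s ^ (CARD('n) + length is) * w ^ N)" by (simp add: power_mult_distrib)
   also have "... <= 2 ^ N * s ^ N * Q" using s by (intro mult_left_mono 1) auto
   finally show ?thesis using False s fin[of s] by (simp add: min_absorb2 mult_ac)
  qed
 qed
 then show "cmod (Dl is (%y. cplx (r ^ CARD('n)) * (cut k y * mol (r / 8) (y - u)) * resid (Suc N) r ph y) y) *
  (min r s) ^ (CARD('n) + length is) * (1 + norm (y - z) / min r s) ^ N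
  <= 18 ^ N * (2 ^ N * (local_const * (resid_const TYPE('n) (Suc N) N * c))) * ?v ^ N" by (simp only: \<rho>_def Q_def)
qed

lemma localized_bound:
 assumes x: "x \<in> E" and b: "bump N c x s ph" and s: "s > 0" and u: "u \<in> shell k"
 shows "cmod (f (%y. piece k ph y * mol (rad (Suc k) / 8) (y - u))) <= far_const * c * lam * (d u ^ (N - CARD('n)) / norm (x - u) ^ N)"
proof -
 define r where "r = rad (Suc k)"
 have r0: "r > 0" by (simp add: r_def rad_pos)
 have c: "c >= 0" by (rule bump_nonneg[OF b s])
 have du: "r / 2 <= d u" using u r_def by (auto simp: shell_def)
 have xu: "norm (x - u) > 0" using d_le[OF x, of u] du r0 by (subst norm_minus_commute) linarith
 obtain z where z: "z \<in> E" "norm (z - u) = d u" using nearest[of u] by auto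
 define Q where "Q = 2 ^ N * (local_const * (resid_const TYPE('n) (Suc N) N * c))"
 have Q: "Q >= 0" using local_const_nonneg resid_const_pos[where 'n='n, of "Suc N" N] c by (simp add: Q_def)
 define g where "g = (%y. piece k ph y * mol (r / 8) (y - u))"
 have ph: "ph \<in> schwartz" by (rule bump_schwartz[OF b])
 have gs: "g \<in> schwartz"
 proof -
  have "(%y. piece k ph y * mol (r / 8) (y - u)) \<in> schwartz"
   using r0 by (intro schwartz_mult_ubd schwartz_ubd piece_schwartz ph schwartz_shift mol_schwartz) auto
  then show ?thesis by (simp add: g_def)
 qed
 have "(%y. cplx (r ^ CARD('n)) * (cut k y * mol (r / 8) (y - u)) * resid (Suc N) r ph y) = (%y. cplx (r ^ CARD('n)) * g y)"
  by (auto simp: g_def piece_def r_def mult_ac)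
 with localized_bump[OF x b s r_def u z(2)]
 have bb: "bump N (18 ^ N * Q * (r / norm (x - u)) ^ N) z (min r s) (%y. cplx (r ^ CARD('n)) * g y)" unfolding Q_def by (simp only:)
 have "cmod (f (%y. cplx (r ^ CARD('n)) * g y)) <= mi_card TYPE('n) N * (18 ^ N * Q * (r / norm (x - u)) ^ N) * lam"
  by (rule f_bump[OF z(1) bb]) (use r0 s in simp)
 then have "r ^ CARD('n) * cmod (f g) <= mi_card TYPE('n) N * (18 ^ N * Q * (r / norm (x - u)) ^ N) * lam"
  using r0 by (simp add: tempered_cmult[OF f gs] norm_mult norm_power)
 also have "(r / norm (x - u)) ^ N = r ^ CARD('n) * (r ^ (N - CARD('n)) / norm (x - u) ^ N)" using N by (simp add: power_divide flip: power_add)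
 finally have "r ^ CARD('n) * cmod (f g) <= r ^ CARD('n) * (mi_card TYPE('n) N * (18 ^ N * Q * (r ^ (N - CARD('n)) / norm (x - u) ^ N)) * lam)"
  by (simp add: mult_ac)
 then have "cmod (f g) <= mi_card TYPE('n) N * (18 ^ N * Q * (r ^ (N - CARD('n)) / norm (x - u) ^ N)) * lam"
  using r0 by (simp only: mult_le_cancel_left_pos zero_less_power)
 also have "... <= mi_card TYPE('n) N * (18 ^ N * Q * (2 ^ N * d u ^ (N - CARD('n)) / norm (x - u) ^ N)) * lam"
 proof -
  have "r ^ (N - CARD('n)) <= 2 ^ (N - CARD('n)) * d u ^ (N - CARD('n))" using du r0 by (intro power_le_scaled) auto
  also have "... <= 2 ^ N * d u ^ (N - CARD('n))" using d_nonneg[of u] by (intro mult_right_mono power_increasing) auto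
  finally show ?thesis using mi_card_pos[where 'n='n, of N] Q lam by (intro mult_right_mono mult_left_mono divide_right_mono mult_nonneg_nonneg) auto
 qed
 also have "... = mi_card TYPE('n) N * ((18 ^ N * 2 ^ N) * Q) * lam * (d u ^ (N - CARD('n)) / norm (x - u) ^ N)" by simp
 also have "18 ^ N * 2 ^ N = (36 ^ N :: real)" by (simp flip: power_mult_distrib)
 finally show ?thesis by (simp add: g_def r_def far_const_def Q_def mult_ac)
qed

text \<open>A Marcinkiewicz integral of the distance function, of the order that
  \<open>localized_bound\<close> produces.\<close>

definition far :: "real ^ 'n => ennreal" where
 "far x = (NN u. ennreal (d u ^ (N - CARD('n)) / norm (x - u) ^ N) * indicator (- E) u)"

lemma piece_far:
 assumes x: "x \<in> E" and b: "bump N c x s ph" and s: "s > 0"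
 shows "ennreal (cmod (f (piece k ph))) <=
  ennreal (far_const * c * lam) * (NN u. ennreal (d u ^ (N - CARD('n)) / norm (x - u) ^ N) * indicator (shell k) u)"
proof -
 have ph: "ph \<in> schwartz" by (rule bump_schwartz[OF b])
 let ?K = "mol (rad (Suc k) / 8) :: 'n cfun" and ?w = "indicator (shell k) :: 'n cfun"
 have K: "ubd ?K" using rad_pos[of "Suc k"] by (intro schwartz_ubd mol_schwartz) auto
 have c: "c >= 0" by (rule bump_nonneg[OF b s])
 have e: "(%y. piece k ph y * cnv ?K ?w y) = piece k ph"
 proof
  fix y
  show "piece k ph y * cnv ?K ?w y = piece k ph y"
  proof (cases "cut k y = 0")
   case False
   then show ?thesis using cut_nonzero[of "[]" k y] by (simp add: moll_shell)
  qed (simp add: piece_def)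
 qed
 note T = tempered_partition[OF f piece_schwartz[OF ph, of k] K shell_integrable[of k]]
 have fp: "f (piece k ph) = (LL u. f (%y. piece k ph y * ?K (y - u)) * ?w u)" using T(2) by (simp only: e)
 have "ennreal (cmod (f (piece k ph))) <= (NN u. ennreal (cmod (f (%y. piece k ph y * ?K (y - u)) * ?w u)))"
  unfolding fp by (rule integral_norm_bound_ennreal[OF T(1)])
 also have "... <= (NN u. ennreal (far_const * c * lam) * (ennreal (d u ^ (N - CARD('n)) / norm (x - u) ^ N) * indicator (shell k) u))"
 proof (rule nn_integral_mono)
  fix u :: "real ^ 'n"
  show "ennreal (cmod (f (%y. piece k ph y * ?K (y - u)) * ?w u)) <=
   ennreal (far_const * c * lam) * (ennreal (d u ^ (N - CARD('n)) / norm (x - u) ^ N) * indicator (shell k) u)"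
  proof (cases "u \<in> shell k")
   case True
   have "ennreal (cmod (f (%y. piece k ph y * ?K (y - u)))) <= ennreal (far_const * c * lam * (d u ^ (N - CARD('n)) / norm (x - u) ^ N))"
    by (intro ennreal_leI localized_bound[OF x b s True])
   also have "... = ennreal (far_const * c * lam) * ennreal (d u ^ (N - CARD('n)) / norm (x - u) ^ N)"
    by (rule ennreal_mult) (use c lam far_const_nonneg d_nonneg in auto)
   finally show ?thesis using True by simp
  qed simp
 qed
 also have "... = ennreal (far_const * c * lam) * (NN u. ennreal (d u ^ (N - CARD('n)) / norm (x - u) ^ N) * indicator (shell k) u)"
  by (rule nn_integral_cmult) measurable
 finally show ?thesis .
qed

text \<open>The shells overlap at most 4 times, so the sum over \<open>k\<close> is bounded by a
  single integral over the complement of \<open>E\<close>, uniformly in \<open>m\<close>.\<close>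

lemma approx_far:
 assumes x: "x \<in> E" and b: "bump N c x s ph" and s: "s > 0"
 shows "ennreal (cmod (f ph - f (approx m ph))) <= ennreal (4 * far_const * c * lam) * far x + ennreal (cmod (f (tail m ph)))"
proof -
 have ph: "ph \<in> schwartz" by (rule bump_schwartz[OF b])
 have c: "c >= 0" by (rule bump_nonneg[OF b s])
 let ?F = "%u. ennreal (d u ^ (N - CARD('n)) / norm (x - u) ^ N)"
 have sum: "(%y. \<Sum>k<m. piece k ph y) \<in> schwartz" by (intro schwartz_sum piece_schwartz ph)
 have "f (approx m ph) = f ph - ((\<Sum>k<m. f (piece k ph)) + f (tail m ph))" unfolding approx_eq using ph
  by (simp add: tempered_diff[OF f] tempered_add[OF f] tempered_sum[OF f] sum tail_schwartz piece_schwartz schwartz_add)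
 then have "cmod (f ph - f (approx m ph)) <= (\<Sum>k<m. cmod (f (piece k ph))) + cmod (f (tail m ph))"
  by (auto intro!: order_trans[OF norm_triangle_ineq] norm_sum)
 then have "ennreal (cmod (f ph - f (approx m ph))) <= ennreal ((\<Sum>k<m. cmod (f (piece k ph))) + cmod (f (tail m ph)))" by (rule ennreal_leI)
 also have "... = (\<Sum>k<m. ennreal (cmod (f (piece k ph)))) + ennreal (cmod (f (tail m ph)))" by (simp add: ennreal_plus sum_nonneg sum_ennreal)
 also have "(\<Sum>k<m. ennreal (cmod (f (piece k ph)))) <= (\<Sum>k<m. ennreal (far_const * c * lam) * (NN u. ?F u * indicator (shell k) u))"
  by (intro sum_mono piece_far[OF x b s])
 also have "... = ennreal (far_const * c * lam) * (NN u. (\<Sum>k<m. ?F u * indicator (shell k) u))"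
 proof -
  have "(NN u. (\<Sum>k<m. ?F u * indicator (shell k) u)) = (\<Sum>k<m. NN u. ?F u * indicator (shell k) u)" by (rule nn_integral_sum) measurable
  then show ?thesis by (simp only: sum_distrib_left)
 qed
 also have "... <= ennreal (far_const * c * lam) * (NN u. 4 * (?F u * indicator (- E) u))"
 proof (intro mult_left_mono nn_integral_mono)
  fix u
  have "(\<Sum>k<m. indicator (shell k) u :: ennreal) <= (\<Sum>k. indicator (shell k) u)" by (rule sum_le_suminf) auto
  then have "(\<Sum>k<m. indicator (shell k) u :: ennreal) <= 4 * indicator (- E) u" using shell_overlap by (rule order_trans)
  then have "?F u * (\<Sum>k<m. indicator (shell k) u) <= ?F u * (4 * indicator (- E) u)" by (intro mult_left_mono) auto
  then have "(\<Sum>k<m. ?F u * indicator (shell k) u) <= ?F u * (4 * indicator (- E) u)" by (simp only: sum_distrib_left)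
  then show "(\<Sum>k<m. ?F u * indicator (shell k) u) <= 4 * (?F u * indicator (- E) u)" by (simp only: mult.left_commute)
 qed auto
 also have "(NN u. 4 * (?F u * indicator (- E) u)) = 4 * far x" unfolding far_def using closed by (intro nn_integral_cmult) auto
 also have "ennreal (far_const * c * lam) * (4 * far x) = ennreal (4 * far_const * c * lam) * far x"
 proof -
  have "ennreal (4 * far_const * c * lam) = 4 * ennreal (far_const * c * lam)"
   using ennreal_mult[of 4 "far_const * c * lam"] c lam far_const_nonneg by (simp add: mult_ac)
  then show ?thesis by (simp add: mult_ac)
 qed
 finally show ?thesis by (simp add: add_right_mono)
qed

end

section \<open>Almost everywhere convergence of convex combinations\<close>

text \<open>Iterated midpoints, that is, dyadic convex combinations of members from index
  \<open>m\<close> on. Midpoints are all that the parallelogram law needs, and an induction over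
  them transfers convex bounds.\<close>

inductive_set mids :: "(nat => 'a => complex) => nat => ('a => complex) set"
 for h :: "nat => 'a => complex" and m :: nat where
 base: "m <= i ==> h i \<in> mids h m"
| mid: "a \<in> mids h m ==> b \<in> mids h m ==> (%x. (a x + b x) / 2) \<in> mids h m"

lemma mids_mono: "g \<in> mids h l ==> m <= l ==> g \<in> mids h m" by (induction rule: mids.induct) (auto intro: mids.intros)

lemma mids_measurable: "g \<in> mids h m ==> (!!i. h i \<in> borel_measurable M) ==> g \<in> borel_measurable M" by (induction rule: mids.induct) auto

lemma norm_mid_le: "cmod (a - c) <= R ==> cmod (b - c) <= R ==> cmod ((a + b) / 2 - c) <= R"
proof -
 assume "cmod (a - c) <= R" "cmod (b - c) <= R"
 moreover have "(a + b) / 2 - c = ((a - c) + (b - c)) / 2" by (simp add: field_simps)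
 then have "cmod ((a + b) / 2 - c) = cmod ((a - c) + (b - c)) / 2" by (simp only: norm_divide norm_numeral)
 ultimately show ?thesis using norm_triangle_ineq[of "a - c" "b - c"] by linarith
qed

lemma mids_bound: "g \<in> mids h m ==> (!!i. cmod (h i x) <= B) ==> cmod (g x) <= B" by (induction rule: mids.induct) (use norm_mid_le[where c=0] in auto)

lemma mids_integral:
 assumes "g \<in> mids h m" "!!i. integrable M (%x. h i x * ph x)" "!!i. m <= i ==> cmod ((LINT x|M. h i x * ph x) - c) <= R"
 shows "integrable M (%x. g x * ph x) \<and> cmod ((LINT x|M. g x * ph x) - c) <= R" using assms
proof (induction rule: mids.induct)
 case (mid a b)
 have a: "integrable M (%x. a x * ph x)" "cmod ((LINT x|M. a x * ph x) - c) <= R" using mid by auto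
 have b: "integrable M (%x. b x * ph x)" "cmod ((LINT x|M. b x * ph x) - c) <= R" using mid by auto
 have e: "(%x. (a x + b x) / 2 * ph x) = (%x. (a x * ph x + b x * ph x) / 2)" by (simp add: field_simps)
 have "(LINT x|M. (a x * ph x + b x * ph x) / 2) = ((LINT x|M. a x * ph x) + (LINT x|M. b x * ph x)) / 2" using a(1) b(1) by simp
 then show ?case unfolding e using a b norm_mid_le[OF a(2) b(2)] by simp
qed auto

lemma parallelogram_complex:
 "cmod (a - b) ^ 2 = 2 * cmod a ^ 2 + 2 * cmod b ^ 2 - 4 * cmod ((a + b) / 2) ^ 2"
proof -
 have "cmod ((a + b) / 2) ^ 2 = cmod (a + b) ^ 2 / 4" by (simp add: norm_divide power_divide)
 then show ?thesis by (simp only: cmod_power2) (simp add: power2_eq_square field_simps)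
qed

lemma summable_norm_diff_convergent:
 fixes G :: "nat => complex"
 assumes "summable (%k. cmod (G (Suc k) - G k))"
 shows "convergent G"
proof -
 have "summable (%k. G (Suc k) - G k)" using assms by (rule summable_norm_cancel)
 then have "convergent (%n. \<Sum>k<n. G (Suc k) - G k)" by (simp add: summable_iff_convergent)
 then have "convergent (%n. G n - G 0)" by (simp only: sum_lessThan_telescope)
 then have "convergent (%n. (G n - G 0) + G 0)" by (intro convergent_add convergent_const)
 then show ?thesis by simp
qed

text \<open>
 Almost minimizers of the \<open>L\<^sup>2\<close> norm over the decreasing sets \<open>mids h m\<close> form a Cauchy sequence by the
 parallelogram law.
\<close>

lemma (in finite_measure) convex_combinations_converge:
 fixes h :: "nat => 'a => complex"
 assumes h[measurable]: "!!i. h i \<in> borel_measurable M" and B: "!!i x. cmod (h i x) <= B"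
 obtains v G where "v \<in> borel_measurable M" "!!k. G k \<in> mids h k" "AE x in M. (%k. G k x) \<longlonglongrightarrow> v x"
proof -
 define I where "I = (%g. LINT x|M. cmod (g x) ^ 2)"
 have meas: "g \<in> borel_measurable M" if "g \<in> mids h m" for g m using that h by (rule mids_measurable)
 have bd: "cmod (g x) <= B" if "g \<in> mids h m" for g m x using that B by (rule mids_bound)
 have int: "integrable M (%x. cmod (g x) ^ 2)" if g: "g \<in> borel_measurable M" and "!!x. cmod (g x) <= b" for g and b :: real
 proof (rule integrable_const_bound[where B="b ^ 2"])
  show "AE x in M. norm (cmod (g x) ^ 2) <= b ^ 2" using that(2) by (auto intro!: power_mono)
 qed (use g in measurable)
 have I0: "I g >= 0" for g unfolding I_def by (rule integral_nonneg_AE) simp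
 \<comment> \<open>The infimum of the squared norm over the shrinking sets increases with
   \<open>m\<close> and is bounded; its convergence forces almost minimizers together.\<close>
 define S where "S = (%m. Inf (I ` mids h m))"
 have bdb: "bdd_below (I ` mids h m)" for m using I0 by (intro bdd_belowI[of _ 0]) auto
 have ne: "I ` mids h m ~= {}" for m using mids.base[of m m h] by auto
 have S_le: "S m <= I g" if "g \<in> mids h m" for g m unfolding S_def using that bdb by (intro cInf_lower) auto
 have S_mono: "S m <= S l" if "m <= l" for m l unfolding S_def using that ne bdb by (intro cInf_superset_mono) (auto intro: mids_mono)
 have S_bd: "S m <= I (h m')" if "m <= m'" for m m' using that by (intro S_le mids.base)
 have I_le: "I (h m) <= B ^ 2 * measure M (space M)" for m
 proof -
  have "I (h m) <= (LINT x|M. B ^ 2)" unfolding I_def using B by (intro integral_mono int[of _ B]) (auto intro!: power_mono)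
  then show ?thesis by (simp add: mult.commute)
 qed
 have "convergent S"
 proof (rule Bseq_mono_convergent)
  show "Bseq S"
  proof (rule BseqI')
   fix m
   have "0 <= S m" unfolding S_def using ne I0 by (intro cInf_greatest) auto
   then show "norm (S m) <= B ^ 2 * measure M (space M)" using S_bd[of m m] I_le[of m] by simp
  qed
 qed (use S_mono in auto)
 then obtain S0 where S0: "S \<longlonglongrightarrow> S0" by (auto simp: convergent_def)
 have S_le0: "S m <= S0" for m using S0 S_mono by (intro incseq_le) (auto simp: incseq_def)
 have "\<exists>g. g \<in> mids h m \<and> I g < S m + inverse (real (Suc m))" for m
 proof -
  have "\<exists>y\<in>I ` mids h m. y < S m + inverse (real (Suc m))" unfolding S_def using ne bdb by (intro cInf_lessD) auto
  then show ?thesis by auto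
 qed
 then obtain g where g: "!!m. g m \<in> mids h m" "!!m. I (g m) < S m + inverse (real (Suc m))" by metis
 define \<eta> where "\<eta> = (%m. (S0 - S m) + inverse (real (Suc m)))"
 have \<eta>0: "\<eta> \<longlonglongrightarrow> 0"
 proof -
  have "(%m. (S0 - S m) + inverse (real (Suc m))) \<longlonglongrightarrow> (S0 - S0) + 0" by (intro tendsto_intros S0 LIMSEQ_inverse_real_of_nat)
  then show ?thesis by (simp add: \<eta>_def)
 qed
 have dist: "I (%x. g m x - g l x) <= 2 * \<eta> m + 2 * \<eta> l" for m l
 proof -
  define q where "q = min m l"
  have gq: "g m \<in> mids h q" "g l \<in> mids h q" unfolding q_def by (rule mids_mono[OF g(1)], simp)+
  have mm: "(%x. (g m x + g l x) / 2) \<in> mids h q" by (rule mids.mid[OF gq])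
  have i: "S q <= I (%x. (g m x + g l x) / 2)" "integrable M (%x. cmod ((g m x + g l x) / 2) ^ 2)" by (rule S_le[OF mm], rule int[OF meas[OF mm] bd[OF mm]])
  have j: "integrable M (%x. cmod (g m x) ^ 2)" "integrable M (%x. cmod (g l x) ^ 2)" using g(1) by (auto intro: int meas bd)
  have "I (%x. g m x - g l x) = (LINT x|M. 2 * cmod (g m x) ^ 2 + 2 * cmod (g l x) ^ 2 - 4 * cmod ((g m x + g l x) / 2) ^ 2)"
   unfolding I_def by (rule Bochner_Integration.integral_cong[OF refl parallelogram_complex])
  also have "... = (LINT x|M. 2 * cmod (g m x) ^ 2 + 2 * cmod (g l x) ^ 2) - (LINT x|M. 4 * cmod ((g m x + g l x) / 2) ^ 2)"
   using i(2) j by (intro Bochner_Integration.integral_diff Bochner_Integration.integrable_add integrable_mult_right)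
  also have "... = 2 * I (g m) + 2 * I (g l) - 4 * I (%x. (g m x + g l x) / 2)"
   unfolding I_def using j by (subst Bochner_Integration.integral_add) (auto intro!: integrable_mult_right simp del: norm_divide)
  finally have 1: "I (%x. g m x - g l x) = 2 * I (g m) + 2 * I (g l) - 4 * I (%x. (g m x + g l x) / 2)" .
  have "S q = S m \<or> S q = S l" by (auto simp: q_def min_def)
  \<comment> \<open>One of S m and S l is S q, and the other one is at most the limit S0.\<close>
  then have "S q >= S m + S l - S0" using S_le0[of m] S_le0[of l] by auto
  then show ?thesis using 1 i(1) g(2)[of m] g(2)[of l] by (simp add: \<eta>_def)
 qed
 have "\<exists>m\<ge>k. \<eta> m <= (1 / 4) ^ k / 4" for k
 proof -
  have "\<forall>\<^sub>F m in sequentially. \<eta> m < (1 / 4) ^ k / 4" by (rule order_tendstoD(2)[OF \<eta>0]) simp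
  then have "\<forall>\<^sub>F m in sequentially. m >= k \<and> \<eta> m < (1 / 4) ^ k / 4" using eventually_ge_at_top[of k] by eventually_elim simp
  then obtain m where "m >= k" "\<eta> m < (1 / 4) ^ k / 4" unfolding eventually_sequentially by blast
  then show ?thesis by (intro exI[of _ m]) simp
 qed
 \<comment> \<open>A subsequence with error 4^(-k) in the squared norm; even after multiplication by
   2^k it stays summable.\<close>
 then obtain s where s: "!!k. s k >= k" "!!k. \<eta> (s k) <= (1 / 4) ^ k / 4" by metis
 define G where "G = (%k. g (s k))"
 have Gm: "G k \<in> mids h k" for k unfolding G_def using g(1) s(1) by (rule mids_mono)
 have [measurable]: "G k \<in> borel_measurable M" for k by (rule meas[OF Gm])
 have I_G: "I (%x. G (Suc k) x - G k x) <= (1 / 4) ^ k" for k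
 proof -
  have "(1 / 4 :: real) ^ Suc k = (1 / 4) ^ k / 4" "(1 / 4 :: real) ^ k >= 0" by simp_all
  then have "2 * \<eta> (s (Suc k)) + 2 * \<eta> (s k) <= (1 / 4) ^ k" using s(2)[of k] s(2)[of "Suc k"] by linarith
  then show ?thesis using dist[of "s (Suc k)" "s k"] unfolding G_def by linarith
 qed
 define V where "V = measure M (space M)"
 have nn: "(\<integral>\<^sup>+ x. ennreal (cmod (G (Suc k) x - G k x)) \<partial>M) <= ennreal ((1 / 2) ^ k * (V + 1))" for k
 proof -
  have bnd: "cmod (G (Suc k) x - G k x) <= 2 * B" for x
   using norm_triangle_ineq4[of "G (Suc k) x" "G k x"] bd[OF Gm, of "Suc k" x] bd[OF Gm, of k x] by linarith
  have i2: "integrable M (%x. cmod (G (Suc k) x - G k x) ^ 2)" by (rule int[OF _ bnd]) measurable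
  have "(\<integral>\<^sup>+ x. ennreal (cmod (G (Suc k) x - G k x)) \<partial>M) <= (\<integral>\<^sup>+ x. ennreal ((1 / 2) ^ k + 2 ^ k * cmod (G (Suc k) x - G k x) ^ 2) \<partial>M)"
  proof (intro nn_integral_mono ennreal_leI)
   fix x
   let ?a = "cmod (G (Suc k) x - G k x)"
   \<comment> \<open>Passes from squares to first powers pointwise, in place of the Cauchy-Schwarz
     inequality; the summand (1 / 2) ^ k is integrable because the measure is finite.\<close>
   show "?a <= (1 / 2) ^ k + 2 ^ k * ?a ^ 2"
   proof (cases "?a <= (1 / 2) ^ k")
    case True
    then show ?thesis by (simp add: add_increasing2)
   next
    case False
    have "(2 :: real) ^ k * (1 / 2) ^ k = 1" by (simp flip: power_mult_distrib)
    then have "1 <= 2 ^ k * ?a" using False mult_left_mono[of "(1 / 2) ^ k" ?a "2 ^ k"] by simp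
    then have "1 * ?a <= 2 ^ k * ?a * ?a" by (intro mult_right_mono) auto
    then show ?thesis by (simp add: power2_eq_square mult.assoc add_increasing)
   qed
  qed
  also have "... = ennreal (LINT x|M. (1 / 2) ^ k + 2 ^ k * cmod (G (Suc k) x - G k x) ^ 2)" using i2 by (intro nn_integral_eq_integral) auto
  also have "(LINT x|M. (1 / 2) ^ k + 2 ^ k * cmod (G (Suc k) x - G k x) ^ 2) = (1 / 2) ^ k * V + 2 ^ k * I (%x. G (Suc k) x - G k x)"
   using i2 by (simp add: I_def V_def mult.commute)
  also have "... <= (1 / 2) ^ k * V + 2 ^ k * (1 / 4) ^ k" by (intro add_left_mono mult_left_mono I_G) auto
  also have "2 ^ k * (1 / 4) ^ k = (1 / 2 :: real) ^ k" by (simp flip: power_mult_distrib)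
  finally show ?thesis by (simp add: distrib_left ennreal_leI)
 qed
 have V0: "V >= 0" by (simp add: V_def)
 have "(\<integral>\<^sup>+ x. (\<Sum>k. ennreal (cmod (G (Suc k) x - G k x))) \<partial>M) = (\<Sum>k. \<integral>\<^sup>+ x. ennreal (cmod (G (Suc k) x - G k x)) \<partial>M)"
  by (rule nn_integral_suminf) measurable
 also have "... <= (\<Sum>k. ennreal ((1 / 2) ^ k * (V + 1)))" by (intro suminf_le nn) auto
 also have "... = ennreal (\<Sum>k. (1 / 2) ^ k * (V + 1))" using V0 by (intro suminf_ennreal2 summable_mult2 summable_geometric) auto
 also have "... < \<infinity>" by simp
 finally have "AE x in M. (\<Sum>k. ennreal (cmod (G (Suc k) x - G k x))) ~= \<infinity>" by (intro nn_integral_PInf_AE) auto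
 then have "AE x in M. (%k. G k x) \<longlonglongrightarrow> lim (%k. G k x)"
 proof eventually_elim
  fix x assume "(\<Sum>k. ennreal (cmod (G (Suc k) x - G k x))) ~= \<infinity>"
  then have "summable (%k. cmod (G (Suc k) x - G k x))" by (intro summable_suminf_not_top) auto
  then have "convergent (%k. G k x)" by (rule summable_norm_diff_convergent)
  then show "(%k. G k x) \<longlonglongrightarrow> lim (%k. G k x)" by (simp add: convergent_LIMSEQ_iff)
 qed
 moreover have "(%x. lim (%k. G k x)) \<in> borel_measurable M" by measurable
 ultimately show ?thesis using that Gm by blast
qed

section \<open>Kernels of the smoothed pieces\<close>

context good_part
begin

text \<open>The density of ph \<mapsto> f (\<rho> smoothing ph), combined from the densities that
  \<open>tempered_moll\<close> gives for the single mollifications.\<close>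

definition ker :: "('n cfun) => real => 'n cfun" where
 "ker \<rho> r u = (\<Sum>j=1..Suc N. coef (Suc N) j * f (%y. \<rho> y * mol (real j * step (Suc N) r) (y - u)))"

definition ker_const :: real where
 "ker_const = (\<Sum>j=1..Suc N. cmod (coef (Suc N) j)) *
  (mi_card TYPE('n) N * (2 ^ N * (2 ^ N * (cut_const TYPE('n) N * (mol_const TYPE('n) N * (8 * real (Suc N)) ^ (CARD('n) + N)))) * 8 ^ N))"

lemma ker_const_nonneg: "ker_const >= 0" using cut_const_pos[where 'n='n, of N] mol_const(1)[where 'n='n, of N] mi_card_pos[where 'n='n, of N]
 by (simp add: ker_const_def sum_nonneg)

lemma ker_smoothing:
 assumes \<rho>: "ubd \<rho>" and r: "r > 0" and ph: "ph \<in> schwartz"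
 shows "integrable lborel (%u. ker \<rho> r u * ph u)"
  and "f (%y. \<rho> y * smoothing (Suc N) r ph y) = (LL u. ker \<rho> r u * ph u)"
  and "continuous_on UNIV (ker \<rho> r)"
proof -
 let ?t = "%j. real j * step (Suc N) r" and ?c = "coef (Suc N)"
 have t: "?t j > 0" if "j \<in> {1..Suc N}" for j using that r by (intro step_mult_pos) auto
 note T = tempered_moll[OF f \<rho> ph t]
 have e: "ker \<rho> r u * ph u = (\<Sum>j=1..Suc N. ?c j * (f (%y. \<rho> y * mol (?t j) (y - u)) * ph u))" for u
  unfolding ker_def sum_distrib_right by (simp only: mult.assoc)
 show "integrable lborel (%u. ker \<rho> r u * ph u)" unfolding e by (intro Bochner_Integration.integrable_sum integrable_mult_right T(1))
 have "(%y. \<rho> y * smoothing (Suc N) r ph y) = (%y. \<Sum>j=1..Suc N. ?c j * (\<rho> y * moll (?t j) ph y))"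
  unfolding smoothing_def sum_distrib_left by (simp only: mult.left_commute)
 then have "f (%y. \<rho> y * smoothing (Suc N) r ph y) = f (%y. \<Sum>j=1..Suc N. ?c j * (\<rho> y * moll (?t j) ph y))" by (rule arg_cong)
 also have "... = (\<Sum>j=1..Suc N. f (%y. ?c j * (\<rho> y * moll (?t j) ph y)))"
  by (intro tempered_sum[OF f] schwartz_cmult schwartz_mult_ubd \<rho> moll_schwartz ph t)
 also have "... = (\<Sum>j=1..Suc N. LL u. ?c j * (f (%y. \<rho> y * mol (?t j) (y - u)) * ph u))"
 proof (rule sum.cong[OF refl])
  fix j assume j: "j \<in> {1..Suc N}"
  have "f (%y. ?c j * (\<rho> y * moll (?t j) ph y)) = ?c j * f (%y. \<rho> y * moll (?t j) ph y)"
   by (intro tempered_cmult[OF f] schwartz_mult_ubd \<rho> moll_schwartz ph t j)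
  then show "f (%y. ?c j * (\<rho> y * moll (?t j) ph y)) = (LL u. ?c j * (f (%y. \<rho> y * mol (?t j) (y - u)) * ph u))"
   by (simp only: T(2)[OF j] integral_mult_right_zero)
 qed
 also have "... = (LL u. ker \<rho> r u * ph u)" unfolding e by (rule Bochner_Integration.integral_sum[symmetric]) (intro integrable_mult_right T(1))
 finally show "f (%y. \<rho> y * smoothing (Suc N) r ph y) = (LL u. ker \<rho> r u * ph u)" .
 show "continuous_on UNIV (ker \<rho> r)" unfolding ker_def[abs_def] by (intro continuous_on_sum continuous_on_mult continuous_on_const T(3))
qed

lemma ker_eq_0:
 assumes r: "r > 0" and \<rho>: "!!y. norm (y - u) < r / 8 ==> \<rho> y = 0"
 shows "ker \<rho> r u = 0" unfolding ker_def
proof (rule sum.neutral, rule)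
 fix j assume j: "j \<in> {1..Suc N}"
 let ?t = "real j * step (Suc N) r"
 have t1: "?t > 0" by (rule step_mult_pos) (use j r in auto)
 have t2: "?t <= r / 8" by (rule step_le) (use j r in auto)
 note t = t1 t2
 have "\<rho> y * mol ?t (y - u) = 0" for y using \<rho>[of y] t mol_eq_0[OF t(1), of "y - u"] by (cases "norm (y - u) < r / 8") auto
 then have "(%y. \<rho> y * mol ?t (y - u)) = (%y. 0)" by (rule ext)
 then show "coef (Suc N) j * f (%y. \<rho> y * mol ?t (y - u)) = 0" by (simp only: tempered_0[OF f] mult_zero_right)
qed

text \<open>Seen from u, the functions \<rho> mol (. - u) are bumps of scale \<open>r\<close>, which
  gives the bound by M f at u. Unless the kernel vanishes, the support condition places a point of
  \<open>E\<close> within 7 r of u, which gives the bound by \<open>lam\<close> at the cost (1 + 7)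
  ^ N.\<close>

lemma ker_bound:
 assumes \<rho>: "ubd \<rho>" "!!js y. length js <= N ==> cmod (Dl js \<rho> y) * r ^ length js <= cut_const TYPE('n) N"
  and r: "r > 0" and supp: "!!y. 6 * r < d y ==> \<rho> y = 0"
 shows "cmod (ker \<rho> r u) <= ker_const * lam"
  and "b >= 0 ==> grand_maximal N f u <= ennreal b ==> cmod (ker \<rho> r u) <= ker_const * b"
proof -
 define Q where "Q = 2 ^ N * (2 ^ N * (cut_const TYPE('n) N * (mol_const TYPE('n) N * (8 * real (Suc N)) ^ (CARD('n) + N))))"
 have Q: "Q >= 0" using cut_const_pos[where 'n='n, of N] mol_const(1)[where 'n='n, of N] by (simp add: Q_def)
 have bump: "bump N Q u r (%y. \<rho> y * mol (real j * step (Suc N) r) (y - u))" if j: "j \<in> {1..Suc N}" for j unfolding bump_def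
 proof (intro conjI allI impI)
  let ?t = "real j * step (Suc N) r"
  have t1: "?t > 0" by (rule step_mult_pos) (use j r in auto)
 have t2: "?t <= r / 8" by (rule step_le) (use j r in auto)
 note t = t1 t2
  have t': "r / (8 * real (Suc N)) <= ?t" using j r unfolding step_def by (simp add: divide_right_mono)
  have ms: "mol ?t \<in> (schwartz :: ('n cfun) set)" by (rule mol_schwartz[OF t(1)])
  show "(%y. \<rho> y * mol ?t (y - u)) \<in> schwartz" by (intro schwartz_mult_ubd \<rho> schwartz_shift ms)
  fix "is" :: "'n list" and y assume l: "length is <= N"
  let ?D = "cmod (Dl is (%y. \<rho> y * mol ?t (y - u)) y)"
  have D: "?D * r ^ (CARD('n) + length is) <= 2 ^ N * (cut_const TYPE('n) N * (mol_const TYPE('n) N * (8 * real (Suc N)) ^ (CARD('n) + N)))"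
   by (rule cutoff_mult_mol[OF ubd_smooth[OF \<rho>(1)] \<rho>(2) r t' _ l]) auto
  show "?D * r ^ (CARD('n) + length is) * (1 + norm (y - u) / r) ^ N <= Q"
  proof (cases "norm (y - u) <= r")
   case True
   have "norm (y - u) / r <= 1" using True r by simp
   then have "(1 + norm (y - u) / r) ^ N <= 2 ^ N" using r by (intro power_mono) auto
   then have "?D * r ^ (CARD('n) + length is) * (1 + norm (y - u) / r) ^ N <= ?D * r ^ (CARD('n) + length is) * 2 ^ N" using r by (intro mult_left_mono) auto
   also have "... <= 2 ^ N * (cut_const TYPE('n) N * (mol_const TYPE('n) N * (8 * real (Suc N)) ^ (CARD('n) + N))) * 2 ^ N" by (intro mult_right_mono D) auto
   also have "... = Q" by (simp add: Q_def)
   finally show ?thesis .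
  next
   case False
   have "Dl is (%y. \<rho> y * mol ?t (y - u)) y = 0"
   proof (rule Dl_eq_0_open)
    show "open {y. r < norm (y - u)}" by (intro open_Collect_less continuous_intros)
    show "y \<in> {y. r < norm (y - u)}" using False by simp
    fix v assume "v \<in> {y. r < norm (y - u)}"
    then show "\<rho> v * mol ?t (v - u) = 0" using t r by (simp add: mol_eq_0)
   qed
   then show ?thesis using Q by simp
  qed
 qed
 have sum: "cmod (ker \<rho> r u) <= ker_const * b"
  if "!!j. j \<in> {1..Suc N} ==> cmod (f (%y. \<rho> y * mol (real j * step (Suc N) r) (y - u))) <= mi_card TYPE('n) N * (Q * 8 ^ N) * b" for b
 proof -
  have "cmod (ker \<rho> r u) <= (\<Sum>j=1..Suc N. cmod (coef (Suc N) j) * (mi_card TYPE('n) N * (Q * 8 ^ N) * b))"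
   unfolding ker_def by (rule sum_norm_le) (simp only: norm_mult mult_left_mono that norm_ge_zero)
  also have "... = ker_const * b" by (simp only: ker_const_def Q_def sum_distrib_right mult.assoc)
  finally show ?thesis .
 qed
 show "cmod (ker \<rho> r u) <= ker_const * lam"
 proof (cases "d u <= 7 * r")
  case True
  obtain z where z: "z \<in> E" "norm (z - u) = d u" using nearest[of u] by auto
  show ?thesis
  proof (rule sum)
   fix j assume j: "j \<in> {1..Suc N}"
   have "bump N (Q * (1 + 7) ^ N) z r (%y. \<rho> y * mol (real j * step (Suc N) r) (y - u))" by (rule bump_shift[OF bump[OF j] r]) (use True z in auto)
   from f_bump[OF z(1) this r]
   show "cmod (f (%y. \<rho> y * mol (real j * step (Suc N) r) (y - u))) <= mi_card TYPE('n) N * (Q * 8 ^ N) * lam" by simp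
  qed
 next
  case False
  have "ker \<rho> r u = 0"
  proof (rule ker_eq_0[OF r])
   fix y assume "norm (y - u) < r / 8"
   then have "6 * r < d y" using d_lipschitz[of u y] False r by (simp add: norm_minus_commute)
   then show "\<rho> y = 0" by (rule supp)
  qed
  then show ?thesis using ker_const_nonneg lam by simp
 qed
 assume b: "b >= 0" "grand_maximal N f u <= ennreal b"
 show "cmod (ker \<rho> r u) <= ker_const * b"
 proof (rule sum)
  fix j assume j: "j \<in> {1..Suc N}"
  let ?g = "%y. \<rho> y * mol (real j * step (Suc N) r) (y - u)"
  have "ennreal (cmod (f ?g)) <= ennreal (mi_card TYPE('n) N * Q) * grand_maximal N f u" by (rule bump_le_grand_maximal[OF f bump[OF j] r])
  also have "... <= ennreal (mi_card TYPE('n) N * Q) * ennreal b" by (intro mult_left_mono b) auto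
  also have "... = ennreal (mi_card TYPE('n) N * Q * b)" using Q b mi_card_pos[where 'n='n, of N] by (simp add: ennreal_mult)
  finally have "cmod (f ?g) <= mi_card TYPE('n) N * Q * b" using Q b mi_card_pos[where 'n='n, of N] by (subst (asm) ennreal_le_iff) auto
  also have "mi_card TYPE('n) N * Q * b * 1 <= mi_card TYPE('n) N * Q * b * 8 ^ N" using Q b mi_card_pos[where 'n='n, of N] by (intro mult_left_mono) auto
  finally show "cmod (f ?g) <= mi_card TYPE('n) N * (Q * 8 ^ N) * b" by (simp add: mult_ac)
 qed
qed

definition dens :: "nat => 'n cfun" where
 "dens m u = (\<Sum>k<m. ker (cut k) (rad (Suc k)) u) + ker (rest m) (rad m) u"

lemma dens_measurable [measurable]: "dens m \<in> borel_measurable borel"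
proof -
 have [measurable]: "ker (cut k) (rad (Suc k)) \<in> borel_measurable borel" "ker (rest k) (rad k) \<in> borel_measurable borel" for k
  using ker_smoothing(3)[OF cut_ubd rad_pos schwartz_0] ker_smoothing(3)[OF rest_ubd rad_pos schwartz_0] by (auto intro: borel_measurable_continuous_onI)
 show ?thesis unfolding dens_def[abs_def] by measurable
qed

lemma dens_integral:
 assumes ph: "ph \<in> schwartz"
 shows "integrable lborel (%u. dens m u * ph u)" and "f (approx m ph) = (LL u. dens m u * ph u)"
proof -
 note C = ker_smoothing[OF cut_ubd rad_pos ph] and R = ker_smoothing[OF rest_ubd rad_pos ph]
 have e: "dens m u * ph u = (\<Sum>k<m. ker (cut k) (rad (Suc k)) u * ph u) + ker (rest m) (rad m) u * ph u" for u
  by (simp add: dens_def distrib_right sum_distrib_right)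
 have s: "integrable lborel (%u. \<Sum>k<m. ker (cut k) (rad (Suc k)) u * ph u)" by (intro Bochner_Integration.integrable_sum C(1))
 show "integrable lborel (%u. dens m u * ph u)" unfolding e by (intro Bochner_Integration.integrable_add s R(1))
 have S: "(%y. cut k y * smoothing (Suc N) (rad (Suc k)) ph y) \<in> schwartz" "(%y. rest m y * smoothing (Suc N) (rad m) ph y) \<in> schwartz" for k
  by (intro schwartz_mult_ubd cut_ubd rest_ubd smoothing_schwartz ph rad_pos)+
 have "f (approx m ph) = (\<Sum>k<m. f (%y. cut k y * smoothing (Suc N) (rad (Suc k)) ph y)) + f (%y. rest m y * smoothing (Suc N) (rad m) ph y)"
  unfolding approx_def by (subst tempered_add[OF f schwartz_sum]) (auto simp: tempered_sum[OF f] S)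
 also have "... = (\<Sum>k<m. LL u. ker (cut k) (rad (Suc k)) u * ph u) + (LL u. ker (rest m) (rad m) u * ph u)" by (simp only: C(2) R(2))
 also have "... = (LL u. dens m u * ph u)" unfolding e using s C(1) R(1) by (simp add: Bochner_Integration.integral_add Bochner_Integration.integral_sum)
 finally show "f (approx m ph) = (LL u. dens m u * ph u)" .
qed

text \<open>At each point at most 4 of the kernels of the cutoffs \<open>cut k\<close> are nonzero,
  because they vanish off their shells; the kernel of \<open>rest m\<close> makes 5.\<close>

lemma dens_bound_aux:
 assumes B: "B >= 0" "!!k. cmod (ker (cut k) (rad (Suc k)) u) <= B" "cmod (ker (rest m) (rad m) u) <= B"
 shows "cmod (dens m u) <= 5 * B"
proof -
 have z: "cmod (ker (cut k) (rad (Suc k)) u) <= B * indicator (shell k) u" for k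
 proof (cases "u \<in> shell k")
  case False
  have "ker (cut k) (rad (Suc k)) u = 0"
  proof (rule ker_eq_0[OF rad_pos])
   fix y assume "norm (y - u) < rad (Suc k) / 8"
   then have "d y < rad (Suc k) \<or> 6 * rad (Suc k) < d y"
    using d_lipschitz[of u y] d_lipschitz[of y u] False rad_pos[of "Suc k"] by (auto simp: shell_def norm_minus_commute)
   then show "cut k y = 0" using cut_eq_0[of y k "[]"] by simp
  qed
  then show ?thesis using False by simp
 qed (use B in simp)
 have "cmod (dens m u) <= (\<Sum>k<m. cmod (ker (cut k) (rad (Suc k)) u)) + cmod (ker (rest m) (rad m) u)"
  unfolding dens_def by (intro order_trans[OF norm_triangle_ineq] add_mono norm_sum order_refl)
 also have "... <= (\<Sum>k<m. B * indicator (shell k) u) + B" by (intro add_mono sum_mono z B)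
 also have "(\<Sum>k<m. B * indicator (shell k) u) <= B * 4" unfolding sum_distrib_left[symmetric] using B by (intro mult_left_mono shell_overlap_sum) auto
 finally show ?thesis by simp
qed

lemma dens_bound:
 "cmod (dens m u) <= 5 * (ker_const * lam)"
 "b >= 0 ==> grand_maximal N f u <= ennreal b ==> cmod (dens m u) <= 5 * (ker_const * b)"
proof -
 have c: "!!y. 6 * rad (Suc k) < d y ==> cut k y = 0" for k using cut_eq_0[of _ k "[]"] by simp
 have r: "!!y. 6 * rad m < d y ==> rest m y = 0" using rest_eq_0[of m _ "[]"] rad_pos[of m] by simp
 note C = ker_bound[OF cut_ubd cut_deriv rad_pos c] and R = ker_bound[OF rest_ubd rest_deriv rad_pos r]
 show "cmod (dens m u) <= 5 * (ker_const * lam)" using ker_const_nonneg lam by (intro dens_bound_aux C(1) R(1)) auto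
 show "cmod (dens m u) <= 5 * (ker_const * b)" if "b >= 0" "grand_maximal N f u <= ennreal b"
  using ker_const_nonneg that by (intro dens_bound_aux C(2) R(2)) auto
qed

end

text \<open>A finite measure with the null sets of \<open>lborel\<close>: bounded densities become
  square integrable, and almost everywhere statements transfer.\<close>

definition decay_measure :: "'a::euclidean_space measure" where
 "decay_measure = density lborel (%x. ennreal (1 / (1 + norm x) ^ (DIM('a) + 1)))"

lemma finite_decay_measure: "finite_measure (decay_measure :: 'a::euclidean_space measure)"
proof (rule finite_measureI)
 have "integrable lborel (%x :: 'a. 1 / (1 + norm x) ^ (DIM('a) + 1))" by (rule integrable_inverse_power) simp
 then have "(NN x. ennreal (1 / (1 + norm (x :: 'a)) ^ (DIM('a) + 1))) ~= \<infinity>" by (subst nn_integral_eq_integral) auto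
 then show "emeasure (decay_measure :: 'a measure) (space decay_measure) ~= \<infinity>"
  by (simp add: decay_measure_def emeasure_density cong: nn_integral_cong)
qed

lemma AE_decay_measure: "(AE x in decay_measure. P x) \<longleftrightarrow> (AE x in lborel. P (x :: 'a::euclidean_space))"
proof -
 have "0 < ennreal (1 / (1 + norm x) ^ (DIM('a) + 1))" for x :: 'a by (simp add: add_pos_nonneg)
 then show ?thesis unfolding decay_measure_def by (subst AE_density) auto
qed

lemma measurable_decay_measure: "borel_measurable decay_measure = (borel_measurable borel :: ('a::euclidean_space => complex) set)"
 by (rule measurable_cong_sets) (simp_all add: decay_measure_def)

context good_part
begin

lemma schwartz_abs_integrable: "ph \<in> schwartz ==> integrable lborel (%u. cmod (ph u))" for ph :: "'n cfun"
 using schwartz_integrable0 by (rule integrable_norm)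

text \<open>The weak limit is realized as an almost everywhere limit of convex combinations of the
  densities. Hence it keeps the pointwise size bounds, and the estimates for f (approx i ph) pass to
  its pairings by dominated convergence.\<close>

lemma good_function:
 obtains v where "v \<in> borel_measurable borel" "AE u in lborel. cmod (v u) <= 5 * (ker_const * lam)"
  "AE u in lborel. ennreal (cmod (v u)) <= ennreal (5 * ker_const) * grand_maximal N f u"
  "!!ph. ph \<in> schwartz ==> integrable lborel (%u. v u * ph u)"
  "!!x c s ph. x \<in> E ==> bump N c x s ph ==> s > 0 ==>
   ennreal (cmod (LL u. v u * ph u)) <= ennreal (mi_card TYPE('n) N * ((1 + 5 * piece_const) * c)) * grand_maximal N f x"
  "!!x c s ph. x \<in> E ==> bump N c x s ph ==> s > 0 ==>
   ennreal (cmod (f ph - (LL u. v u * ph u))) <= ennreal (4 * far_const * c * lam) * far x"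
proof -
 define B where "B = 5 * (ker_const * lam)"
 have B0: "B >= 0" using ker_const_nonneg lam by (simp add: B_def)
 have hB: "cmod (dens i x) <= B" for i x unfolding B_def by (rule dens_bound(1))
 have hm: "dens i \<in> borel_measurable decay_measure" for i by (simp add: measurable_decay_measure)
 obtain v G where v: "v \<in> borel_measurable decay_measure" and G: "!!k. G k \<in> mids dens k"
  and conv: "AE x in decay_measure. (%k. G k x) \<longlonglongrightarrow> v x"
  by (rule finite_measure.convex_combinations_converge[OF finite_decay_measure hm hB]) (rule that)
 have vm[measurable]: "v \<in> borel_measurable borel" using v by (simp add: measurable_decay_measure)
 have conv: "AE x in lborel. (%k. G k x) \<longlonglongrightarrow> v x" using conv by (simp add: AE_decay_measure)
 have Gm[measurable]: "G k \<in> borel_measurable borel" for k by (rule mids_measurable[OF G]) simp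
 have GB: "cmod (G k x) <= B" for k x by (rule mids_bound[OF G hB])
 have vB: "AE u in lborel. cmod (v u) <= B" using conv
 proof eventually_elim
  fix x assume "(%k. G k x) \<longlonglongrightarrow> v x"
  then show "cmod (v x) <= B" by (intro Lim_bounded[OF tendsto_norm]) (auto simp: GB)
 qed
 have vM: "AE u in lborel. ennreal (cmod (v u)) <= ennreal (5 * ker_const) * grand_maximal N f u" using conv vB
 proof eventually_elim
  fix x assume lim: "(%k. G k x) \<longlonglongrightarrow> v x" and vx: "cmod (v x) <= B"
  show "ennreal (cmod (v x)) <= ennreal (5 * ker_const) * grand_maximal N f x"
  proof (cases "grand_maximal N f x <= ennreal lam")
   case True
   then obtain b where b: "b >= 0" "grand_maximal N f x = ennreal b" by (cases "grand_maximal N f x") (auto simp: top_unique)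
   have "cmod (G k x) <= 5 * (ker_const * b)" for k by (rule mids_bound[OF G]) (rule dens_bound(2), use b in auto)
   then have "cmod (v x) <= 5 * (ker_const * b)" using lim by (intro Lim_bounded[OF tendsto_norm]) auto
   then have "ennreal (cmod (v x)) <= ennreal (5 * ker_const * b)" by (intro ennreal_leI) (simp add: mult.assoc)
   also have "... = ennreal (5 * ker_const) * ennreal b" using b ker_const_nonneg by (intro ennreal_mult) auto
   finally show ?thesis by (simp add: b)
  next
   case False
   have "ennreal (cmod (v x)) <= ennreal (5 * ker_const * lam)" using vx by (intro ennreal_leI) (simp add: B_def mult.assoc)
   also have "... = ennreal (5 * ker_const) * ennreal lam" using lam ker_const_nonneg by (intro ennreal_mult) auto
   also have "... <= ennreal (5 * ker_const) * grand_maximal N f x" using False by (intro mult_left_mono) auto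
   finally show ?thesis .
  qed
 qed
 have int: "integrable lborel (%u. v u * ph u)" and lim: "(%k. LL u. G k u * ph u) \<longlonglongrightarrow> (LL u. v u * ph u)"
  if ph: "ph \<in> schwartz" for ph
 proof -
  have [measurable]: "ph \<in> borel_measurable borel" by (rule schwartz_measurable[OF ph])
  have i: "integrable lborel (%u. B * cmod (ph u))" by (intro integrable_mult_right schwartz_abs_integrable ph)
  have c: "AE x in lborel. (%k. G k x * ph x) \<longlonglongrightarrow> v x * ph x" using conv by eventually_elim (rule tendsto_mult_right)
  have b: "AE x in lborel. norm (G k x * ph x) <= B * cmod (ph x)" for k using GB by (intro AE_I2) (simp add: norm_mult mult_right_mono)
  show "integrable lborel (%u. v u * ph u)" by (rule integrable_dominated_convergence[OF _ _ i c b]) measurable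
  show "(%k. LL u. G k u * ph u) \<longlonglongrightarrow> (LL u. v u * ph u)" by (rule integral_dominated_convergence[OF _ _ i c b]) measurable
 qed
 \<comment> \<open>A bound valid for all late approximations holds for their convex combinations and
   so for the limit. With a = 0 it gives the size, with a = f ph the error.\<close>
 have bound: "cmod ((LL u. v u * ph u) - a) <= R"
  if ph: "ph \<in> schwartz" and R: "!!i. m <= i ==> cmod (f (approx i ph) - a) <= R" for ph a R m
 proof (rule Lim_bounded[OF tendsto_norm[OF tendsto_diff[OF lim[OF ph] tendsto_const]]])
  show "\<forall>k\<ge>m. norm ((LL u. G k u * ph u) - a) <= R"
  proof (intro allI impI)
   fix k assume "m <= k"
   then have Gk: "G k \<in> mids dens m" using G by (rule mids_mono[rotated])
   show "norm ((LL u. G k u * ph u) - a) <= R" using mids_integral[OF Gk dens_integral(1)[OF ph], of a R] R unfolding dens_integral(2)[OF ph] by blast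
  qed
 qed
 have rad_ev: "\<exists>m. \<forall>i\<ge>m. rad i <= s" if "s > 0" for s
 proof -
  have "\<forall>\<^sub>F i in sequentially. rad i < s" by (rule order_tendstoD(2)[OF rad_tendsto that])
  then show ?thesis unfolding eventually_sequentially by (meson less_imp_le)
 qed
 have p1: "ennreal (cmod (LL u. v u * ph u)) <= ennreal (mi_card TYPE('n) N * ((1 + 5 * piece_const) * c)) * grand_maximal N f x"
  if x: "x \<in> E" and b: "bump N c x s ph" and s: "s > 0" for x c s ph
 proof -
  have "grand_maximal N f x <= ennreal lam" using x E by auto
  then obtain a where a: "a >= 0" "grand_maximal N f x = ennreal a" by (cases "grand_maximal N f x") (auto simp: top_unique)
  have c: "c >= 0" by (rule bump_nonneg[OF b s])
  let ?C = "mi_card TYPE('n) N * ((1 + 5 * piece_const) * c)"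
  have C: "?C >= 0" using c piece_const_pos mi_card_pos[where 'n='n, of N] by simp
  obtain m where m: "!!i. i >= m ==> rad i <= s" using rad_ev[OF s] by auto
  have "cmod ((LL u. v u * ph u) - 0) <= ?C * a"
  proof (rule bound[OF bump_schwartz[OF b], of m])
   fix i assume "m <= i"
   have "ennreal (cmod (f (approx i ph))) <= ennreal ?C * grand_maximal N f x"
    by (rule bump_le_grand_maximal[OF f approx_bump[OF x b s m[OF \<open>m <= i\<close>]] s])
   also have "... = ennreal (?C * a)" using C a by (simp add: ennreal_mult)
   finally show "cmod (f (approx i ph) - 0) <= ?C * a" using C a by (subst (asm) ennreal_le_iff) auto
  qed
  then have "ennreal (cmod (LL u. v u * ph u)) <= ennreal (?C * a)" by (intro ennreal_leI) simp
  also have "... = ennreal ?C * ennreal a" using C a by (intro ennreal_mult) auto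
  finally show ?thesis by (simp add: a)
 qed
 have p2: "ennreal (cmod (f ph - (LL u. v u * ph u))) <= ennreal (4 * far_const * c * lam) * far x"
  if x: "x \<in> E" and b: "bump N c x s ph" and s: "s > 0" for x c s ph
 proof (cases "ennreal (4 * far_const * c * lam) * far x")
  case (real X)
  have ph: "ph \<in> schwartz" by (rule bump_schwartz[OF b])
  \<comment> \<open>\<open>tail_small\<close> asks for one more order of decay; any constant
    \<open>c'\<close> will do, since only the limit 0 is taken from it.\<close>
  obtain c' where b': "bump (Suc N) c' x s ph" using schwartz_bump[OF ph s] by metis
  have "cmod ((LL u. v u * ph u) - f ph) <= X"
  proof (rule field_le_epsilon)
   fix \<epsilon> :: real assume \<epsilon>: "\<epsilon> > 0"
   have "\<forall>\<^sub>F m in sequentially. norm (f (tail m ph)) < \<epsilon>"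
    by (rule order_tendstoD(2)[OF tendsto_norm_zero[OF tail_small[OF x b' s]] \<epsilon>])
   then obtain m where m: "!!i. i >= m ==> cmod (f (tail i ph)) < \<epsilon>" unfolding eventually_sequentially by auto
   show "cmod ((LL u. v u * ph u) - f ph) <= X + \<epsilon>"
   proof (rule bound[OF ph, of m])
    fix i assume i: "m <= i"
    have "ennreal (cmod (f ph - f (approx i ph))) <= ennreal X + ennreal (cmod (f (tail i ph)))" using approx_far[OF x b s, of i] real by simp
    also have "... = ennreal (X + cmod (f (tail i ph)))" using real by simp
    finally have "cmod (f ph - f (approx i ph)) <= X + cmod (f (tail i ph))" using real by (subst (asm) ennreal_le_iff) auto
    then show "cmod (f (approx i ph) - f ph) <= X + \<epsilon>" using m[OF i] by (simp add: norm_minus_commute)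
   qed
  qed
  then show ?thesis using real by (simp add: norm_minus_commute ennreal_leI)
 qed simp
 show ?thesis using that[OF vm _ vM int p1 p2] vB by (simp add: B_def)
qed

end

section \<open>The size of the error\<close>

context exceptional_set
begin

text \<open>The Marcinkiewicz integral with exponent n + 1, whose integral over \<open>E\<close> is
  controlled by the measure of the complement. The error integral \<open>far\<close> is bounded by a
  power of it.\<close>

definition near :: "real ^ 'n => ennreal" where
 "near x = (NN u. ennreal (d u / norm (x - u) ^ (CARD('n) + 1)) * indicator (- E) u)"

definition near_const :: real where
 "near_const = 2 ^ (2 * CARD('n) + 2) / unit_ball_vol (real CARD('n))"

lemma near_const_pos: "near_const > 0" by (simp add: near_const_def)

lemma near_measurable [measurable]: "near \<in> borel_measurable borel"
proof -
 have "- E \<in> sets borel" using closed by auto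
 then have "(%x. NN u. ennreal (d u / norm (x - u) ^ (CARD('n) + 1)) * indicator (- E) u) \<in> borel_measurable borel" by measurable
 then show ?thesis by (simp add: near_def[abs_def])
qed

text \<open>On the ball of radius d u / 2 around u the distance to \<open>E\<close> at most halves
  and the distance to \<open>x\<close> at most doubles. So \<open>near x\<close> is at least the
  integrand at u times the volume of that ball, up to a constant.\<close>

lemma near_ge:
 assumes x: "x \<in> E" and u: "u \<notin> E"
 shows "ennreal (d u / norm (x - u) ^ (CARD('n) + 1) * d u ^ CARD('n)) <= ennreal near_const * near x"
proof -
 let ?n = "CARD('n)" and ?V = "unit_ball_vol (real CARD('n))"
 have du: "d u > 0" using u d_pos by simp
 have xu: "d u <= norm (x - u)" using d_le[OF x, of u] by (simp add: norm_minus_commute)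
 define a where "a = d u / (2 * (2 ^ (?n + 1) * norm (x - u) ^ (?n + 1)))"
 have a0: "a >= 0" using du by (simp add: a_def)
 have "(NN w. ennreal a * indicator (ball u (d u / 2)) w) <= near x" unfolding near_def
 proof (rule nn_integral_mono)
  fix w :: "real ^ 'n"
  show "ennreal a * indicator (ball u (d u / 2)) w <= ennreal (d w / norm (x - w) ^ (?n + 1)) * indicator (- E) w"
  proof (cases "w \<in> ball u (d u / 2)")
   case True
   then have wu: "norm (u - w) < d u / 2" by (simp add: dist_norm)
   then have dw: "d u / 2 <= d w" using d_lipschitz[of u w] by simp
   then have "w \<notin> E" using du d_pos[of w] by auto
   have xw: "norm (x - w) <= 2 * norm (x - u)" using norm_triangle_ineq[of "x - u" "u - w"] wu xu du by simp
   have xw0: "norm (x - w) > 0" using \<open>w \<notin> E\<close> x by auto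
   have "norm (x - w) ^ (?n + 1) <= 2 ^ (?n + 1) * norm (x - u) ^ (?n + 1)" using xw by (intro power_le_scaled) auto
   then have "(d u / 2) / (2 ^ (?n + 1) * norm (x - u) ^ (?n + 1)) <= d w / norm (x - w) ^ (?n + 1)" using dw du xw0 by (intro frac_le zero_less_power) auto
   then have "a <= d w / norm (x - w) ^ (?n + 1)" by (simp add: a_def)
   then show ?thesis using \<open>w \<notin> E\<close> True by (simp add: ennreal_leI)
  qed simp
 qed
 also have "(NN w. ennreal a * indicator (ball u (d u / 2)) w) = ennreal a * emeasure lborel (ball u (d u / 2))" by (rule nn_integral_cmult_indicator) simp
 also have "emeasure lborel (ball u (d u / 2)) = ennreal (?V * (d u / 2) ^ ?n)" using du by (simp add: emeasure_ball)
 finally have le: "ennreal (a * (?V * (d u / 2) ^ ?n)) <= near x" using a0 du by (simp add: ennreal_mult)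
 have e: "d u / norm (x - u) ^ (?n + 1) * d u ^ ?n = near_const * (a * (?V * (d u / 2) ^ ?n))"
 proof -
  have "2 * ?n + 2 = Suc ((?n + 1) + ?n)" by simp
  then have nc: "near_const = 2 * (2 ^ (?n + 1) * 2 ^ ?n) / ?V" unfolding near_const_def by (simp only: power_Suc power_add)
  have aux: "P ~= 0 ==> T ~= 0 ==> V ~= 0 ==> X ~= 0 ==>
    D / X * Q = 2 * (P * T) / V * (D / (2 * (P * X)) * (V * (Q / T)))" for D X Q P T V :: real by (simp add: field_simps)
  have "norm (x - u) ^ (?n + 1) ~= 0" using xu du by auto
  moreover have "?V ~= 0" by (rule less_imp_neq[OF unit_ball_vol_pos, symmetric]) simp
  ultimately show ?thesis unfolding nc a_def power_divide by (intro aux) auto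
 qed
 show ?thesis unfolding e using near_const_pos a0 du by (subst ennreal_mult) (auto intro!: mult_left_mono le)
qed

lemma power_ratio_bound:
 fixes a b :: real
 assumes "0 < a" "a <= b" "n <= M" "M <= K"
 shows "a ^ (K - n) / b ^ K <= a ^ (M - n) / b ^ M"
proof -
 obtain q where q: "K = M + q" using assms(4) le_Suc_ex by blast
 have "a ^ (K - n) = a ^ (M - n) * a ^ q" using assms q by (simp flip: power_add)
 also have "... <= a ^ (M - n) * b ^ q" using assms by (intro mult_left_mono power_mono) auto
 finally have "a ^ (K - n) / b ^ K <= a ^ (M - n) * b ^ q / b ^ K" using assms by (intro divide_right_mono) auto
 also have "... = a ^ (M - n) / b ^ M" using assms q by (simp add: power_add)
 finally show ?thesis .
qed

text \<open>
 The integrand \<open>G\<close> of \<open>near x\<close> is essentially constant on balls of radius \<open>d u / 2\<close>, so \<open>G (d u)\<^sup>n\<close> is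
 bounded by \<open>near x\<close>; the integrand below is at most \<open>G (G (d u)\<^sup>n)\<^sup>j\<^sup>-\<^sup>1\<close>.
\<close>

lemma far_le_near:
 assumes x: "x \<in> E" and j: "0 < j" "j * (CARD('n) + 1) <= K"
 shows "(NN u. ennreal (d u ^ (K - CARD('n)) / norm (x - u) ^ K) * indicator (- E) u) <=
  ennreal (near_const ^ (j - 1)) * near x ^ j"
proof -
 let ?n = "CARD('n)"
 obtain i where i: "j = Suc i" using j(1) by (cases j) auto
 have [measurable]: "- E \<in> sets borel" using closed by auto
 have "(NN u. ennreal (d u ^ (K - ?n) / norm (x - u) ^ K) * indicator (- E) u) <=
  (NN u. (ennreal near_const * near x) ^ i * (ennreal (d u / norm (x - u) ^ (?n + 1)) * indicator (- E) u))"
 proof (rule nn_integral_mono)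
  fix u :: "real ^ 'n"
  show "ennreal (d u ^ (K - ?n) / norm (x - u) ^ K) * indicator (- E) u <=
   (ennreal near_const * near x) ^ i * (ennreal (d u / norm (x - u) ^ (?n + 1)) * indicator (- E) u)"
  proof (cases "u \<in> E")
   case False
   let ?G = "d u / norm (x - u) ^ (?n + 1)" and ?M = "j * (?n + 1)"
   have du: "d u > 0" using False d_pos by simp
   have xu: "d u <= norm (x - u)" using d_le[OF x, of u] by (simp add: norm_minus_commute)
   have G0: "?G >= 0" using du by simp
   \<comment> \<open>As d u <= norm (x - u), surplus orders can be discarded down to exactly j * (n
     + 1), which splits into j groups.\<close>
   have "d u ^ (K - ?n) / norm (x - u) ^ K <= d u ^ (?M - ?n) / norm (x - u) ^ ?M" by (rule power_ratio_bound[OF du xu _ j(2)]) (simp add: i)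
   also have "d u ^ (?M - ?n) = (d u * d u ^ ?n) ^ i * d u"
   proof -
    have "?M - ?n = (?n + 1) * i + 1" by (simp add: i algebra_simps)
    then show ?thesis by (simp only: power_add power_mult) (simp add: mult_ac)
   qed
   also have "norm (x - u) ^ ?M = (norm (x - u) ^ (?n + 1)) ^ i * norm (x - u) ^ (?n + 1)" by (metis i mult.commute power_Suc2 power_mult)
   also have "(d u * d u ^ ?n) ^ i * d u / ((norm (x - u) ^ (?n + 1)) ^ i * norm (x - u) ^ (?n + 1)) = (?G * d u ^ ?n) ^ i * ?G"
    by (simp add: power_divide power_mult_distrib)
   finally have "ennreal (d u ^ (K - ?n) / norm (x - u) ^ K) <= ennreal ((?G * d u ^ ?n) ^ i * ?G)" by (rule ennreal_leI)
   also have "... = ennreal (?G * d u ^ ?n) ^ i * ennreal ?G" using G0 du by (subst ennreal_mult) (auto simp: ennreal_power)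
   also have "... <= (ennreal near_const * near x) ^ i * ennreal ?G" by (intro mult_right_mono power_mono near_ge[OF x False]) auto
   finally show ?thesis using False by simp
  qed simp
 qed
 also have "... = (ennreal near_const * near x) ^ i * near x" unfolding near_def[of x, symmetric] by (subst nn_integral_cmult) (auto simp: near_def)
 also have "... = ennreal (near_const ^ (j - 1)) * near x ^ j" using near_const_pos by (simp add: i power_mult_distrib ennreal_power[symmetric] mult_ac)
 finally show ?thesis .
qed

text \<open>After exchanging the integrals, each u contributes an integral over norm (x - u) >= d u
  of order 1 / d u, which cancels the numerator.\<close>

lemma near_integral:
 "(NN x. near x * indicator E x) <= ennreal (2 * (unit_ball_vol (real CARD('n)) * 2 ^ CARD('n))) * emeasure lborel (- E)"
proof -
 let ?n = "CARD('n)" and ?C = "2 * (unit_ball_vol (real CARD('n)) * 2 ^ CARD('n))"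
 have [measurable]: "E \<in> sets borel" "- E \<in> sets borel" using closed by auto
 let ?g = "%x u. ennreal (d u / norm (x - u) ^ (?n + 1)) * indicator (- E) u * indicator E x"
 have [measurable]: "case_prod ?g \<in> borel_measurable (lborel \<Otimes>\<^sub>M lborel)" unfolding split_beta' by measurable
 have "(NN x. near x * indicator E x) = (NN x. (NN u. ?g x u))" unfolding near_def by (intro nn_integral_cong nn_integral_multc[symmetric]) measurable
 also have "... = (NN u. (NN x. ?g x u))" by (rule lborel_pair.Fubini'[symmetric]) measurable
 also have "... <= (NN u. ennreal ?C * indicator (- E) u)"
 proof (rule nn_integral_mono)
  fix u :: "real ^ 'n"
  show "(NN x. ?g x u) <= ennreal ?C * indicator (- E) u"
  proof (cases "u \<in> E")
   case False
   have du: "d u > 0" using False d_pos by simp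
   have "(NN x. ?g x u) <= (NN x. ennreal (d u) * (indicator {x. d u <= norm (x - u)} x * ennreal (1 / norm (x - u) ^ (?n + 1))))"
   proof (rule nn_integral_mono)
    fix x
    show "?g x u <= ennreal (d u) * (indicator {x. d u <= norm (x - u)} x * ennreal (1 / norm (x - u) ^ (?n + 1)))"
    proof (cases "x \<in> E")
     case True
     then have "d u <= norm (x - u)" using d_le[OF True, of u] by (simp add: norm_minus_commute)
     moreover have "ennreal (d u / norm (x - u) ^ (?n + 1)) = ennreal (d u) * ennreal (1 / norm (x - u) ^ (?n + 1))" using du by (simp flip: ennreal_mult)
     ultimately show ?thesis using True False by simp
    qed simp
   qed
   also have "... = ennreal (d u) * (NN x. indicator {x. d u <= norm (x - u)} x * ennreal (1 / norm (x - u) ^ (?n + 1)))" by (rule nn_integral_cmult) measurable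
   also have "... <= ennreal (d u) * ennreal (?C / d u ^ 1)" using nn_integral_tail_le[of "?n + 1" "d u" u] du by (intro mult_left_mono) auto
   also have "... = ennreal ?C" using du by (simp flip: ennreal_mult)
   finally show ?thesis using False by simp
  qed simp
 qed
 also have "... = ennreal ?C * emeasure lborel (- E)" by (rule nn_integral_cmult_indicator) simp
 finally show ?thesis .
qed

end

section \<open>Density\<close>

definition density_functional :: "('n::finite cfun) => ('n cfun) => complex" where
 "density_functional v ph = (if ph \<in> schwartz then (LL u. v u * ph u) else 0)"

lemma bounded_integral_bump:
 fixes v :: "'n::finite cfun"
 assumes N: "CARD('n) < N" and v: "AE u in lborel. cmod (v u) <= B" and b: "bump N c x s ph" "s > 0"
  and i: "integrable lborel (%u. v u * ph u)" and B: "B >= 0"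
 shows "cmod (LL u. v u * ph u) <= B * (c * decay_mass TYPE('n) N)"
proof -
 have "cmod (LL u. v u * ph u) <= (LL u. cmod (v u * ph u))" by (rule integral_norm_bound)
 also have "... <= (LL u. B * cmod (ph u))"
 proof (rule integral_mono_AE)
  show "integrable lborel (%u. B * cmod (ph u))" by (intro integrable_mult_right integrable_norm schwartz_integrable0 bump_schwartz[OF b(1)])
  show "AE u in lborel. cmod (v u * ph u) <= B * cmod (ph u)" using v by eventually_elim (simp add: norm_mult mult_right_mono)
 qed (use i in simp)
 also have "... = B * (LL u. cmod (ph u))" by (rule integral_mult_right_zero)
 also have "... <= B * (c * decay_mass TYPE('n) N)" by (intro mult_left_mono B bump_abs_integral[OF N b(2,1)])
 finally show ?thesis .
qed

lemma density_functional_tempered: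
 fixes v :: "'n::finite cfun"
 assumes N: "CARD('n) < N" and v: "AE u in lborel. cmod (v u) <= B" and B: "B >= 0"
  and i: "!!ph. ph \<in> schwartz ==> integrable lborel (%u. v u * ph u)"
 shows "density_functional v \<in> tempered"
proof (rule temperedI[where C="B * decay_mass TYPE('n) N" and N=N])
 fix ph :: "'n cfun" assume ph: "ph \<in> schwartz"
 have "cmod (LL u. v u * ph u) <= B * (schwartz_norm N ph * decay_mass TYPE('n) N)"
  by (rule bounded_integral_bump[OF N v schwartz_norm_bump[OF ph] _ i[OF ph] B]) simp
 then show "cmod (density_functional v ph) <= B * decay_mass TYPE('n) N * schwartz_norm N ph" using ph by (simp add: density_functional_def mult_ac)
next
 fix c and ph :: "'n cfun" assume ph: "ph \<in> schwartz"
 have "(LL u. v u * (c * ph u)) = (LL u. c * (v u * ph u))" by (simp only: mult.left_commute)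
 then show "density_functional v (%x. c * ph x) = c * density_functional v ph" using ph by (simp add: density_functional_def schwartz_cmult)
qed (auto simp: density_functional_def schwartz_add distrib_left i)

text \<open>One constant for all estimates, to be chosen before \<open>f\<close> and
  \<open>lam\<close>. The function \<open>w\<close> stands for \<open>near\<close>, abstracted so
  that the density argument is free of the locale.\<close>

definition good_density :: "nat => nat => real => (('n::finite cfun) => complex) => real =>
  ('n cfun) => (real ^ 'n => ennreal) => bool" where
 "good_density N j C f lam v w \<longleftrightarrow> v \<in> borel_measurable borel \<and> (AE u in lborel. cmod (v u) <= C * lam) \<and>
   (AE u in lborel. ennreal (cmod (v u)) <= ennreal C * grand_maximal N f u) \<and>
   (\<forall>ph\<in>schwartz. integrable lborel (%u. v u * ph u)) \<and>
   (\<forall>x. grand_maximal N (density_functional v) x <= ennreal C * grand_maximal N f x) \<and>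
   (\<forall>x. grand_maximal N (%ph. f ph - density_functional v ph) x <= ennreal C * grand_maximal N f x) \<and>
   w \<in> borel_measurable borel \<and>
   (\<forall>x. grand_maximal N f x <= ennreal lam -->
    grand_maximal N (%ph. f ph - density_functional v ph) x <= ennreal (C * lam) * w x ^ j) \<and>
   (NN x. w x * indicator {x. grand_maximal N f x <= ennreal lam} x) <=
    ennreal C * emeasure lborel {x. ennreal lam < grand_maximal N f x}"

lemma good_approximation:
 assumes N: "CARD('n::finite) < N" and j: "0 < j" "j * (CARD('n) + 1) <= N"
 obtains C where "C > 0" "!!(f :: ('n cfun) => complex) lam. f \<in> tempered ==> lam > 0 ==>
  emeasure lborel {x. ennreal lam < grand_maximal N f x} < emeasure lborel (ball (0 :: real ^ 'n) 1) ==>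
  \<exists>v w. good_density N j C f lam v w"
proof -
 \<comment> \<open>The locale constants are exported as functions of \<open>N\<close> and the
   dimension alone, so \<open>C\<close> can be formed before \<open>f\<close>, \<open>lam\<close>
   and the set \<open>E\<close> are given.\<close>
 define kc where "kc = good_part.ker_const TYPE('n) N"
 define pc where "pc = good_part.piece_const TYPE('n) N"
 define fc where "fc = good_part.far_const TYPE('n) N"
 define nc where "nc = exceptional_set.near_const TYPE('n)"
 define mc where "mc = mi_card TYPE('n) N"
 define gc where "gc = mc * (1 + 5 * pc) + 5 * kc * decay_mass TYPE('n) N"
 define tc where "tc = 2 * (unit_ball_vol (real CARD('n)) * 2 ^ CARD('n))"
 define C where "C = 1 + \<bar>5 * kc\<bar> + \<bar>mc\<bar> + \<bar>gc\<bar> + \<bar>4 * fc * nc ^ (j - 1)\<bar> + \<bar>tc\<bar>"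
 have C0: "C > 0" by (simp add: C_def add_pos_nonneg)
 have Cle: "5 * kc <= C" "gc <= C" "mc + gc <= C" "4 * fc * nc ^ (j - 1) <= C" "tc <= C" unfolding C_def by linarith+
 have mc: "mc > 0" by (simp add: mc_def mi_card_pos)
 show ?thesis
 proof (rule that[OF C0])
  fix f :: "('n cfun) => complex" and lam :: real
  assume f: "f \<in> tempered" and lam: "lam > 0"
   and small: "emeasure lborel {x. ennreal lam < grand_maximal N f x} < emeasure lborel (ball (0 :: real ^ 'n) 1)"
  define E where "E = {x. grand_maximal N f x <= ennreal lam}"
  have cE: "- E = {x. ennreal lam < grand_maximal N f x}" by (auto simp: E_def not_le)
  interpret good_part E f N lam
  proof unfold_locales
   show "closed E" using grand_maximal_lsc[OF f, of "ennreal lam" N] by (simp add: closed_def cE)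
   show "E ~= {}"
   proof
    assume "E = {}"
    then have "emeasure lborel (- E) = emeasure lborel (UNIV :: (real ^ 'n) set)" by simp
    also have "... = \<infinity>" by simp
    finally show False using small unfolding cE by simp
   qed
   show "emeasure lborel (- E) < emeasure lborel (ball (0 :: real ^ 'n) 1)" unfolding cE by (rule small)
  qed (use f N lam in \<open>auto simp: E_def\<close>)
  have nn: "kc >= 0" "pc > 0" "fc >= 0" "nc > 0"
   unfolding kc_def pc_def fc_def nc_def using ker_const_nonneg piece_const_pos far_const_nonneg near_const_pos by auto
  have dm: "decay_mass TYPE('n) N >= 0" by (rule decay_mass_nonneg)
  have gc0: "gc >= 0" using nn mc dm by (simp add: gc_def)
  obtain v where v: "v \<in> borel_measurable borel" "AE u in lborel. cmod (v u) <= 5 * (kc * lam)"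
    "AE u in lborel. ennreal (cmod (v u)) <= ennreal (5 * kc) * grand_maximal N f u"
   and vi: "!!ph. ph \<in> schwartz ==> integrable lborel (%u. v u * ph u)"
   and v1: "!!x c s ph. x \<in> E ==> bump N c x s ph ==> s > 0 ==>
    ennreal (cmod (LL u. v u * ph u)) <= ennreal (mc * ((1 + 5 * pc) * c)) * grand_maximal N f x"
   and v2: "!!x c s ph. x \<in> E ==> bump N c x s ph ==> s > 0 ==>
    ennreal (cmod (f ph - (LL u. v u * ph u))) <= ennreal (4 * fc * c * lam) * far x" by (rule good_function[folded kc_def pc_def fc_def mc_def]) (rule that)
  let ?g = "density_functional v"
  have scale: "ennreal a * X <= ennreal C * X" if "a <= C" for a X using that by (intro mult_right_mono ennreal_leI) auto
  have g: "ennreal (cmod (?g ph)) <= ennreal gc * grand_maximal N f x" if b: "bump N 1 x s ph" and s: "s > 0" for x s ph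
  proof (cases "x \<in> E")
   case True
   have "ennreal (cmod (?g ph)) <= ennreal (mc * ((1 + 5 * pc) * 1)) * grand_maximal N f x"
    using v1[OF True b s] bump_schwartz[OF b] by (simp add: density_functional_def)
   also have "... <= ennreal gc * grand_maximal N f x" using nn dm by (intro mult_right_mono ennreal_leI) (auto simp: gc_def)
   finally show ?thesis .
  next
   \<comment> \<open>Off \<open>E\<close> the maximal function exceeds \<open>lam\<close>, so the
     uniform bound of \<open>v\<close> is already a bound by M f.\<close>
   case False
   have "cmod (?g ph) <= 5 * (kc * lam) * (1 * decay_mass TYPE('n) N)"
    using bounded_integral_bump[OF N v(2) b s vi[OF bump_schwartz[OF b]]] nn lam bump_schwartz[OF b] by (simp add: density_functional_def)
   also have "... <= gc * lam" using mc nn lam by (simp add: gc_def algebra_simps)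
   finally have "ennreal (cmod (?g ph)) <= ennreal (gc * lam)" by (rule ennreal_leI)
   also have "... = ennreal gc * ennreal lam" using gc0 lam by (intro ennreal_mult) auto
   also have "... <= ennreal gc * grand_maximal N f x" using False by (intro mult_left_mono) (auto simp: E_def)
   finally show ?thesis .
  qed
  have M1: "grand_maximal N ?g x <= ennreal C * grand_maximal N f x" for x
  proof (rule grand_maximal_le)
   fix ph and s :: real assume "s > 0" "bump N 1 x s ph"
   then show "ennreal (cmod (?g ph)) <= ennreal C * grand_maximal N f x"
    using g[of x s ph] scale[OF Cle(2), of "grand_maximal N f x"] by (auto intro: order_trans)
  qed
  have M2: "grand_maximal N (%ph. f ph - ?g ph) x <= ennreal C * grand_maximal N f x" for x
  proof (rule grand_maximal_le)
   fix ph and s :: real assume s: "s > 0" and b: "bump N 1 x s ph"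
   have "ennreal (cmod (f ph - ?g ph)) <= ennreal (cmod (f ph) + cmod (?g ph))" by (intro ennreal_leI norm_triangle_ineq4)
   also have "... = ennreal (cmod (f ph)) + ennreal (cmod (?g ph))" by simp
   also have "... <= ennreal (mc * 1) * grand_maximal N f x + ennreal gc * grand_maximal N f x"
    unfolding mc_def by (intro add_mono g[OF b s] bump_le_grand_maximal[OF f b s])
   also have "... = ennreal (mc + gc) * grand_maximal N f x" using mc gc0 by (simp add: distrib_right)
   also have "... <= ennreal C * grand_maximal N f x" by (rule scale[OF Cle(3)])
   finally show "ennreal (cmod (f ph - ?g ph)) <= ennreal C * grand_maximal N f x" .
  qed
  have M3: "grand_maximal N (%ph. f ph - ?g ph) x <= ennreal (C * lam) * near x ^ j" if x: "grand_maximal N f x <= ennreal lam" for x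
  proof (rule grand_maximal_le)
   fix ph and s :: real assume s: "s > 0" and b: "bump N 1 x s ph"
   have xE: "x \<in> E" using x by (simp add: E_def)
   have "ennreal (cmod (f ph - ?g ph)) <= ennreal (4 * fc * 1 * lam) * far x" using v2[OF xE b s] bump_schwartz[OF b] by (simp add: density_functional_def)
   also have "... <= ennreal (4 * fc * 1 * lam) * (ennreal (nc ^ (j - 1)) * near x ^ j)"
    unfolding far_def nc_def by (intro mult_left_mono far_le_near[OF xE j]) auto
   also have "... = ennreal (4 * fc * nc ^ (j - 1) * lam) * near x ^ j"
    using nn lam by (simp add: mult.assoc[symmetric] ennreal_mult[symmetric]) (simp add: mult_ac)
   also have "... <= ennreal (C * lam) * near x ^ j" using Cle(4) lam by (intro mult_right_mono ennreal_leI) auto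
   finally show "ennreal (cmod (f ph - ?g ph)) <= ennreal (C * lam) * near x ^ j" .
  qed
  have M4: "(NN x. near x * indicator E x) <= ennreal C * emeasure lborel (- E)"
   using near_integral scale[OF Cle(5), of "emeasure lborel (- E)"] unfolding tc_def by (rule order_trans)
  have vb: "AE u in lborel. cmod (v u) <= C * lam" using v(2)
  proof eventually_elim
   fix u assume "cmod (v u) <= 5 * (kc * lam)"
   also have "... <= C * lam" using Cle(1) lam mult_right_mono[of "5 * kc" C lam] by simp
   finally show "cmod (v u) <= C * lam" .
  qed
  have vm: "AE u in lborel. ennreal (cmod (v u)) <= ennreal C * grand_maximal N f u" using v(3) by eventually_elim (rule order_trans[OF _ scale[OF Cle(1)]])
  show "\<exists>v w. good_density N j C f lam v w"
   unfolding good_density_def using v(1) vb vm vi M1 M2 near_measurable M3 M4 unfolding cE unfolding E_def by blast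
 qed
qed

lemma ennpowr_scale:
 assumes X: "X <= ennreal C * Y" and C: "C > 0" and e: "e > 0" and l: "l > 0" and r: "0 < r" "r <= pp"
 shows "ennpowr (X / ennreal e) r <= ennreal (max 1 (C * l / e) powr pp) * ennpowr (Y / ennreal l) r"
proof (cases Y)
 case top
 then show ?thesis using l by (simp add: ennpowr_def ennreal_top_divide ennreal_mult_top)
next
 case (real y)
 let ?R = "max 1 (C * l / e)"
 have "X / ennreal e <= (ennreal C * ennreal y) / ennreal e" using X real by (intro divide_right_mono_ennreal) simp
 also have "... = ennreal (C * y / e)" using real C e by (simp add: divide_ennreal flip: ennreal_mult)
 finally have "ennpowr (X / ennreal e) r <= ennpowr (ennreal (C * y / e)) r" using r by (intro ennpowr_mono) auto
 also have "... = ennreal ((C * y / e) powr r)" using real C e by (intro ennpowr_ennreal) auto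
 also have "C * y / e = (C * l / e) * (y / l)" using l by simp
 also have "((C * l / e) * (y / l)) powr r = (C * l / e) powr r * (y / l) powr r" by (rule powr_mult)
 also have "... <= ?R powr pp * (y / l) powr r"
 proof (intro mult_right_mono)
  have "(C * l / e) powr r <= ?R powr r" using C l e r by (intro powr_mono2) auto
  also have "... <= ?R powr pp" using r by (intro powr_mono) auto
  finally show "(C * l / e) powr r <= ?R powr pp" .
 qed simp
 finally have "ennpowr (X / ennreal e) r <= ennreal (?R powr pp * (y / l) powr r)" by (simp add: ennreal_leI)
 also have "... = ennreal (?R powr pp) * ennreal ((y / l) powr r)" by (rule ennreal_mult) auto
 also have "ennreal ((y / l) powr r) = ennpowr (Y / ennreal l) r" using real l by (simp add: divide_ennreal ennpowr_ennreal)
 finally show ?thesis .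
qed

lemma ennpowr_tendsto_0:
 assumes a: "(a \<longlongrightarrow> 0) F" and r: "r > 0"
 shows "((%i. ennpowr (a i) r) \<longlongrightarrow> 0) F"
proof -
 have ev: "\<forall>\<^sub>F i in F. a i < 1" by (rule order_tendstoD(2)[OF a]) simp
 have "((%i. enn2real (a i)) \<longlongrightarrow> 0) F" using a by (intro tendsto_enn2real) auto
 then have "((%i. enn2real (a i) powr r) \<longlongrightarrow> 0) F" by (rule tendsto_zero_powrI[OF _ tendsto_const _ r]) simp
 then have "((%i. ennreal (enn2real (a i) powr r)) \<longlongrightarrow> ennreal 0) F" by (rule tendsto_ennrealI)
 then have "((%i. ennreal (enn2real (a i) powr r)) \<longlongrightarrow> 0) F" by simp
 moreover have "\<forall>\<^sub>F i in F. ennreal (enn2real (a i) powr r) = ennpowr (a i) r" using ev by eventually_elim (auto simp: ennpowr_def)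
 ultimately show ?thesis by (rule Lim_transform_eventually)
qed

lemma suminf_finite_tendsto_0:
 fixes W :: "nat => ennreal"
 assumes "(\<Sum>i. W i) ~= \<infinity>"
 shows "W \<longlonglongrightarrow> 0"
proof -
 have W: "W i ~= \<infinity>" for i
 proof
  assume "W i = \<infinity>"
  moreover have "W i <= (\<Sum>i. W i)" using sum_le_suminf[of W "{i}"] by simp
  ultimately show False using assms by (simp add: top_unique)
 qed
 have e: "W = (%i. ennreal (enn2real (W i)))" using W by (auto simp: less_top)
 then have "(\<Sum>i. ennreal (enn2real (W i))) ~= \<infinity>" using assms by simp
 then have "summable (%i. enn2real (W i))" by (intro summable_suminf_not_top) auto
 then have "(%i. enn2real (W i)) \<longlonglongrightarrow> 0" by (rule summable_LIMSEQ_zero)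
 then have "(%i. ennreal (enn2real (W i))) \<longlonglongrightarrow> ennreal 0" by (rule tendsto_ennrealI)
 then show ?thesis using e by simp
qed

text \<open>Heights for the density argument: as a < pm, the measure bound (t / l)^(-pm) beats t^a.
  The last property keeps the superlevel set smaller than the unit ball.\<close>

lemma threshold_exists:
 fixes l pm V \<delta> a :: real
 assumes "l > 0" "pm > a" "a > 0" "V > 0" "\<delta> > 0"
 obtains t where "t >= l" "t >= k" "t powr a * (t / l) powr (- pm) <= \<delta>" "(t / l) powr (- pm) < V"
proof -
 have "((%t. l powr pm * t powr (a - pm)) \<longlongrightarrow> l powr pm * 0) at_top"
  using assms by (intro tendsto_intros tendsto_neg_powr filterlim_ident) auto
 then have 1: "\<forall>\<^sub>F t in at_top. l powr pm * t powr (a - pm) < \<delta>" using assms by (intro order_tendstoD(2)) auto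
 have "((%t. l powr pm * t powr (- pm)) \<longlongrightarrow> l powr pm * 0) at_top" using assms by (intro tendsto_intros tendsto_neg_powr filterlim_ident) auto
 then have 2: "\<forall>\<^sub>F t in at_top. l powr pm * t powr (- pm) < V" using assms by (intro order_tendstoD(2)) auto
 have "\<forall>\<^sub>F t in at_top. l powr pm * t powr (a - pm) < \<delta> \<and> l powr pm * t powr (- pm) < V \<and> t >= l \<and> t >= k"
  using 1 2 eventually_ge_at_top[of l] eventually_ge_at_top[of k] by eventually_elim auto
 then obtain t where t: "l powr pm * t powr (a - pm) < \<delta>" "l powr pm * t powr (- pm) < V" "t >= l" "t >= k" unfolding eventually_at_top_linorder by blast
 have e: "(t / l) powr (- pm) = l powr pm * t powr (- pm)" using assms t by (simp add: powr_divide powr_minus field_simps)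
 have "t powr (a - pm) = t powr a * t powr (- pm)" using powr_add[of t a "- pm"] by simp
 then have e2: "t powr a * (t / l) powr (- pm) = l powr pm * t powr (a - pm)" unfolding e by (simp only: mult_ac)
 have 3: "t powr a * (t / l) powr (- pm) <= \<delta>" unfolding e2 using t(1) by (rule less_imp_le)
 have 4: "(t / l) powr (- pm) < V" unfolding e by (rule t(2))
 show ?thesis by (rule that[OF t(3,4) 3 4])
qed

lemma represents_density_functional:
 fixes v :: "'n::finite cfun"
 assumes [measurable]: "v \<in> borel_measurable borel" and i: "!!ph. ph \<in> schwartz ==> integrable lborel (%u. v u * ph u)"
 shows "represents v (density_functional v)" unfolding represents_def
proof (intro ballI conjI)
 fix ph :: "'n cfun" assume ph: "ph \<in> schwartz"
 have [measurable]: "ph \<in> borel_measurable borel" by (rule schwartz_measurable[OF ph])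
 show "integrable lebesgue (%x. v x * ph x)" using i[OF ph] by (subst integrable_completion) auto
 show "density_functional v ph = (LINT x|lebesgue. v x * ph x)" using ph by (subst integral_completion) (auto simp: density_functional_def)
qed

lemma tempered_minus:
 fixes f g :: "('n::finite cfun) => complex"
 assumes f: "f \<in> tempered" and g: "g \<in> tempered"
 shows "(%ph. f ph - g ph) \<in> tempered"
proof -
 have bd: "\<exists>M C. C >= 0 \<and> (\<forall>ph\<in>schwartz. cmod (h ph) <= C * schwartz_norm M ph)"
  if h: "h \<in> tempered" for h :: "('n cfun) => complex"
 proof -
  obtain M C where C: "C >= 0" "!!ph B. ph \<in> schwartz ==>
   (!!is x. length is <= M ==> (1 + norm x) ^ M * cmod (Dl is ph x) <= B) ==> cmod (h ph) <= C * B" using tempered_bound[OF h] by metis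
  have "cmod (h ph) <= C * schwartz_norm M ph" if "ph \<in> schwartz" for ph by (rule C(2)[OF that]) (rule schwartz_norm_ge[OF that])
  then show ?thesis using C(1) by blast
 qed
 obtain M C M' C' where C: "C >= 0" "!!ph. ph \<in> schwartz ==> cmod (f ph) <= C * schwartz_norm M ph"
  and C': "C' >= 0" "!!ph. ph \<in> schwartz ==> cmod (g ph) <= C' * schwartz_norm M' ph" using bd[OF f] bd[OF g] by metis
 show ?thesis
 proof (rule temperedI[where C="C + C'" and N="max M M'"])
  fix ph :: "'n cfun" assume ph: "ph \<in> schwartz"
  have "cmod (f ph - g ph) <= cmod (f ph) + cmod (g ph)" by (rule norm_triangle_ineq4)
  also have "... <= C * schwartz_norm M ph + C' * schwartz_norm M' ph" by (intro add_mono C C' ph)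
  also have "... <= C * schwartz_norm (max M M') ph + C' * schwartz_norm (max M M') ph" by (intro add_mono mult_left_mono schwartz_norm_mono ph C C') auto
  finally show "cmod (f ph - g ph) <= (C + C') * schwartz_norm (max M M') ph" by (simp add: distrib_right)
 qed (auto simp: tempered_add[OF f] tempered_add[OF g] tempered_cmult[OF f] tempered_cmult[OF g]
   tempered_out[OF f] tempered_out[OF g] right_diff_distrib)
qed

text \<open>Almost everywhere convergence of the errors is a summability argument. On the sublevel
  set at height t the error is at most C t w^j, that is, C times the j-th power of t^(1/j) w; the
  integral of the latter is at most of order t^(1/j - pm), which can be made summable because 1/j <
  pm.\<close>

lemma hardy_dense_Lp:
 fixes p :: "real ^ 'n::finite => real"
 assumes p[measurable]: "p \<in> borel_measurable lebesgue" and pm: "0 < pm" "!!x. pm <= p x" and pp: "!!x. p x <= pp" "pp <= p0"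
  and N: "CARD('n) < N" and j: "0 < j" "j * (CARD('n) + 1) <= N" "1 / real j < pm"
 shows "hardy_dense N p {f \<in> hardy N p. \<exists>g\<in>Lp_fun p0. represents g f}" unfolding hardy_dense_def
proof (intro conjI ballI allI impI)
 fix f e assume f: "f \<in> hardy N p" and e: "e > (0 :: ennreal)"
 have pos: "p x > 0" for x using pm by (rule less_le_trans)
 have ft: "f \<in> tempered" using f by (simp add: hardy_def)
 obtain e' where e': "e' > 0" "ennreal e' < e"
 proof (cases e)
  case (real r)
  then show ?thesis using e that[of "r / 2"] by (simp add: ennreal_less_iff)
 next
  case top
  then show ?thesis using that[of 1] by simp
 qed
 let ?M = "grand_maximal N f"
 have "modular_set p ?M ~= {}" using f var_norm_finite[of p ?M] by (simp add: hardy_def hardy_norm_def)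
 then obtain l where l: "l > 0" "(\<integral>\<^sup>+ x. ennpowr (?M x / ennreal l) (p x) \<partial>lebesgue) <= 1" by (auto simp: modular_set_def)
 define F where "F = (%x. ennpowr (?M x / ennreal l) (p x))"
 have Mb: "grand_maximal N h \<in> borel_measurable borel" if "h \<in> tempered" for h :: "('n cfun) => complex" using that by (rule grand_maximal_measurable)
 have Ml: "grand_maximal N h \<in> borel_measurable lebesgue" if "h \<in> tempered" for h :: "('n cfun) => complex"
  using Mb[OF that] by (intro measurable_completion) simp
 have [measurable]: "?M \<in> borel_measurable borel" "?M \<in> borel_measurable lebesgue" using Mb Ml ft by auto
 have Fm[measurable]: "F \<in> borel_measurable lebesgue" unfolding F_def by measurable
 have F1: "(\<integral>\<^sup>+ x. F x \<partial>lebesgue) <= 1" using l by (simp add: F_def)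
 let ?V = "unit_ball_vol (real CARD('n))"
 have V: "emeasure lborel (ball (0 :: real ^ 'n) 1) = ennreal ?V" by (simp add: emeasure_ball)
 \<comment> \<open>Chebyshev's inequality with the smallest exponent, allowed since t / l >=
   1.\<close>
 have level: "emeasure lborel {x. ennreal t < ?M x} <= ennreal ((t / l) powr (- pm))" if t: "t >= l" for t
 proof -
  let ?O = "{x. ennreal t < ?M x}"
  have O: "?O \<in> sets borel" by measurable
  have Ol: "?O \<in> sets lebesgue" using O by (intro sets_completionI_sets) simp
  have "ennreal ((t / l) powr pm) * emeasure lebesgue ?O = (\<integral>\<^sup>+ x. ennreal ((t / l) powr pm) * indicator ?O x \<partial>lebesgue)"
   using Ol by (rule nn_integral_cmult_indicator[symmetric])
  also have "... <= (\<integral>\<^sup>+ x. F x \<partial>lebesgue)"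
  proof (rule nn_integral_mono)
   fix x
   show "ennreal ((t / l) powr pm) * indicator ?O x <= F x"
   proof (cases "x \<in> ?O")
    case True
    have "1 <= t / l" using t l by simp
    then have "ennreal ((t / l) powr pm) <= ennreal ((t / l) powr p x)" by (intro ennreal_leI powr_mono pm)
    also have "... = ennpowr (ennreal t / ennreal l) (p x)" using t l by (simp add: divide_ennreal ennpowr_ennreal)
    also have "... <= F x" unfolding F_def using True pos[of x] by (intro ennpowr_mono divide_right_mono_ennreal) auto
    finally show ?thesis using True by simp
   qed simp
  qed
  finally have le: "ennreal ((t / l) powr pm) * emeasure lborel ?O <= 1" using F1 O by simp
  have c: "(t / l) powr (- pm) * (t / l) powr pm = 1" using t l by (simp flip: powr_add)
  have "emeasure lborel ?O = ennreal ((t / l) powr (- pm)) * (ennreal ((t / l) powr pm) * emeasure lborel ?O)"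
   using c by (simp add: mult.assoc[symmetric] ennreal_mult[symmetric])
  also have "... <= ennreal ((t / l) powr (- pm)) * 1" using le by (rule mult_left_mono) simp
  finally show ?thesis by simp
 qed
 obtain C where C: "C > 0" and app: "!!(f :: ('n cfun) => complex) lam. f \<in> tempered ==> lam > 0 ==>
  emeasure lborel {x. ennreal lam < grand_maximal N f x} < emeasure lborel (ball (0 :: real ^ 'n) 1) ==>
  \<exists>v w. good_density N j C f lam v w" by (rule good_approximation[OF N j(1,2)]) (rule that)
 have "\<exists>t. t >= l \<and> t >= real i \<and> t powr (1 / real j) * (t / l) powr (- pm) <= (1 / 2) ^ i \<and> (t / l) powr (- pm) < ?V" for i
  by (rule threshold_exists[of l "1 / real j" pm ?V "(1 / 2) ^ i" "real i"]) (use l j in auto)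
 then obtain t where t: "!!i. t i >= l" "!!i. t i >= real i"
  "!!i. t i powr (1 / real j) * (t i / l) powr (- pm) <= (1 / 2) ^ i" "!!i. (t i / l) powr (- pm) < ?V" by metis
 have t0: "t i > 0" for i using t(1)[of i] l by simp
 have small: "emeasure lborel {x. ennreal (t i) < ?M x} < emeasure lborel (ball (0 :: real ^ 'n) 1)" for i
  unfolding V by (rule le_less_trans[OF level[OF t(1)]]) (use t(4)[of i] in \<open>simp add: ennreal_less_iff\<close>)
 have "\<exists>v w. good_density N j C f (t i) v w" for i by (rule app[OF ft t0 small])
 then obtain v w where P: "!!i. good_density N j C f (t i) (v i) (w i)" by metis
 have vm[measurable]: "v i \<in> borel_measurable borel"
  and vb: "AE u in lborel. cmod (v i u) <= C * t i"
  and vM: "AE u in lborel. ennreal (cmod (v i u)) <= ennreal C * ?M u"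
  and vi: "ph \<in> schwartz ==> integrable lborel (%u. v i u * ph u)"
  and M1: "grand_maximal N (density_functional (v i)) x <= ennreal C * ?M x"
  and M2: "grand_maximal N (%ph. f ph - density_functional (v i) ph) x <= ennreal C * ?M x"
  and wm[measurable]: "w i \<in> borel_measurable borel"
  and M3: "?M x <= ennreal (t i) ==> grand_maximal N (%ph. f ph - density_functional (v i) ph) x <= ennreal (C * t i) * w i x ^ j"
  and M4: "(NN x. w i x * indicator {x. ?M x <= ennreal (t i)} x) <= ennreal C * emeasure lborel {x. ennreal (t i) < ?M x}"
  for i x ph using P[of i] unfolding good_density_def by blast+
 let ?g = "%i. density_functional (v i)"
 let ?D = "%i. grand_maximal N (%ph. f ph - ?g i ph)"
 have gt: "?g i \<in> tempered" for i using C t0[of i] by (intro density_functional_tempered[OF N vb] vi) auto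
 have dt: "(%ph. f ph - ?g i ph) \<in> tempered" for i by (rule tempered_minus[OF ft gt])
 have Dm[measurable]: "?D i \<in> borel_measurable lebesgue" for i by (rule Ml[OF dt])
 have Mfin: "AE x in lebesgue. ?M x ~= \<infinity>"
 proof -
  have "(\<integral>\<^sup>+ x. F x \<partial>lebesgue) ~= \<infinity>" using F1 by (auto simp: top_unique)
  then have "AE x in lebesgue. F x ~= \<infinity>" by (intro nn_integral_PInf_AE Fm)
  then show ?thesis by eventually_elim (use l in \<open>auto simp: F_def ennpowr_def ennreal_top_divide\<close>)
 qed
 \<comment> \<open>On the sublevel set the error bound is C * W i ^ j. The integrals of
   \<open>W i\<close> are summable by the choice of the heights, so \<open>W i\<close> tends to 0
   almost everywhere.\<close>
 define W where "W = (%i x. ennreal (t i powr (1 / real j)) * (w i x * indicator {x. ?M x <= ennreal (t i)} x))"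
 have Wm: "W i \<in> borel_measurable lborel" for i unfolding W_def by measurable
 have Wi: "(NN x. W i x) <= ennreal (C * (1 / 2) ^ i)" for i
 proof -
  have "(NN x. W i x) = ennreal (t i powr (1 / real j)) * (NN x. w i x * indicator {x. ?M x <= ennreal (t i)} x)"
   unfolding W_def by (rule nn_integral_cmult) measurable
  also have "... <= ennreal (t i powr (1 / real j)) * (ennreal C * ennreal ((t i / l) powr (- pm)))" by (intro mult_left_mono order_trans[OF M4] level t) auto
  also have "... = ennreal (C * (t i powr (1 / real j) * (t i / l) powr (- pm)))" using C by (simp add: mult_ac flip: ennreal_mult)
  also have "... <= ennreal (C * (1 / 2) ^ i)" using C by (intro ennreal_leI mult_left_mono t) auto
  finally show ?thesis .
 qed
 have "(NN x. (\<Sum>i. W i x)) = (\<Sum>i. NN x. W i x)" by (rule nn_integral_suminf[OF Wm])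
 also have "... <= (\<Sum>i. ennreal (C * (1 / 2) ^ i))" by (intro suminf_le Wi) auto
 also have "... = ennreal (\<Sum>i. C * (1 / 2) ^ i)" using C by (intro suminf_ennreal2 summable_mult summable_geometric) auto
 also have "... < \<infinity>" by simp
 finally have "AE x in lborel. (\<Sum>i. W i x) ~= \<infinity>" using Wm by (intro nn_integral_PInf_AE borel_measurable_suminf) auto
 then have W0: "AE x in lebesgue. (%i. W i x) \<longlonglongrightarrow> 0" by (intro AE_completion) (auto elim!: eventually_mono intro: suminf_finite_tendsto_0)
 have D0: "AE x in lebesgue. (%i. ?D i x) \<longlonglongrightarrow> 0" using Mfin W0
 proof eventually_elim
  fix x assume fin: "?M x ~= \<infinity>" and W: "(%i. W i x) \<longlonglongrightarrow> 0"
  then obtain b where b: "?M x = ennreal b" by (cases "?M x") auto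
  have lim: "(%i. ennreal C * W i x) \<longlonglongrightarrow> ennreal C * 0" by (rule ennreal_tendsto_cmult[OF _ W]) simp
  have "\<forall>\<^sub>F i in sequentially. b <= real i" by (rule eventually_at_top_linorderI[of "nat \<lceil>b\<rceil>"]) linarith
  moreover have "\<forall>\<^sub>F i in sequentially. W i x < 1" by (rule order_tendstoD(2)[OF W]) simp
  ultimately have ev: "\<forall>\<^sub>F i in sequentially. ?D i x <= ennreal C * W i x"
  proof eventually_elim
   fix i assume i: "b <= real i" and W1: "W i x < 1"
   have Mt: "?M x <= ennreal (t i)" unfolding b using i t(2)[of i] by (intro ennreal_leI) simp
   have Wx: "W i x = ennreal (t i powr (1 / real j)) * w i x" using Mt by (simp add: W_def)
   have "?D i x <= ennreal (C * t i) * w i x ^ j" by (rule M3[OF Mt])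
   also have "... = ennreal C * (ennreal (t i) * w i x ^ j)" using C t0[of i] by (simp add: ennreal_mult mult.assoc)
   also have "ennreal (t i) * w i x ^ j = W i x ^ j"
   proof -
    have "(t i powr (1 / real j)) ^ j = t i" using t0[of i] j by (simp add: powr_power)
    then show ?thesis unfolding Wx by (simp add: power_mult_distrib ennreal_power)
   qed
   also have "W i x ^ j = W i x ^ (j - 1) * W i x" using j(1) by (metis Suc_diff_1 power_Suc2)
   also have "... <= 1 ^ (j - 1) * W i x" using W1 by (intro mult_right_mono power_mono) auto
   finally show "?D i x <= ennreal C * W i x" by (simp add: mult_left_mono)
  qed
  show "(%i. ?D i x) \<longlonglongrightarrow> 0" by (rule tendsto_sandwich[OF _ ev tendsto_const]) (use lim in auto)
 qed
 let ?R = "max 1 (C * l / e') powr pp"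
 have "(%i. \<integral>\<^sup>+ x. ennpowr (?D i x / ennreal e') (p x) \<partial>lebesgue) \<longlonglongrightarrow> (\<integral>\<^sup>+ x. 0 \<partial>(lebesgue :: (real ^ 'n) measure))"
 proof (rule nn_integral_dominated_convergence)
  show "(%x. ennreal ?R * F x) \<in> borel_measurable lebesgue" by measurable
  show "(\<integral>\<^sup>+ x. ennreal ?R * F x \<partial>lebesgue) < \<infinity>"
  proof -
   have "(\<integral>\<^sup>+ x. ennreal ?R * F x \<partial>lebesgue) = ennreal ?R * (\<integral>\<^sup>+ x. F x \<partial>lebesgue)" by (rule nn_integral_cmult[OF Fm])
   also have "... <= ennreal ?R * 1" by (intro mult_left_mono F1) simp
   also have "... < \<infinity>" by simp
   finally show ?thesis .
  qed
  show "AE x in lebesgue. ennpowr (?D i x / ennreal e') (p x) <= ennreal ?R * F x" for i unfolding F_def by (intro AE_I2 ennpowr_scale M2 C e' l pos pp)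
  show "AE x in lebesgue. (%i. ennpowr (?D i x / ennreal e') (p x)) \<longlonglongrightarrow> 0" using D0
  proof eventually_elim
   fix x assume "(%i. ?D i x) \<longlonglongrightarrow> 0"
   then have "(%i. ennreal (1 / e') * ?D i x) \<longlonglongrightarrow> ennreal (1 / e') * 0" by (rule ennreal_tendsto_cmult[rotated]) simp
   moreover have "ennreal (1 / e') * y = y / ennreal e'" for y using e' by (simp add: divide_ennreal_def inverse_ennreal mult.commute inverse_eq_divide)
   ultimately have "(%i. ?D i x / ennreal e') \<longlonglongrightarrow> 0" by simp
   then show "(%i. ennpowr (?D i x / ennreal e') (p x)) \<longlonglongrightarrow> 0" by (rule ennpowr_tendsto_0[OF _ pos])
  qed
 qed measurable
 then have "(%i. \<integral>\<^sup>+ x. ennpowr (?D i x / ennreal e') (p x) \<partial>lebesgue) \<longlonglongrightarrow> 0" by simp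
 then have "\<forall>\<^sub>F i in sequentially. (\<integral>\<^sup>+ x. ennpowr (?D i x / ennreal e') (p x) \<partial>lebesgue) < 1"
  by (rule order_tendstoD(2)) simp
 then obtain i where i: "(\<integral>\<^sup>+ x. ennpowr (?D i x / ennreal e') (p x) \<partial>lebesgue) < 1" unfolding eventually_sequentially by blast
 have close: "hardy_norm N p (%ph. f ph - ?g i ph) < e"
 proof -
  have "e' \<in> modular_set p (?D i)" using i e' by (simp add: modular_set_def)
  then show ?thesis unfolding hardy_norm_def using e'(2) by (rule le_less_trans[OF var_norm_le])
 qed
 have hardy: "?g i \<in> hardy N p"
 proof -
  have "(\<integral>\<^sup>+ x. ennpowr (grand_maximal N (?g i) x / ennreal (C * l)) (p x) \<partial>lebesgue) <= (\<integral>\<^sup>+ x. F x \<partial>lebesgue)"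
  proof (rule nn_integral_mono)
   fix x
   have "grand_maximal N (?g i) x / ennreal (C * l) <= (ennreal C * ?M x) / ennreal (C * l)" by (rule divide_right_mono_ennreal[OF M1])
   also have "... = ?M x / ennreal l" by (rule ennreal_divide_scale[OF C l(1)])
   finally show "ennpowr (grand_maximal N (?g i) x / ennreal (C * l)) (p x) <= F x" unfolding F_def using pos[of x] by (intro ennpowr_mono) auto
  qed
  also note F1
  finally have "C * l \<in> modular_set p (grand_maximal N (?g i))" using C l by (simp add: modular_set_def)
  then have "var_norm p (grand_maximal N (?g i)) < \<infinity>" by (subst var_norm_finite) auto
  then show ?thesis using gt[of i] by (simp add: hardy_def hardy_norm_def)
 qed
 have Lp: "v i \<in> Lp_fun p0"
 proof -
  have vl[measurable]: "v i \<in> borel_measurable lebesgue" by (intro measurable_completion) simp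
  have "integrable lebesgue (%x. cmod (v i x) powr p0)"
  proof (rule integrableI_bounded)
   have "(\<integral>\<^sup>+ x. ennreal (norm (cmod (v i x) powr p0)) \<partial>lebesgue) <= (\<integral>\<^sup>+ x. ennreal ((C * t i) powr p0) * F x \<partial>lebesgue)"
   proof (rule nn_integral_mono_AE)
    show "AE x in lebesgue. ennreal (norm (cmod (v i x) powr p0)) <= ennreal ((C * t i) powr p0) * F x"
     using AE_completion[OF vb[of i]] AE_completion[OF vM[of i]]
    proof eventually_elim
     fix x assume 1: "cmod (v i x) <= C * t i" and 2: "ennreal (cmod (v i x)) <= ennreal C * ?M x"
     define a where "a = cmod (v i x) / (C * t i)"
     have Ct: "C * t i > 0" using C t0 by simp
     have a: "0 <= a" "a <= 1" using 1 Ct by (auto simp: a_def)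
     have "ennreal a <= ?M x / ennreal l"
     proof (cases "?M x")
      case top
      then show ?thesis using l by (simp add: ennreal_top_divide)
     next
      case (real y)
      have "ennreal (cmod (v i x)) <= ennreal (C * y)" using 2 real C by (simp add: ennreal_mult)
      then have "cmod (v i x) <= C * y" using real C by (subst (asm) ennreal_le_iff) auto
      then have "a <= C * y / (C * t i)" unfolding a_def using Ct by (intro divide_right_mono) auto
      also have "... = y / t i" using C by simp
      also have "... <= y / l" using t(1)[of i] l real by (intro divide_left_mono) (auto intro: mult_pos_pos t0)
      finally show ?thesis using real l by (simp add: divide_ennreal ennreal_leI)
     qed
     then have "ennpowr (ennreal a) (p x) <= F x" unfolding F_def using pos[of x] by (intro ennpowr_mono) auto
     then have aF: "ennreal (a powr p x) <= F x" using a by (simp add: ennpowr_ennreal)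
     \<comment> \<open>After scaling into [0, 1], p x <= p0 lets the power p x dominate the power
       p0; integrability then comes from the modular of M f.\<close>
     have "cmod (v i x) powr p0 = (C * t i) powr p0 * a powr p0" using Ct a by (subst powr_mult[symmetric]) (auto simp: a_def)
     also have "... <= (C * t i) powr p0 * a powr p x"
     proof (rule mult_left_mono)
      have "p x <= p0" using pp(1)[of x] pp(2) by simp
      then show "a powr p0 <= a powr p x" using a pos[of x] by (cases "a = 0") (auto intro: powr_mono')
     qed simp
     finally have "ennreal (cmod (v i x) powr p0) <= ennreal ((C * t i) powr p0 * a powr p x)" by (rule ennreal_leI)
     also have "... = ennreal ((C * t i) powr p0) * ennreal (a powr p x)" by (rule ennreal_mult) auto
     also have "... <= ennreal ((C * t i) powr p0) * F x" by (rule mult_left_mono[OF aF]) simp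
     finally show "ennreal (norm (cmod (v i x) powr p0)) <= ennreal ((C * t i) powr p0) * F x" by simp
    qed
   qed
   also have "... = ennreal ((C * t i) powr p0) * (\<integral>\<^sup>+ x. F x \<partial>lebesgue)" by (rule nn_integral_cmult[OF Fm])
   also have "... <= ennreal ((C * t i) powr p0) * 1" by (intro mult_left_mono F1) simp
   also have "... < \<infinity>" by simp
   finally show "(\<integral>\<^sup>+ x. ennreal (norm (cmod (v i x) powr p0)) \<partial>lebesgue) < \<infinity>" .
  qed measurable
  then show ?thesis using vl by (simp add: Lp_fun_def)
 qed
 have "represents (v i) (?g i)" by (rule represents_density_functional[OF vm vi])
 then have "?g i \<in> {f \<in> hardy N p. \<exists>g\<in>Lp_fun p0. represents g f}" using hardy Lp by auto
 then show "\<exists>h\<in>{f \<in> hardy N p. \<exists>g\<in>Lp_fun p0. represents g f}. hardy_norm N p (%ph. f ph - h ph) < e"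
  using close by (rule bexI[where x="?g i", rotated])
qed auto

section \<open>From the hypotheses on the exponents to quantitative bounds\<close>

lemma exp_minus_pos:
 fixes p :: "real ^ 'n::finite => real"
 assumes "0 < exp_minus p"
 obtains pm where "0 < pm" "!!x. pm <= p x"
proof -
 have le: "exp_minus p <= ereal (p x)" for x unfolding exp_minus_def by (rule INF_lower) simp
 then obtain pm where "exp_minus p = ereal pm" using assms le[of 0] by (cases "exp_minus p") auto
 then show ?thesis using that[of pm] assms le by simp
qed

lemma exp_plus_real:
 fixes p :: "real ^ 'n::finite => real"
 assumes "exp_plus p < ereal r"
 obtains pp where "exp_plus p = ereal pp" "pp < r" "!!x. p x <= pp"
proof -
 have le: "ereal (p x) <= exp_plus p" for x unfolding exp_plus_def by (rule SUP_upper) simp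
 then obtain pp where pp: "exp_plus p = ereal pp" using assms le[of 0] by (cases "exp_plus p") auto
 then show ?thesis using that[of pp] assms le by simp
qed

text \<open>Replacing the distance by an upper bound \<open>t\<close> is harmless, since ln (1 / t)
  decreases in \<open>t\<close>. For distances of at least 1 / 2 this logarithm is at most ln 2, and
  |p x - p y| <= pp suffices.\<close>

lemma local_log_holder_bound:
 fixes p :: "real ^ 'n::finite => real"
 assumes "local_log_holder p" and p: "!!x. 0 < p x" "!!x. p x <= pp"
 obtains A where "!!x y t. norm (x - y) <= t ==> 0 < t ==> t <= 1 ==> \<bar>p x - p y\<bar> * ln (1 / t) <= A"
proof -
 obtain c where c: "!!x y. 0 < norm (x - y) ==> norm (x - y) < 1 / 2 ==> \<bar>p x - p y\<bar> <= c / (- ln (norm (x - y)))"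
  using assms(1) unfolding local_log_holder_def by blast
 have pp0: "pp > 0" using p(1)[of 0] p(2)[of 0] by linarith
 have "\<bar>p x - p y\<bar> * ln (1 / t) <= \<bar>c\<bar> + pp * ln 2" if t: "norm (x - y) <= t" "0 < t" "t <= 1" for x y t
 proof -
  have lt: "ln (1 / t) >= 0" using t by simp
  consider "x = y" | "0 < norm (x - y)" "norm (x - y) < 1 / 2" | "norm (x - y) >= 1 / 2" by force
  then show ?thesis
  proof cases
   case 1
   then show ?thesis using pp0 by simp
  next
   case 2
   have l: "- ln (norm (x - y)) > 0" using 2 by simp
   have "1 / t <= 1 / norm (x - y)" using t(1) 2(1) by (intro frac_le) simp_all
   moreover have "0 < 1 / t" "0 < 1 / norm (x - y)" using t(2) 2(1) by simp_all
   ultimately have "ln (1 / t) <= ln (1 / norm (x - y))" by (simp only: ln_le_cancel_iff)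
   also have "... = - ln (norm (x - y))" using 2 by (simp add: ln_div)
   finally have "\<bar>p x - p y\<bar> * ln (1 / t) <= \<bar>p x - p y\<bar> * (- ln (norm (x - y)))" by (rule mult_left_mono) simp
   also have "... <= c" using c[OF 2] l by (simp only: pos_le_divide_eq)
   also have "... <= \<bar>c\<bar> + pp * ln 2" using pp0 by (simp add: add_increasing2)
   finally show ?thesis .
  next
   case 3
   have "ln (1 / t) <= ln 2" using 3 t by (subst ln_le_cancel_iff) (auto simp: divide_le_eq)
   moreover have "\<bar>p x - p y\<bar> <= pp" using p[of x] p[of y] by linarith
   ultimately have "\<bar>p x - p y\<bar> * ln (1 / t) <= pp * ln 2" using lt pp0 by (intro mult_mono) auto
   then show ?thesis by simp
  qed
 qed
 then show ?thesis by (rule that)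
qed

text \<open>The number \<open>p_inf\<close> of the decay condition is the limit of \<open>p\<close> at infinity.\<close>

lemma log_holder_limit:
 fixes p :: "real ^ 'n::finite => real"
 assumes "log_holder_at_infinity p" and p: "!!x. pm <= p x" "!!x. p x <= pp"
 obtains B pinf where "pm <= pinf" "pinf <= pp" "!!x. \<bar>p x - pinf\<bar> * ln (exp 1 + norm x) <= B"
proof -
 obtain C pinf where C: "!!x. \<bar>p x - pinf\<bar> <= C / ln (exp 1 + norm x)" using assms(1) unfolding log_holder_at_infinity_def by blast
 have l: "ln (exp 1 + norm x) >= 1" for x :: "real ^ 'n"
 proof -
  have "ln (exp 1) <= ln (exp 1 + norm x)" by (subst ln_le_cancel_iff) (auto intro: add_pos_nonneg)
  then show ?thesis by simp
 qed
 have B: "\<bar>p x - pinf\<bar> * ln (exp 1 + norm x) <= C" for x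
 proof -
  have "ln (exp 1 + norm x) > 0" using l[of x] by linarith
  then show ?thesis using C[of x] by (simp only: pos_le_divide_eq)
 qed
 have close: "\<exists>x. \<bar>p x - pinf\<bar> <= \<epsilon>" if \<epsilon>: "\<epsilon> > 0" for \<epsilon>
 proof -
  \<comment> \<open>A point so far out that the bound at infinity drops to \<epsilon>; there
    \<open>pinf\<close> is within \<epsilon> of a value of \<open>p\<close>.\<close>
  obtain x :: "real ^ 'n" where x: "norm x = exp (\<bar>C\<bar> / \<epsilon>)" using vector_choose_size[of "exp (\<bar>C\<bar> / \<epsilon>)"] by auto
  have "\<bar>C\<bar> / \<epsilon> = ln (exp (\<bar>C\<bar> / \<epsilon>))" by simp
  also have "... <= ln (exp 1 + norm x)" unfolding x by (subst ln_le_cancel_iff) (auto intro: add_pos_pos)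
  finally have "\<bar>C\<bar> <= ln (exp 1 + norm x) * \<epsilon>" using \<epsilon> by (simp only: pos_divide_le_eq)
  then have "\<bar>p x - pinf\<bar> * ln (exp 1 + norm x) <= \<epsilon> * ln (exp 1 + norm x)" using B[of x] by (simp add: mult.commute)
  moreover have "ln (exp 1 + norm x) > 0" using l[of x] by linarith
  ultimately have "\<bar>p x - pinf\<bar> <= \<epsilon>" by (simp only: mult_le_cancel_right_pos)
  then show ?thesis ..
 qed
 have "pm <= pinf"
 proof (rule field_le_epsilon)
  fix \<epsilon> :: real assume "\<epsilon> > 0"
  then obtain x where "\<bar>p x - pinf\<bar> <= \<epsilon>" using close by blast
  then show "pm <= pinf + \<epsilon>" using p(1)[of x] by linarith
 qed
 moreover have "pinf <= pp"
 proof (rule field_le_epsilon)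
  fix \<epsilon> :: real assume "\<epsilon> > 0"
  then obtain x where "\<bar>p x - pinf\<bar> <= \<epsilon>" using close by blast
  then show "pinf <= pp + \<epsilon>" using p(2)[of x] by linarith
 qed
 ultimately show ?thesis using B by (rule that)
qed

theorem theorem12:
  fixes p q :: "real ^ 'n \<Rightarrow> real" and \<alpha> :: real
  assumes "0 < \<alpha>" and "\<alpha> < real CARD('n)"
    and "p \<in> borel_measurable lebesgue" and "\<And>x. 0 < p x"
    and "local_log_holder p" and "log_holder_at_infinity p"
    and "0 < exp_minus p" and "exp_minus p \<le> exp_plus p"
    and "exp_plus p < ereal (real CARD('n) / \<alpha>)"
    and "\<And>x. 1 / q x = 1 / p x - \<alpha> / real CARD('n)"
  shows "\<exists>N0. \<forall>N\<ge>N0.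
    (\<forall>p0. max 1 (exp_plus p) < ereal p0 \<and> p0 < real CARD('n) / \<alpha> \<longrightarrow>
       hardy_dense N p {f \<in> hardy N p. \<exists>g\<in>Lp_fun p0. represents g f}) \<and>
    (\<exists>T. bounded_hardy_operator N p q T \<and>
      (\<forall>p0 f g. max 1 (exp_plus p) < ereal p0 \<and> p0 < real CARD('n) / \<alpha> \<and>
         f \<in> hardy N p \<and> g \<in> Lp_fun p0 \<and> represents g f \<longrightarrow>
         represents (riesz_potential \<alpha> g) (T f)))"
proof -
  obtain pm where pm: "0 < pm" "\<And>x. pm \<le> p x" using exp_minus_pos[OF assms(7)] by blast
  obtain pp where pp: "exp_plus p = ereal pp" "pp < real CARD('n) / \<alpha>" "\<And>x. p x \<le> pp"
    using exp_plus_real[OF assms(9)] by blast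
  obtain A where A: "\<And>x y t. norm (x - y) \<le> t \<Longrightarrow> 0 < t \<Longrightarrow> t \<le> 1 \<Longrightarrow> \<bar>p x - p y\<bar> * ln (1 / t) \<le> A"
    by (rule local_log_holder_bound[OF assms(5,4) pp(3)]) (rule that)
  obtain B pinf where B: "pm \<le> pinf" "pinf \<le> pp" "\<And>x. \<bar>p x - pinf\<bar> * ln (exp 1 + norm x) \<le> B"
    by (rule log_holder_limit[OF assms(6) pm(2) pp(3)]) (rule that)
  have \<alpha>pp: "\<alpha> * pp < real CARD('n)" using pp(2) assms(1) by (simp add: less_divide_eq mult.commute)
  interpret riesz_exponents p pm pp pinf A B \<alpha> q
    by unfold_locales (fact assms(3) pm pp(3) B A assms(1,10) \<alpha>pp)+
  \<comment> \<open>The power j of the Marcinkiewicz integral has to satisfy 1 / j < pm; the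
    successor keeps it positive.\<close>
  obtain k where k: "1 / real (Suc k) < pm" using nat_approx_posE[OF pm(1)] by blast
  define j where "j = Suc k"
  \<comment> \<open>The threshold for \<open>N\<close> gives each of the j factors its n + 1 orders
    of decay, and it also forces N > n, as the boundedness of the operator requires.\<close>
  show ?thesis
  proof (intro exI[of _ "j * (CARD('n) + 1)"] allI impI conjI)
    fix N assume jN: "j * (CARD('n) + 1) \<le> N"
    have "1 * (CARD('n) + 1) \<le> j * (CARD('n) + 1)" unfolding j_def by (rule mult_le_mono1) simp
    from order_trans[OF this jN] have N: "CARD('n) < N" by simp
    show "hardy_dense N p {f \<in> hardy N p. \<exists>g\<in>Lp_fun p0. represents g f}"
      if "max 1 (exp_plus p) < ereal p0 \<and> p0 < real CARD('n) / \<alpha>" for p0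
      by (rule hardy_dense_Lp[OF assms(3) pm pp(3) _ N _ jN]) (use that pp(1) k in \<open>auto simp: j_def\<close>)
    have "represents (riesz_potential \<alpha> g) (riesz_op \<alpha> f)"
      if "max 1 (exp_plus p) < ereal p0 \<and> p0 < real CARD('n) / \<alpha> \<and> f \<in> hardy N p \<and> g \<in> Lp_fun p0 \<and> represents g f" for p0 f g
    proof (rule riesz_agreement[OF assms(1,2)])
      show "1 \<le> p0" using that by (simp add: one_ereal_def)
      show "\<alpha> * p0 < real CARD('n)" using that assms(1) by (simp add: less_divide_eq mult.commute)
    qed (use that in auto)
    then show "\<exists>T. bounded_hardy_operator N p q T \<and>
      (\<forall>p0 f g. max 1 (exp_plus p) < ereal p0 \<and> p0 < real CARD('n) / \<alpha> \<and>
         f \<in> hardy N p \<and> g \<in> Lp_fun p0 \<and> represents g f \<longrightarrow>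
         represents (riesz_potential \<alpha> g) (T f))"
      using riesz_op_bounded[OF N assms(2)] by blast
  qed
qed

end
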